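(* Let $K$ be a compact convex subset of $\mathbb{R}^d$, $m\ge0$ an integer and $\alpha\in(0,1)$. Then $\mathbf F^\alpha_m(K)$ is isomorphic (as a Banach space) to the dual of $\mathbf{ch}^{m,\alpha}(K)$, the corresponding duality bracket being the restriction to $\mathbf{ch}^{m,\alpha}(K)\times\mathbf F^\alpha_m(K)$ of the bracket $\langle\cdot,\cdot\rangle\colon\mathbf{CH}^{m,\alpha}(K)\times\mathbf F^\alpha_m(K)\to\mathbb{R}$. That is, $T\mapsto\langle\cdot,T\rangle$ is a continuous linear bijection with continuous inverse from $\mathbf F^\alpha_m(K)$ onto $\mathbf{ch}^{m,\alpha}(K)^*$.
   Context: Currents: a (compactly supported) $m$-current $T$ in $\mathbb{R}^d$ is a continuous linear functional on $C^\infty(\mathbb{R}^d;\wedge^m\mathbb{R}^d)$ (smooth $m$-forms with the usual topology); $\partial T(\omega)=T(d\omega)$ for $m\ge1$. Covectors carry the comass norm and $\|\omega\|_\infty$ is the supremum of the comass. $\mathbf M(T)=\sup\{T(\omega):\|\omega\|_\infty\le1\}$; $\mathbf N(T)=\mathbf M(T)+\mathbf M(\partial T)$ for $m\ge1$, $\mathbf N=\mathbf M$ for $m=0$; $T$ is normal if $\mathbf N(T)<\infty$. For normal $T$, the flat norm is $\mathbf F(T)=\sup\{T(\omega):\max\{\|\omega\|_\infty,\|d\omega\|_\infty\}\le1\}$. $T$ is flat if it is the weak limit of an $\mathbf F$-Cauchy sequence $(T_n)$ of normal currents with $\bigcup_n\operatorname{spt}T_n$ relatively compact; then $\mathbf F(T)=\lim\mathbf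 F(T_n)$. $\mathbf N_m(K)$ is the space of normal $m$-currents supported in $K$. A flat $m$-current $T$ is $\alpha$-fractional if it admits an $\alpha$-fractional decomposition, i.e. a sequence $(T_k)_{k\ge0}$ of normal $m$-currents, all supported in a common compact set, with $\sum_k\mathbf N(T_k)^{1-\alpha}\mathbf F(T_k)^\alpha<\infty$ and $T=\sum_kT_k$ ($\mathbf F$-convergent series). $\mathbf F^\alpha(T)=\inf\sum_k\mathbf N(T_k)^{1-\alpha}\mathbf F(T_k)^\alpha$ over all such decompositions. $\mathbf F^\alpha_m(K)$ is the Banach space of $\alpha$-fractional $m$-currents with support in $K$, normed by $\mathbf F^\alpha$. An $\alpha$-fractional $m$-charge over $K$ is a linear functional $\omega\colon\mathbf N_m(K)\to\mathbb{R}$ for which there is $C\ge0$ with $|\omega(T)|\le C\,\mathbf N(T)^{1-\alpha}\mathbf F(T)^\alpha$ for all $T\in\mathbf N_m(K)$; $\mathbf{CH}^{m,\alpha}(K)$ is the space of these, and $\|\omega\|_{\mathbf{CH}^{m,\alpha}(K)}$ is the infimum of such $C$. For $K$ convex, the bracket $\langle\omega,T\rangle$, for $\omega\in\mathbf{CH}^{m,\alpha}(K)$ and $T\in\mathbf F^\alpha_m(K)$, is defined by $\langle\omega,T\rangle=\sum_k\omega(T_k)$ where $(T_k)$ is any $\alpha$-fractional decomposition of $T$ into normal currents supported in $K$ (such a decomposition exists, and the value does not depend on the choice). Every $\omega\in C^\infty(\mathbb{R}^d;\wedge^m\mathbb{R}^d)$ defines $\iota_K(\omega)\in\mathbf{CH}^{m,\alpha}(K)$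 by $\iota_K(\omega)(T)=T(\omega)$. The space $\mathbf{ch}^{m,\alpha}(K)$ of little $\alpha$-fractional $m$-charges is the closure of $\{\iota_K(\omega):\omega\in C^\infty(\mathbb{R}^d;\wedge^m\mathbb{R}^d)\}$ in $\mathbf{CH}^{m,\alpha}(K)$, with the norm inherited from $\mathbf{CH}^{m,\alpha}(K)$. *)

theory Defs
  imports "HOL-Analysis.Analysis" "HOL-Library.Function_Algebras"
begin

(* Forms, currents, charges and functionals on spaces of charges are all functions,
   added and scaled pointwise. *)

instantiation "fun" :: (type, real_vector) real_vector
begin

definition scaleR_fun_def: "c *\<^sub>R f = (\<lambda>x. c *\<^sub>R f x)"

instance
  by standard (simp_all add: scaleR_fun_def plus_fun_def fun_eq_iff scaleR_add_right scaleR_add_left)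

end

(* Linear functionals on a linear subspace V of the ambient type.  They are extended by 0
   outside V, so that equality of functions is equality of functionals on V. *)
definition linear_functionals :: "'v::real_vector set \<Rightarrow> ('v \<Rightarrow> real) set" where
  "linear_functionals V = {\<Phi>.
     (\<forall>f\<in>V. \<forall>g\<in>V. \<Phi> (f + g) = \<Phi> f + \<Phi> g) \<and>
     (\<forall>c. \<forall>f\<in>V. \<Phi> (c *\<^sub>R f) = c * \<Phi> f) \<and>
     (\<forall>f. f \<notin> V \<longrightarrow> \<Phi> f = 0)}"


section \<open>Differential forms\<close>

(* An m-covector is an alternating m-linear form on the vectors v 0, ..., v (m - 1); the
   remaining values of v are ignored. *)
type_synonym 'a covector = "(nat \<Rightarrow> 'a) \<Rightarrow> real"
type_synonym 'a form = "'a \<Rightarrow> 'a covector"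

definition covectors :: "nat \<Rightarrow> 'a::euclidean_space covector set" where
  "covectors m = {\<phi>.
     (\<forall>v w. (\<forall>i<m. v i = w i) \<longrightarrow> \<phi> v = \<phi> w) \<and>
     (\<forall>v. \<forall>i<m. linear (\<lambda>u. \<phi> (v(i := u)))) \<and>
     (\<forall>v. \<forall>i<m. \<forall>j<m. i \<noteq> j \<longrightarrow> v i = v j \<longrightarrow> \<phi> v = 0)}"

(* The simple m-vectors of Euclidean norm at most 1 are exactly the products
   v 0 \<and> ... \<and> v (m - 1) of vectors of norm at most 1. *)
definition comass :: "nat \<Rightarrow> 'a::euclidean_space covector \<Rightarrow> ereal" where
  "comass m \<phi> = (SUP v\<in>{v. \<forall>i<m. norm (v i) \<le> 1}. ereal \<bar>\<phi> v\<bar>)"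

primrec iter_deriv :: "'a list \<Rightarrow> ('a::euclidean_space \<Rightarrow> real) \<Rightarrow> 'a \<Rightarrow> real" where
  "iter_deriv [] f = f"
| "iter_deriv (u # us) f = iter_deriv us (\<lambda>x. frechet_derivative f (at x) u)"

definition smooth :: "('a::euclidean_space \<Rightarrow> real) \<Rightarrow> bool" where
  "smooth f \<longleftrightarrow> (\<forall>us x. iter_deriv us f differentiable (at x))"

definition smooth_forms :: "nat \<Rightarrow> 'a::euclidean_space form set" where
  "smooth_forms m = {\<omega>. (\<forall>x. \<omega> x \<in> covectors m) \<and> (\<forall>v. smooth (\<lambda>x. \<omega> x v))}"

definition form_norm :: "nat \<Rightarrow> 'a::euclidean_space form \<Rightarrow> ereal" where
  "form_norm m \<omega> = (SUP x. comass m (\<omega> x))"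

(* d\<omega> (x; v 0, ..., v m) is the alternating sum over i of the derivative of
   \<omega> (\<cdot>; v 0, ..., v m without v i) at x in the direction v i. *)
definition ext_deriv :: "nat \<Rightarrow> 'a::euclidean_space form \<Rightarrow> 'a form" where
  "ext_deriv m \<omega> = (\<lambda>x v. \<Sum>i\<le>m. (- 1) ^ i *
     frechet_derivative (\<lambda>y. \<omega> y (\<lambda>j. if j < i then v j else v (Suc j))) (at x) (v i))"

(* Locally uniform convergence of all derivatives: the locally convex topology given by the
   seminorms sup over C of |iter_deriv us (\<lambda>y. \<omega> y v)|, with C compact, us a list of
   directions and v a tuple of vectors. *)
definition form_topology :: "nat \<Rightarrow> 'a::euclidean_space form topology" where
  "form_topology m = topology_generated_by
     {{\<eta> \<in> smooth_forms m. \<forall>x\<in>C. \<bar>iter_deriv us (\<lambda>y. \<eta> y v - \<omega> y v) x\<bar> < \<epsilon>} | \<omega> C us v \<epsilon>.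
        \<omega> \<in> smooth_forms m \<and> compact C \<and> 0 < \<epsilon>}"

definition form_support :: "'a::euclidean_space form \<Rightarrow> 'a set" where
  "form_support \<omega> = closure {x. \<exists>v. \<omega> x v \<noteq> 0}"


section \<open>Normal and flat currents\<close>

type_synonym 'a current = "'a form \<Rightarrow> real"

definition currents :: "nat \<Rightarrow> 'a::euclidean_space current set" where
  "currents m = {T \<in> linear_functionals (smooth_forms m).
     continuous_map (form_topology m) euclideanreal T}"

definition spt :: "nat \<Rightarrow> 'a::euclidean_space current \<Rightarrow> 'a set" where
  "spt m T = - \<Union> {U. open U \<and> (\<forall>\<omega>\<in>smooth_forms m.
     compact (form_support \<omega>) \<and> form_support \<omega> \<subseteq> U \<longrightarrow> T \<omega> = 0)}"

(* Used for m-currents with m \<ge> 1 only. *)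
definition boundary :: "nat \<Rightarrow> 'a::euclidean_space current \<Rightarrow> 'a current" where
  "boundary m T = (\<lambda>\<omega>. if \<omega> \<in> smooth_forms (m - 1) then T (ext_deriv (m - 1) \<omega>) else 0)"

definition mass :: "nat \<Rightarrow> 'a::euclidean_space current \<Rightarrow> ereal" where
  "mass m T = (SUP \<omega>\<in>{\<omega> \<in> smooth_forms m. form_norm m \<omega> \<le> 1}. ereal (T \<omega>))"

definition normal_mass :: "nat \<Rightarrow> 'a::euclidean_space current \<Rightarrow> ereal" where
  "normal_mass m T = (if m = 0 then mass m T else mass m T + mass (m - 1) (boundary m T))"

definition normal_currents :: "nat \<Rightarrow> 'a::euclidean_space current set" where
  "normal_currents m = {T \<in> currents m. normal_mass m T < \<infinity>}"

definition normal_currents_in :: "nat \<Rightarrow> 'a::euclidean_space set \<Rightarrow> 'a current set" where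
  "normal_currents_in m K = {T \<in> normal_currents m. spt m T \<subseteq> K}"

definition normal_flat_norm :: "nat \<Rightarrow> 'a::euclidean_space current \<Rightarrow> ereal" where
  "normal_flat_norm m T =
     (SUP \<omega>\<in>{\<omega> \<in> smooth_forms m. max (form_norm m \<omega>) (form_norm (Suc m) (ext_deriv m \<omega>)) \<le> 1}.
        ereal (T \<omega>))"

definition flat_approximation ::
    "nat \<Rightarrow> (nat \<Rightarrow> 'a::euclidean_space current) \<Rightarrow> 'a current \<Rightarrow> bool" where
  "flat_approximation m Ts T \<longleftrightarrow>
     (\<forall>n. Ts n \<in> normal_currents m) \<and>
     (\<forall>\<epsilon>>0. \<exists>N. \<forall>i\<ge>N. \<forall>j\<ge>N. normal_flat_norm m (Ts i - Ts j) < ereal \<epsilon>) \<and>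
     compact (closure (\<Union>n. spt m (Ts n))) \<and>
     (\<forall>\<omega>\<in>smooth_forms m. (\<lambda>n. Ts n \<omega>) \<longlonglongrightarrow> T \<omega>)"

definition flat_currents :: "nat \<Rightarrow> 'a::euclidean_space current set" where
  "flat_currents m = {T \<in> currents m. \<exists>Ts. flat_approximation m Ts T}"

(* The limit does not depend on the approximating sequence; constant sequences show that
   this extends normal_flat_norm. *)
definition flat_norm :: "nat \<Rightarrow> 'a::euclidean_space current \<Rightarrow> real" where
  "flat_norm m T = (THE r. \<exists>Ts. flat_approximation m Ts T \<and>
     (\<lambda>n. normal_flat_norm m (Ts n)) \<longlonglongrightarrow> ereal r)"


section \<open>Fractional currents\<close>

definition frac_weight :: "nat \<Rightarrow> real \<Rightarrow> 'a::euclidean_space current \<Rightarrow> real" where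
  "frac_weight m \<alpha> T =
     real_of_ereal (normal_mass m T) powr (1 - \<alpha>) * real_of_ereal (normal_flat_norm m T) powr \<alpha>"

definition frac_decomposition ::
    "nat \<Rightarrow> real \<Rightarrow> (nat \<Rightarrow> 'a::euclidean_space current) \<Rightarrow> 'a current \<Rightarrow> bool" where
  "frac_decomposition m \<alpha> Ts T \<longleftrightarrow>
     (\<exists>C. compact C \<and> (\<forall>k. Ts k \<in> normal_currents_in m C)) \<and>
     summable (\<lambda>k. frac_weight m \<alpha> (Ts k)) \<and>
     (\<lambda>n. flat_norm m (T - (\<Sum>k<n. Ts k))) \<longlonglongrightarrow> 0"

definition frac_currents :: "nat \<Rightarrow> real \<Rightarrow> 'a::euclidean_space current set" where
  "frac_currents m \<alpha> = {T \<in> flat_currents m. \<exists>Ts. frac_decomposition m \<alpha> Ts T}"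

definition frac_norm :: "nat \<Rightarrow> real \<Rightarrow> 'a::euclidean_space current \<Rightarrow> real" where
  "frac_norm m \<alpha> T = Inf {\<Sum>k. frac_weight m \<alpha> (Ts k) | Ts. frac_decomposition m \<alpha> Ts T}"

definition frac_currents_in :: "nat \<Rightarrow> real \<Rightarrow> 'a::euclidean_space set \<Rightarrow> 'a current set" where
  "frac_currents_in m \<alpha> K = {T \<in> frac_currents m \<alpha>. spt m T \<subseteq> K}"


section \<open>Fractional charges\<close>

type_synonym 'a charge = "'a current \<Rightarrow> real"

definition frac_charges :: "nat \<Rightarrow> real \<Rightarrow> 'a::euclidean_space set \<Rightarrow> 'a charge set" where
  "frac_charges m \<alpha> K = {\<omega> \<in> linear_functionals (normal_currents_in m K).
     \<exists>C\<ge>0. \<forall>T\<in>normal_currents_in m K. \<bar>\<omega> T\<bar> \<le> C * frac_weight m \<alpha> T}"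

definition charge_norm :: "nat \<Rightarrow> real \<Rightarrow> 'a::euclidean_space set \<Rightarrow> 'a charge \<Rightarrow> real" where
  "charge_norm m \<alpha> K \<omega> =
     Inf {C. 0 \<le> C \<and> (\<forall>T\<in>normal_currents_in m K. \<bar>\<omega> T\<bar> \<le> C * frac_weight m \<alpha> T)}"

definition charge_of_form :: "nat \<Rightarrow> 'a::euclidean_space set \<Rightarrow> 'a form \<Rightarrow> 'a charge" where
  "charge_of_form m K \<omega> = (\<lambda>T. if T \<in> normal_currents_in m K then T \<omega> else 0)"

definition little_frac_charges :: "nat \<Rightarrow> real \<Rightarrow> 'a::euclidean_space set \<Rightarrow> 'a charge set" where
  "little_frac_charges m \<alpha> K = {\<omega> \<in> frac_charges m \<alpha> K.
     \<forall>\<epsilon>>0. \<exists>\<eta>\<in>smooth_forms m. charge_norm m \<alpha> K (\<omega> - charge_of_form m K \<eta>) < \<epsilon>}"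

(* For K convex such a decomposition exists, and the sum does not depend on it. *)
definition bracket ::
    "nat \<Rightarrow> real \<Rightarrow> 'a::euclidean_space set \<Rightarrow> 'a charge \<Rightarrow> 'a current \<Rightarrow> real" where
  "bracket m \<alpha> K \<omega> T = (THE r. \<exists>Ts. frac_decomposition m \<alpha> Ts T \<and>
     (\<forall>k. Ts k \<in> normal_currents_in m K) \<and> (\<lambda>k. \<omega> (Ts k)) sums r)"


section \<open>Duals and isomorphisms of normed spaces\<close>

(* A normed space is given by its carrier, a linear subspace V of the ambient type, and
   its norm p. *)

definition dual_space :: "'v::real_vector set \<Rightarrow> ('v \<Rightarrow> real) \<Rightarrow> ('v \<Rightarrow> real) set" where
  "dual_space V p = {\<Phi> \<in> linear_functionals V. \<exists>B\<ge>0. \<forall>f\<in>V. \<bar>\<Phi> f\<bar> \<le> B * p f}"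

definition dual_norm :: "'v::real_vector set \<Rightarrow> ('v \<Rightarrow> real) \<Rightarrow> ('v \<Rightarrow> real) \<Rightarrow> real" where
  "dual_norm V p \<Phi> = Inf {B. 0 \<le> B \<and> (\<forall>f\<in>V. \<bar>\<Phi> f\<bar> \<le> B * p f)}"

definition bounded_linear_between ::
    "'v::real_vector set \<Rightarrow> ('v \<Rightarrow> real) \<Rightarrow> 'w::real_vector set \<Rightarrow> ('w \<Rightarrow> real) \<Rightarrow> ('v \<Rightarrow> 'w) \<Rightarrow> bool" where
  "bounded_linear_between V p W q J \<longleftrightarrow>
     J \<in> V \<rightarrow> W \<and>
     (\<forall>f\<in>V. \<forall>g\<in>V. J (f + g) = J f + J g) \<and>
     (\<forall>c. \<forall>f\<in>V. J (c *\<^sub>R f) = c *\<^sub>R J f) \<and>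
     (\<exists>B. \<forall>f\<in>V. q (J f) \<le> B * p f)"

definition isomorphism_between ::
    "'v::real_vector set \<Rightarrow> ('v \<Rightarrow> real) \<Rightarrow> 'w::real_vector set \<Rightarrow> ('w \<Rightarrow> real) \<Rightarrow> ('v \<Rightarrow> 'w) \<Rightarrow> bool" where
  "isomorphism_between V p W q J \<longleftrightarrow>
     bij_betw J V W \<and>
     bounded_linear_between V p W q J \<and>
     bounded_linear_between W q V p (inv_into V J)"

end

theory Submission
  imports Defs
begin

(* Both halves rest on the fact that the fractional currents in K are exactly the linear functionals
   T on smooth forms with |T eta| <= B ||eta|| for the charge norm of eta over K.

   If T = sum T_k is any fractional decomposition, then T eta is the limit of T (f^* eta),
   where f is smooth, 1-Lipschitz, has values in K and coincides near K with a homothety composed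
   with the orthogonal projection onto the affine hull of K; flat currents do not see this
   projection. As the f_# T_k are normal currents in K of no larger weight,
   |T eta| <= (sum of the weights of T_k) ||eta||.

   Conversely, a functional bounded by the charge norm is split by the Hahn-Banach theorem into
   functionals T_j bounded by the suprema over the normal currents in K with
   N <= 2^(alpha j) and F <= 2^(-(1 - alpha) j). These T_j are normal currents in K with summable
   weights. No compactness theorem for normal currents is needed.

   The bracket with a little charge is the limit of T eta_n for forms eta_n approximating the charge, so
   the dual of the little charges consists of the functionals above. *)

section \<open>Smooth functions\<close>

text \<open>The obstacle is that an \<alpha>-fractional decomposition may use normal currents
  supported in any compact set, whereas charges over K only see currents supported in K. The
  currents must therefore be pushed into K without increasing N or F. The closest point map of K
  does this geometrically, but it is merely Lipschitz, and smooth forms cannot be pulled back along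
  it. Averaging it over small translations makes it smooth and, by convexity, keeps its values in K;
  an even kernel moreover leaves it unchanged where it is affine. Since it is not affine near the
  relative boundary, K is shrunk beforehand by a homothety of ratio \<mu> < 1, and \<mu> tends to 1
  at the end. If K has empty interior, the closest point map is, near the shrunken set, the
  projection onto the affine hull and not the identity, which is why flat currents have to be shown
  insensitive to it.

  The isomorphism comes with the constant 4 in both directions: a factor 2 for rounding to dyadic
  levels times a factor 2 for estimating mass and boundary mass separately.\<close>

definition ck :: "nat \<Rightarrow> 'a::euclidean_space set \<Rightarrow> ('a \<Rightarrow> real) \<Rightarrow> bool" where
  "ck n S f \<longleftrightarrow> (\<forall>us x. length us \<le> n \<longrightarrow> x \<in> S \<longrightarrow> iter_deriv us f differentiable (at x))"

text \<open>The filtration by finite order is what makes induction possible: differentiating a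
  product or a composite once leaves functions of order n, to which the induction hypothesis
  applies. The set S is there for functions that are smooth only locally, such as
  \<open>inverse\<close> away from 0.\<close>

lemma smooth_iff_ck: "smooth f \<longleftrightarrow> (\<forall>n. ck n UNIV f)"
  unfolding smooth_def ck_def by auto

lemma ck_0: "ck 0 S f \<longleftrightarrow> (\<forall>x\<in>S. f differentiable (at x))"
  unfolding ck_def by auto

lemma ck_Suc: "ck (Suc n) S f \<longleftrightarrow>
    (\<forall>x\<in>S. f differentiable (at x)) \<and> (\<forall>u. ck n S (\<lambda>x. frechet_derivative f (at x) u))"
proof
  assume L: "ck (Suc n) S f"
  show "(\<forall>x\<in>S. f differentiable (at x)) \<and> (\<forall>u. ck n S (\<lambda>x. frechet_derivative f (at x) u))"
    unfolding ck_def
  proof (intro conjI ballI allI impI)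
    fix x assume "x \<in> S"
    then have "iter_deriv [] f differentiable (at x)" using L unfolding ck_def by (metis le0 list.size(3))
    then show "f differentiable (at x)" by simp
  next
    fix u x :: 'a and us :: "'a list" assume "length us \<le> n" "x \<in> S"
    then have "iter_deriv (u # us) f differentiable (at x)" using L unfolding ck_def
      by (metis Suc_le_mono length_Cons)
    then show "iter_deriv us (\<lambda>x. frechet_derivative f (at x) u) differentiable (at x)" by simp
  qed
next
  assume R: "(\<forall>x\<in>S. f differentiable (at x)) \<and> (\<forall>u. ck n S (\<lambda>x. frechet_derivative f (at x) u))"
  show "ck (Suc n) S f" unfolding ck_def
  proof (intro allI impI)
    fix us :: "'a list" and x :: 'a assume "length us \<le> Suc n" "x \<in> S"
    then show "iter_deriv us f differentiable (at x)"
      using R by (cases us) (auto simp: ck_def)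
  qed
qed

lemma ck_diff: "ck n S f \<Longrightarrow> x \<in> S \<Longrightarrow> f differentiable (at x)"
  by (cases n) (auto simp: ck_0 ck_Suc)

lemma ck_le: "ck n S f \<Longrightarrow> k \<le> n \<Longrightarrow> ck k S f"
  unfolding ck_def by auto

lemma ck_subset: "ck n S f \<Longrightarrow> R \<subseteq> S \<Longrightarrow> ck n R f"
  unfolding ck_def by auto

text \<open>On an open set f and g have the same germ at every point, hence the same derivative; the
  derivatives agree on S again, which closes the induction.\<close>

lemma ck_cong:
  assumes "open S" "\<And>x. x \<in> S \<Longrightarrow> f x = g x" "ck n S g"
  shows "ck n S f"
  using assms(2,3)
proof (induction n arbitrary: f g)
  case 0
  show ?case unfolding ck_0
  proof
    fix x assume x: "x \<in> S"
    have "g differentiable (at x)" using ck_diff 0 x by blast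
    then obtain D where "(g has_derivative D) (at x)" unfolding differentiable_def by blast
    then have "(f has_derivative D) (at x)"
      by (rule has_derivative_transform_within_open[OF _ assms(1) x]) (use 0 in auto)
    then show "f differentiable (at x)" unfolding differentiable_def by blast
  qed
next
  case (Suc n)
  have D: "(f has_derivative frechet_derivative g (at x)) (at x)" if x: "x \<in> S" for x
  proof -
    have "(g has_derivative frechet_derivative g (at x)) (at x)"
      using ck_diff Suc(3) x frechet_derivative_works by blast
    then show ?thesis
      by (rule has_derivative_transform_within_open[OF _ assms(1) x]) (use Suc in auto)
  qed
  have "ck n S (\<lambda>x. frechet_derivative f (at x) u)" for u
  proof (rule Suc.IH)
    show "ck n S (\<lambda>x. frechet_derivative g (at x) u)" using Suc(3) ck_Suc by blast
    show "frechet_derivative f (at x) u = frechet_derivative g (at x) u" if "x \<in> S" for x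
      using D[OF that] frechet_derivative_at by metis
  qed
  then show ?case using D unfolding ck_Suc differentiable_def by blast
qed

text \<open>Any explicit derivative D may replace \<open>frechet_derivative f\<close>: by uniqueness
  the two agree on S, and \<open>ck_cong\<close> transfers the order.\<close>

lemma ck_SucI:
  assumes "open S" "\<And>x. x \<in> S \<Longrightarrow> (f has_derivative D x) (at x)"
    "\<And>u. ck n S (\<lambda>x. D x u)"
  shows "ck (Suc n) S f"
  unfolding ck_Suc
proof (intro conjI ballI allI)
  show "f differentiable (at x)" if "x \<in> S" for x using assms(2)[OF that] differentiable_def by blast
  show "ck n S (\<lambda>x. frechet_derivative f (at x) u)" for u
    by (rule ck_cong[OF assms(1) _ assms(3)[of u]]) (use assms(2) frechet_derivative_at in metis)
qed

lemma ck_D: "ck n S f \<Longrightarrow> x \<in> S \<Longrightarrow> (f has_derivative frechet_derivative f (at x)) (at x)"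
  using ck_diff frechet_derivative_works by blast

lemma ck_const: "open S \<Longrightarrow> ck n S (\<lambda>x. c)"
proof (induction n arbitrary: c)
  case 0 then show ?case by (simp add: ck_0)
next
  case (Suc n) show ?case
    by (rule ck_SucI[where D="\<lambda>x h. 0"]) (use Suc in auto)
qed

lemma ck_bounded_linear: "open S \<Longrightarrow> bounded_linear f \<Longrightarrow> ck n S f"
  by (cases n) (auto simp: ck_0 bounded_linear_imp_differentiable intro!: ck_SucI[where D="\<lambda>x h. f h"] ck_const
      bounded_linear_imp_has_derivative)

lemma ck_add:
  assumes "open S" "ck n S f" "ck n S g" shows "ck n S (\<lambda>x. f x + g x)"
  using assms(2,3)
proof (induction n arbitrary: f g)
  case 0 then show ?case by (auto simp: ck_0 intro: differentiable_add)
next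
  case (Suc n)
  show ?case
  proof (rule ck_SucI[OF assms(1)])
    show "((\<lambda>x. f x + g x) has_derivative
        (\<lambda>h. frechet_derivative f (at x) h + frechet_derivative g (at x) h)) (at x)" if "x \<in> S" for x
      by (intro has_derivative_add ck_D[OF Suc(2) that] ck_D[OF Suc(3) that])
    show "ck n S (\<lambda>x. frechet_derivative f (at x) u + frechet_derivative g (at x) u)" for u
      using Suc ck_Suc by blast
  qed
qed

lemma ck_mult:
  assumes "open S" "ck n S f" "ck n S g" shows "ck n S (\<lambda>x. f x * g x)"
  using assms(2,3)
proof (induction n arbitrary: f g)
  case 0 then show ?case by (auto simp: ck_0 intro: differentiable_mult)
next
  case (Suc n)
  show ?case
  proof (rule ck_SucI[OF assms(1)])
    show "((\<lambda>x. f x * g x) has_derivative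
        (\<lambda>h. f x * frechet_derivative g (at x) h + frechet_derivative f (at x) h * g x)) (at x)" if "x \<in> S" for x
      by (intro has_derivative_mult ck_D[OF Suc(2) that] ck_D[OF Suc(3) that])
    show "ck n S (\<lambda>x. f x * frechet_derivative g (at x) u + frechet_derivative f (at x) u * g x)" for u
      using Suc(2,3)[unfolded ck_Suc] ck_le[OF Suc(2), of n] ck_le[OF Suc(3), of n]
      by (intro ck_add[OF assms(1)] Suc.IH) simp_all
  qed
qed

lemma ck_sum:
  assumes "open S" "\<And>i. i \<in> I \<Longrightarrow> ck n S (f i)" shows "ck n S (\<lambda>x. \<Sum>i\<in>I. f i x)"
  using assms(2) by (induction I rule: infinite_finite_induct) (auto simp: ck_const ck_add assms(1))

lemma ck_prod:
  assumes "open S" "\<And>i. i \<in> I \<Longrightarrow> ck n S (f i)" shows "ck n S (\<lambda>x. \<Prod>i\<in>I. f i x)"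
  using assms(2) by (induction I rule: infinite_finite_induct) (auto simp: ck_const ck_mult assms(1))

text \<open>The chain rule in coordinates: the derivative becomes a finite sum of products of real
  functions, the shape to which \<open>ck_sum\<close> and \<open>ck_mult\<close> apply.\<close>

lemma has_derivative_compose_basis:
  fixes P :: "'a::euclidean_space \<Rightarrow> 'b::euclidean_space" and g :: "'b \<Rightarrow> real"
  assumes "(g has_derivative G) (at (P x))" "\<And>b. b \<in> Basis \<Longrightarrow> ((\<lambda>x. P x \<bullet> b) has_derivative P' b) (at x)"
  shows "((\<lambda>x. g (P x)) has_derivative (\<lambda>h. \<Sum>b\<in>Basis. P' b h * G b)) (at x)"
proof -
  have "(P has_derivative (\<lambda>h. \<Sum>b\<in>Basis. P' b h *\<^sub>R b)) (at x)"
    by (rule has_derivative_componentwise_within[THEN iffD2]) (use assms(2) in \<open>auto simp: inner_sum_left inner_Basis if_distrib cong: if_cong\<close>)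
  from has_derivative_compose[OF this assms(1)]
  have "((\<lambda>x. g (P x)) has_derivative (\<lambda>h. G (\<Sum>b\<in>Basis. P' b h *\<^sub>R b))) (at x)" by simp
  moreover have "linear G" using assms(1) has_derivative_linear by blast
  ultimately show ?thesis by (simp add: linear_sum linear_cmul)
qed

text \<open>Induction on n with g generalised: the derivative of the composite is a sum of products
  of a derivative of a coordinate of P with a partial derivative of g composed with P, and both
  factors are of order n.\<close>

lemma ck_compose:
  fixes P :: "'a::euclidean_space \<Rightarrow> 'b::euclidean_space"
  assumes "open S" "open U" "P ` S \<subseteq> U" "\<And>b. b \<in> Basis \<Longrightarrow> ck n S (\<lambda>x. P x \<bullet> b)" "ck n U g"
  shows "ck n S (\<lambda>x. g (P x))"
  using assms(4,5)
proof (induction n arbitrary: g)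
  case 0
  show ?case unfolding ck_0
  proof
    fix x assume x: "x \<in> S"
    have "(g has_derivative frechet_derivative g (at (P x))) (at (P x))" using 0 x assms(3) ck_D by blast
    moreover have "((\<lambda>x. P x \<bullet> b) has_derivative frechet_derivative (\<lambda>x. P x \<bullet> b) (at x)) (at x)" if "b \<in> Basis" for b
      using 0 x that ck_D by blast
    ultimately show "(\<lambda>x. g (P x)) differentiable (at x)"
      unfolding differentiable_def using has_derivative_compose_basis[of g _ P x "\<lambda>b. frechet_derivative (\<lambda>x. P x \<bullet> b) (at x)"] by blast
  qed
next
  case (Suc n)
  show ?case
  proof (rule ck_SucI[OF assms(1)])
    show "((\<lambda>x. g (P x)) has_derivative (\<lambda>h. \<Sum>b\<in>Basis. frechet_derivative (\<lambda>x. P x \<bullet> b) (at x) h *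
        frechet_derivative g (at (P x)) b)) (at x)" if "x \<in> S" for x
      by (rule has_derivative_compose_basis) (use that Suc assms(3) ck_D in blast)+
    show "ck n S (\<lambda>x. \<Sum>b\<in>Basis. frechet_derivative (\<lambda>x. P x \<bullet> b) (at x) u *
        frechet_derivative g (at (P x)) b)" for u
    proof (intro ck_sum ck_mult assms(1))
      fix b :: 'b assume b: "b \<in> Basis"
      show "ck n S (\<lambda>x. frechet_derivative (\<lambda>x. P x \<bullet> b) (at x) u)" using Suc(2)[OF b] ck_Suc by blast
      show "ck n S (\<lambda>x. frechet_derivative g (at (P x)) b)"
        by (rule Suc.IH[of "\<lambda>y. frechet_derivative g (at y) b"])
          (use Suc(3)[unfolded ck_Suc] ck_le[OF Suc(2), of _ n] in simp_all)
    qed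
  qed
qed

lemma ck_compose_real:
  fixes f :: "'a::euclidean_space \<Rightarrow> real"
  assumes "open S" "open U" "f ` S \<subseteq> U" "ck n S f" "ck n U g"
  shows "ck n S (\<lambda>x. g (f x))"
  by (rule ck_compose[where P=f]) (use assms in auto)

lemma ck_DERIV_I:
  fixes f :: "real \<Rightarrow> real"
  assumes "open S" "\<And>x. x \<in> S \<Longrightarrow> (f has_real_derivative D x) (at x)" "ck n S D"
  shows "ck (Suc n) S f"
proof (rule ck_SucI[OF assms(1)])
  show "(f has_derivative (\<lambda>h. D x * h)) (at x)" if "x \<in> S" for x
    using assms(2)[OF that] by (simp add: has_field_derivative_def mult_commute_abs)
  show "ck n S (\<lambda>x. D x * u)" for u by (intro ck_mult ck_const assms)
qed

text \<open>The derivative of 1/x is -(1/x)^2, a product of functions already known to be of order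
  n.\<close>

lemma ck_inverse: "ck n {0::real<..} inverse"
proof (induction n)
  case 0
  show ?case unfolding ck_0 by (auto intro!: differentiable_inverse)
next
  case (Suc n)
  show ?case
  proof (rule ck_DERIV_I)
    show "(inverse has_real_derivative (- 1) * (inverse x * inverse x)) (at x)" if "x \<in> {0<..}" for x :: real
      using that by (auto intro!: derivative_eq_intros)
    show "ck n {0<..} (\<lambda>x::real. (- 1) * (inverse x * inverse x))"
      by (intro ck_mult ck_const Suc) auto
  qed auto
qed

lemma smoothI: "(\<And>n. ck n UNIV f) \<Longrightarrow> smooth f" by (simp add: smooth_iff_ck)
lemma smoothD: "smooth f \<Longrightarrow> ck n UNIV f" by (simp add: smooth_iff_ck)

lemma smooth_has_derivative: "smooth f \<Longrightarrow> (f has_derivative frechet_derivative f (at x)) (at x)"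
  using ck_D smoothD UNIV_I by blast

lemma smooth_deriv: "smooth f \<Longrightarrow> smooth (\<lambda>x. frechet_derivative f (at x) u)"
  unfolding smooth_iff_ck by (metis ck_Suc)

lemma smooth_iter_deriv: "smooth f \<Longrightarrow> smooth (iter_deriv us f)"
  by (induction us arbitrary: f) (auto intro: smooth_deriv)

lemma smooth_const: "smooth (\<lambda>x. c)" by (simp add: smooth_iff_ck ck_const)
lemma smooth_bounded_linear: "bounded_linear f \<Longrightarrow> smooth f"
  by (simp add: smooth_iff_ck ck_bounded_linear)
lemma smooth_add: "smooth f \<Longrightarrow> smooth g \<Longrightarrow> smooth (\<lambda>x. f x + g x)"
  by (simp add: smooth_iff_ck ck_add)
lemma smooth_mult: "smooth f \<Longrightarrow> smooth g \<Longrightarrow> smooth (\<lambda>x. f x * g x)"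
  by (simp add: smooth_iff_ck ck_mult)
lemma smooth_sum: "(\<And>i. i \<in> I \<Longrightarrow> smooth (f i)) \<Longrightarrow> smooth (\<lambda>x. \<Sum>i\<in>I. f i x)"
  by (simp add: smooth_iff_ck ck_sum)
lemma smooth_prod: "(\<And>i. i \<in> I \<Longrightarrow> smooth (f i)) \<Longrightarrow> smooth (\<lambda>x. \<Prod>i\<in>I. f i x)"
  by (simp add: smooth_iff_ck ck_prod)
lemma smooth_minus: "smooth f \<Longrightarrow> smooth (\<lambda>x. - f x)"
  using smooth_mult[OF smooth_const[of "-1"]] by fastforce
lemma smooth_diff: "smooth f \<Longrightarrow> smooth g \<Longrightarrow> smooth (\<lambda>x. f x - g x)"
  using smooth_add[OF _ smooth_minus] by fastforce
lemma smooth_inner: "smooth (\<lambda>x. x \<bullet> e)"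
  by (intro smooth_bounded_linear bounded_linear_inner_left)

section \<open>Smooth maps between Euclidean spaces\<close>

definition smooth_map :: "('a::euclidean_space \<Rightarrow> 'b::euclidean_space) \<Rightarrow> bool" where
  "smooth_map P \<longleftrightarrow> (\<forall>b\<in>Basis. smooth (\<lambda>x. P x \<bullet> b))"

lemma smooth_compose: "smooth g \<Longrightarrow> smooth_map P \<Longrightarrow> smooth (\<lambda>x. g (P x))"
  unfolding smooth_iff_ck smooth_map_def by (blast intro: ck_compose[OF open_UNIV open_UNIV subset_UNIV])

lemma smooth_compose_real: "smooth g \<Longrightarrow> smooth f \<Longrightarrow> smooth (\<lambda>x. g (f x :: real))"
  by (rule smooth_compose) (auto simp: smooth_map_def)

lemma smooth_continuous: "smooth f \<Longrightarrow> continuous_on S f"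
  by (meson smooth_has_derivative continuous_at_imp_continuous_on has_derivative_continuous)

lemma smooth_map_has_derivative:
  assumes "smooth_map P" shows "(P has_derivative frechet_derivative P (at x)) (at x)"
proof -
  have D: "(P has_derivative (\<lambda>h. \<Sum>b\<in>Basis. frechet_derivative (\<lambda>x. P x \<bullet> b) (at x) h *\<^sub>R b)) (at x)"
    by (rule has_derivative_componentwise_within[THEN iffD2])
      (use assms smooth_has_derivative in \<open>auto simp: smooth_map_def inner_sum_left inner_Basis if_distrib cong: if_cong\<close>)
  then show ?thesis by (simp only: frechet_derivative_at[OF D, symmetric])
qed

lemma frechet_derivative_inner:
  assumes "smooth_map P"
  shows "frechet_derivative (\<lambda>x. P x \<bullet> b) (at x) u = frechet_derivative P (at x) u \<bullet> b"
proof -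
  have "((\<lambda>x. P x \<bullet> b) has_derivative (\<lambda>u. frechet_derivative P (at x) u \<bullet> b)) (at x)"
    by (intro has_derivative_inner_left smooth_map_has_derivative assms)
  then show ?thesis using frechet_derivative_at by metis
qed

lemma smooth_map_inner: assumes "smooth_map P" shows "smooth (\<lambda>x. P x \<bullet> a)"
proof -
  have "P x \<bullet> a = (\<Sum>b\<in>Basis. (P x \<bullet> b) * (a \<bullet> b))" for x by (rule euclidean_inner)
  then show ?thesis using assms unfolding smooth_map_def by (auto intro!: smooth_sum smooth_mult smooth_const)
qed

lemma smooth_map_deriv:
  assumes "smooth_map P" shows "smooth_map (\<lambda>x. frechet_derivative P (at x) u)"
  unfolding smooth_map_def
proof
  fix b :: 'b assume "b \<in> Basis"
  then have "smooth (\<lambda>x. frechet_derivative (\<lambda>x. P x \<bullet> b) (at x) u)"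
    using assms smooth_deriv unfolding smooth_map_def by blast
  then show "smooth (\<lambda>x. frechet_derivative P (at x) u \<bullet> b)"
    using frechet_derivative_inner[OF assms] by simp
qed

section \<open>Symmetry of second derivatives\<close>

lemma smooth_line_derivative:
  assumes "smooth g"
  shows "((\<lambda>t. g (x + t *\<^sub>R u)) has_real_derivative frechet_derivative g (at (x + t *\<^sub>R u)) u) (at t)"
proof -
  have "((\<lambda>t. x + t *\<^sub>R u) has_derivative (\<lambda>h. h *\<^sub>R u)) (at t)"
    by (auto intro!: derivative_eq_intros)
  from has_derivative_compose[OF this smooth_has_derivative[OF assms]]
  have "((\<lambda>t. g (x + t *\<^sub>R u)) has_derivative (\<lambda>h. frechet_derivative g (at (x + t *\<^sub>R u)) (h *\<^sub>R u))) (at t)" .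
  moreover have "linear (frechet_derivative g (at (x + t *\<^sub>R u)))"
    using smooth_has_derivative[OF assms] has_derivative_linear by blast
  ultimately show ?thesis unfolding has_field_derivative_def by (simp add: linear_cmul mult.commute[of _ "frechet_derivative g (at (x + t *\<^sub>R u)) u"])
qed

text \<open>The mean value theorem is applied in direction u to the difference g (x + s w) - g x,
  and then in direction w to the derivative so obtained.\<close>

lemma smooth_second_difference:
  assumes g: "smooth g" and s: "s > 0"
  shows "\<exists>a\<in>{0..s}. \<exists>b\<in>{0..s}. g (x + s *\<^sub>R u + s *\<^sub>R w) - g (x + s *\<^sub>R u) - g (x + s *\<^sub>R w) + g x =
    s\<^sup>2 * frechet_derivative (\<lambda>y. frechet_derivative g (at y) u) (at (x + a *\<^sub>R u + b *\<^sub>R w)) w"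
proof -
  define h where "h t = g ((x + s *\<^sub>R w) + t *\<^sub>R u) - g (x + t *\<^sub>R u)" for t
  have "(h has_real_derivative (frechet_derivative g (at ((x + s *\<^sub>R w) + t *\<^sub>R u)) u - frechet_derivative g (at (x + t *\<^sub>R u)) u)) (at t)" for t
    unfolding h_def by (intro DERIV_diff smooth_line_derivative g)
  from MVT2[OF s this]
  obtain a where a: "0 < a" "a < s" "h s - h 0 = (s - 0) * (frechet_derivative g (at ((x + s *\<^sub>R w) + a *\<^sub>R u)) u - frechet_derivative g (at (x + a *\<^sub>R u)) u)"
    by blast
  define k where "k t = frechet_derivative g (at ((x + a *\<^sub>R u) + t *\<^sub>R w)) u" for t
  have "(k has_real_derivative frechet_derivative (\<lambda>y. frechet_derivative g (at y) u) (at ((x + a *\<^sub>R u) + t *\<^sub>R w)) w) (at t)" for t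
    unfolding k_def by (intro smooth_line_derivative smooth_deriv g)
  from MVT2[OF s this]
  obtain b where b: "0 < b" "b < s" "k s - k 0 = (s - 0) * frechet_derivative (\<lambda>y. frechet_derivative g (at y) u) (at ((x + a *\<^sub>R u) + b *\<^sub>R w)) w"
    by blast
  have "g (x + s *\<^sub>R u + s *\<^sub>R w) - g (x + s *\<^sub>R u) - g (x + s *\<^sub>R w) + g x = h s - h 0"
    unfolding h_def by (simp add: algebra_simps)
  also have "\<dots> = s * (k s - k 0)" using a(3) unfolding k_def by (simp add: algebra_simps)
  also have "\<dots> = s\<^sup>2 * frechet_derivative (\<lambda>y. frechet_derivative g (at y) u) (at ((x + a *\<^sub>R u) + b *\<^sub>R w)) w"
    using b(3) by (simp add: power2_eq_square)
  finally show ?thesis using a b by (intro bexI[of _ a] bexI[of _ b]) auto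
qed

text \<open>The second difference quotient is unchanged when u and w are exchanged, and by
  continuity it converges to either mixed derivative as the step tends to 0.\<close>

lemma smooth_second_derivative_symmetric:
  assumes g: "smooth g"
  shows "frechet_derivative (\<lambda>y. frechet_derivative g (at y) u) (at x) w =
         frechet_derivative (\<lambda>y. frechet_derivative g (at y) w) (at x) u"
proof -
  let ?A = "\<lambda>u w y. frechet_derivative (\<lambda>y. frechet_derivative g (at y) u) (at y) w"
  define q where "q n = 1 / real (Suc n)" for n
  have q: "q n > 0" for n unfolding q_def by simp
  have q0: "q \<longlonglongrightarrow> 0" unfolding q_def using LIMSEQ_inverse_real_of_nat by (simp add: inverse_eq_divide)
  have main: "(\<lambda>n. (g (x + q n *\<^sub>R u + q n *\<^sub>R w) - g (x + q n *\<^sub>R u) - g (x + q n *\<^sub>R w) + g x) / (q n)\<^sup>2) \<longlonglongrightarrow> ?A u w x" for u w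
  proof -
    have "\<forall>n. \<exists>a b. a \<in> {0..q n} \<and> b \<in> {0..q n} \<and> g (x + q n *\<^sub>R u + q n *\<^sub>R w) - g (x + q n *\<^sub>R u) - g (x + q n *\<^sub>R w) + g x =
        (q n)\<^sup>2 * ?A u w (x + a *\<^sub>R u + b *\<^sub>R w)"
      using smooth_second_difference[OF g q] by blast
    then obtain a b where ab: "\<And>n. a n \<in> {0..q n}" "\<And>n. b n \<in> {0..q n}"
      "\<And>n. g (x + q n *\<^sub>R u + q n *\<^sub>R w) - g (x + q n *\<^sub>R u) - g (x + q n *\<^sub>R w) + g x =
        (q n)\<^sup>2 * ?A u w (x + a n *\<^sub>R u + b n *\<^sub>R w)" by metis
    have a0: "a \<longlonglongrightarrow> 0" by (rule tendsto_sandwich[OF _ _ tendsto_const q0]) (use ab in auto)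
    have b0: "b \<longlonglongrightarrow> 0" by (rule tendsto_sandwich[OF _ _ tendsto_const q0]) (use ab in auto)
    have "(\<lambda>n. x + a n *\<^sub>R u + b n *\<^sub>R w) \<longlonglongrightarrow> x + 0 *\<^sub>R u + 0 *\<^sub>R w"
      by (intro tendsto_intros a0 b0)
    then have "(\<lambda>n. x + a n *\<^sub>R u + b n *\<^sub>R w) \<longlonglongrightarrow> x" by simp
    moreover have "isCont (?A u w) x"
      using smooth_continuous[OF smooth_deriv[OF smooth_deriv[OF g]], of UNIV]
      by (simp add: continuous_on_eq_continuous_at)
    ultimately have "(\<lambda>n. ?A u w (x + a n *\<^sub>R u + b n *\<^sub>R w)) \<longlonglongrightarrow> ?A u w x"
      by (rule isCont_tendsto_compose[rotated])
    moreover have "(g (x + q n *\<^sub>R u + q n *\<^sub>R w) - g (x + q n *\<^sub>R u) - g (x + q n *\<^sub>R w) + g x) / (q n)\<^sup>2 = ?A u w (x + a n *\<^sub>R u + b n *\<^sub>R w)" for n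
      using ab(3)[of n] q[of n] by simp
    ultimately show ?thesis by simp
  qed
  have "(\<lambda>n. (g (x + q n *\<^sub>R w + q n *\<^sub>R u) - g (x + q n *\<^sub>R w) - g (x + q n *\<^sub>R u) + g x) / (q n)\<^sup>2) =
    (\<lambda>n. (g (x + q n *\<^sub>R u + q n *\<^sub>R w) - g (x + q n *\<^sub>R u) - g (x + q n *\<^sub>R w) + g x) / (q n)\<^sup>2)"
    by (auto simp: algebra_simps)
  then show ?thesis using main[of u w] main[of w u] by (simp only: LIMSEQ_unique)
qed

section \<open>Cutoff functions\<close>

text \<open>The functions exp(-1/t) / t^k, and not exp(-1/t) alone, because this family is closed
  under differentiation up to linear combinations.\<close>

definition flat_exp :: "nat \<Rightarrow> real \<Rightarrow> real" where
  "flat_exp k t = (if t > 0 then exp (- 1 / t) / t ^ k else 0)"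

lemma flat_exp_derivative:
  "(flat_exp k has_real_derivative (flat_exp (k + 2) t - real k * flat_exp (Suc k) t)) (at t)"
proof -
  consider "t > 0" | "t < 0" | "t = 0" by linarith
  then show ?thesis
  proof cases
    case 1
    have "((\<lambda>t. exp (- 1 / t) / t ^ k) has_real_derivative (flat_exp (k + 2) t - real k * flat_exp (Suc k) t)) (at t)"
    proof (cases k)
      case 0
      show ?thesis using 1 by (auto intro!: derivative_eq_intros simp: flat_exp_def 0 power2_eq_square)
    next
      case (Suc j)
      have p: "((\<lambda>t. t ^ Suc j) has_real_derivative real (Suc j) * t ^ j) (at t)"
        using DERIV_pow[of "Suc j" t UNIV] by simp
      have e: "((\<lambda>t. exp (- 1 / t)) has_real_derivative exp (- 1 / t) * (1 / t\<^sup>2)) (at t)"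
        using 1 by (auto intro!: derivative_eq_intros simp: power2_eq_square)
      have "((\<lambda>t. exp (- 1 / t) / t ^ Suc j) has_real_derivative
          (exp (- 1 / t) * (1 / t\<^sup>2) * t ^ Suc j - exp (- 1 / t) * (real (Suc j) * t ^ j)) / (t ^ Suc j * t ^ Suc j)) (at t)"
        by (rule DERIV_divide[OF e p]) (use 1 in simp)
      moreover have "(exp (- 1 / t) * (1 / t\<^sup>2) * t ^ Suc j - exp (- 1 / t) * (real (Suc j) * t ^ j)) / (t ^ Suc j * t ^ Suc j)
          = flat_exp (k + 2) t - real k * flat_exp (Suc k) t"
        using 1 by (simp add: flat_exp_def Suc field_simps power2_eq_square)
      ultimately show ?thesis unfolding Suc by simp
    qed
    then show ?thesis
      by (rule has_field_derivative_transform_within_open[where S="{0<..}"]) (use 1 in \<open>auto simp: flat_exp_def\<close>)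
  next
    case 2
    have "((\<lambda>t. 0) has_real_derivative (flat_exp (k + 2) t - real k * flat_exp (Suc k) t)) (at t)"
      using 2 by (auto simp: flat_exp_def)
    then show ?thesis
      by (rule has_field_derivative_transform_within_open[where S="{..<0}"]) (use 2 in \<open>auto simp: flat_exp_def\<close>)
  next
    case 3
    \<comment> \<open>At 0 the difference quotient from the right is again exp(-1/h) times a power
      of 1/h, and the exponential wins; from the left it is 0.\<close>
    have "((\<lambda>h. flat_exp k h / h) \<longlongrightarrow> 0) (at 0)"
    proof (rule filterlim_split_at)
      have "((\<lambda>h::real. exp (- 1 / h) / h ^ k / h) \<longlongrightarrow> 0) (at_right 0)"
      proof -
        have "((\<lambda>h::real. inverse h ^ Suc k / exp (inverse h)) \<longlongrightarrow> 0) (at_right 0)"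
          by (rule filterlim_compose[OF tendsto_power_div_exp_0 filterlim_inverse_at_top_right])
        moreover have "inverse h ^ Suc k / exp (inverse h) = exp (- 1 / h) / h ^ k / h" for h :: real
          by (simp add: exp_minus inverse_eq_divide power_one_over divide_simps)
        ultimately show ?thesis by simp
      qed
      moreover have "eventually (\<lambda>h. exp (- 1 / h) / h ^ k / h = flat_exp k h / h) (at_right 0)"
        by (auto simp: eventually_at_filter flat_exp_def)
      ultimately show "((\<lambda>h. flat_exp k h / h) \<longlongrightarrow> 0) (at_right 0)" using tendsto_cong by fast
      have "eventually (\<lambda>h. 0 = flat_exp k h / h) (at_left 0)"
        by (auto simp: eventually_at_filter flat_exp_def)
      then show "((\<lambda>h. flat_exp k h / h) \<longlongrightarrow> 0) (at_left 0)" using tendsto_cong tendsto_const by fast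
    qed
    then show ?thesis using 3 by (simp add: DERIV_def flat_exp_def)
  qed
qed

lemma ck_flat_exp: "ck n UNIV (flat_exp k)"
proof (induction n arbitrary: k)
  case 0
  show ?case unfolding ck_0
    using flat_exp_derivative[of k] by (auto simp: has_field_derivative_def differentiable_def)
next
  case (Suc n)
  show ?case
  proof (rule ck_DERIV_I[OF open_UNIV flat_exp_derivative])
    have "ck n UNIV (\<lambda>t. flat_exp (k + 2) t + (- real k) * flat_exp (Suc k) t)"
      by (intro ck_add ck_mult ck_const open_UNIV Suc)
    then show "ck n UNIV (\<lambda>t. flat_exp (k + 2) t - real k * flat_exp (Suc k) t)" by simp
  qed
qed

definition cutoff :: "real \<Rightarrow> real" where
  "cutoff t = flat_exp 0 (2 - t) * inverse (flat_exp 0 (2 - t) + flat_exp 0 (t - 1))"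

lemma flat_exp_nonneg: "flat_exp k t \<ge> 0" by (simp add: flat_exp_def)

text \<open>The arguments 2 - t and t - 1 add up to 1, so at least one of them is positive.\<close>

lemma cutoff_denom_pos: "flat_exp 0 (2 - t) + flat_exp 0 (t - 1) > 0"
  using flat_exp_nonneg[of 0 "2 - t"] flat_exp_nonneg[of 0 "t - 1"]
  by (cases "t < 2") (auto simp: flat_exp_def add_nonneg_pos)

lemma smooth_cutoff: "smooth cutoff"
proof (rule smoothI)
  fix n
  have a: "ck n UNIV (\<lambda>t::real. 2 - t)" "ck n UNIV (\<lambda>t::real. t - 1)"
    using smooth_diff[OF smooth_const[of 2] smooth_bounded_linear[OF bounded_linear_ident]]
      smooth_diff[OF smooth_bounded_linear[OF bounded_linear_ident] smooth_const[of 1]] by (auto intro: smoothD)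
  have b: "ck n UNIV (\<lambda>t::real. flat_exp 0 (2 - t))" "ck n UNIV (\<lambda>t::real. flat_exp 0 (t - 1))"
    by (rule ck_compose_real[OF open_UNIV open_UNIV subset_UNIV _ ck_flat_exp], rule a)+
  have "ck n UNIV (\<lambda>t. inverse (flat_exp 0 (2 - t) + flat_exp 0 (t - 1)))"
    by (rule ck_compose_real[of UNIV "{0<..}" _ _ inverse])
      (use cutoff_denom_pos in \<open>auto intro!: ck_inverse ck_add b\<close>)
  then have "ck n UNIV (\<lambda>t. flat_exp 0 (2 - t) * inverse (flat_exp 0 (2 - t) + flat_exp 0 (t - 1)))"
    by (intro ck_mult b) auto
  then show "ck n UNIV cutoff" unfolding cutoff_def[abs_def] .
qed

lemma cutoff_range: "0 \<le> cutoff t" "cutoff t \<le> 1"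
  using flat_exp_nonneg[of 0 "2 - t"] flat_exp_nonneg[of 0 "t - 1"] cutoff_denom_pos[of t]
  by (auto simp: cutoff_def field_simps)

lemma cutoff_1: "t \<le> 1 \<Longrightarrow> cutoff t = 1"
  using cutoff_denom_pos[of t] by (simp add: cutoff_def flat_exp_def)

lemma cutoff_0: "t \<ge> 2 \<Longrightarrow> cutoff t = 0"
  by (simp add: cutoff_def flat_exp_def)

text \<open>The squared norm is a polynomial in the coordinates, so no smoothness is lost at the
  centre.\<close>

definition bump :: "'a::euclidean_space \<Rightarrow> real \<Rightarrow> 'a \<Rightarrow> real" where
  "bump a r x = cutoff ((norm (x - a))\<^sup>2 / r\<^sup>2)"

lemma smooth_bump: "smooth (bump a r)"
proof -
  have e: "(norm (x - a))\<^sup>2 / r\<^sup>2 = (\<Sum>b\<in>Basis. (x \<bullet> b - a \<bullet> b) * (x \<bullet> b - a \<bullet> b)) * (1 / r\<^sup>2)" for x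
    unfolding power2_norm_eq_inner euclidean_inner[of "x - a" "x - a"] by (simp add: inner_diff_left)
  have "smooth (\<lambda>x. cutoff ((\<Sum>b\<in>Basis. (x \<bullet> b - a \<bullet> b) * (x \<bullet> b - a \<bullet> b)) * (1 / r\<^sup>2)))"
    by (rule smooth_compose_real[OF smooth_cutoff])
      (intro smooth_mult smooth_sum smooth_diff smooth_const smooth_inner)
  then show ?thesis unfolding bump_def[abs_def] e .
qed

lemma bump_range: "0 \<le> bump a r x" "bump a r x \<le> 1"
  by (auto simp: bump_def cutoff_range)

lemma bump_1: "norm (x - a) \<le> r \<Longrightarrow> bump a r x = 1"
  by (cases "r = 0") (auto simp: bump_def intro!: cutoff_1 power_mono simp: divide_le_eq)

lemma bump_0: assumes "r > 0" "norm (x - a) \<ge> 2 * r" shows "bump a r x = 0"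
proof -
  have "(2 * r)\<^sup>2 \<le> (norm (x - a))\<^sup>2" using assms by (intro power_mono) auto
  then have "4 * r\<^sup>2 \<le> (norm (x - a))\<^sup>2" by (simp add: power_mult_distrib)
  moreover have "0 < r\<^sup>2" using assms by simp
  moreover have "0 \<le> r\<^sup>2" by simp
  ultimately have "2 * r\<^sup>2 \<le> (norm (x - a))\<^sup>2" by linarith
  then have "(norm (x - a))\<^sup>2 / r\<^sup>2 \<ge> 2" using assms by (simp add: le_divide_eq)
  then show ?thesis by (simp add: bump_def cutoff_0)
qed

section \<open>Covectors\<close>

definition del :: "nat \<Rightarrow> (nat \<Rightarrow> 'a) \<Rightarrow> nat \<Rightarrow> 'a" where
  "del i v = (\<lambda>j. if j < i then v j else v (Suc j))"

text \<open>The simplicial face identity. It pairs the terms that cancel in d d = 0 and in the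
  compatibility of d with pullback.\<close>

lemma del_del: "i \<le> j \<Longrightarrow> del j (del i v) = del i (del (Suc j) v)"
  by (auto simp: del_def fun_eq_iff)

lemma covector_cong:
  assumes "\<phi> \<in> covectors m" "\<And>i. i < m \<Longrightarrow> v i = w i" shows "\<phi> v = \<phi> w"
proof -
  have "(\<forall>i<m. v i = w i) \<longrightarrow> \<phi> v = \<phi> w" using assms(1) unfolding covectors_def by simp
  then show ?thesis using assms(2) by simp
qed

lemma covector_linear: "\<phi> \<in> covectors m \<Longrightarrow> i < m \<Longrightarrow> linear (\<lambda>u. \<phi> (v(i := u)))"
  unfolding covectors_def by blast

lemma covector_alternating:
  "\<phi> \<in> covectors m \<Longrightarrow> i < m \<Longrightarrow> j < m \<Longrightarrow> i \<noteq> j \<Longrightarrow> v i = v j \<Longrightarrow> \<phi> v = 0"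
  unfolding covectors_def by blast

lemma covector_add: "\<phi> \<in> covectors m \<Longrightarrow> i < m \<Longrightarrow> \<phi> (v(i := a + b)) = \<phi> (v(i := a)) + \<phi> (v(i := b))"
  using linear_add[OF covector_linear] by blast

lemma covector_diff: "\<phi> \<in> covectors m \<Longrightarrow> i < m \<Longrightarrow> \<phi> (v(i := a - b)) = \<phi> (v(i := a)) - \<phi> (v(i := b))"
  using linear_diff[OF covector_linear] by blast

lemma covector_scale: "\<phi> \<in> covectors m \<Longrightarrow> i < m \<Longrightarrow> \<phi> (v(i := c *\<^sub>R a)) = c * \<phi> (v(i := a))"
  using linear_cmul[OF covector_linear] by fastforce

text \<open>Polarisation: expand the vanishing value with a + b in both slots.\<close>

lemma covector_swap:
  assumes "\<phi> \<in> covectors m" "i < m" "j < m" "i \<noteq> j"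
  shows "\<phi> (v(i := b, j := a)) = - \<phi> (v(i := a, j := b))"
proof -
  have z: "\<phi> (v(i := c, j := c)) = 0" for c by (rule covector_alternating[OF assms]) (use assms in auto)
  have 1: "\<phi> (v(i := a + b, j := a + b)) = \<phi> (v(i := a + b, j := a)) + \<phi> (v(i := a + b, j := b))"
    using covector_add[OF assms(1,3), of "v(i := a + b)"] .
  have 2: "\<phi> (v(i := a + b, j := c)) = \<phi> (v(i := a, j := c)) + \<phi> (v(i := b, j := c))" for c
    using covector_add[OF assms(1,2), of "v(j := c)"] assms(4) by (simp only: fun_upd_twist not_False_eq_True)
  show ?thesis using 1 2[of a] 2[of b] z[of a] z[of b] z[of "a + b"] by linarith
qed

text \<open>Entry j reaches the front after j transpositions of neighbours, each of which changes
  the sign.\<close>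

lemma covector_front:
  assumes "\<phi> \<in> covectors m" "j < m"
  shows "\<phi> v = (-1) ^ j * \<phi> (case_nat (v j) (del j v))"
  using assms(2)
proof (induction j arbitrary: v)
  case 0
  have "case_nat (v 0) (del 0 v) = v" by (auto simp: del_def fun_eq_iff split: nat.split)
  then show ?case by simp
next
  case (Suc j)
  let ?v = "v(j := v (Suc j), Suc j := v j)"
  have "\<phi> ?v = - \<phi> (v(j := v j, Suc j := v (Suc j)))"
    by (rule covector_swap[OF assms(1)]) (use Suc in auto)
  then have 1: "\<phi> v = - \<phi> ?v" by simp
  have "\<phi> ?v = (-1) ^ j * \<phi> (case_nat (?v j) (del j ?v))" by (rule Suc.IH) (use Suc in simp)
  moreover have "del j ?v = del (Suc j) v" by (auto simp: del_def fun_eq_iff less_Suc_eq)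
  moreover have "?v j = v (Suc j)" by simp
  ultimately have "\<phi> ?v = (-1) ^ j * \<phi> (case_nat (v (Suc j)) (del (Suc j) v))" by simp
  from 1[unfolded this] show ?case by simp
qed

text \<open>The interior product of \<phi> with e.\<close>

lemma covector_case_nat:
  assumes "\<phi> \<in> covectors (Suc n)" shows "(\<lambda>w. \<phi> (case_nat e w)) \<in> covectors n"
proof -
  have u: "case_nat e (v(i := a)) = (case_nat e v)(Suc i := a)" for v i a
    by (auto simp: fun_eq_iff split: nat.split)
  show ?thesis unfolding covectors_def
  proof (intro CollectI conjI allI impI)
    show "\<phi> (case_nat e v) = \<phi> (case_nat e w)" if "\<forall>i<n. v i = w i" for v w
      by (rule covector_cong[OF assms]) (use that in \<open>auto split: nat.split\<close>)
    show "linear (\<lambda>b. \<phi> (case_nat e (v(i := b))))" if "i < n" for v i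
      unfolding u by (rule covector_linear[OF assms]) (use that in auto)
    show "\<phi> (case_nat e v) = 0" if "i < n" "j < n" "i \<noteq> j" "v i = v j" for v i j
      by (rule covector_alternating[OF assms, of "Suc i" "Suc j"]) (use that in auto)
  qed
qed

text \<open>\<open>PiE\<close> fixes the entries from m on, which makes the index set finite; a
  covector of degree m does not depend on them. All tuples are kept, not only the increasing ones,
  so that multilinearity alone gives the expansion.\<close>

abbreviation basis_tuples :: "nat \<Rightarrow> (nat \<Rightarrow> 'a::euclidean_space) set" where
  "basis_tuples m \<equiv> PiE {..<m} (\<lambda>_. Basis)"

lemma finite_basis_tuples: "finite (basis_tuples m)"
  by (intro finite_PiE) auto

text \<open>Slot after slot is expanded in the basis; k counts the slots already done. The formula
  reduces questions of smoothness and comass to the finitely many coefficients \<phi> I.\<close>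

lemma covector_expand:
  assumes "\<phi> \<in> covectors m"
  shows "\<phi> v = (\<Sum>I\<in>basis_tuples m. (\<Prod>j<m. v j \<bullet> I j) * \<phi> I)"
proof -
  have "\<phi> v = (\<Sum>I\<in>basis_tuples k. (\<Prod>j<k. v j \<bullet> I j) * \<phi> (\<lambda>j. if j < k then I j else v j))" if "k \<le> m" for k
    using that
  proof (induction k)
    case 0 then show ?case by simp
  next
    case (Suc k)
    have "\<phi> v = (\<Sum>I\<in>basis_tuples k. (\<Prod>j<k. v j \<bullet> I j) * \<phi> (\<lambda>j. if j < k then I j else v j))"
      using Suc by simp
    also have "\<dots> = (\<Sum>I\<in>basis_tuples k. \<Sum>b\<in>Basis. (\<Prod>j<Suc k. v j \<bullet> (I(k := b)) j) *
        \<phi> (\<lambda>j. if j < Suc k then (I(k := b)) j else v j))"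
    proof (rule sum.cong[OF refl])
      fix I :: "nat \<Rightarrow> 'a"
      let ?w = "\<lambda>j. if j < k then I j else v j"
      have l: "linear (\<lambda>u. \<phi> (?w(k := u)))" using covector_linear[OF assms] Suc by simp
      have "\<phi> ?w = \<phi> (?w(k := \<Sum>b\<in>Basis. (v k \<bullet> b) *\<^sub>R b))"
        by (rule arg_cong[of _ _ \<phi>]) (simp add: euclidean_representation fun_eq_iff)
      also have "\<dots> = (\<Sum>b\<in>Basis. (v k \<bullet> b) * \<phi> (?w(k := b)))"
        using linear_sum[OF l, of "\<lambda>b. (v k \<bullet> b) *\<^sub>R b" Basis] linear_cmul[OF l] by simp
      finally have "(\<Prod>j<k. v j \<bullet> I j) * \<phi> ?w = (\<Sum>b\<in>Basis. ((\<Prod>j<k. v j \<bullet> I j) * (v k \<bullet> b)) * \<phi> (?w(k := b)))"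
        by (simp add: sum_distrib_left mult.assoc)
      moreover have "?w(k := b) = (\<lambda>j. if j < Suc k then (I(k := b)) j else v j)" for b
        by (auto simp: fun_eq_iff)
      moreover have "(\<Prod>j<k. v j \<bullet> I j) * (v k \<bullet> b) = (\<Prod>j<Suc k. v j \<bullet> (I(k := b)) j)" for b
        by simp
      ultimately show "(\<Prod>j<k. v j \<bullet> I j) * \<phi> ?w = (\<Sum>b\<in>Basis. (\<Prod>j<Suc k. v j \<bullet> (I(k := b)) j) *
        \<phi> (\<lambda>j. if j < Suc k then (I(k := b)) j else v j))" by presburger
    qed
    also have "\<dots> = (\<Sum>I\<in>basis_tuples (Suc k). (\<Prod>j<Suc k. v j \<bullet> I j) * \<phi> (\<lambda>j. if j < Suc k then I j else v j))"
    proof -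
      let ?h = "\<lambda>(b, I). I(k := b)"
      let ?g = "\<lambda>I. (\<Prod>j<Suc k. v j \<bullet> I j) * \<phi> (\<lambda>j. if j < Suc k then I j else v j)"
      have e: "basis_tuples (Suc k) = ?h ` (Basis \<times> basis_tuples k)"
        by (simp add: lessThan_Suc PiE_insert_eq)
      have inj: "inj_on ?h (Basis \<times> basis_tuples k :: ('a \<times> (nat \<Rightarrow> 'a)) set)"
      proof (rule inj_onI, clarify)
        fix b b' :: 'a and I I' :: "nat \<Rightarrow> 'a"
        assume I: "I \<in> basis_tuples k" "I' \<in> basis_tuples k" and q: "I(k := b) = I'(k := b')"
        have "b = b'" using fun_cong[OF q, of k] by simp
        moreover have "I j = I' j" for j
          using fun_cong[OF q, of j] I by (cases "j = k") (auto simp: PiE_def extensional_def)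
        ultimately show "b = b' \<and> I = I'" by auto
      qed
      have "(\<Sum>I\<in>basis_tuples (Suc k). ?g I) = (\<Sum>(b, I)\<in>Basis \<times> basis_tuples k. ?g (I(k := b)))"
        unfolding e by (subst sum.reindex[OF inj]) (simp add: case_prod_unfold comp_def)
      also have "\<dots> = (\<Sum>I\<in>basis_tuples k. \<Sum>b\<in>Basis. ?g (I(k := b)))"
        by (subst sum.cartesian_product[symmetric], subst sum.swap) simp
      finally show ?thesis by simp
    qed
    finally show ?case .
  qed
  from this[of m] have "\<phi> v = (\<Sum>I\<in>basis_tuples m. (\<Prod>j<m. v j \<bullet> I j) * \<phi> (\<lambda>j. if j < m then I j else v j))" by simp
  moreover have "\<phi> (\<lambda>j. if j < m then I j else v j) = \<phi> I" for I by (rule covector_cong[OF assms]) auto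
  ultimately show ?thesis by simp
qed

lemma covector_bound:
  assumes "\<phi> \<in> covectors m" "\<And>i. i < m \<Longrightarrow> norm (v i) \<le> 1"
  shows "\<bar>\<phi> v\<bar> \<le> (\<Sum>I\<in>basis_tuples m. \<bar>\<phi> I\<bar>)"
proof -
  have "\<bar>(\<Prod>j<m. v j \<bullet> I j) * \<phi> I\<bar> \<le> \<bar>\<phi> I\<bar>" if "I \<in> basis_tuples m" for I
  proof -
    have "\<bar>v j \<bullet> I j\<bar> \<le> 1" if "j < m" for j
    proof -
      have "I j \<in> Basis" using that \<open>I \<in> basis_tuples m\<close> by auto
      then show ?thesis using Basis_le_norm[of "I j" "v j"] assms(2)[OF that] by simp
    qed
    then have "\<bar>\<Prod>j<m. v j \<bullet> I j\<bar> \<le> 1" unfolding abs_prod by (intro prod_le_1) auto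
    then show ?thesis by (simp add: abs_mult mult_left_le_one_le)
  qed
  then show ?thesis unfolding covector_expand[OF assms(1), of v]
    by (intro order.trans[OF sum_abs] sum_mono)
qed

lemma covector_scale_all:
  assumes "\<phi> \<in> covectors m" shows "\<phi> (\<lambda>i. c *\<^sub>R v i) = c ^ m * \<phi> v"
proof -
  have "(\<Prod>j<m. (c *\<^sub>R v j) \<bullet> I j) = c ^ m * (\<Prod>j<m. v j \<bullet> I j)" for I
    by (simp add: prod.distrib)
  then show ?thesis
    unfolding covector_expand[OF assms, of v] covector_expand[OF assms, of "\<lambda>i. c *\<^sub>R v i"]
    by (simp add: sum_distrib_left mult.assoc)
qed

lemma covectors_zero: "(\<lambda>v. 0) \<in> covectors m"
  unfolding covectors_def by (auto intro: linearI)

lemma covectorsI: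
  assumes "\<And>v w. (\<And>i. i < m \<Longrightarrow> v i = w i) \<Longrightarrow> \<phi> v = \<phi> w"
    "\<And>v i. i < m \<Longrightarrow> linear (\<lambda>u. \<phi> (v(i := u)))"
    "\<And>v i j. i < m \<Longrightarrow> j < m \<Longrightarrow> i \<noteq> j \<Longrightarrow> v i = v j \<Longrightarrow> \<phi> v = 0"
  shows "\<phi> \<in> covectors m"
  unfolding covectors_def using assms by blast

lemma covectors_add:
  assumes "\<phi> \<in> covectors m" "\<psi> \<in> covectors m" shows "(\<lambda>v. \<phi> v + \<psi> v) \<in> covectors m"
proof (rule covectorsI)
  show "\<phi> v + \<psi> v = \<phi> w + \<psi> w" if "\<And>i. i < m \<Longrightarrow> v i = w i" for v w
    using covector_cong[OF assms(1) that] covector_cong[OF assms(2) that] by simp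
  show "linear (\<lambda>u. \<phi> (v(i := u)) + \<psi> (v(i := u)))" if "i < m" for v i
    using linear_compose_add[OF covector_linear[OF assms(1) that] covector_linear[OF assms(2) that]] .
qed (simp add: covector_alternating[OF assms(1)] covector_alternating[OF assms(2)])

lemma covectors_scale:
  assumes "\<phi> \<in> covectors m" shows "(\<lambda>v. c * \<phi> v) \<in> covectors m"
proof (rule covectorsI)
  show "c * \<phi> v = c * \<phi> w" if "\<And>i. i < m \<Longrightarrow> v i = w i" for v w
    using covector_cong[OF assms that] by simp
  show "linear (\<lambda>u. c * \<phi> (v(i := u)))" if "i < m" for v i
    using linear_compose_scale_right[OF covector_linear[OF assms that], of c] by simp
qed (simp add: covector_alternating[OF assms])

lemma covectors_compose:
  assumes "\<phi> \<in> covectors m" "linear P" shows "(\<lambda>v. \<phi> (\<lambda>j. P (v j))) \<in> covectors m"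
proof -
  have u: "(\<lambda>j. P ((v(i := a)) j)) = (\<lambda>j. P (v j))(i := P a)" for v i a by auto
  show ?thesis unfolding covectors_def
  proof (intro CollectI conjI allI impI)
    show "\<phi> (\<lambda>j. P (v j)) = \<phi> (\<lambda>j. P (w j))" if "\<forall>i<m. v i = w i" for v w
      by (rule covector_cong[OF assms(1)]) (use that in auto)
    show "linear (\<lambda>b. \<phi> (\<lambda>j. P ((v(i := b)) j)))" if "i < m" for v i
      unfolding u using linear_compose[OF assms(2) covector_linear[OF assms(1) that]] by (simp add: comp_def)
    show "\<phi> (\<lambda>j. P (v j)) = 0" if "i < m" "j < m" "i \<noteq> j" "v i = v j" for v i j
      by (rule covector_alternating[OF assms(1) that(1-3)]) (use that in auto)
  qed
qed

text \<open>Each v j is split into a multiple of e and a remainder \<pi> (v j) = v j - (v j . e) e.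
  By alternation at most one slot may receive e, so the expansion collapses. The second sum is the
  wedge of the covector dual to e with the interior product of \<phi> with e.\<close>

lemma covector_split_direction:
  fixes e :: "'a::euclidean_space"
  assumes \<phi>: "\<phi> \<in> covectors m"
  shows "\<phi> v = \<phi> (\<lambda>j. v j - (v j \<bullet> e) *\<^sub>R e) +
    (\<Sum>i<m. (-1) ^ i * (v i \<bullet> e) * \<phi> (case_nat e (del i v)))"
proof -
  let ?p = "\<lambda>a. a - (a \<bullet> e) *\<^sub>R e"
  let ?w = "\<lambda>k j. if j < k then ?p (v j) else v j"
  \<comment> \<open>As soon as slot k holds e, the e-parts of the earlier slots contribute nothing,
    since e would occur twice.\<close>
  have upd: "\<phi> ((?w l)(k := e)) = \<phi> (v(k := e))" if "l \<le> k" "k < m" for l k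
    using that
  proof (induction l)
    case 0 then show ?case by simp
  next
    case (Suc l)
    have q: "(?w (Suc l))(k := e) = ((?w l)(k := e))(l := ?p (v l))" using Suc by (auto simp: fun_eq_iff)
    have "\<phi> ((?w (Suc l))(k := e)) = \<phi> (((?w l)(k := e))(l := v l)) - (v l \<bullet> e) * \<phi> (((?w l)(k := e))(l := e))"
      unfolding q using Suc by (simp only: covector_diff[OF \<phi>] covector_scale[OF \<phi>])
    also have "\<phi> (((?w l)(k := e))(l := e)) = 0"
      by (rule covector_alternating[OF \<phi>, of l k]) (use Suc in auto)
    also have "((?w l)(k := e))(l := v l) = (?w l)(k := e)" using Suc by (auto simp: fun_eq_iff)
    finally show ?case using Suc by simp
  qed
  have "\<phi> v = \<phi> (?w k) + (\<Sum>i<k. (-1) ^ i * (v i \<bullet> e) * \<phi> (case_nat e (del i v)))" if "k \<le> m" for k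
    using that
  proof (induction k)
    case 0 then show ?case by simp
  next
    case (Suc k)
    have q: "?w (Suc k) = (?w k)(k := ?p (v k))" "(?w k)(k := v k) = ?w k" by (auto simp: fun_eq_iff)
    have "\<phi> (?w (Suc k)) = \<phi> (?w k) - (v k \<bullet> e) * \<phi> ((?w k)(k := e))"
      unfolding q(1) using Suc by (simp add: covector_diff[OF \<phi>] covector_scale[OF \<phi>] q(2))
    also have "\<phi> ((?w k)(k := e)) = \<phi> (v(k := e))" using upd[of k k] Suc by simp
    also have "\<dots> = (-1) ^ k * \<phi> (case_nat e (del k v))"
    proof -
      have "del k (v(k := e)) = del k v" by (auto simp: del_def fun_eq_iff)
      then show ?thesis using covector_front[OF \<phi>, of k "v(k := e)"] Suc by simp
    qed
    finally show ?case using Suc by simp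
  qed
  from this[of m] have "\<phi> v = \<phi> (?w m) + (\<Sum>i<m. (-1) ^ i * (v i \<bullet> e) * \<phi> (case_nat e (del i v)))" by simp
  also have "\<phi> (?w m) = \<phi> (\<lambda>j. ?p (v j))" by (rule covector_cong[OF \<phi>]) auto
  finally show ?thesis .
qed

section \<open>Smooth forms\<close>

lemma smooth_formsI: "(\<And>x. \<omega> x \<in> covectors m) \<Longrightarrow> (\<And>v. smooth (\<lambda>x. \<omega> x v)) \<Longrightarrow> \<omega> \<in> smooth_forms m"
  by (simp add: smooth_forms_def)

lemma smooth_forms_covector: "\<omega> \<in> smooth_forms m \<Longrightarrow> \<omega> x \<in> covectors m"
  by (simp add: smooth_forms_def)

lemma smooth_forms_smooth: "\<omega> \<in> smooth_forms m \<Longrightarrow> smooth (\<lambda>x. \<omega> x v)"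
  by (simp add: smooth_forms_def)

lemma smooth_forms_zero: "0 \<in> smooth_forms m"
  by (simp add: smooth_forms_def covectors_zero smooth_const zero_fun_def)

lemma smooth_forms_add: "\<omega> \<in> smooth_forms m \<Longrightarrow> \<eta> \<in> smooth_forms m \<Longrightarrow> \<omega> + \<eta> \<in> smooth_forms m"
  by (simp add: smooth_forms_def covectors_add smooth_add plus_fun_def)

lemma smooth_forms_mult:
  "smooth \<kappa> \<Longrightarrow> \<omega> \<in> smooth_forms m \<Longrightarrow> (\<lambda>x v. \<kappa> x * \<omega> x v) \<in> smooth_forms m"
  by (simp add: smooth_forms_def covectors_scale smooth_mult)

lemma smooth_forms_scaleR: "\<omega> \<in> smooth_forms m \<Longrightarrow> c *\<^sub>R \<omega> \<in> smooth_forms m"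
  by (simp add: smooth_forms_def covectors_scale smooth_mult smooth_const scaleR_fun_def)

lemma smooth_forms_diff:
  assumes "\<omega> \<in> smooth_forms m" "\<eta> \<in> smooth_forms m" shows "\<omega> - \<eta> \<in> smooth_forms m"
proof -
  have "\<omega> - \<eta> = \<omega> + (- 1) *\<^sub>R \<eta>" by (simp add: fun_eq_iff scaleR_fun_def)
  then show ?thesis using assms by (simp only: smooth_forms_add smooth_forms_scaleR)
qed

section \<open>Directional and exterior derivatives of a form\<close>

definition dform :: "'a::euclidean_space form \<Rightarrow> 'a \<Rightarrow> 'a \<Rightarrow> 'a covector" where
  "dform \<omega> x u w = frechet_derivative (\<lambda>y. \<omega> y w) (at x) u"

lemma dform_has_derivative:
  "\<omega> \<in> smooth_forms m \<Longrightarrow> ((\<lambda>y. \<omega> y w) has_derivative (\<lambda>u. dform \<omega> x u w)) (at x)"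
  unfolding dform_def using smooth_has_derivative[OF smooth_forms_smooth] .

lemma dform_eqI: "((\<lambda>y. \<omega> y w) has_derivative D) (at x) \<Longrightarrow> dform \<omega> x u w = D u"
  unfolding dform_def using frechet_derivative_at by metis

lemma dform_linear: "\<omega> \<in> smooth_forms m \<Longrightarrow> linear (\<lambda>u. dform \<omega> x u w)"
  using dform_has_derivative has_derivative_linear by blast

text \<open>The identities that define a covector hold at every point y, so they may be
  differentiated in y.\<close>

lemma dform_covector:
  assumes "\<omega> \<in> smooth_forms m" shows "dform \<omega> x u \<in> covectors m"
  unfolding covectors_def
proof (intro CollectI conjI allI impI)
  note c = smooth_forms_covector[OF assms]
  note D = dform_has_derivative[OF assms]
  show "dform \<omega> x u v = dform \<omega> x u w" if "\<forall>i<m. v i = w i" for v w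
  proof -
    have "(\<lambda>y. \<omega> y v) = (\<lambda>y. \<omega> y w)" using covector_cong[OF c] that by blast
    then show ?thesis unfolding dform_def by simp
  qed
  show "linear (\<lambda>b. dform \<omega> x u (v(i := b)))" if i: "i < m" for v i
  proof (rule linearI)
    fix a b :: 'a and r :: real
    show "dform \<omega> x u (v(i := a + b)) = dform \<omega> x u (v(i := a)) + dform \<omega> x u (v(i := b))"
      by (rule dform_eqI, simp only: covector_add[OF c i], intro has_derivative_add D)
    show "dform \<omega> x u (v(i := r *\<^sub>R a)) = r *\<^sub>R dform \<omega> x u (v(i := a))"
      by (rule dform_eqI, simp only: covector_scale[OF c i] real_scaleR_def, intro has_derivative_mult_right D)
  qed
  show "dform \<omega> x u v = 0" if "i < m" "j < m" "i \<noteq> j" "v i = v j" for v i j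
    by (rule dform_eqI) (simp add: covector_alternating[OF c that])
qed

lemma smooth_dform: "\<omega> \<in> smooth_forms m \<Longrightarrow> smooth (\<lambda>x. dform \<omega> x u w)"
  unfolding dform_def by (intro smooth_deriv smooth_forms_smooth)

lemma ext_deriv_eq: "ext_deriv m \<omega> x v = (\<Sum>i\<le>m. (-1) ^ i * dform \<omega> x (v i) (del i v))"
  unfolding ext_deriv_def dform_def del_def by simp

lemma dform_add:
  assumes "\<omega> \<in> smooth_forms m" "\<eta> \<in> smooth_forms m"
  shows "dform (\<omega> + \<eta>) x u w = dform \<omega> x u w + dform \<eta> x u w"
proof -
  have "((\<lambda>y. \<omega> y w + \<eta> y w) has_derivative (\<lambda>u. dform \<omega> x u w + dform \<eta> x u w)) (at x)"
    by (rule has_derivative_add[OF dform_has_derivative[OF assms(1)] dform_has_derivative[OF assms(2)]])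
  then show ?thesis using dform_eqI[of "\<omega> + \<eta>" w] by (simp add: plus_fun_def)
qed

lemma ext_deriv_add:
  "\<omega> \<in> smooth_forms m \<Longrightarrow> \<eta> \<in> smooth_forms m \<Longrightarrow> ext_deriv m (\<omega> + \<eta>) = ext_deriv m \<omega> + ext_deriv m \<eta>"
  by (auto simp: fun_eq_iff ext_deriv_eq dform_add ring_distribs sum.distrib)

text \<open>The Leibniz rule; the second sum is d\<kappa> \<and> \<omega>.\<close>

lemma ext_deriv_mult:
  assumes "smooth \<kappa>" "\<omega> \<in> smooth_forms m"
  shows "ext_deriv m (\<lambda>x v. \<kappa> x * \<omega> x v) x v = \<kappa> x * ext_deriv m \<omega> x v +
    (\<Sum>i\<le>m. (-1) ^ i * (frechet_derivative \<kappa> (at x) (v i) * \<omega> x (del i v)))"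
proof -
  have "dform (\<lambda>x v. \<kappa> x * \<omega> x v) x u w = \<kappa> x * dform \<omega> x u w + frechet_derivative \<kappa> (at x) u * \<omega> x w" for u w
    by (rule dform_eqI, rule has_derivative_mult[OF smooth_has_derivative[OF assms(1)] dform_has_derivative[OF assms(2)]])
  then show ?thesis by (simp add: ext_deriv_eq ring_distribs sum.distrib sum_distrib_left ac_simps)
qed

lemma ext_deriv_scaleR:
  assumes "\<omega> \<in> smooth_forms m" shows "ext_deriv m (c *\<^sub>R \<omega>) = c *\<^sub>R ext_deriv m \<omega>"
proof -
  have "dform (c *\<^sub>R \<omega>) x u w = c * dform \<omega> x u w" for x u w
    by (rule dform_eqI) (simp add: scaleR_fun_def has_derivative_mult_right dform_has_derivative[OF assms])
  then show ?thesis by (auto simp: fun_eq_iff ext_deriv_eq scaleR_fun_def sum_distrib_left ac_simps)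
qed

text \<open>The point is alternation. If v a = v b, every term with i other than a and b contains
  the repeated vector twice, and the two remaining terms are opposite once that vector is moved to
  the front.\<close>

lemma ext_deriv_smooth_forms:
  assumes \<omega>: "\<omega> \<in> smooth_forms m" shows "ext_deriv m \<omega> \<in> smooth_forms (Suc m)"
proof (rule smooth_formsI)
  show "smooth (\<lambda>x. ext_deriv m \<omega> x v)" for v
    unfolding ext_deriv_eq by (intro smooth_sum smooth_mult smooth_const smooth_dform[OF \<omega>])
  fix x
  note c = dform_covector[OF \<omega>, of x]
  show "ext_deriv m \<omega> x \<in> covectors (Suc m)" unfolding covectors_def
  proof (intro CollectI conjI allI impI)
    show "ext_deriv m \<omega> x v = ext_deriv m \<omega> x w" if "\<forall>i<Suc m. v i = w i" for v w
      unfolding ext_deriv_eq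
    proof (rule sum.cong[OF refl])
      fix i assume "i \<in> {..m}"
      moreover have "dform \<omega> x (v i) (del i v) = dform \<omega> x (v i) (del i w)"
        by (rule covector_cong[OF c]) (use that in \<open>auto simp: del_def\<close>)
      ultimately show "(-1) ^ i * dform \<omega> x (v i) (del i v) = (-1) ^ i * dform \<omega> x (w i) (del i w)"
        using that by auto
    qed
    show "linear (\<lambda>u. ext_deriv m \<omega> x (v(k := u)))" if k: "k < Suc m" for v k
      unfolding ext_deriv_eq
    proof (intro linear_compose_sum ballI)
      fix i assume i: "i \<in> {..m}"
      have "linear (\<lambda>u. dform \<omega> x ((v(k := u)) i) (del i (v(k := u))))"
      proof (cases "i = k")
        case True
        then have "del i (v(k := u)) = del i v" for u by (auto simp: del_def)
        then show ?thesis using dform_linear[OF \<omega>] True by simp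
      next
        case False
        define k' where "k' = (if k < i then k else k - 1)"
        have "del i (v(k := u)) = (del i v)(k' := u)" for u
          using False by (auto simp: del_def k'_def fun_eq_iff)
        moreover have "k' < m" using False i k unfolding k'_def by auto
        ultimately show ?thesis using covector_linear[OF c] False by simp
      qed
      from linear_compose_scale_right[OF this, of "(-1) ^ i"]
      show "linear (\<lambda>u. (-1) ^ i * dform \<omega> x ((v(k := u)) i) (del i (v(k := u))))" by simp
    qed
    have alt: "ext_deriv m \<omega> x v = 0" if ab: "b < Suc m" "a < b" "v a = v b" for v a b
    proof -
      \<comment> \<open>Dropping the earlier entry a moves entry b = Suc c to position c; this shift
        by one gives the two terms opposite signs.\<close>
      obtain c where bc: "b = Suc c" using ab by (cases b) auto
      let ?t = "\<lambda>i. (-1) ^ i * dform \<omega> x (v i) (del i v)"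
      have "?t i = 0" if "i \<in> {..m} - {a, b}" for i
      proof -
        have "dform \<omega> x (v i) (del i v) = 0"
          by (rule covector_alternating[OF c, where i="if a < i then a else a - 1" and j="if b < i then b else c"])
            (use that ab bc in \<open>auto simp: del_def\<close>)
        then show ?thesis by simp
      qed
      then have "ext_deriv m \<omega> x v = (\<Sum>i\<in>{a, b}. ?t i)"
        unfolding ext_deriv_eq by (intro sum.mono_neutral_right) (use ab in auto)
      also have "\<dots> = ?t a + ?t b" using ab bc by simp
      also have "?t a = (-1) ^ (a + (c)) * dform \<omega> x (v a) (case_nat (v b) (del (c) (del a v)))"
      proof -
        have "del a v (c) = v b" using ab bc by (auto simp: del_def)
        then show ?thesis using covector_front[OF c, of c "v a" "del a v"] ab bc by (simp add: power_add)
      qed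
      also have "?t b = (-1) ^ (b + a) * dform \<omega> x (v a) (case_nat (v b) (del a (del b v)))"
      proof -
        have "del b v a = v b" using ab bc by (auto simp: del_def)
        then show ?thesis using covector_front[OF c, of a "v b" "del b v"] ab by (simp add: power_add)
      qed
      also have "del (c) (del a v) = del a (del b v)" using del_del[of a c v] ab bc by simp
      also have "(-1::real) ^ (b + a) = - ((-1) ^ (a + (c)))" using bc by (simp add: add.commute)
      finally show ?thesis by simp
    qed
    show "ext_deriv m \<omega> x v = 0" if "i < Suc m" "j < Suc m" "i \<noteq> j" "v i = v j" for v i j
      using alt[of j i v] alt[of i j v] that by (cases "i < j") auto
  qed
qed

text \<open>The map sending (i, j) with i \<le> j to (Suc j, i) is a bijection onto the remaining
  pairs and changes the parity of i + j.\<close>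

lemma sum_alternating_pairs:
  fixes f :: "nat \<Rightarrow> nat \<Rightarrow> real"
  assumes "\<And>i j. i \<le> j \<Longrightarrow> j \<le> m \<Longrightarrow> f i j = f (Suc j) i"
  shows "(\<Sum>i\<le>Suc m. \<Sum>j\<le>m. (-1) ^ (i + j) * f i j) = 0"
proof -
  let ?g = "\<lambda>(i, j). (-1) ^ (i + j) * f i j"
  let ?A = "{(i, j). i \<le> j \<and> j \<le> m}" and ?B = "{(i, j). j < i \<and> i \<le> Suc m}"
  have fin: "finite ?A" "finite ?B"
    by (rule finite_subset[of _ "{..Suc m} \<times> {..Suc m}"]; auto)+
  have "(\<Sum>i\<le>Suc m. \<Sum>j\<le>m. (-1) ^ (i + j) * f i j) = (\<Sum>p\<in>{..Suc m} \<times> {..m}. ?g p)"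
    by (simp add: sum.cartesian_product)
  also have "{..Suc m} \<times> {..m} = ?A \<union> ?B" by auto
  also have "(\<Sum>p\<in>?A \<union> ?B. ?g p) = (\<Sum>p\<in>?A. ?g p) + (\<Sum>p\<in>?B. ?g p)"
    by (rule sum.union_disjoint) (use fin in auto)
  also have "(\<Sum>p\<in>?B. ?g p) = (\<Sum>p\<in>?A. - ?g p)"
    by (rule sum.reindex_bij_witness[where i="\<lambda>(i, j). (Suc j, i)" and j="\<lambda>(i, j). (j, i - 1)"])
      (use assms in \<open>auto simp: add.commute gr0_conv_Suc dest!: less_imp_Suc_add\<close>)
  finally show ?thesis by (simp add: sum_negf)
qed

lemma ext_deriv_ext_deriv:
  assumes \<omega>: "\<omega> \<in> smooth_forms m" shows "ext_deriv (Suc m) (ext_deriv m \<omega>) x v = 0"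
proof -
  have d: "dform (ext_deriv m \<omega>) x u w =
      (\<Sum>j\<le>m. (-1) ^ j * frechet_derivative (\<lambda>y. dform \<omega> y (w j) (del j w)) (at x) u)" for u w
    unfolding ext_deriv_eq
    by (rule dform_eqI) (intro has_derivative_sum has_derivative_mult_right smooth_has_derivative smooth_dform[OF \<omega>])
  \<comment> \<open>The second derivative of \<omega> in the directions of two of the vectors,
    evaluated on the others. Its invariance under the pairing is \<open>del_del\<close> together
    with the symmetry of second derivatives.\<close>
  define f where "f i j = frechet_derivative (\<lambda>y. dform \<omega> y (del i v j) (del j (del i v))) (at x) (v i)" for i j
  have "f i j = f (Suc j) i" if "i \<le> j" for i j
  proof -
    have "del i v j = v (Suc j)" "del (Suc j) v i = v i" using that by (auto simp: del_def)
    then show ?thesis unfolding f_def del_del[OF that] dform_def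
      using smooth_second_derivative_symmetric[OF smooth_forms_smooth[OF \<omega>]] by simp
  qed
  then have "(\<Sum>i\<le>Suc m. \<Sum>j\<le>m. (-1) ^ (i + j) * f i j) = 0" by (intro sum_alternating_pairs)
  then show ?thesis unfolding ext_deriv_eq[of "Suc m"] d f_def by (simp add: sum_distrib_left power_add mult.assoc)
qed

section \<open>Pullback\<close>

definition pullback :: "('a::euclidean_space \<Rightarrow> 'a) \<Rightarrow> 'a form \<Rightarrow> 'a form" where
  "pullback P \<omega> = (\<lambda>x v. \<omega> (P x) (\<lambda>j. frechet_derivative P (at x) (v j)))"

lemma smooth_map_second_symmetric:
  assumes "smooth_map P"
  shows "frechet_derivative (\<lambda>y. frechet_derivative P (at y) u) (at x) w =
         frechet_derivative (\<lambda>y. frechet_derivative P (at y) w) (at x) u"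
proof (rule euclidean_eqI)
  fix b :: 'b assume b: "b \<in> Basis"
  have s: "smooth (\<lambda>x. P x \<bullet> b)" using assms b smooth_map_def by blast
  have "frechet_derivative (\<lambda>y. frechet_derivative P (at y) u) (at x) w \<bullet> b =
     frechet_derivative (\<lambda>y. frechet_derivative (\<lambda>x. P x \<bullet> b) (at y) u) (at x) w" for u w
    unfolding frechet_derivative_inner[OF assms]
    using frechet_derivative_inner[OF smooth_map_deriv[OF assms]] by metis
  then show "frechet_derivative (\<lambda>y. frechet_derivative P (at y) u) (at x) w \<bullet> b =
         frechet_derivative (\<lambda>y. frechet_derivative P (at y) w) (at x) u \<bullet> b"
    using smooth_second_derivative_symmetric[OF s] by simp
qed

lemma pullback_smooth_forms:
  assumes P: "smooth_map P" and \<omega>: "\<omega> \<in> smooth_forms m" shows "pullback P \<omega> \<in> smooth_forms m"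
proof (rule smooth_formsI)
  show "pullback P \<omega> x \<in> covectors m" for x
    unfolding pullback_def
    by (rule covectors_compose[OF smooth_forms_covector[OF \<omega>] has_derivative_linear[OF smooth_map_has_derivative[OF P]]])
  fix v
  have e: "pullback P \<omega> y v = (\<Sum>I\<in>basis_tuples m. (\<Prod>j<m. frechet_derivative P (at y) (v j) \<bullet> I j) * \<omega> (P y) I)" for y
    unfolding pullback_def by (rule covector_expand[OF smooth_forms_covector[OF \<omega>]])
  show "smooth (\<lambda>x. pullback P \<omega> x v)" unfolding e
    by (intro smooth_sum smooth_mult smooth_prod smooth_map_inner smooth_map_deriv P
        smooth_compose[OF smooth_forms_smooth[OF \<omega>]])
qed

text \<open>The product rule: one term differentiates \<omega> along P, each of the others
  differentiates one slot and so contains a second derivative of P. Expanding in coordinates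
  beforehand means that only products of real functions have to be differentiated.\<close>

lemma dform_pullback:
  assumes P: "smooth_map P" and \<omega>: "\<omega> \<in> smooth_forms m"
  shows "dform (pullback P \<omega>) x u w = dform \<omega> (P x) (frechet_derivative P (at x) u) (\<lambda>j. frechet_derivative P (at x) (w j)) +
    (\<Sum>j<m. \<omega> (P x) ((\<lambda>k. frechet_derivative P (at x) (w k))(j := frechet_derivative (\<lambda>y. frechet_derivative P (at y) (w j)) (at x) u)))"
proof -
  let ?P = "\<lambda>x. frechet_derivative P (at x)"
  let ?Q = "\<lambda>w. frechet_derivative (\<lambda>y. ?P y w) (at x)"
  have e: "pullback P \<omega> y w = (\<Sum>I\<in>basis_tuples m. (\<Prod>j<m. ?P y (w j) \<bullet> I j) * \<omega> (P y) I)" for y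
    unfolding pullback_def by (rule covector_expand[OF smooth_forms_covector[OF \<omega>]])
  have 1: "((\<lambda>y. ?P y a \<bullet> b) has_derivative (\<lambda>u. ?Q a u \<bullet> b)) (at x)" for a b
    by (intro has_derivative_inner_left smooth_map_has_derivative smooth_map_deriv P)
  have 2: "((\<lambda>y. \<omega> (P y) I) has_derivative (\<lambda>u. dform \<omega> (P x) (?P x u) I)) (at x)" for I
    by (rule has_derivative_compose[OF smooth_map_has_derivative[OF P] dform_has_derivative[OF \<omega>]])
  have "((\<lambda>y. pullback P \<omega> y w) has_derivative (\<lambda>u. \<Sum>I\<in>basis_tuples m.
      (\<Prod>j<m. ?P x (w j) \<bullet> I j) * dform \<omega> (P x) (?P x u) I +
      (\<Sum>j<m. ?Q (w j) u \<bullet> I j * (\<Prod>k\<in>{..<m} - {j}. ?P x (w k) \<bullet> I k)) * \<omega> (P x) I)) (at x)"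
    unfolding e
  proof (rule has_derivative_sum, rule has_derivative_mult[OF _ 2])
    fix I
    show "((\<lambda>y. \<Prod>j<m. ?P y (w j) \<bullet> I j) has_derivative
        (\<lambda>u. \<Sum>j<m. ?Q (w j) u \<bullet> I j * (\<Prod>k\<in>{..<m} - {j}. ?P x (w k) \<bullet> I k))) (at x)"
      by (rule has_derivative_prod) (rule 1)
  qed
  from dform_eqI[of "pullback P \<omega>" w, OF this, of u]
  have "dform (pullback P \<omega>) x u w = (\<Sum>I\<in>basis_tuples m. (\<Prod>j<m. ?P x (w j) \<bullet> I j) * dform \<omega> (P x) (?P x u) I +
     (\<Sum>j<m. ?Q (w j) u \<bullet> I j * (\<Prod>k\<in>{..<m} - {j}. ?P x (w k) \<bullet> I k)) * \<omega> (P x) I)" .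
  also have "\<dots> = (\<Sum>I\<in>basis_tuples m. (\<Prod>j<m. ?P x (w j) \<bullet> I j) * dform \<omega> (P x) (?P x u) I) +
     (\<Sum>j<m. \<Sum>I\<in>basis_tuples m. (?Q (w j) u \<bullet> I j * (\<Prod>k\<in>{..<m} - {j}. ?P x (w k) \<bullet> I k)) * \<omega> (P x) I)"
    by (simp add: sum.distrib sum_distrib_right sum.swap[of _ "{..<m}"])
  also have "(\<Sum>I\<in>basis_tuples m. (\<Prod>j<m. ?P x (w j) \<bullet> I j) * dform \<omega> (P x) (?P x u) I) =
    dform \<omega> (P x) (?P x u) (\<lambda>j. ?P x (w j))"
    using covector_expand[OF dform_covector[OF \<omega>]] by metis
  also have "(\<Sum>j<m. \<Sum>I\<in>basis_tuples m. (?Q (w j) u \<bullet> I j * (\<Prod>k\<in>{..<m} - {j}. ?P x (w k) \<bullet> I k)) * \<omega> (P x) I) =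
    (\<Sum>j<m. \<omega> (P x) ((\<lambda>k. ?P x (w k))(j := ?Q (w j) u)))"
  proof (rule sum.cong[OF refl])
    fix j assume j: "j \<in> {..<m}"
    have "(\<Prod>k<m. ((\<lambda>k. ?P x (w k))(j := ?Q (w j) u)) k \<bullet> I k) =
        ?Q (w j) u \<bullet> I j * (\<Prod>k\<in>{..<m} - {j}. ?P x (w k) \<bullet> I k)" for I
      by (subst prod.remove[OF _ j]) (auto intro!: prod.cong)
    then show "(\<Sum>I\<in>basis_tuples m. (?Q (w j) u \<bullet> I j * (\<Prod>k\<in>{..<m} - {j}. ?P x (w k) \<bullet> I k)) * \<omega> (P x) I) =
      \<omega> (P x) ((\<lambda>k. ?P x (w k))(j := ?Q (w j) u))"
      unfolding covector_expand[OF smooth_forms_covector[OF \<omega>], of "P x" "(\<lambda>k. ?P x (w k))(j := ?Q (w j) u)"] by simp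
  qed
  finally show ?thesis .
qed

text \<open>The terms with a second derivative of P cancel by its symmetry, under the same pairing
  as for d d = 0, once the differentiated slot has been moved to the front.\<close>

lemma ext_deriv_pullback:
  assumes P: "smooth_map P" and \<omega>: "\<omega> \<in> smooth_forms m"
  shows "ext_deriv m (pullback P \<omega>) = pullback P (ext_deriv m \<omega>)"
proof (intro ext)
  fix x v
  let ?P = "\<lambda>x. frechet_derivative P (at x)"
  let ?Q = "\<lambda>w. frechet_derivative (\<lambda>y. ?P y w) (at x)"
  let ?R = "\<Sum>i\<le>m. (-1) ^ i * (\<Sum>j<m. \<omega> (P x) ((\<lambda>k. ?P x (del i v k))(j := ?Q (del i v j) (v i))))"
  have "ext_deriv m (pullback P \<omega>) x v = (\<Sum>i\<le>m. (-1) ^ i * dform \<omega> (P x) (?P x (v i)) (\<lambda>j. ?P x (del i v j))) + ?R"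
    unfolding ext_deriv_eq dform_pullback[OF P \<omega>] by (simp add: ring_distribs sum.distrib)
  also have "(\<Sum>i\<le>m. (-1) ^ i * dform \<omega> (P x) (?P x (v i)) (\<lambda>j. ?P x (del i v j))) = pullback P (ext_deriv m \<omega>) x v"
  proof -
    have "del i (\<lambda>j. ?P x (v j)) = (\<lambda>j. ?P x (del i v j))" for i by (auto simp: del_def)
    then show ?thesis unfolding pullback_def ext_deriv_eq by simp
  qed
  also have "?R = 0"
  proof (cases m)
    case 0 then show ?thesis by simp
  next
    case (Suc n)
    define f where "f i j = \<omega> (P x) (case_nat (?Q (del i v j) (v i)) (\<lambda>k. ?P x (del j (del i v) k)))" for i j
    have "\<omega> (P x) ((\<lambda>k. ?P x (w k))(j := a)) = (-1) ^ j * \<omega> (P x) (case_nat a (\<lambda>k. ?P x (del j w k)))" if "j < m" for w j a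
    proof -
      have "del j ((\<lambda>k. ?P x (w k))(j := a)) = (\<lambda>k. ?P x (del j w k))" by (auto simp: del_def)
      then show ?thesis using covector_front[OF smooth_forms_covector[OF \<omega>, of "P x"] that, of "(\<lambda>k. ?P x (w k))(j := a)"] by simp
    qed
    then have "?R = (\<Sum>i\<le>m. \<Sum>j<m. (-1) ^ (i + j) * f i j)"
      unfolding f_def by (simp add: sum_distrib_left power_add mult.assoc)
    also have "\<dots> = (\<Sum>i\<le>Suc n. \<Sum>j\<le>n. (-1) ^ (i + j) * f i j)" unfolding Suc lessThan_Suc_atMost ..
    also have "\<dots> = 0"
    proof (rule sum_alternating_pairs)
      fix i j :: nat assume ij: "i \<le> j"
      have "del i v j = v (Suc j)" "del (Suc j) v i = v i" using ij by (auto simp: del_def)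
      then show "f i j = f (Suc j) i" unfolding f_def del_del[OF ij]
        using smooth_map_second_symmetric[OF P] by simp
    qed
    finally show ?thesis .
  qed
  finally show "ext_deriv m (pullback P \<omega>) x v = pullback P (ext_deriv m \<omega>) x v" by simp
qed

section \<open>Linear functionals on forms\<close>

lemma linear_functionals_add: "T \<in> linear_functionals V \<Longrightarrow> f \<in> V \<Longrightarrow> g \<in> V \<Longrightarrow> T (f + g) = T f + T g"
  by (simp add: linear_functionals_def)

lemma linear_functionals_scaleR: "T \<in> linear_functionals V \<Longrightarrow> f \<in> V \<Longrightarrow> T (c *\<^sub>R f) = c * T f"
  by (simp add: linear_functionals_def)

lemma linear_functionals_outside: "T \<in> linear_functionals V \<Longrightarrow> f \<notin> V \<Longrightarrow> T f = 0"
  by (simp add: linear_functionals_def)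

lemma linear_functionals_zero: "T \<in> linear_functionals V \<Longrightarrow> f \<in> V \<Longrightarrow> T 0 = 0"
  using linear_functionals_scaleR[of T V f 0] by simp

lemma linear_functionals_uminus: "T \<in> linear_functionals V \<Longrightarrow> f \<in> V \<Longrightarrow> T (- f) = - T f"
  using linear_functionals_scaleR[of T V f "-1"] by simp

lemma linear_functionals_diff:
  assumes "T \<in> linear_functionals V" "f \<in> V" "g \<in> V" "- g \<in> V" shows "T (f - g) = T f - T g"
  using linear_functionals_add[OF assms(1,2,4)] linear_functionals_uminus[OF assms(1,3)] by simp

lemma linear_functionals_eqI:
  assumes "S \<in> linear_functionals V" "T \<in> linear_functionals V" "\<And>f. f \<in> V \<Longrightarrow> S f = T f" shows "S = T"
  using assms by (metis ext linear_functionals_outside)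

lemma linear_functionals_plus: "S \<in> linear_functionals V \<Longrightarrow> T \<in> linear_functionals V \<Longrightarrow> S + T \<in> linear_functionals V"
  by (auto simp: linear_functionals_def algebra_simps)

lemma linear_functionals_cmul: "T \<in> linear_functionals V \<Longrightarrow> c *\<^sub>R T \<in> linear_functionals V"
  by (auto simp: linear_functionals_def scaleR_fun_def algebra_simps)

lemma linear_functionals_minus: "S \<in> linear_functionals V \<Longrightarrow> T \<in> linear_functionals V \<Longrightarrow> S - T \<in> linear_functionals V"
  by (auto simp: linear_functionals_def algebra_simps)

lemma smooth_forms_uminus: "\<omega> \<in> smooth_forms m \<Longrightarrow> - \<omega> \<in> smooth_forms m"
  using smooth_forms_scaleR[of \<omega> m "-1"] by simp

lemma form_functional_diff:
  "T \<in> linear_functionals (smooth_forms m) \<Longrightarrow> \<omega> \<in> smooth_forms m \<Longrightarrow> \<eta> \<in> smooth_forms m \<Longrightarrow> T (\<omega> - \<eta>) = T \<omega> - T \<eta>"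
  by (simp add: linear_functionals_diff smooth_forms_uminus)

lemma currents_linear: "T \<in> currents m \<Longrightarrow> T \<in> linear_functionals (smooth_forms m)"
  by (simp add: currents_def)

section \<open>The topology of smooth forms\<close>

lemma iter_deriv_add:
  "smooth f \<Longrightarrow> smooth g \<Longrightarrow> iter_deriv us (\<lambda>x. f x + g x) = (\<lambda>x. iter_deriv us f x + iter_deriv us g x)"
proof (induction us arbitrary: f g)
  case Nil then show ?case by simp
next
  case (Cons u us)
  have "frechet_derivative (\<lambda>x. f x + g x) (at x) = (\<lambda>h. frechet_derivative f (at x) h + frechet_derivative g (at x) h)" for x
    by (rule frechet_derivative_at[symmetric]) (intro has_derivative_add smooth_has_derivative Cons)
  then show ?case using Cons.IH[OF smooth_deriv smooth_deriv] Cons.prems by simp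
qed

definition form_nbhd :: "nat \<Rightarrow> 'a::euclidean_space form \<Rightarrow> 'a set \<Rightarrow> 'a list \<Rightarrow> (nat \<Rightarrow> 'a) \<Rightarrow> real \<Rightarrow> 'a form set" where
  "form_nbhd m \<omega> C us v \<epsilon> = {\<eta> \<in> smooth_forms m. \<forall>x\<in>C. \<bar>iter_deriv us (\<lambda>y. \<eta> y v - \<omega> y v) x\<bar> < \<epsilon>}"

lemma form_topology_eq: "form_topology m = topology_generated_by
    {form_nbhd m \<omega> C us v \<epsilon> | \<omega> C us v \<epsilon>. \<omega> \<in> smooth_forms m \<and> compact C \<and> 0 < \<epsilon>}"
  unfolding form_topology_def form_nbhd_def ..

lemma topspace_form_topology: "topspace (form_topology m) = (smooth_forms m :: 'a::euclidean_space form set)"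
proof -
  let ?\<S> = "{form_nbhd m \<omega> C us v \<epsilon> | (\<omega> :: 'a form) C us v \<epsilon>. \<omega> \<in> smooth_forms m \<and> compact C \<and> 0 < \<epsilon>}"
  have "\<Union>?\<S> \<subseteq> smooth_forms m" by (auto simp: form_nbhd_def)
  moreover have "smooth_forms m \<subseteq> \<Union>?\<S>"
  proof
    fix \<omega> :: "'a form" assume \<omega>: "\<omega> \<in> smooth_forms m"
    have "form_nbhd m \<omega> {} [] (\<lambda>_. 0) 1 \<in> ?\<S>"
      by (intro CollectI exI[of _ \<omega>] exI[of _ "{}"] exI[of _ "[]"] exI[of _ "\<lambda>_. 0"] exI[of _ 1]) (use \<omega> in auto)
    moreover have "\<omega> \<in> form_nbhd m \<omega> {} [] (\<lambda>_. 0) 1" using \<omega> by (simp add: form_nbhd_def)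
    ultimately show "\<omega> \<in> \<Union>?\<S>" by (rule UnionI)
  qed
  ultimately show ?thesis unfolding form_topology_eq topology_generated_by_topspace by (rule equalityI)
qed

lemma openin_form_nbhd: "\<omega> \<in> smooth_forms m \<Longrightarrow> compact C \<Longrightarrow> 0 < \<epsilon> \<Longrightarrow> openin (form_topology m) (form_nbhd m \<omega> C us v \<epsilon>)"
  unfolding form_topology_eq by (rule topology_generated_by_Basis) blast

text \<open>Continuity refers to a topology generated by a subbasis, so the passage to sequences is
  an induction over the generation of open sets: a sequence converging in all seminorms is
  eventually in every open set that contains \<omega>.\<close>

lemma current_tendsto:
  assumes T: "T \<in> currents m" and \<omega>s: "\<And>n. \<omega>s n \<in> smooth_forms m" and \<omega>: "\<omega> \<in> smooth_forms m"
    and conv: "\<And>C us v \<epsilon>. compact C \<Longrightarrow> \<epsilon> > 0 \<Longrightarrow>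
      eventually (\<lambda>n. \<forall>x\<in>C. \<bar>iter_deriv us (\<lambda>y. \<omega>s n y v - \<omega> y v) x\<bar> < \<epsilon>) sequentially"
  shows "(\<lambda>n. T (\<omega>s n)) \<longlonglongrightarrow> T \<omega>"
proof (rule topological_tendstoI)
  fix S :: "real set" assume S: "open S" "T \<omega> \<in> S"
  let ?\<S> = "{form_nbhd m \<omega> C us v \<epsilon> | \<omega> C us v \<epsilon>. \<omega> \<in> smooth_forms m \<and> compact C \<and> 0 < \<epsilon>}"
  have ev: "generate_topology_on ?\<S> W \<Longrightarrow> \<omega> \<in> W \<longrightarrow> eventually (\<lambda>n. \<omega>s n \<in> W) sequentially" for W
  proof (induction rule: generate_topology_on.induct)
    case Empty then show ?case by simp
  next
    case (Int a b) then show ?case by (auto intro: eventually_conj)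
  next
    case (UN \<K>)
    show ?case
    proof
      assume "\<omega> \<in> \<Union>\<K>"
      then obtain X where "X \<in> \<K>" "\<omega> \<in> X" by blast
      then have "eventually (\<lambda>n. \<omega>s n \<in> X) sequentially" using UN by blast
      then show "eventually (\<lambda>n. \<omega>s n \<in> \<Union>\<K>) sequentially"
        by (rule eventually_mono) (use \<open>X \<in> \<K>\<close> in blast)
    qed
  next
    case (Basis s)
    show ?case
    proof
      assume "\<omega> \<in> s"
      obtain \<zeta> C us v \<epsilon> where s: "s = form_nbhd m \<zeta> C us v \<epsilon>" and \<zeta>: "\<zeta> \<in> smooth_forms m" and C: "compact C" and "0 < \<epsilon>"
        using Basis by blast
      let ?g = "\<lambda>x. \<bar>iter_deriv us (\<lambda>y. \<omega> y v - \<zeta> y v) x\<bar>"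
      have sm: "smooth (\<lambda>y. \<omega> y v - \<zeta> y v)" by (intro smooth_diff smooth_forms_smooth[OF \<omega>] smooth_forms_smooth[OF \<zeta>])
      have lt: "?g x < \<epsilon>" if "x \<in> C" for x using \<open>\<omega> \<in> s\<close> that unfolding s form_nbhd_def by auto
      obtain b where b: "b < \<epsilon>" "\<And>x. x \<in> C \<Longrightarrow> ?g x \<le> b"
      proof (cases "C = {}")
        case True then show ?thesis using that[of 0] \<open>0 < \<epsilon>\<close> by auto
      next
        case False
        have "continuous_on C ?g"
          by (intro continuous_intros smooth_continuous smooth_iter_deriv sm)
        from continuous_attains_sup[OF C False this] obtain y where "y \<in> C" "\<And>x. x \<in> C \<Longrightarrow> ?g x \<le> ?g y" by blast
        then show ?thesis using that[of "?g y"] lt by blast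
      qed
      have "eventually (\<lambda>n. \<forall>x\<in>C. \<bar>iter_deriv us (\<lambda>y. \<omega>s n y v - \<omega> y v) x\<bar> < \<epsilon> - b) sequentially"
        by (rule conv[OF C]) (use b in simp)
      then show "eventually (\<lambda>n. \<omega>s n \<in> s) sequentially"
      proof (rule eventually_mono)
        fix n assume n: "\<forall>x\<in>C. \<bar>iter_deriv us (\<lambda>y. \<omega>s n y v - \<omega> y v) x\<bar> < \<epsilon> - b"
        have sn: "smooth (\<lambda>y. \<omega>s n y v - \<omega> y v)" by (intro smooth_diff smooth_forms_smooth[OF \<omega>] smooth_forms_smooth[OF \<omega>s])
        have "\<bar>iter_deriv us (\<lambda>y. \<omega>s n y v - \<zeta> y v) x\<bar> < \<epsilon>" if "x \<in> C" for x
        proof -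
          have "(\<lambda>y. \<omega>s n y v - \<zeta> y v) = (\<lambda>y. (\<omega>s n y v - \<omega> y v) + (\<omega> y v - \<zeta> y v))" by auto
          then have "iter_deriv us (\<lambda>y. \<omega>s n y v - \<zeta> y v) x =
             iter_deriv us (\<lambda>y. \<omega>s n y v - \<omega> y v) x + iter_deriv us (\<lambda>y. \<omega> y v - \<zeta> y v) x"
            using iter_deriv_add[OF sn sm] by simp
          moreover have "\<bar>iter_deriv us (\<lambda>y. \<omega>s n y v - \<omega> y v) x\<bar> < \<epsilon> - b" using n that by blast
          ultimately show ?thesis using b(2)[OF that] by linarith
        qed
        then show "\<omega>s n \<in> s" unfolding s form_nbhd_def using \<omega>s by auto
      qed
    qed
  qed
  have "openin (form_topology m) {\<eta> \<in> topspace (form_topology m). T \<eta> \<in> S}"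
    using T S(1) unfolding currents_def continuous_map_def by auto
  then have "generate_topology_on ?\<S> {\<eta> \<in> topspace (form_topology m). T \<eta> \<in> S}"
    unfolding form_topology_eq by (rule openin_topology_generated_by)
  from ev[OF this] have "eventually (\<lambda>n. \<omega>s n \<in> {\<eta> \<in> topspace (form_topology m). T \<eta> \<in> S}) sequentially"
    using S(2) \<omega> by (simp add: topspace_form_topology)
  then show "eventually (\<lambda>n. T (\<omega>s n) \<in> S) sequentially" by (rule eventually_mono) auto
qed

text \<open>Finitely many seminorms of \<open>form_topology\<close>, on coefficients only. Order one
  suffices because the functionals considered below are bounded in terms of \<omega> and
  d\<omega>.\<close>

definition C1_bound :: "nat \<Rightarrow> 'a set \<Rightarrow> real \<Rightarrow> 'a::euclidean_space form \<Rightarrow> bool" where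
  "C1_bound m C b \<eta> \<longleftrightarrow> (\<forall>x\<in>C. \<forall>I\<in>basis_tuples m. \<bar>\<eta> x I\<bar> \<le> b \<and> (\<forall>u\<in>Basis. \<bar>dform \<eta> x u I\<bar> \<le> b))"

text \<open>Domination by finitely many seminorms gives continuity. The bound may be one-sided,
  since it is applied both to \<eta> - \<eta>0 and to \<eta>0 - \<eta>.\<close>

lemma currentsI:
  fixes \<Phi> :: "'a::euclidean_space current"
  assumes L: "\<Phi> \<in> linear_functionals (smooth_forms m)" and C: "compact C" and A: "A \<ge> 0"
    and bd: "\<And>\<eta> b. \<eta> \<in> smooth_forms m \<Longrightarrow> b \<ge> 0 \<Longrightarrow> C1_bound m C b \<eta> \<Longrightarrow> \<Phi> \<eta> \<le> A * b"
  shows "\<Phi> \<in> currents m"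
proof -
  have "continuous_map (form_topology m) euclideanreal \<Phi>" unfolding continuous_map_def
  proof (intro conjI allI impI)
    show "\<Phi> \<in> topspace (form_topology m) \<rightarrow> topspace euclideanreal" by simp
    fix U assume "openin euclideanreal U"
    then have U: "open U" by simp
    show "openin (form_topology m) {\<eta> \<in> topspace (form_topology m). \<Phi> \<eta> \<in> U}"
    proof (subst openin_subopen, intro ballI)
      fix \<eta>0 assume "\<eta>0 \<in> {\<eta> \<in> topspace (form_topology m). \<Phi> \<eta> \<in> U}"
      then have \<eta>0: "\<eta>0 \<in> smooth_forms m" "\<Phi> \<eta>0 \<in> U" by (auto simp: topspace_form_topology)
      obtain \<delta> where \<delta>: "\<delta> > 0" "ball (\<Phi> \<eta>0) \<delta> \<subseteq> U" using U \<eta>0 open_contains_ball by blast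
      \<comment> \<open>Chosen so that A * \<epsilon> < \<delta>, also for A = 0.\<close>
      define \<epsilon> where "\<epsilon> = \<delta> / (2 * (A + 1))"
      have \<epsilon>: "\<epsilon> > 0" "A * \<epsilon> < \<delta>" unfolding \<epsilon>_def using \<delta>(1) A by (auto simp: field_simps add_strict_increasing)
      \<comment> \<open>The empty list stands for the values, the singletons for the first partial
        derivatives.\<close>
      let ?L = "insert [] ((\<lambda>u. [u]) ` Basis) :: 'a list set"
      let ?W = "topspace (form_topology m) \<inter> (\<Inter>(us, I)\<in>?L \<times> basis_tuples m. form_nbhd m \<eta>0 C us I \<epsilon>)"
      have fin: "finite (?L \<times> basis_tuples m)" by (intro finite_cartesian_product finite_basis_tuples) auto
      have "openin (form_topology m) ?W"
      proof -
        have "openin (form_topology m) (topspace (form_topology m) \<inter> \<Inter>((\<lambda>(us, I). form_nbhd m \<eta>0 C us I \<epsilon>) ` (?L \<times> basis_tuples m)))"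
          by (rule openin_Int_Inter) (use fin openin_form_nbhd[OF \<eta>0(1) C \<epsilon>(1)] in auto)
        then show ?thesis .
      qed
      moreover have "\<eta>0 \<in> ?W"
      proof -
        have z: "iter_deriv us (\<lambda>y. 0) x = 0" for us and x :: 'a
          by (induction us) (auto simp: frechet_derivative_const)
        show ?thesis using \<eta>0(1) \<epsilon> z by (auto simp: topspace_form_topology form_nbhd_def)
      qed
      moreover have "?W \<subseteq> {\<eta> \<in> topspace (form_topology m). \<Phi> \<eta> \<in> U}"
      proof
        fix \<eta> assume \<eta>W: "\<eta> \<in> ?W"
        then have \<eta>: "\<eta> \<in> smooth_forms m" by (simp add: topspace_form_topology)
        have d: "\<eta> - \<eta>0 \<in> smooth_forms m" "\<eta>0 - \<eta> \<in> smooth_forms m" using \<eta> \<eta>0 by (auto intro: smooth_forms_diff)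
        have nb: "\<bar>iter_deriv us (\<lambda>y. \<eta> y I - \<eta>0 y I) x\<bar> \<le> \<epsilon>" if "us \<in> ?L" "I \<in> basis_tuples m" "x \<in> C" for us I x
        proof -
          have "\<eta> \<in> form_nbhd m \<eta>0 C us I \<epsilon>" using \<eta>W that(1,2) by blast
          then show ?thesis using that(3) by (auto simp: form_nbhd_def less_imp_le)
        qed
        have c: "C1_bound m C \<epsilon> (\<eta> - \<eta>0)" unfolding C1_bound_def dform_def
          using nb[of "[]"] nb[of "[_]"] by auto
        have c': "C1_bound m C \<epsilon> (\<eta>0 - \<eta>)"
        proof -
          have "dform (\<eta>0 - \<eta>) x u I = - dform (\<eta> - \<eta>0) x u I" for x u I
          proof (rule dform_eqI)
            have "((\<lambda>y. - ((\<eta> - \<eta>0) y I)) has_derivative (\<lambda>u. - dform (\<eta> - \<eta>0) x u I)) (at x)"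
              by (intro has_derivative_minus dform_has_derivative[OF d(1)])
            then show "((\<lambda>y. (\<eta>0 - \<eta>) y I) has_derivative (\<lambda>u. - dform (\<eta> - \<eta>0) x u I)) (at x)" by simp
          qed
          then show ?thesis using c unfolding C1_bound_def by (simp add: abs_minus_commute)
        qed
        have "\<bar>\<Phi> \<eta> - \<Phi> \<eta>0\<bar> \<le> A * \<epsilon>"
          using bd[OF d(1) _ c] bd[OF d(2) _ c'] \<epsilon>(1) form_functional_diff[OF L \<eta> \<eta>0(1)] form_functional_diff[OF L \<eta>0(1) \<eta>] by auto
        then have "\<Phi> \<eta> \<in> ball (\<Phi> \<eta>0) \<delta>" using \<epsilon>(2) by (simp add: dist_real_def abs_minus_commute)
        then show "\<eta> \<in> {\<eta> \<in> topspace (form_topology m). \<Phi> \<eta> \<in> U}" using \<delta>(2) \<eta> by (auto simp: topspace_form_topology)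
      qed
      ultimately show "\<exists>W. openin (form_topology m) W \<and> \<eta>0 \<in> W \<and> W \<subseteq> {\<eta> \<in> topspace (form_topology m). \<Phi> \<eta> \<in> U}" by blast
    qed
  qed
  then show ?thesis using L by (simp add: currents_def)
qed

lemma currents_add: "S \<in> currents m \<Longrightarrow> T \<in> currents m \<Longrightarrow> S + T \<in> currents m"
  by (simp add: currents_def linear_functionals_plus) (simp add: plus_fun_def continuous_map_add)

lemma currents_scaleR: "T \<in> currents m \<Longrightarrow> c *\<^sub>R T \<in> currents m"
  by (simp add: currents_def linear_functionals_cmul) (simp add: scaleR_fun_def continuous_map_real_mult_left)

lemma currents_diff: assumes "S \<in> currents m" "T \<in> currents m" shows "S - T \<in> currents m"
proof -
  have "S - T = S + (-1) *\<^sub>R T" by (simp add: fun_eq_iff scaleR_fun_def)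
  then show ?thesis using currents_add[OF assms(1) currents_scaleR[OF assms(2)]] by metis
qed

lemma currents_zero: "0 \<in> currents m"
  by (simp add: currents_def linear_functionals_def zero_fun_def)

section \<open>Supports\<close>

lemma form_support_mono: "(\<And>x v. \<omega> x v = 0 \<Longrightarrow> \<eta> x v = 0) \<Longrightarrow> form_support \<eta> \<subseteq> form_support \<omega>"
  unfolding form_support_def by (rule closure_mono) blast

lemma compact_form_support: "form_support \<omega> \<subseteq> C \<Longrightarrow> compact C \<Longrightarrow> compact (form_support \<omega>)"
  using compact_Int_closed[of C "form_support \<omega>"] by (simp add: form_support_def inf.absorb2)

(* Cover the support of the form by finitely many balls on which T vanishes, and peel off one
   ball at a time: zeta = b zeta + (1 - b) zeta for a bump b equal to 1 on that ball. *)
lemma current_vanish_compact: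
  assumes T: "T \<in> currents m" and \<omega>: "\<omega> \<in> smooth_forms m"
    and S: "compact (form_support \<omega>)" "form_support \<omega> \<inter> spt m T = {}"
  shows "T \<omega> = 0"
proof -
  let ?S = "form_support \<omega>"
  have "\<exists>r. r > 0 \<and> (\<forall>\<eta>\<in>smooth_forms m. compact (form_support \<eta>) \<and> form_support \<eta> \<subseteq> cball x (2 * r) \<longrightarrow> T \<eta> = 0)"
    if "x \<in> ?S" for x
  proof -
    have "x \<notin> spt m T" using that S by blast
    then obtain U where U: "open U" "x \<in> U"
      "\<forall>\<omega>\<in>smooth_forms m. compact (form_support \<omega>) \<and> form_support \<omega> \<subseteq> U \<longrightarrow> T \<omega> = 0"
      unfolding spt_def by blast
    then obtain e where "e > 0" "cball x e \<subseteq> U" using open_contains_cball by blast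
    then show ?thesis using U by (intro exI[of _ "e / 2"]) auto
  qed
  then obtain r where r: "\<And>x. x \<in> ?S \<Longrightarrow> r x > 0"
    "\<And>x \<eta>. x \<in> ?S \<Longrightarrow> \<eta> \<in> smooth_forms m \<Longrightarrow> compact (form_support \<eta>) \<Longrightarrow> form_support \<eta> \<subseteq> cball x (2 * r x) \<Longrightarrow> T \<eta> = 0"
    by metis
  have "finite F \<Longrightarrow> F \<subseteq> ?S \<Longrightarrow> (\<forall>\<zeta>\<in>smooth_forms m. form_support \<zeta> \<subseteq> ?S \<longrightarrow>
      (\<forall>x v. \<zeta> x v \<noteq> 0 \<longrightarrow> x \<in> (\<Union>a\<in>F. ball a (r a))) \<longrightarrow> T \<zeta> = 0)" for F
  proof (induction F rule: finite_induct)
    case empty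
    show ?case
    proof (intro ballI impI)
      fix \<zeta> :: "'a form" assume "\<forall>x v. \<zeta> x v \<noteq> 0 \<longrightarrow> x \<in> (\<Union>a\<in>{}. ball a (r a))"
      then have "\<zeta> = 0" by (auto simp: fun_eq_iff)
      then show "T \<zeta> = 0" using linear_functionals_zero[OF currents_linear[OF T] \<omega>] by simp
    qed
  next
    case (insert a F)
    show ?case
    proof (intro ballI impI)
      fix \<zeta> :: "'a form" assume \<zeta>: "\<zeta> \<in> smooth_forms m" "form_support \<zeta> \<subseteq> ?S"
        "\<forall>x v. \<zeta> x v \<noteq> 0 \<longrightarrow> x \<in> (\<Union>a\<in>insert a F. ball a (r a))"
      let ?b = "bump a (r a)"
      let ?\<zeta>1 = "\<lambda>x v. ?b x * \<zeta> x v" and ?\<zeta>2 = "\<lambda>x v. (1 - ?b x) * \<zeta> x v"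
      have ra: "a \<in> ?S" "r a > 0" using r insert by auto
      have f: "?\<zeta>1 \<in> smooth_forms m" "?\<zeta>2 \<in> smooth_forms m"
        by (intro smooth_forms_mult smooth_diff smooth_const smooth_bump \<zeta>(1))+
      have "\<zeta> = ?\<zeta>1 + ?\<zeta>2" by (auto simp: fun_eq_iff algebra_simps)
      then have "T \<zeta> = T ?\<zeta>1 + T ?\<zeta>2" using linear_functionals_add[OF currents_linear[OF T] f] by simp
      moreover have "T ?\<zeta>1 = 0"
      proof (rule r(2)[OF ra(1) f(1)])
        have "form_support ?\<zeta>1 \<subseteq> form_support \<zeta>" by (rule form_support_mono) auto
        then have "form_support ?\<zeta>1 \<subseteq> ?S" using \<zeta>(2) by (rule order.trans)
        then show "compact (form_support ?\<zeta>1)" using S(1) by (rule compact_form_support)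
        have "x \<in> cball a (2 * r a)" if "?\<zeta>1 x v \<noteq> 0" for x v
          using that bump_0[OF ra(2), of x a] by (cases "2 * r a \<le> norm (x - a)") (auto simp: dist_norm norm_minus_commute)
        then show "form_support ?\<zeta>1 \<subseteq> cball a (2 * r a)" unfolding form_support_def
          by (intro closure_minimal) auto
      qed
      moreover have "T ?\<zeta>2 = 0"
      proof -
        have "form_support ?\<zeta>2 \<subseteq> form_support \<zeta>" by (rule form_support_mono) auto
        moreover have "x \<in> (\<Union>a\<in>F. ball a (r a))" if "?\<zeta>2 x v \<noteq> 0" for x v
        proof -
          have "\<zeta> x v \<noteq> 0" "x \<notin> ball a (r a)"
            using that bump_1[of x a "r a"] by (auto simp: dist_norm norm_minus_commute)
          then show ?thesis using \<zeta>(3) by blast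
        qed
        ultimately show ?thesis using insert f(2) \<zeta>(2) by blast
      qed
      ultimately show "T \<zeta> = 0" by simp
    qed
  qed
  note ind = this
  have cov: "?S \<subseteq> (\<Union>a\<in>?S. ball a (r a))" using r(1) by fastforce
  obtain F where F: "F \<subseteq> ?S" "finite F" "?S \<subseteq> (\<Union>a\<in>F. ball a (r a))"
    by (rule compactE_image[OF S(1) _ cov]) simp_all
  have "x \<in> ?S" if "\<omega> x v \<noteq> 0" for x v
    unfolding form_support_def by (rule subsetD[OF closure_subset]) (use that in blast)
  then have "\<forall>x v. \<omega> x v \<noteq> 0 \<longrightarrow> x \<in> (\<Union>a\<in>F. ball a (r a))" using F(3) by (meson subsetD)
  then show ?thesis using ind[OF F(2,1), THEN bspec, OF \<omega>] by simp
qed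

text \<open>A form without compact support is replaced by its products with bumps of radius n + 1.
  Near any given compact set these eventually coincide with \<omega>, so they converge to it in all
  seminorms.\<close>

lemma current_vanish:
  assumes T: "T \<in> currents m" and \<omega>: "\<omega> \<in> smooth_forms m" and S: "form_support \<omega> \<inter> spt m T = {}"
  shows "T \<omega> = 0"
proof -
  let ?w = "\<lambda>n x v. bump 0 (real (Suc n)) x * \<omega> x v"
  have w: "?w n \<in> smooth_forms m" for n by (intro smooth_forms_mult smooth_bump \<omega>)
  have "T (?w n) = 0" for n
  proof (rule current_vanish_compact[OF T w])
    have s: "form_support (?w n) \<subseteq> form_support \<omega>" by (rule form_support_mono) auto
    show "form_support (?w n) \<inter> spt m T = {}" using s S by blast
    have "x \<in> cball 0 (2 * real (Suc n))" if "?w n x v \<noteq> 0" for x v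
      using that bump_0[of "real (Suc n)" x 0] by (cases "2 * real (Suc n) \<le> norm x") (auto simp del: of_nat_Suc)
    then have "form_support (?w n) \<subseteq> cball 0 (2 * real (Suc n))" unfolding form_support_def
      by (intro closure_minimal) auto
    then show "compact (form_support (?w n))" by (rule compact_form_support) simp
  qed
  moreover have "(\<lambda>n. T (?w n)) \<longlonglongrightarrow> T \<omega>"
  proof (rule current_tendsto[OF T w \<omega>])
    fix C :: "'a set" and us v and \<epsilon> :: real assume C: "compact C" and \<epsilon>: "\<epsilon> > 0"
    obtain B where B: "\<And>x. x \<in> C \<Longrightarrow> norm x \<le> B" using C compact_imp_bounded bounded_iff by metis
    have z: "iter_deriv us g x = 0" if "\<And>y. y \<in> U \<Longrightarrow> g y = 0" "open U" "x \<in> U" for g x and U :: "'a set"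
      using that(1,3)
    proof (induction us arbitrary: g x)
      case (Cons u us)
      have "frechet_derivative g (at y) u = 0" if "y \<in> U" for y
      proof -
        have "((\<lambda>x. 0) has_derivative (\<lambda>h. 0)) (at y)" by simp
        then have "(g has_derivative (\<lambda>h. 0)) (at y)"
          by (rule has_derivative_transform_within_open[OF _ \<open>open U\<close> \<open>y \<in> U\<close>]) (use Cons in auto)
        then show ?thesis using frechet_derivative_at by metis
      qed
      then show ?case using Cons.IH Cons.prems(2) by simp
    qed simp
    obtain N where N: "real N > B" using reals_Archimedean2 by blast
    have "eventually (\<lambda>n. real (Suc n) > B) sequentially"
      by (rule eventually_sequentiallyI[of N]) (use N in linarith)
    then show "eventually (\<lambda>n. \<forall>x\<in>C. \<bar>iter_deriv us (\<lambda>y. ?w n y v - \<omega> y v) x\<bar> < \<epsilon>) sequentially"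
    proof (rule eventually_mono)
      fix n assume n: "real (Suc n) > B"
      have "iter_deriv us (\<lambda>y. ?w n y v - \<omega> y v) x = 0" if "x \<in> C" for x
      proof (rule z)
        show "x \<in> ball 0 (real (Suc n))" using n B[OF that] by (simp del: of_nat_Suc)
        show "?w n y v - \<omega> y v = 0" if "y \<in> ball 0 (real (Suc n))" for y
          using bump_1[of y 0 "real (Suc n)"] that by (simp del: of_nat_Suc)
      qed simp
      then show "\<forall>x\<in>C. \<bar>iter_deriv us (\<lambda>y. ?w n y v - \<omega> y v) x\<bar> < \<epsilon>" using \<epsilon> by simp
    qed
  qed
  ultimately show ?thesis by (simp add: LIMSEQ_const_iff)
qed

text \<open>The difference of the two forms vanishes on the open set U, so its support avoids that
  of T.\<close>

lemma current_cong:
  assumes T: "T \<in> currents m" and "\<omega> \<in> smooth_forms m" "\<eta> \<in> smooth_forms m"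
    and U: "open U" "spt m T \<subseteq> U" "\<And>x v. x \<in> U \<Longrightarrow> \<omega> x v = \<eta> x v"
  shows "T \<omega> = T \<eta>"
proof -
  have "form_support (\<omega> - \<eta>) \<subseteq> - U" unfolding form_support_def
    by (rule closure_minimal) (use U in auto)
  then have "form_support (\<omega> - \<eta>) \<inter> spt m T = {}" using U(2) by blast
  then have "T (\<omega> - \<eta>) = 0" by (rule current_vanish[OF T smooth_forms_diff[OF assms(2,3)]])
  then show ?thesis using form_functional_diff[OF currents_linear[OF T] assms(2,3)] by simp
qed

lemma spt_add: "spt m (S + T) \<subseteq> spt m S \<union> spt m T"
proof
  fix x assume x: "x \<in> spt m (S + T)"
  show "x \<in> spt m S \<union> spt m T"
  proof (rule ccontr)
    assume "x \<notin> spt m S \<union> spt m T"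
    then obtain U V where "open U" "x \<in> U" "\<forall>\<omega>\<in>smooth_forms m. compact (form_support \<omega>) \<and> form_support \<omega> \<subseteq> U \<longrightarrow> S \<omega> = 0"
      "open V" "x \<in> V" "\<forall>\<omega>\<in>smooth_forms m. compact (form_support \<omega>) \<and> form_support \<omega> \<subseteq> V \<longrightarrow> T \<omega> = 0"
      unfolding spt_def by blast
    then have "open (U \<inter> V) \<and> (\<forall>\<omega>\<in>smooth_forms m. compact (form_support \<omega>) \<and> form_support \<omega> \<subseteq> U \<inter> V \<longrightarrow> (S + T) \<omega> = 0)" "x \<in> U \<inter> V"
      by auto
    then show False using x unfolding spt_def by blast
  qed
qed

lemma spt_scaleR: "spt m (c *\<^sub>R T) \<subseteq> spt m T"
proof
  fix x assume x: "x \<in> spt m (c *\<^sub>R T)"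
  show "x \<in> spt m T"
  proof (rule ccontr)
    assume "x \<notin> spt m T"
    then obtain U where "open U" "x \<in> U" "\<forall>\<omega>\<in>smooth_forms m. compact (form_support \<omega>) \<and> form_support \<omega> \<subseteq> U \<longrightarrow> T \<omega> = 0"
      unfolding spt_def by blast
    then have "open U \<and> (\<forall>\<omega>\<in>smooth_forms m. compact (form_support \<omega>) \<and> form_support \<omega> \<subseteq> U \<longrightarrow> (c *\<^sub>R T) \<omega> = 0)" "x \<in> U"
      by (auto simp: scaleR_fun_def)
    then show False using x unfolding spt_def by blast
  qed
qed

lemma spt_diff: "spt m (S - T) \<subseteq> spt m S \<union> spt m T"
proof -
  have "S - T = S + (-1) *\<^sub>R T" by (simp add: fun_eq_iff scaleR_fun_def)
  then show ?thesis using spt_add[of m S "(-1) *\<^sub>R T"] spt_scaleR[of m "-1" T] by auto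
qed

lemma spt_subsetI:
  assumes "closed K" "\<And>\<omega>. \<omega> \<in> smooth_forms m \<Longrightarrow> form_support \<omega> \<inter> K = {} \<Longrightarrow> T \<omega> = 0"
  shows "spt m T \<subseteq> K"
proof
  fix x assume x: "x \<in> spt m T"
  show "x \<in> K"
  proof (rule ccontr)
    assume "x \<notin> K"
    moreover have "open (- K)" using assms by auto
    moreover have "\<forall>\<omega>\<in>smooth_forms m. compact (form_support \<omega>) \<and> form_support \<omega> \<subseteq> - K \<longrightarrow> T \<omega> = 0" using assms by blast
    ultimately show False using x unfolding spt_def by blast
  qed
qed

section \<open>Comass bounds\<close>

text \<open>The inequality \<open>form_norm m \<omega> \<le> ereal c\<close> stated in the reals, so
  that neither suprema nor infinite comass get in the way.\<close>

definition form_bound :: "nat \<Rightarrow> real \<Rightarrow> 'a::euclidean_space form \<Rightarrow> bool" where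
  "form_bound m c \<omega> \<longleftrightarrow> (\<forall>x v. (\<forall>i<m. norm (v i) \<le> 1) \<longrightarrow> \<bar>\<omega> x v\<bar> \<le> c)"

definition flat_bound :: "nat \<Rightarrow> real \<Rightarrow> 'a::euclidean_space form \<Rightarrow> bool" where
  "flat_bound m c \<omega> \<longleftrightarrow> form_bound m c \<omega> \<and> form_bound (Suc m) c (ext_deriv m \<omega>)"

lemma form_boundD: "form_bound m c \<omega> \<Longrightarrow> (\<And>i. i < m \<Longrightarrow> norm (v i) \<le> 1) \<Longrightarrow> \<bar>\<omega> x v\<bar> \<le> c"
  unfolding form_bound_def by simp

lemma form_boundI: "(\<And>x v. (\<And>i. i < m \<Longrightarrow> norm (v i) \<le> 1) \<Longrightarrow> \<bar>\<omega> x v\<bar> \<le> c) \<Longrightarrow> form_bound m c \<omega>"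
  unfolding form_bound_def by simp

lemma form_bound_mono: "form_bound m c \<omega> \<Longrightarrow> c \<le> c' \<Longrightarrow> form_bound m c' \<omega>"
  unfolding form_bound_def by (meson order.trans)

lemma form_bound_scaleR: "form_bound m c \<omega> \<Longrightarrow> form_bound m (\<bar>a\<bar> * c) (a *\<^sub>R \<omega>)"
  unfolding form_bound_def by (simp add: scaleR_fun_def abs_mult mult_left_mono)

lemma flat_bound_mono: "flat_bound m c \<omega> \<Longrightarrow> c \<le> c' \<Longrightarrow> flat_bound m c' \<omega>"
  unfolding flat_bound_def using form_bound_mono by blast

lemma flat_bound_scaleR: "flat_bound m c \<omega> \<Longrightarrow> \<omega> \<in> smooth_forms m \<Longrightarrow> flat_bound m (\<bar>a\<bar> * c) (a *\<^sub>R \<omega>)"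
  unfolding flat_bound_def by (simp add: ext_deriv_scaleR form_bound_scaleR)

lemma form_norm_le: "form_norm m \<omega> \<le> ereal c \<longleftrightarrow> form_bound m c \<omega>"
  unfolding form_norm_def comass_def form_bound_def by (auto simp: SUP_le_iff)

lemma mass_le: "mass m T \<le> ereal c \<longleftrightarrow> (\<forall>\<omega>\<in>smooth_forms m. form_bound m 1 \<omega> \<longrightarrow> T \<omega> \<le> c)"
  unfolding mass_def one_ereal_def form_norm_le by (auto simp: SUP_le_iff)

lemma normal_flat_norm_le:
  "normal_flat_norm m T \<le> ereal c \<longleftrightarrow> (\<forall>\<omega>\<in>smooth_forms m. flat_bound m 1 \<omega> \<longrightarrow> T \<omega> \<le> c)"
  unfolding normal_flat_norm_def max.bounded_iff one_ereal_def form_norm_le flat_bound_def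
  by (auto simp: SUP_le_iff)

text \<open>Homogeneity carries an estimate on the unit ball of P to every radius. P stands for
  \<open>form_bound\<close>, \<open>flat_bound\<close> and, later,
  \<open>level_bound\<close>.\<close>

lemma homogeneous_bound:
  assumes T: "T \<in> linear_functionals (smooth_forms m)"
    and hom: "\<And>a c \<omega>. \<omega> \<in> smooth_forms m \<Longrightarrow> P c \<omega> \<Longrightarrow> P (\<bar>a\<bar> * c) (a *\<^sub>R \<omega>)"
    and mono: "\<And>c c' \<omega>. P c \<omega> \<Longrightarrow> c \<le> c' \<Longrightarrow> P c' \<omega>"
    and M: "\<And>\<omega>. \<omega> \<in> smooth_forms m \<Longrightarrow> P 1 \<omega> \<Longrightarrow> T \<omega> \<le> M" "M \<ge> 0"
    and \<omega>: "\<omega> \<in> smooth_forms m" "P c \<omega>" "c \<ge> (0::real)"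
  shows "\<bar>T \<omega>\<bar> \<le> c * M"
proof -
  have "T \<eta> \<le> c * M" if \<eta>: "\<eta> \<in> smooth_forms m" "P c \<eta>" for \<eta>
  proof (rule field_le_epsilon)
    fix e :: real assume e: "e > 0"
    \<comment> \<open>The radius c may be 0, so \<eta> is divided by a slightly larger positive d;
      the denominator M + 1 keeps the resulting error (d - c) * M at most e.\<close>
    define d where "d = c + e / (M + 1)"
    have d: "d > 0" "c \<le> d" using e M(2) \<omega>(3) by (auto simp: d_def add_nonneg_pos)
    have "P 1 ((1 / d) *\<^sub>R \<eta>)" using hom[OF \<eta>(1) mono[OF \<eta>(2) d(2)], of "1 / d"] d by simp
    then have "(1 / d) * T \<eta> \<le> M" using M(1)[OF smooth_forms_scaleR[OF \<eta>(1)]] linear_functionals_scaleR[OF T \<eta>(1)] by metis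
    then have "T \<eta> \<le> d * M" using d by (simp add: field_simps)
    also have "\<dots> \<le> c * M + e"
    proof -
      have "e / (M + 1) * M \<le> e" using e M(2) by (simp add: field_simps)
      then show ?thesis unfolding d_def by (simp add: algebra_simps)
    qed
    finally show "T \<eta> \<le> c * M + e" .
  qed
  from this[OF \<omega>(1,2)] this[of "(-1) *\<^sub>R \<omega>"] show ?thesis
    using hom[OF \<omega>(1,2), of "-1"] \<omega> smooth_forms_scaleR[OF \<omega>(1), of "-1"] linear_functionals_scaleR[OF T \<omega>(1), of "-1"] by simp
qed

lemma form_bound_functional:
  assumes "T \<in> linear_functionals (smooth_forms m)" "\<And>\<omega>. \<omega> \<in> smooth_forms m \<Longrightarrow> form_bound m 1 \<omega> \<Longrightarrow> T \<omega> \<le> M" "M \<ge> 0"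
    "\<omega> \<in> smooth_forms m" "form_bound m c \<omega>" "c \<ge> 0"
  shows "\<bar>T \<omega>\<bar> \<le> c * M"
  by (rule homogeneous_bound[where P="form_bound m", OF assms(1) form_bound_scaleR form_bound_mono assms(2-6)])

lemma flat_bound_functional:
  assumes "T \<in> linear_functionals (smooth_forms m)" "\<And>\<omega>. \<omega> \<in> smooth_forms m \<Longrightarrow> flat_bound m 1 \<omega> \<Longrightarrow> T \<omega> \<le> M" "M \<ge> 0"
    "\<omega> \<in> smooth_forms m" "flat_bound m c \<omega>" "c \<ge> 0"
  shows "\<bar>T \<omega>\<bar> \<le> c * M"
  by (rule homogeneous_bound[where P="flat_bound m", OF assms(1) flat_bound_scaleR flat_bound_mono assms(2-6)])

section \<open>Mass and flat norm of normal currents\<close>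

abbreviation nmass :: "nat \<Rightarrow> 'a::euclidean_space current \<Rightarrow> real" where
  "nmass m T \<equiv> real_of_ereal (normal_mass m T)"

abbreviation fnorm :: "nat \<Rightarrow> 'a::euclidean_space current \<Rightarrow> real" where
  "fnorm m T \<equiv> real_of_ereal (normal_flat_norm m T)"

lemma boundary_linear:
  assumes "T \<in> linear_functionals (smooth_forms (Suc n))"
  shows "boundary (Suc n) T \<in> linear_functionals (smooth_forms n)"
  unfolding linear_functionals_def boundary_def
  by (auto simp: smooth_forms_add smooth_forms_scaleR ext_deriv_add ext_deriv_scaleR ext_deriv_smooth_forms
      linear_functionals_add[OF assms] linear_functionals_scaleR[OF assms])

lemma functional_zero: "T \<in> linear_functionals (smooth_forms m) \<Longrightarrow> T 0 = 0"
  using linear_functionals_zero smooth_forms_zero by blast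

lemma ext_deriv_zero: "ext_deriv m 0 = 0"
  using ext_deriv_scaleR[OF smooth_forms_zero, of m 0] by simp

lemma form_bound_zero: "form_bound m 1 0" by (simp add: form_bound_def)
lemma flat_bound_zero: "flat_bound m 1 0" by (simp add: flat_bound_def ext_deriv_zero form_bound_zero)

lemma mass_nonneg: "T \<in> linear_functionals (smooth_forms m) \<Longrightarrow> mass m T \<ge> 0"
  unfolding mass_def one_ereal_def form_norm_le
  by (rule SUP_upper2[of 0]) (auto simp: smooth_forms_zero form_bound_zero functional_zero)

lemma normal_flat_norm_nonneg: "T \<in> linear_functionals (smooth_forms m) \<Longrightarrow> normal_flat_norm m T \<ge> 0"
  unfolding normal_flat_norm_def max.bounded_iff one_ereal_def form_norm_le flat_bound_def[symmetric]
  by (rule SUP_upper2[of 0]) (auto simp: smooth_forms_zero flat_bound_zero functional_zero)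

text \<open>Mass and boundary mass as real numbers a and b, with b chosen as 0 in degree 0. The
  condition \<open>m = Suc n\<close> makes the boundary estimate vacuous there, so later proofs need
  no distinction by degree.\<close>

lemma nmass_split:
  assumes T: "T \<in> normal_currents m"
  obtains a b where "nmass m T = a + b" "normal_mass m T = ereal (a + b)" "a \<ge> 0" "b \<ge> 0"
    "\<And>\<omega>. \<omega> \<in> smooth_forms m \<Longrightarrow> form_bound m 1 \<omega> \<Longrightarrow> T \<omega> \<le> a"
    "\<And>n \<beta>. m = Suc n \<Longrightarrow> \<beta> \<in> smooth_forms n \<Longrightarrow> form_bound n 1 \<beta> \<Longrightarrow> T (ext_deriv n \<beta>) \<le> b"
proof -
  have L: "T \<in> linear_functionals (smooth_forms m)" using T by (simp add: normal_currents_def currents_linear)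
  have fin: "normal_mass m T < \<infinity>" using T by (simp add: normal_currents_def)
  show thesis
  proof (cases m)
    case 0
    then have "mass m T < \<infinity>" using fin by (simp add: normal_mass_def)
    then obtain a where a: "mass m T = ereal a" using mass_nonneg[OF L] by (cases "mass m T") auto
    show ?thesis
      by (rule that[of a 0]) (use a 0 mass_nonneg[OF L] mass_le[of m T a] in \<open>auto simp: normal_mass_def\<close>)
  next
    case (Suc n)
    note nn = mass_nonneg[OF L] mass_nonneg[OF boundary_linear[OF L[unfolded Suc]]]
    have e: "normal_mass m T = mass m T + mass n (boundary m T)" using Suc by (simp add: normal_mass_def)
    then have "mass m T < \<infinity>" "mass n (boundary m T) < \<infinity>" using fin nn by auto
    then obtain a b where ab: "mass m T = ereal a" "mass n (boundary m T) = ereal b"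
      using nn Suc by (cases "mass m T"; cases "mass n (boundary m T)") auto
    show ?thesis
      by (rule that[of a b])
        (use ab Suc nn e mass_le[of m T a] mass_le[of n "boundary m T" b] in \<open>auto simp: boundary_def\<close>)
  qed
qed

lemma normal_currentsI:
  assumes T: "T \<in> currents m"
    and a: "\<And>\<omega>. \<omega> \<in> smooth_forms m \<Longrightarrow> form_bound m 1 \<omega> \<Longrightarrow> T \<omega> \<le> a"
    and b: "\<And>n \<beta>. m = Suc n \<Longrightarrow> \<beta> \<in> smooth_forms n \<Longrightarrow> form_bound n 1 \<beta> \<Longrightarrow> T (ext_deriv n \<beta>) \<le> b" "b \<ge> 0"
  shows "T \<in> normal_currents m" "nmass m T \<le> a + b"
proof -
  have "mass m T \<le> ereal a" using a by (simp add: mass_le)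
  moreover have "mass (m - 1) (boundary m T) \<le> ereal b" if "m \<noteq> 0"
    using that b by (cases m) (auto simp: mass_le boundary_def)
  ultimately have le: "normal_mass m T \<le> ereal (a + b)"
  proof (cases "m = 0")
    case True
    have "ereal a \<le> ereal (a + b)" using b(2) by simp
    then show ?thesis using True \<open>mass m T \<le> ereal a\<close> by (simp add: normal_mass_def order.trans)
  next
    case False
    then have "normal_mass m T = mass m T + mass (m - 1) (boundary m T)" by (simp add: normal_mass_def)
    also have "\<dots> \<le> ereal a + ereal b"
      by (rule add_mono) (use \<open>mass m T \<le> ereal a\<close> \<open>m \<noteq> 0 \<Longrightarrow> mass (m - 1) (boundary m T) \<le> ereal b\<close> False in auto)
    finally show ?thesis by simp
  qed
  then show n: "T \<in> normal_currents m" using T by (auto simp: normal_currents_def)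
  from nmass_split[OF n] obtain c d where "nmass m T = c + d" "normal_mass m T = ereal (c + d)" by metis
  then show "nmass m T \<le> a + b" using le by simp
qed

lemma normal_currents_linear: "T \<in> normal_currents m \<Longrightarrow> T \<in> linear_functionals (smooth_forms m)"
  by (simp add: normal_currents_def currents_linear)

lemma nmass_nonneg: "T \<in> normal_currents m \<Longrightarrow> nmass m T \<ge> 0"
  by (erule nmass_split) simp

lemma nmass_bound:
  assumes T: "T \<in> normal_currents m" and \<omega>: "\<omega> \<in> smooth_forms m" "form_bound m c \<omega>" "c \<ge> 0"
  shows "\<bar>T \<omega>\<bar> \<le> c * nmass m T"
proof -
  from nmass_split[OF T] obtain a b where ab: "nmass m T = a + b" "a \<ge> 0" "b \<ge> 0"
    "\<And>\<omega>. \<omega> \<in> smooth_forms m \<Longrightarrow> form_bound m 1 \<omega> \<Longrightarrow> T \<omega> \<le> a" by metis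
  show ?thesis
    by (rule form_bound_functional[OF normal_currents_linear[OF T] _ nmass_nonneg[OF T] \<omega>]) (use ab in force)
qed

lemma nmass_boundary_bound:
  assumes T: "T \<in> normal_currents (Suc n)" and \<beta>: "\<beta> \<in> smooth_forms n" "form_bound n c \<beta>" "c \<ge> 0"
  shows "\<bar>T (ext_deriv n \<beta>)\<bar> \<le> c * nmass (Suc n) T"
proof -
  from nmass_split[OF T] obtain a b where ab: "nmass (Suc n) T = a + b" "a \<ge> 0" "b \<ge> 0"
    "\<And>\<beta>. \<beta> \<in> smooth_forms n \<Longrightarrow> form_bound n 1 \<beta> \<Longrightarrow> T (ext_deriv n \<beta>) \<le> b" by metis
  have "\<bar>boundary (Suc n) T \<beta>\<bar> \<le> c * nmass (Suc n) T"
    by (rule form_bound_functional[OF boundary_linear[OF normal_currents_linear[OF T]] _ nmass_nonneg[OF T] \<beta>])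
      (use ab in \<open>force simp: boundary_def\<close>)
  then show ?thesis using \<beta>(1) by (simp add: boundary_def)
qed

lemma normal_currents_add:
  assumes "S \<in> normal_currents m" "T \<in> normal_currents m" shows "S + T \<in> normal_currents m"
proof -
  from nmass_split[OF assms(1)] obtain a b where 1: "a \<ge> 0" "b \<ge> 0"
    "\<And>\<omega>. \<omega> \<in> smooth_forms m \<Longrightarrow> form_bound m 1 \<omega> \<Longrightarrow> S \<omega> \<le> a"
    "\<And>n \<beta>. m = Suc n \<Longrightarrow> \<beta> \<in> smooth_forms n \<Longrightarrow> form_bound n 1 \<beta> \<Longrightarrow> S (ext_deriv n \<beta>) \<le> b" by metis
  from nmass_split[OF assms(2)] obtain c d where 2: "c \<ge> 0" "d \<ge> 0"
    "\<And>\<omega>. \<omega> \<in> smooth_forms m \<Longrightarrow> form_bound m 1 \<omega> \<Longrightarrow> T \<omega> \<le> c"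
    "\<And>n \<beta>. m = Suc n \<Longrightarrow> \<beta> \<in> smooth_forms n \<Longrightarrow> form_bound n 1 \<beta> \<Longrightarrow> T (ext_deriv n \<beta>) \<le> d" by metis
  show ?thesis
  proof (rule normal_currentsI(1)[where a="a + c" and b="b + d"])
    show "S + T \<in> currents m" using assms by (simp add: normal_currents_def currents_add)
  qed (use 1 2 in \<open>auto intro: add_mono\<close>)
qed

lemma normal_currents_scaleR:
  assumes T: "T \<in> normal_currents m"
  shows "t *\<^sub>R T \<in> normal_currents m" "t \<ge> 0 \<Longrightarrow> nmass m (t *\<^sub>R T) \<le> t * nmass m T"
proof -
  from nmass_split[OF T] obtain a b where 1: "nmass m T = a + b" "a \<ge> 0" "b \<ge> 0"
    "\<And>\<omega>. \<omega> \<in> smooth_forms m \<Longrightarrow> form_bound m 1 \<omega> \<Longrightarrow> T \<omega> \<le> a"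
    "\<And>n \<beta>. m = Suc n \<Longrightarrow> \<beta> \<in> smooth_forms n \<Longrightarrow> form_bound n 1 \<beta> \<Longrightarrow> T (ext_deriv n \<beta>) \<le> b" by metis
  have c: "t *\<^sub>R T \<in> currents m" for t using T by (simp add: normal_currents_def currents_scaleR)
  have pos: "t *\<^sub>R T \<in> normal_currents m" "nmass m (t *\<^sub>R T) \<le> t * a + t * b" if "t \<ge> 0" for t
    using normal_currentsI[OF c, where a="t * a" and b="t * b" and t1=t] 1 that
    by (auto simp: scaleR_fun_def mult_left_mono)
  show "nmass m (t *\<^sub>R T) \<le> t * nmass m T" if "t \<ge> 0" using pos(2)[OF that] 1 by (simp add: ring_distribs)
  show "t *\<^sub>R T \<in> normal_currents m"
  proof (rule normal_currentsI(1)[OF c, where a="\<bar>t\<bar> * nmass m T" and b="\<bar>t\<bar> * nmass m T"])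
    show "(t *\<^sub>R T) \<omega> \<le> \<bar>t\<bar> * nmass m T" if "\<omega> \<in> smooth_forms m" "form_bound m 1 \<omega>" for \<omega>
    proof -
      have "t * T \<omega> \<le> \<bar>t\<bar> * \<bar>T \<omega>\<bar>" by (metis abs_ge_self abs_mult)
      also have "\<dots> \<le> \<bar>t\<bar> * nmass m T" using nmass_bound[OF T that] by (simp add: mult_left_mono)
      finally show ?thesis by (simp add: scaleR_fun_def)
    qed
    show "(t *\<^sub>R T) (ext_deriv n \<beta>) \<le> \<bar>t\<bar> * nmass m T" if "m = Suc n" "\<beta> \<in> smooth_forms n" "form_bound n 1 \<beta>" for n \<beta>
    proof -
      have "t * T (ext_deriv n \<beta>) \<le> \<bar>t\<bar> * \<bar>T (ext_deriv n \<beta>)\<bar>" by (metis abs_ge_self abs_mult)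
      also have "\<dots> \<le> \<bar>t\<bar> * nmass m T" using nmass_boundary_bound[of T n \<beta> 1] T that by (simp add: mult_left_mono)
      finally show ?thesis by (simp add: scaleR_fun_def)
    qed
  qed (use nmass_nonneg[OF T] in simp)
qed

lemma normal_flat_norm_le_nmass:
  assumes T: "T \<in> normal_currents m" shows "normal_flat_norm m T \<le> ereal (nmass m T)"
  unfolding normal_flat_norm_le flat_bound_def using nmass_bound[OF T, of _ 1] by force

text \<open>Since \<open>real_of_ereal\<close> sends infinity to 0, \<open>fnorm\<close> carries
  information only once an upper bound is known.\<close>

lemma finite_fnorm:
  assumes "T \<in> linear_functionals (smooth_forms m)" "normal_flat_norm m T \<le> ereal c"
  shows "normal_flat_norm m T = ereal (fnorm m T)" "0 \<le> fnorm m T" "fnorm m T \<le> c"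
  using normal_flat_norm_nonneg[OF assms(1)] assms(2) by (cases "normal_flat_norm m T"; auto)+

lemma normal_fnorm:
  assumes "T \<in> normal_currents m"
  shows "normal_flat_norm m T = ereal (fnorm m T)" "0 \<le> fnorm m T" "fnorm m T \<le> nmass m T"
  using finite_fnorm[OF normal_currents_linear[OF assms] normal_flat_norm_le_nmass[OF assms]] by auto

lemma fnorm_bound:
  assumes T: "T \<in> linear_functionals (smooth_forms m)" "normal_flat_norm m T \<le> ereal M"
    and \<omega>: "\<omega> \<in> smooth_forms m" "flat_bound m c \<omega>" "c \<ge> 0"
  shows "\<bar>T \<omega>\<bar> \<le> c * M"
proof (rule flat_bound_functional[OF T(1) _ _ \<omega>])
  show "T \<eta> \<le> M" if "\<eta> \<in> smooth_forms m" "flat_bound m 1 \<eta>" for \<eta>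
    using T(2) that by (simp add: normal_flat_norm_le)
  show "M \<ge> 0" using normal_flat_norm_nonneg[OF T(1)] T(2) by (metis ereal_less_eq(5) order.trans)
qed

lemma normal_fnorm_bound:
  "T \<in> normal_currents m \<Longrightarrow> \<omega> \<in> smooth_forms m \<Longrightarrow> flat_bound m c \<omega> \<Longrightarrow> c \<ge> 0 \<Longrightarrow> \<bar>T \<omega>\<bar> \<le> c * fnorm m T"
  using fnorm_bound[OF normal_currents_linear] normal_fnorm(1) by (metis order.refl)

lemma fnorm_scaleR:
  assumes T: "T \<in> normal_currents m" "t \<ge> 0" shows "fnorm m (t *\<^sub>R T) \<le> t * fnorm m T"
proof -
  have "normal_flat_norm m (t *\<^sub>R T) \<le> ereal (t * fnorm m T)" unfolding normal_flat_norm_le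
  proof (intro ballI impI)
    fix \<omega> :: "'a form" assume "\<omega> \<in> smooth_forms m" "flat_bound m 1 \<omega>"
    from normal_fnorm_bound[OF T(1) this] have "T \<omega> \<le> fnorm m T" by simp
    then show "(t *\<^sub>R T) \<omega> \<le> t * fnorm m T" using T(2) by (simp add: scaleR_fun_def mult_left_mono)
  qed
  then show ?thesis by (rule finite_fnorm(3)[OF normal_currents_linear[OF normal_currents_scaleR(1)[OF T(1)]]])
qed

lemma normal_currents_zero: "0 \<in> normal_currents m"
  by (rule normal_currentsI(1)[OF currents_zero, where a=0 and b=0]) auto

lemma normal_currents_in_zero: "closed K \<Longrightarrow> 0 \<in> normal_currents_in m K"
  by (simp add: normal_currents_in_def normal_currents_zero spt_subsetI)

lemma normal_currents_in_add: "S \<in> normal_currents_in m K \<Longrightarrow> T \<in> normal_currents_in m K \<Longrightarrow> S + T \<in> normal_currents_in m K"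
  unfolding normal_currents_in_def using normal_currents_add spt_add[of m S T] by blast

lemma normal_currents_in_scaleR: "T \<in> normal_currents_in m K \<Longrightarrow> t *\<^sub>R T \<in> normal_currents_in m K"
  unfolding normal_currents_in_def using normal_currents_scaleR(1) spt_scaleR[of m t T] by blast

lemma normal_currents_in_sum:
  "closed K \<Longrightarrow> (\<And>i. i \<in> A \<Longrightarrow> T i \<in> normal_currents_in m K) \<Longrightarrow> (\<Sum>i\<in>A. T i) \<in> normal_currents_in m K"
  by (induction A rule: infinite_finite_induct) (auto simp: normal_currents_in_zero normal_currents_in_add)

lemma normal_currents_inD: "T \<in> normal_currents_in m K \<Longrightarrow> T \<in> normal_currents m"
  "T \<in> normal_currents_in m K \<Longrightarrow> T \<in> currents m" "T \<in> normal_currents_in m K \<Longrightarrow> spt m T \<subseteq> K"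
  by (auto simp: normal_currents_in_def normal_currents_def)

section \<open>Cutting off forms\<close>

text \<open>Comass bounds are required on all of space, where a smooth form may be unbounded. A
  current supported in \<open>ball 0 r\<close> cannot tell the form from this truncation, which has
  finite comass together with its differential.\<close>

definition cut_form :: "real \<Rightarrow> 'a::euclidean_space form \<Rightarrow> 'a form" where
  "cut_form r \<eta> = (\<lambda>x v. bump 0 r x * \<eta> x v)"

lemma cut_smooth_forms: "\<eta> \<in> smooth_forms m \<Longrightarrow> cut_form r \<eta> \<in> smooth_forms m"
  unfolding cut_form_def by (intro smooth_forms_mult smooth_bump)

lemma current_cut:
  assumes "T \<in> currents m" "spt m T \<subseteq> ball 0 r" "\<eta> \<in> smooth_forms m" shows "T (cut_form r \<eta>) = T \<eta>"
proof (rule current_cong[OF assms(1) cut_smooth_forms[OF assms(3)] assms(3) open_ball assms(2)])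
  fix x v assume "x \<in> ball (0::'a) r"
  then show "cut_form r \<eta> x v = \<eta> x v" using bump_1[of x 0 r] by (simp add: cut_form_def)
qed

lemma frechet_derivative_const_on_open:
  assumes "open U" "x \<in> U" "\<And>y. y \<in> U \<Longrightarrow> f y = c"
  shows "frechet_derivative f (at x) = (\<lambda>h. 0)"
proof -
  have "((\<lambda>x. c) has_derivative (\<lambda>h. 0)) (at x)" by simp
  then have "(f has_derivative (\<lambda>h. 0)) (at x)"
    by (rule has_derivative_transform_within_open[OF _ assms(1,2)]) (use assms(3) in auto)
  then show ?thesis using frechet_derivative_at by metis
qed

lemma linear_functional_basis_bound:
  fixes f :: "'a::euclidean_space \<Rightarrow> real"
  assumes "linear f" "\<And>b. b \<in> Basis \<Longrightarrow> \<bar>f b\<bar> \<le> c"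
  shows "\<bar>f u\<bar> \<le> real DIM('a) * c * norm u"
proof -
  have "f u = f (\<Sum>b\<in>Basis. (u \<bullet> b) *\<^sub>R b)" by (simp add: euclidean_representation)
  also have "\<dots> = (\<Sum>b\<in>Basis. (u \<bullet> b) * f b)" using assms(1) by (simp add: linear_sum linear_cmul)
  finally have "\<bar>f u\<bar> \<le> (\<Sum>b\<in>Basis. \<bar>(u \<bullet> b) * f b\<bar>)" by (metis sum_abs)
  also have "\<dots> \<le> (\<Sum>b\<in>(Basis::'a set). norm u * c)"
    by (rule sum_mono) (simp add: abs_mult mult_mono Basis_le_norm assms(2))
  finally show ?thesis by (simp add: mult.commute mult.left_commute)
qed

lemma smooth_deriv_bound_compact:
  assumes f: "smooth f" and C: "compact C"
  shows "\<exists>L\<ge>0. \<forall>x\<in>C. \<forall>u. \<bar>frechet_derivative f (at x) u\<bar> \<le> L * norm (u::'a::euclidean_space)"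
proof -
  have "\<exists>c. \<forall>x\<in>C. \<bar>frechet_derivative f (at x) b\<bar> \<le> c" for b
  proof -
    have "compact ((\<lambda>x. frechet_derivative f (at x) b) ` C)"
      by (intro compact_continuous_image smooth_continuous smooth_deriv f C)
    then show ?thesis using compact_imp_bounded bounded_iff by (metis (mono_tags, lifting) image_eqI real_norm_def)
  qed
  then obtain c where c: "\<And>b x. x \<in> C \<Longrightarrow> \<bar>frechet_derivative f (at x) b\<bar> \<le> c b" by metis
  let ?c = "\<Sum>b\<in>Basis. \<bar>c b\<bar>"
  have "\<bar>frechet_derivative f (at x) u\<bar> \<le> real DIM('a) * ?c * norm u" if "x \<in> C" for x u
  proof (rule linear_functional_basis_bound)
    show "linear (frechet_derivative f (at x))" using smooth_has_derivative[OF f] has_derivative_linear by blast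
    show "\<bar>frechet_derivative f (at x) b\<bar> \<le> ?c" if "b \<in> Basis" for b
    proof -
      have "\<bar>frechet_derivative f (at x) b\<bar> \<le> \<bar>c b\<bar>" using c[OF \<open>x \<in> C\<close>, of b] by linarith
      also have "\<dots> \<le> ?c" by (rule member_le_sum) (use that in auto)
      finally show ?thesis .
    qed
  qed
  moreover have "real DIM('a) * ?c \<ge> 0" by (simp add: sum_nonneg)
  ultimately show ?thesis by blast
qed

text \<open>Compactness bounds the derivative on a ball slightly larger than the one outside of
  which the bump vanishes; beyond it the derivative is 0.\<close>

lemma bump_deriv_bound:
  assumes r: "r > 0"
  obtains L where "L \<ge> 0" "\<And>x u. \<bar>frechet_derivative (bump a r) (at x) u\<bar> \<le> L * norm (u::'a::euclidean_space)"
proof -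
  obtain L where L: "L \<ge> 0" "\<forall>x\<in>cball a (3 * r). \<forall>u. \<bar>frechet_derivative (bump a r) (at x) u\<bar> \<le> L * norm u"
    using smooth_deriv_bound_compact[OF smooth_bump compact_cball] by blast
  have "\<bar>frechet_derivative (bump a r) (at x) u\<bar> \<le> L * norm u" for x u
  proof (cases "x \<in> cball a (3 * r)")
    case False
    have "frechet_derivative (bump a r) (at x) = (\<lambda>h. 0)"
    proof (rule frechet_derivative_const_on_open[of "- cball a (2 * r)"])
      show "x \<in> - cball a (2 * r)" using False r by auto
      show "bump a r y = 0" if "y \<in> - cball a (2 * r)" for y
        using that bump_0[OF r, of y a] by (auto simp: dist_norm norm_minus_commute)
    qed auto
    then show ?thesis using L by simp
  qed (use L in blast)
  then show ?thesis using that L(1) by blast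
qed

lemma abs_bump_le_1: "\<bar>bump a r x\<bar> \<le> 1"
  using bump_range[of a r x] by linarith

lemma C1_bound_exists:
  assumes C: "compact C" and \<eta>: "\<eta> \<in> smooth_forms m"
  shows "\<exists>b\<ge>0. C1_bound m C b \<eta>"
proof -
  have bd: "\<exists>c. \<forall>x\<in>C. \<bar>f x\<bar> \<le> c" if "smooth f" for f
  proof -
    have "compact (f ` C)" by (intro compact_continuous_image smooth_continuous that C)
    then show ?thesis using compact_imp_bounded bounded_iff by (metis (mono_tags, lifting) image_eqI real_norm_def)
  qed
  have "\<forall>I. \<exists>c. \<forall>x\<in>C. \<bar>\<eta> x I\<bar> \<le> c" using bd[OF smooth_forms_smooth[OF \<eta>]] by blast
  then obtain c where c: "\<And>I x. x \<in> C \<Longrightarrow> \<bar>\<eta> x I\<bar> \<le> c I" by metis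
  have "\<forall>u I. \<exists>c. \<forall>x\<in>C. \<bar>dform \<eta> x u I\<bar> \<le> c" using bd[OF smooth_dform[OF \<eta>]] by blast
  then obtain d where d: "\<And>u I x. x \<in> C \<Longrightarrow> \<bar>dform \<eta> x u I\<bar> \<le> d u I" by metis
  define b where "b = (\<Sum>I\<in>basis_tuples m. \<bar>c I\<bar>) + (\<Sum>u\<in>Basis. \<Sum>I\<in>basis_tuples m. \<bar>d u I\<bar>)"
  have nn: "0 \<le> (\<Sum>I\<in>basis_tuples m. \<bar>c I\<bar>)" "0 \<le> (\<Sum>u\<in>Basis. \<Sum>I\<in>basis_tuples m. \<bar>d u I\<bar>)" by (simp_all add: sum_nonneg)
  have "C1_bound m C b \<eta>" unfolding C1_bound_def
  proof (intro ballI conjI)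
    fix x :: 'a and I :: "nat \<Rightarrow> 'a" assume x: "x \<in> C" and I: "I \<in> basis_tuples m"
    have "\<bar>\<eta> x I\<bar> \<le> \<bar>c I\<bar>" using c[OF x, of I] by linarith
    also have "\<dots> \<le> (\<Sum>I\<in>basis_tuples m. \<bar>c I\<bar>)" by (rule member_le_sum[OF I]) (auto simp: finite_basis_tuples)
    finally show "\<bar>\<eta> x I\<bar> \<le> b" using nn b_def by linarith
    fix u :: 'a assume u: "u \<in> Basis"
    have "\<bar>dform \<eta> x u I\<bar> \<le> \<bar>d u I\<bar>" using d[OF x, of u I] by linarith
    also have "\<dots> \<le> (\<Sum>I\<in>basis_tuples m. \<bar>d u I\<bar>)" by (rule member_le_sum[OF I]) (auto simp: finite_basis_tuples)
    also have "\<dots> \<le> (\<Sum>u\<in>Basis. \<Sum>I\<in>basis_tuples m. \<bar>d u I\<bar>)" by (rule member_le_sum[OF u, of "\<lambda>u. \<Sum>I\<in>basis_tuples m. \<bar>d u I\<bar>"]) (auto simp: sum_nonneg)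
    finally show "\<bar>dform \<eta> x u I\<bar> \<le> b" using nn b_def by linarith
  qed
  then show ?thesis using nn b_def by (intro exI[of _ b]) auto
qed

lemma covector_bound_const:
  fixes \<phi> :: "'a::euclidean_space covector"
  assumes "\<phi> \<in> covectors m" "\<And>i. i < m \<Longrightarrow> norm (v i) \<le> 1" "\<And>I. I \<in> basis_tuples m \<Longrightarrow> \<bar>\<phi> I\<bar> \<le> b"
  shows "\<bar>\<phi> v\<bar> \<le> real (card (basis_tuples m :: (nat \<Rightarrow> 'a) set)) * b"
proof -
  have "(\<Sum>I\<in>basis_tuples m. \<bar>\<phi> I\<bar>) \<le> real (card (basis_tuples m :: (nat \<Rightarrow> 'a) set)) * b"
    by (rule sum_bounded_above) (rule assms(3))
  then show ?thesis using covector_bound[of \<phi> m v, OF assms(1,2)] by linarith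
qed

text \<open>A pointwise consequence of the Leibniz rule. All constants refer to the single point x,
  so that different regions can be estimated with different bounds.\<close>

lemma ext_deriv_mult_bound:
  assumes "smooth \<kappa>" "\<omega> \<in> smooth_forms m" "\<And>i. i < Suc m \<Longrightarrow> norm (v i) \<le> 1" "0 \<le> L"
    and L: "\<And>u. \<bar>frechet_derivative \<kappa> (at x) u\<bar> \<le> L * norm u"
    and k: "\<bar>\<kappa> x\<bar> \<le> k" and e: "\<bar>ext_deriv m \<omega> x v\<bar> \<le> e"
    and c: "\<And>w. (\<And>i. i < m \<Longrightarrow> norm (w i) \<le> 1) \<Longrightarrow> \<bar>\<omega> x w\<bar> \<le> c"
  shows "\<bar>ext_deriv m (\<lambda>x v. \<kappa> x * \<omega> x v) x v\<bar> \<le> k * e + real (Suc m) * (L * c)"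
proof -
  have "\<bar>(-1) ^ i * (frechet_derivative \<kappa> (at x) (v i) * \<omega> x (del i v))\<bar> \<le> L * c" if "i \<in> {..m}" for i
  proof -
    have "norm (v i) \<le> 1" using assms(3)[of i] that by simp
    then have "L * norm (v i) \<le> L * 1" using \<open>0 \<le> L\<close> by (rule mult_left_mono)
    then have "\<bar>frechet_derivative \<kappa> (at x) (v i)\<bar> \<le> L * 1" using L[of "v i"] by linarith
    moreover have "\<bar>\<omega> x (del i v)\<bar> \<le> c" by (rule c) (use assms(3) in \<open>auto simp: del_def\<close>)
    ultimately show ?thesis using \<open>0 \<le> L\<close> by (simp add: abs_mult power_abs mult_mono)
  qed
  from sum_bounded_above[of "{..m}", OF this]
  have "(\<Sum>i\<le>m. \<bar>(-1) ^ i * (frechet_derivative \<kappa> (at x) (v i) * \<omega> x (del i v))\<bar>) \<le> real (Suc m) * (L * c)" by simp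
  then have "\<bar>\<Sum>i\<le>m. (-1) ^ i * (frechet_derivative \<kappa> (at x) (v i) * \<omega> x (del i v))\<bar> \<le> real (Suc m) * (L * c)"
    by (rule order.trans[OF sum_abs])
  moreover have "\<bar>\<kappa> x * ext_deriv m \<omega> x v\<bar> \<le> k * e"
    unfolding abs_mult by (rule mult_mono) (use k e in auto)
  ultimately show ?thesis unfolding ext_deriv_mult[OF assms(1,2)] by linarith
qed

text \<open>The constant A depends on r and m but not on the form. Hence a functional controlled by
  the flat bound of truncations satisfies the criterion of \<open>currentsI\<close>.\<close>

lemma cut_flat_bound:
  assumes r: "r > 0"
  obtains A where "A \<ge> 0" "\<And>\<eta> b. \<eta> \<in> smooth_forms m \<Longrightarrow> b \<ge> 0 \<Longrightarrow> C1_bound m (cball 0 (2 * r)) b \<eta> \<Longrightarrow>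
    flat_bound m (A * b) (cut_form r (\<eta> :: 'a::euclidean_space form))"
proof -
  let ?n = "real (card (basis_tuples m :: (nat \<Rightarrow> 'a) set))"
  obtain L where L: "L \<ge> 0" "\<And>x u. \<bar>frechet_derivative (bump (0::'a) r) (at x) u\<bar> \<le> L * norm u"
    using bump_deriv_bound[OF r] by blast
  let ?E = "real (Suc m) * (real DIM('a) * ?n)"
  define A where "A = ?n + ?E + real (Suc m) * (L * ?n)"
  have A: "A \<ge> 0" "?n \<le> A" unfolding A_def using L(1) by auto
  have "flat_bound m (A * b) (cut_form r \<eta>)" if \<eta>: "\<eta> \<in> smooth_forms m" and b: "b \<ge> 0" and C1: "C1_bound m (cball 0 (2 * r)) b \<eta>" for \<eta> :: "'a form" and b
  proof -
    have 1: "\<bar>\<eta> x v\<bar> \<le> ?n * b" if "x \<in> cball 0 (2 * r)" "\<And>i. i < m \<Longrightarrow> norm (v i) \<le> 1" for x v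
      by (rule covector_bound_const[OF smooth_forms_covector[OF \<eta>] that(2)]) (use C1 that(1) in \<open>auto simp: C1_bound_def\<close>)
    have 2: "\<bar>ext_deriv m \<eta> x v\<bar> \<le> ?E * b" if x: "x \<in> cball 0 (2 * r)" and v: "\<And>i. i < Suc m \<Longrightarrow> norm (v i) \<le> 1" for x v
    proof -
      have "\<bar>(-1) ^ i * dform \<eta> x (v i) (del i v)\<bar> \<le> real DIM('a) * (?n * b)" if "i \<in> {..m}" for i
      proof -
        have "\<bar>dform \<eta> x (v i) (del i v)\<bar> \<le> real DIM('a) * (?n * b) * norm (v i)"
        proof (rule linear_functional_basis_bound[OF dform_linear[OF \<eta>]])
          show "\<bar>dform \<eta> x u (del i v)\<bar> \<le> ?n * b" if "u \<in> Basis" for u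
          proof (rule covector_bound_const[OF dform_covector[OF \<eta>]])
            show "norm (del i v j) \<le> 1" if "j < m" for j using v that by (auto simp: del_def)
            show "\<bar>dform \<eta> x u I\<bar> \<le> b" if "I \<in> basis_tuples m" for I
              using C1 x that \<open>u \<in> Basis\<close> by (auto simp: C1_bound_def)
          qed
        qed
        also have "\<dots> \<le> real DIM('a) * (?n * b) * 1" by (rule mult_left_mono) (use v that b in auto)
        finally show ?thesis by (simp add: abs_mult power_abs)
      qed
      from sum_bounded_above[of "{..m}", OF this]
      have "(\<Sum>i\<le>m. \<bar>(-1) ^ i * dform \<eta> x (v i) (del i v)\<bar>) \<le> ?E * b" by (simp add: mult.assoc)
      then show ?thesis unfolding ext_deriv_eq by (rule order.trans[OF sum_abs])
    qed
    have z: "cut_form r \<eta> x v = 0" if "x \<notin> cball 0 (2 * r)" for x v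
      using that bump_0[OF r, of x 0] by (auto simp: cut_form_def)
    show ?thesis unfolding flat_bound_def
    proof (intro conjI form_boundI)
      fix x :: 'a and v :: "nat \<Rightarrow> 'a" assume v: "\<And>i. i < m \<Longrightarrow> norm (v i) \<le> 1"
      show "\<bar>cut_form r \<eta> x v\<bar> \<le> A * b"
      proof (cases "x \<in> cball 0 (2 * r)")
        case True
        have "\<bar>cut_form r \<eta> x v\<bar> \<le> 1 * (?n * b)" unfolding cut_form_def abs_mult
          by (intro mult_mono 1[OF True v]) (auto simp: abs_bump_le_1)
        also have "\<dots> \<le> A * b" using A(2) b by (simp add: mult_right_mono)
        finally show ?thesis .
      qed (use z A b in simp)
    next
      fix x :: 'a and v :: "nat \<Rightarrow> 'a" assume v: "\<And>i. i < Suc m \<Longrightarrow> norm (v i) \<le> 1"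
      show "\<bar>ext_deriv m (cut_form r \<eta>) x v\<bar> \<le> A * b"
      proof (cases "x \<in> cball 0 (2 * r)")
        case True
        have "\<bar>ext_deriv m (cut_form r \<eta>) x v\<bar> \<le> 1 * (?E * b) + real (Suc m) * (L * (?n * b))" unfolding cut_form_def
          by (rule ext_deriv_mult_bound[OF smooth_bump \<eta> v L]) (use abs_bump_le_1 2[OF True v] 1[OF True] in auto)
        also have "\<dots> \<le> A * b" unfolding A_def using b by (simp add: algebra_simps)
        finally show ?thesis .
      next
        case False
        have "dform (cut_form r \<eta>) x u w = 0" for u w unfolding dform_def
          by (subst frechet_derivative_const_on_open[of "- cball 0 (2 * r)"]) (use False z in auto)
        then show ?thesis using A b by (simp add: ext_deriv_eq)
      qed
    qed
  qed
  then show thesis using that A(1) by blast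
qed

lemma cut_flat_bound_exists:
  assumes "r > 0" "\<eta> \<in> smooth_forms m" shows "\<exists>c\<ge>0. flat_bound m c (cut_form r \<eta>)"
  using cut_flat_bound[OF assms(1)] C1_bound_exists[OF compact_cball assms(2)] assms(2)
  by (metis mult_nonneg_nonneg)

lemma compact_subset_ball: "compact K \<Longrightarrow> \<exists>r>0. K \<subseteq> ball (0::'a::euclidean_space) r"
  by (meson bounded_subset_ballD compact_imp_bounded)

section \<open>Flat currents\<close>

lemma sum_fun_apply: "(\<Sum>i\<in>A. f i) x = (\<Sum>i\<in>A. f i x)"
  by (induction A rule: infinite_finite_induct) auto

text \<open>Each test form separately passes the Cauchy inequality to the weak limit; the supremum
  over forms is taken only afterwards.\<close>

lemma flat_tail:
  assumes T: "T \<in> linear_functionals (smooth_forms m)" and ap: "flat_approximation m Ts T" and \<epsilon>: "\<epsilon> > 0"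
  shows "\<exists>N. \<forall>i\<ge>N. normal_flat_norm m (T - Ts i) \<le> ereal \<epsilon>"
proof -
  obtain N where N: "\<And>i j. i \<ge> N \<Longrightarrow> j \<ge> N \<Longrightarrow> normal_flat_norm m (Ts i - Ts j) < ereal \<epsilon>"
    using ap \<epsilon> unfolding flat_approximation_def by blast
  have "normal_flat_norm m (T - Ts i) \<le> ereal \<epsilon>" if i: "i \<ge> N" for i
    unfolding normal_flat_norm_le
  proof (intro ballI impI)
    fix \<omega> :: "'a form" assume \<omega>: "\<omega> \<in> smooth_forms m" "flat_bound m 1 \<omega>"
    have "(\<lambda>j. Ts j \<omega>) \<longlonglongrightarrow> T \<omega>" using ap \<omega> unfolding flat_approximation_def by blast
    then have lim: "(\<lambda>j. Ts j \<omega> - Ts i \<omega>) \<longlonglongrightarrow> T \<omega> - Ts i \<omega>" by (intro tendsto_intros)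
    have "Ts j \<omega> - Ts i \<omega> \<le> \<epsilon>" if "j \<ge> N" for j
    proof -
      have "normal_flat_norm m (Ts j - Ts i) \<le> ereal \<epsilon>" using N[OF that i] by simp
      then show ?thesis using \<omega> by (auto simp: normal_flat_norm_le)
    qed
    then show "(T - Ts i) \<omega> \<le> \<epsilon>" using LIMSEQ_le_const2[OF lim] by auto
  qed
  then show ?thesis by blast
qed

lemma flat_approximation_normal: "flat_approximation m Ts T \<Longrightarrow> Ts n \<in> normal_currents m"
  by (simp add: flat_approximation_def)

lemma fnorm_triangle:
  assumes "S \<in> linear_functionals (smooth_forms m)" "T \<in> linear_functionals (smooth_forms m)"
    "normal_flat_norm m S \<le> ereal a" "normal_flat_norm m T \<le> ereal b"
  shows "normal_flat_norm m (S + T) \<le> ereal (a + b)" "normal_flat_norm m (S - T) \<le> ereal (a + b)"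
proof -
  have *: "\<bar>S \<omega>\<bar> \<le> a \<and> \<bar>T \<omega>\<bar> \<le> b" if "\<omega> \<in> smooth_forms m" "flat_bound m 1 \<omega>" for \<omega>
    using fnorm_bound[OF assms(1,3) that] fnorm_bound[OF assms(2,4) that] by simp
  show "normal_flat_norm m (S + T) \<le> ereal (a + b)" "normal_flat_norm m (S - T) \<le> ereal (a + b)"
    unfolding normal_flat_norm_le using * by fastforce+
qed

text \<open>By \<open>flat_tail\<close> and the triangle inequality, F(Us n) converges to the
  supremum formula evaluated at T, whatever the approximating sequence Us. So the description in
  \<open>flat_norm\<close> is well defined, and the formula holds for flat currents as well.\<close>

lemma flat_norm_eq:
  assumes T: "T \<in> linear_functionals (smooth_forms m)" and ap: "flat_approximation m Ts T"
  shows "flat_norm m T = fnorm m T" "normal_flat_norm m T = ereal (fnorm m T)"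
proof -
  note lin = normal_currents_linear[OF flat_approximation_normal]
  obtain N where N: "normal_flat_norm m (T - Ts N) \<le> ereal 1" using flat_tail[OF T ap, of 1] by auto
  have "normal_flat_norm m ((T - Ts N) + Ts N) \<le> ereal (1 + fnorm m (Ts N))"
    by (intro fnorm_triangle N linear_functionals_minus T lin[OF ap])
      (use normal_fnorm(1)[OF flat_approximation_normal[OF ap]] in simp)
  then show fin: "normal_flat_norm m T = ereal (fnorm m T)" using finite_fnorm(1)[OF T] by simp
  have lim: "(\<lambda>n. normal_flat_norm m (Us n)) \<longlonglongrightarrow> ereal (fnorm m T)" if Us: "flat_approximation m Us T" for Us
  proof -
    have "(\<lambda>n. fnorm m (Us n)) \<longlonglongrightarrow> fnorm m T"
    proof (rule LIMSEQ_I)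
      fix r :: real assume r: "r > 0"
      obtain N where N: "\<And>i. i \<ge> N \<Longrightarrow> normal_flat_norm m (T - Us i) \<le> ereal (r / 2)" using flat_tail[OF T Us, of "r / 2"] r by auto
      have "norm (fnorm m (Us n) - fnorm m T) < r" if n: "n \<ge> N" for n
      proof -
        note U = flat_approximation_normal[OF Us, of n]
        have "normal_flat_norm m ((T - Us n) + Us n) \<le> ereal (r / 2 + fnorm m (Us n))"
          by (intro fnorm_triangle N[OF n] linear_functionals_minus T lin[OF Us])
            (use normal_fnorm(1)[OF U] in simp)
        moreover have "T - (T - Us n) = Us n" by simp
        moreover have "normal_flat_norm m (T - (T - Us n)) \<le> ereal (fnorm m T + r / 2)"
          by (intro fnorm_triangle N[OF n] linear_functionals_minus T lin[OF Us]) (use fin in simp)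
        ultimately have "fnorm m T \<le> r / 2 + fnorm m (Us n)" "fnorm m (Us n) \<le> fnorm m T + r / 2"
          using normal_fnorm(1)[OF U] fin by (metis diff_add_cancel ereal_less_eq(3), metis ereal_less_eq(3))
        then show ?thesis using r by (simp add: abs_if)
      qed
      then show "\<exists>no. \<forall>n\<ge>no. norm (fnorm m (Us n) - fnorm m T) < r" by blast
    qed
    then have "(\<lambda>n. ereal (fnorm m (Us n))) \<longlonglongrightarrow> ereal (fnorm m T)" by simp
    then show ?thesis using normal_fnorm(1)[OF flat_approximation_normal[OF Us]] by simp
  qed
  show "flat_norm m T = fnorm m T" unfolding flat_norm_def
  proof (rule the_equality)
    show "\<exists>Ts. flat_approximation m Ts T \<and> (\<lambda>n. normal_flat_norm m (Ts n)) \<longlonglongrightarrow> ereal (fnorm m T)"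
      using ap lim by blast
    show "r = fnorm m T" if "\<exists>Ts. flat_approximation m Ts T \<and> (\<lambda>n. normal_flat_norm m (Ts n)) \<longlonglongrightarrow> ereal r" for r
      using that lim LIMSEQ_unique ereal.inject by metis
  qed
qed

text \<open>Supplies the approximating sequence for T minus a partial sum, so that
  \<open>flat_norm_eq\<close> evaluates the norms occurring in
  \<open>frac_decomposition\<close>.\<close>

lemma flat_approximation_minus:
  assumes ap: "flat_approximation m Ts T" and P: "P \<in> normal_currents m" "spt m P \<subseteq> C" "compact C"
  shows "flat_approximation m (\<lambda>n. Ts n - P) (T - P)"
  unfolding flat_approximation_def
proof (intro conjI)
  have e: "Ts n - P = Ts n + (-1) *\<^sub>R P" for n by (simp add: fun_eq_iff scaleR_fun_def)
  show "\<forall>n. Ts n - P \<in> normal_currents m" unfolding e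
    by (intro allI normal_currents_add normal_currents_scaleR(1) P(1) flat_approximation_normal[OF ap])
  show "\<forall>\<epsilon>>0. \<exists>N. \<forall>i\<ge>N. \<forall>j\<ge>N. normal_flat_norm m (Ts i - P - (Ts j - P)) < ereal \<epsilon>"
    using ap unfolding flat_approximation_def by (simp add: fun_eq_iff)
  have "(\<Union>n. spt m (Ts n - P)) \<subseteq> closure (\<Union>n. spt m (Ts n)) \<union> C"
  proof (rule UN_least)
    fix n
    have "spt m (Ts n) \<subseteq> closure (\<Union>n. spt m (Ts n))" using closure_subset[of "\<Union>n. spt m (Ts n)"] by blast
    then show "spt m (Ts n - P) \<subseteq> closure (\<Union>n. spt m (Ts n)) \<union> C" using spt_diff[of m "Ts n" P] P(2) by blast
  qed
  moreover have "compact (closure (\<Union>n. spt m (Ts n)) \<union> C)" using ap P(3) by (auto simp: flat_approximation_def)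
  ultimately show "compact (closure (\<Union>n. spt m (Ts n - P)))"
    by (meson bounded_closure bounded_subset compact_eq_bounded_closed closed_closure)
  show "\<forall>\<omega>\<in>smooth_forms m. (\<lambda>n. (Ts n - P) \<omega>) \<longlonglongrightarrow> (T - P) \<omega>"
    using ap unfolding flat_approximation_def by (auto intro!: tendsto_intros)
qed

lemma spt_flat:
  assumes ap: "flat_approximation m Ts T" shows "spt m T \<subseteq> closure (\<Union>n. spt m (Ts n))"
proof (rule spt_subsetI)
  fix \<omega> :: "'a form" assume \<omega>: "\<omega> \<in> smooth_forms m" "form_support \<omega> \<inter> closure (\<Union>n. spt m (Ts n)) = {}"
  have "Ts n \<omega> = 0" for n
  proof (rule current_vanish[OF _ \<omega>(1)])
    show "Ts n \<in> currents m" using flat_approximation_normal[OF ap] by (simp add: normal_currents_def)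
    show "form_support \<omega> \<inter> spt m (Ts n) = {}" using \<omega>(2) closure_subset[of "\<Union>n. spt m (Ts n)"] by blast
  qed
  then have "(\<lambda>n. Ts n \<omega>) = (\<lambda>n. 0)" by simp
  moreover have "(\<lambda>n. Ts n \<omega>) \<longlonglongrightarrow> T \<omega>" using ap \<omega>(1) by (simp add: flat_approximation_def)
  ultimately have "(\<lambda>n. 0) \<longlonglongrightarrow> T \<omega>" by simp
  then show "T \<omega> = 0" by (simp add: LIMSEQ_const_iff)
qed simp

text \<open>All currents involved have support in one ball, so a smooth form can be truncated there
  to one of finite flat bound; convergence in flat norm then gives convergence of the series on
  every smooth form.\<close>

lemma frac_decomposition_limits:
  assumes T: "T \<in> flat_currents m" and dec: "frac_decomposition m \<alpha> Ts T"
  shows "normal_flat_norm m (T - (\<Sum>k<n. Ts k)) = ereal (fnorm m (T - (\<Sum>k<n. Ts k)))"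
    and "(\<lambda>n. fnorm m (T - (\<Sum>k<n. Ts k))) \<longlonglongrightarrow> 0"
    and "\<eta> \<in> smooth_forms m \<Longrightarrow> (\<lambda>k. Ts k \<eta>) sums T \<eta>"
proof -
  obtain Us where Us: "flat_approximation m Us T" and Tc: "T \<in> currents m" using T by (auto simp: flat_currents_def)
  obtain C where C: "compact C" "\<And>k. Ts k \<in> normal_currents_in m C" using dec unfolding frac_decomposition_def by blast
  let ?P = "\<lambda>n. \<Sum>k<n. Ts k"
  have P: "?P n \<in> normal_currents_in m C" for n by (intro normal_currents_in_sum compact_imp_closed C)
  have ap: "flat_approximation m (\<lambda>i. Us i - ?P n) (T - ?P n)" for n
    by (rule flat_approximation_minus[OF Us _ _ C(1)]) (use normal_currents_inD[OF P] in auto)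
  have cur: "T - ?P n \<in> currents m" for n by (intro currents_diff Tc normal_currents_inD(2)[OF P])
  note eq = flat_norm_eq[OF currents_linear[OF cur] ap]
  show fin: "normal_flat_norm m (T - ?P n) = ereal (fnorm m (T - ?P n))" for n by (rule eq(2))
  show lim: "(\<lambda>n. fnorm m (T - ?P n)) \<longlonglongrightarrow> 0" using dec unfolding frac_decomposition_def eq(1) by blast
  assume \<eta>: "\<eta> \<in> smooth_forms m"
  have cs: "compact (closure (\<Union>n. spt m (Us n)) \<union> C)" using Us C by (auto simp: flat_approximation_def)
  then obtain r where r: "r > 0" "closure (\<Union>n. spt m (Us n)) \<union> C \<subseteq> ball 0 r" using compact_subset_ball by blast
  have sp: "spt m (T - ?P n) \<subseteq> ball 0 r" for n
  proof -
    have "spt m T \<union> spt m (?P n) \<subseteq> closure (\<Union>n. spt m (Us n)) \<union> C"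
      by (rule Un_mono[OF spt_flat[OF Us] normal_currents_inD(3)[OF P[of n]]])
    then show ?thesis using spt_diff[of m T "?P n"] r(2) by (meson order.trans)
  qed
  obtain c where c: "c \<ge> 0" "flat_bound m c (cut_form r \<eta>)" using cut_flat_bound_exists[OF r(1) \<eta>] by blast
  have bd: "\<bar>(T - ?P n) \<eta>\<bar> \<le> c * fnorm m (T - ?P n)" for n
    using fnorm_bound[OF currents_linear[OF cur] _ cut_smooth_forms[OF \<eta>] c(2,1), of n] fin[of n]
      current_cut[OF cur sp \<eta>, of n] by simp
  have z: "(\<lambda>n. c * fnorm m (T - ?P n)) \<longlonglongrightarrow> 0" using tendsto_mult_right_zero[OF lim] by blast
  have "(\<lambda>n. (T - ?P n) \<eta>) \<longlonglongrightarrow> 0"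
    by (rule Lim_null_comparison[OF _ z], rule always_eventually, unfold real_norm_def, rule allI, rule bd)
  then have "(\<lambda>n. T \<eta> - (T - ?P n) \<eta>) \<longlonglongrightarrow> T \<eta> - 0" by (intro tendsto_intros)
  then show "(\<lambda>k. Ts k \<eta>) sums T \<eta>" unfolding sums_def by (simp add: sum_fun_apply)
qed

section \<open>The Hahn--Banach theorem\<close>

(* Zorn's lemma is applied to the linear subspaces G of 'v * real with r <= p x for (x, r) in G;
   such a G is automatically the graph of a function, since (0, r) in G forces r = 0. *)
lemma hahn_banach:
  fixes p f :: "'v::real_vector \<Rightarrow> real"
  assumes V: "subspace V" and W: "subspace W" "W \<subseteq> V"
    and p: "\<And>x y. x \<in> V \<Longrightarrow> y \<in> V \<Longrightarrow> p (x + y) \<le> p x + p y" "\<And>t x. x \<in> V \<Longrightarrow> t \<ge> 0 \<Longrightarrow> p (t *\<^sub>R x) = t * p x"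
    and f: "\<And>x y. x \<in> W \<Longrightarrow> y \<in> W \<Longrightarrow> f (x + y) = f x + f y" "\<And>t x. x \<in> W \<Longrightarrow> f (t *\<^sub>R x) = t * f x"
      "\<And>x. x \<in> W \<Longrightarrow> f x \<le> p x"
  obtains g where "\<And>x y. x \<in> V \<Longrightarrow> y \<in> V \<Longrightarrow> g (x + y) = g x + g y" "\<And>t x. x \<in> V \<Longrightarrow> g (t *\<^sub>R x) = t * g x"
    "\<And>x. x \<in> W \<Longrightarrow> g x = f x" "\<And>x. x \<in> V \<Longrightarrow> g x \<le> p x"
proof -
  define F where "F = (\<lambda>x. (x, f x)) ` W"
  define \<A> where "\<A> = {G. subspace G \<and> F \<subseteq> G \<and> (\<forall>(x, r)\<in>G. x \<in> V \<and> r \<le> p x)}"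
  have f0: "f 0 = 0" using f(2)[OF subspace_0[OF W(1)], of 0] by simp
  have "subspace F" unfolding subspace_def
  proof (intro conjI ballI allI)
    show "0 \<in> F" using f0 subspace_0[OF W(1)] by (force simp: F_def zero_prod_def)
    fix a b assume "a \<in> F" "b \<in> F"
    then show "a + b \<in> F" using f(1) subspace_add[OF W(1)] by (force simp: F_def)
  next
    fix c a assume "a \<in> F"
    then show "c *\<^sub>R a \<in> F" using f(2) subspace_scale[OF W(1)] by (force simp: F_def)
  qed
  moreover have "\<forall>(x, r)\<in>F. x \<in> V \<and> r \<le> p x" using W(2) f(3) by (auto simp: F_def)
  ultimately have "F \<in> \<A>" by (simp add: \<A>_def)
  then have "\<A> \<noteq> {}" by blast
  moreover have "\<Union>\<C> \<in> \<A>" if ne: "\<C> \<noteq> {}" and ch: "subset.chain \<A> \<C>" for \<C>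
  proof -
    have sub: "G \<in> \<A>" if "G \<in> \<C>" for G using ch that by (auto simp: subset_chain_def)
    have tot: "G \<subseteq> H \<or> H \<subseteq> G" if "G \<in> \<C>" "H \<in> \<C>" for G H using ch that by (auto simp: subset_chain_def)
    have "subspace (\<Union>\<C>)" unfolding subspace_def
    proof (intro conjI ballI allI)
      show "0 \<in> \<Union>\<C>" using ne sub by (auto simp: \<A>_def subspace_def)
      fix x y assume "x \<in> \<Union>\<C>" "y \<in> \<Union>\<C>"
      then obtain G H where GH: "G \<in> \<C>" "H \<in> \<C>" "x \<in> G" "y \<in> H" by blast
      obtain E where "E \<in> \<C>" "x \<in> E" "y \<in> E" using tot[OF GH(1,2)] GH by blast
      then show "x + y \<in> \<Union>\<C>" using sub[of E] by (auto simp: \<A>_def intro: subspace_add)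
    next
      fix c x assume "x \<in> \<Union>\<C>"
      then obtain G where "G \<in> \<C>" "x \<in> G" by blast
      then show "c *\<^sub>R x \<in> \<Union>\<C>" using sub[of G] by (auto simp: \<A>_def intro: subspace_scale)
    qed
    then show ?thesis using ne sub unfolding \<A>_def by fast
  qed
  ultimately obtain G where G: "G \<in> \<A>" "\<And>X. X \<in> \<A> \<Longrightarrow> G \<subseteq> X \<Longrightarrow> X = G"
    using subset_Zorn_nonempty[of \<A>] by metis
  have Gs: "subspace G" and FG: "F \<subseteq> G" and GV: "\<And>x r. (x, r) \<in> G \<Longrightarrow> x \<in> V" and Gp: "\<And>x r. (x, r) \<in> G \<Longrightarrow> r \<le> p x"
    using G(1) by (auto simp: \<A>_def)
  have p0: "p 0 = 0" using p(2)[OF subspace_0[OF V], of 0] by simp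
  have sv: "r = s" if "(x, r) \<in> G" "(x, s) \<in> G" for x r s
    using Gp[of 0 "r - s"] Gp[of 0 "s - r"] subspace_diff[OF Gs that] subspace_diff[OF Gs that(2,1)] p0 by simp
  have ex: "\<exists>r. (x, r) \<in> G" if x: "x \<in> V" for x
  proof (rule ccontr)
    assume nx: "\<not> (\<exists>r. (x, r) \<in> G)"
    let ?A = "{s - p (y - x) | y s. (y, s) \<in> G}"
    have G0: "(0, 0) \<in> G" using subspace_0[OF Gs] by (simp add: zero_prod_def)
    have cross: "s - p (y - x) \<le> p (z + x) - r" if "(y, s) \<in> G" "(z, r) \<in> G" for y s z r
    proof -
      have "s + r \<le> p (y + z)" using Gp subspace_add[OF Gs that] by simp
      also have "y + z = (y - x) + (z + x)" by simp
      also have "p \<dots> \<le> p (y - x) + p (z + x)"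
        by (intro p subspace_add[OF V] subspace_diff[OF V] x GV[OF that(1)] GV[OF that(2)])
      finally show ?thesis by simp
    qed
    \<comment> \<open>The value given to x has to lie above every s - p (y - x) and below every p (z
      + x) - r; \<open>cross\<close> says that no lower bound exceeds an upper one.\<close>
    define c where "c = Sup ?A"
    have bdd: "bdd_above ?A" unfolding bdd_above_def using cross[OF _ G0] by blast
    have c1: "s - p (y - x) \<le> c" if "(y, s) \<in> G" for y s
      unfolding c_def by (rule cSup_upper[OF _ bdd]) (use that in blast)
    have c2: "c \<le> p (z + x) - r" if "(z, r) \<in> G" for z r
      unfolding c_def by (rule cSup_least) (use G0 cross[OF _ that] in blast)+
    let ?H = "{(y + t *\<^sub>R x, s + t * c) | y s t. (y, s) \<in> G}"
    have "?H \<in> \<A>" unfolding \<A>_def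
    proof (intro CollectI conjI)
      show "subspace ?H" unfolding subspace_def
      proof (intro conjI ballI allI)
        show "0 \<in> ?H" using G0 by (force simp: zero_prod_def intro: exI[of _ 0])
        fix a b assume "a \<in> ?H" "b \<in> ?H"
        then obtain y s t y' s' t' where ab: "a = (y + t *\<^sub>R x, s + t * c)" "b = (y' + t' *\<^sub>R x, s' + t' * c)" "(y, s) \<in> G" "(y', s') \<in> G" by blast
        have "a + b = ((y + y') + (t + t') *\<^sub>R x, (s + s') + (t + t') * c)" using ab by (simp add: algebra_simps)
        moreover have "(y + y', s + s') \<in> G" using subspace_add[OF Gs ab(3,4)] by simp
        ultimately show "a + b \<in> ?H" by blast
      next
        fix k a assume "a \<in> ?H"
        then obtain y s t where a: "a = (y + t *\<^sub>R x, s + t * c)" "(y, s) \<in> G" by blast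
        have "k *\<^sub>R a = (k *\<^sub>R y + (k * t) *\<^sub>R x, k * s + (k * t) * c)" using a by (simp add: algebra_simps)
        moreover have "(k *\<^sub>R y, k * s) \<in> G" using subspace_scale[OF Gs a(2), of k] by simp
        ultimately show "k *\<^sub>R a \<in> ?H" by blast
      qed
      have "G \<subseteq> ?H" by (force intro: exI[of _ 0])
      then show "F \<subseteq> ?H" using FG by blast
      show "\<forall>(z, r)\<in>?H. z \<in> V \<and> r \<le> p z"
      proof (clarify, intro conjI)
        fix y s t assume ys: "(y, s) \<in> G"
        show "y + t *\<^sub>R x \<in> V" by (intro subspace_add[OF V] subspace_scale[OF V] x GV[OF ys])
        \<comment> \<open>After division by |t|, positive t uses the upper bound for c and negative
          t the lower one.\<close>
        consider "t = 0" | "t > 0" | "t < 0" by linarith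
        then show "s + t * c \<le> p (y + t *\<^sub>R x)"
        proof cases
          case 1 then show ?thesis using Gp[OF ys] by simp
        next
          case 2
          have m: "((1 / t) *\<^sub>R y, (1 / t) * s) \<in> G" using subspace_scale[OF Gs ys, of "1 / t"] by simp
          have "t * c \<le> t * (p ((1 / t) *\<^sub>R y + x) - (1 / t) * s)" using c2[OF m] 2 by (simp add: mult_left_mono)
          also have "\<dots> = p (t *\<^sub>R ((1 / t) *\<^sub>R y + x)) - s"
            using p(2)[of "(1 / t) *\<^sub>R y + x" t] subspace_add[OF V GV[OF m] x] 2 by (simp add: algebra_simps)
          also have "t *\<^sub>R ((1 / t) *\<^sub>R y + x) = y + t *\<^sub>R x" using 2 by (simp add: algebra_simps)
          finally show ?thesis by simp
        next
          case 3
          let ?u = "- t"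
          have u: "?u > 0" using 3 by simp
          have m: "((1 / ?u) *\<^sub>R y, (1 / ?u) * s) \<in> G" using subspace_scale[OF Gs ys, of "1 / ?u"] by simp
          have "?u * ((1 / ?u) * s - p ((1 / ?u) *\<^sub>R y - x)) \<le> ?u * c" using c1[OF m] u by (intro mult_left_mono) auto
          moreover have "?u * ((1 / ?u) * s - p ((1 / ?u) *\<^sub>R y - x)) = s - p (?u *\<^sub>R ((1 / ?u) *\<^sub>R y - x))"
            using p(2)[of "(1 / ?u) *\<^sub>R y - x" ?u] subspace_diff[OF V GV[OF m] x] u by (simp add: algebra_simps)
          moreover have "?u *\<^sub>R ((1 / ?u) *\<^sub>R y - x) = y + t *\<^sub>R x" using u by (simp add: algebra_simps)
          ultimately show ?thesis by simp
        qed
      qed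
    qed
    moreover have "G \<subseteq> ?H" by (force intro: exI[of _ 0])
    ultimately have "?H = G" using G(2) by blast
    moreover have "(x, c) \<in> ?H" using G0 by (force intro: exI[of _ 1])
    ultimately show False using nx by blast
  qed
  define g where "g x = (THE r. (x, r) \<in> G)" for x
  have g: "(x, g x) \<in> G" if "x \<in> V" for x
    unfolding g_def using ex[OF that] sv by (metis theI)
  have ge: "g x = r" if "(x, r) \<in> G" for x r using sv[OF g[OF GV[OF that]] that] .
  show thesis
  proof (rule that[of g])
    show "g (x + y) = g x + g y" if "x \<in> V" "y \<in> V" for x y
      using ge subspace_add[OF Gs g[OF that(1)] g[OF that(2)]] by simp
    show "g (t *\<^sub>R x) = t * g x" if "x \<in> V" for t x
      using ge subspace_scale[OF Gs g[OF that], of t] by simp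
    show "g x = f x" if "x \<in> W" for x using ge[of x "f x"] FG that by (auto simp: F_def)
    show "g x \<le> p x" if "x \<in> V" for x using Gp[OF g[OF that]] .
  qed
qed

section \<open>Decomposing functionals bounded by the charge norm\<close>

(* Dyadic levels, as in the J-method of real interpolation: after division by twice its weight,
   every normal current in K lies in one of them. *)
definition level :: "nat \<Rightarrow> real \<Rightarrow> 'a::euclidean_space set \<Rightarrow> nat \<Rightarrow> 'a current set" where
  "level m \<alpha> K j = {S \<in> normal_currents_in m K.
     nmass m S \<le> 2 powr (\<alpha> * real j) \<and> fnorm m S \<le> 2 powr (- (1 - \<alpha>) * real j)}"

text \<open>With c = 1 this is the polar of the level; it takes the role of a unit ball in
  \<open>homogeneous_bound\<close>.\<close>

definition level_bound :: "nat \<Rightarrow> real \<Rightarrow> 'a::euclidean_space set \<Rightarrow> nat \<Rightarrow> real \<Rightarrow> 'a form \<Rightarrow> bool" where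
  "level_bound m \<alpha> K j c \<eta> \<longleftrightarrow> (\<forall>S\<in>level m \<alpha> K j. \<bar>S \<eta>\<bar> \<le> c)"

lemma levelD:
  assumes "S \<in> level m \<alpha> K j"
  shows "S \<in> normal_currents_in m K" "S \<in> normal_currents m" "S \<in> linear_functionals (smooth_forms m)"
    "S \<in> currents m" "spt m S \<subseteq> K" "nmass m S \<le> 2 powr (\<alpha> * real j)" "fnorm m S \<le> 2 powr (- (1 - \<alpha>) * real j)"
  using assms normal_currents_inD[of S m K] normal_currents_linear[of S m] by (auto simp: level_def)

lemma zero_in_level:
  assumes "closed K" shows "0 \<in> level m \<alpha> K j"
proof -
  have n: "nmass m 0 \<le> 0 + 0" by (rule normal_currentsI(2)[OF currents_zero]) auto
  have f: "fnorm m 0 \<le> 0"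
    by (rule finite_fnorm(3)[OF currents_linear[OF currents_zero]], unfold normal_flat_norm_le) simp
  show ?thesis unfolding level_def
    by (intro CollectI conjI normal_currents_in_zero assms order.trans[OF n] order.trans[OF f]) simp_all
qed

lemma level_bound_mono: "level_bound m \<alpha> K j c \<eta> \<Longrightarrow> c \<le> c' \<Longrightarrow> level_bound m \<alpha> K j c' \<eta>"
  unfolding level_bound_def by (meson order.trans)

lemma level_bound_scaleR:
  "\<eta> \<in> smooth_forms m \<Longrightarrow> level_bound m \<alpha> K j c \<eta> \<Longrightarrow> level_bound m \<alpha> K j (\<bar>a\<bar> * c) (a *\<^sub>R \<eta>)"
  unfolding level_bound_def
  by (simp add: linear_functionals_scaleR[OF levelD(3)] abs_mult mult_left_mono)

text \<open>The flat norm decays along the levels, so a fixed form becomes geometrically small on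
  them. This is what makes the tails of a constant sequence of forms disappear.\<close>

lemma level_bound_flat:
  assumes "\<eta> \<in> smooth_forms m" "flat_bound m c \<eta>" "c \<ge> 0"
  shows "level_bound m \<alpha> K j (c * 2 powr (- (1 - \<alpha>) * real j)) \<eta>"
  unfolding level_bound_def
proof
  fix S assume S: "S \<in> level m \<alpha> K j"
  have "\<bar>S \<eta>\<bar> \<le> c * fnorm m S" by (rule normal_fnorm_bound[OF levelD(2)[OF S] assms])
  also have "\<dots> \<le> c * 2 powr (- (1 - \<alpha>) * real j)" using levelD(7)[OF S] assms(3) by (rule mult_left_mono)
  finally show "\<bar>S \<eta>\<bar> \<le> c * 2 powr (- (1 - \<alpha>) * real j)" .
qed

lemma level_bound_cut:
  assumes "\<eta> \<in> smooth_forms m" "K \<subseteq> ball 0 r"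
  shows "level_bound m \<alpha> K j c (cut_form r \<eta>) \<longleftrightarrow> level_bound m \<alpha> K j c \<eta>"
proof -
  have "S (cut_form r \<eta>) = S \<eta>" if "S \<in> level m \<alpha> K j" for S
    by (rule current_cut[OF levelD(4)[OF that] _ assms(1)]) (use levelD(5)[OF that] assms(2) in blast)
  note eq = this
  show ?thesis unfolding level_bound_def
    by (rule ball_cong[OF refl], drule eq, simp)
qed

lemma powr_interpolate:
  fixes x y :: real
  assumes "x > 0" "y > 0"
  shows "x powr (1 - a) * y powr a * (x / y) powr a = x" "x powr (1 - a) * y powr a = y * (x / y) powr (1 - a)"
  using assms by (simp_all add: powr_divide powr_diff)

text \<open>With w the weight, N = w (N/F)^\<alpha> and F = w (N/F)^(\<alpha> - 1). Taking for j the
  integer part of log2 (N/F), which is nonnegative because F \<le> N, rounds N/F to a power of 2 and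
  costs at most a factor 2.\<close>

lemma frac_weight_level:
  assumes \<alpha>: "0 < \<alpha>" "\<alpha> < 1" and T: "T \<in> normal_currents m" "fnorm m T > 0"
  obtains j where "nmass m T \<le> 2 * frac_weight m \<alpha> T * 2 powr (\<alpha> * real j)"
    "fnorm m T \<le> 2 * frac_weight m \<alpha> T * 2 powr (- (1 - \<alpha>) * real j)"
proof -
  let ?N = "nmass m T" and ?F = "fnorm m T"
  have F: "0 < ?F" "?F \<le> ?N" using T normal_fnorm[OF T(1)] by auto
  then have N: "?N > 0" by linarith
  define j where "j = nat \<lfloor>log 2 (?N / ?F)\<rfloor>"
  have l0: "log 2 (?N / ?F) \<ge> 0" using F by simp
  then have j: "real j \<le> log 2 (?N / ?F)" "log 2 (?N / ?F) < real j + 1" unfolding j_def by linarith+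
  have 1: "2 powr real j \<le> ?N / ?F" using j(1) F N by (simp add: le_log_iff)
  have 2: "?N / ?F < 2 powr (real j + 1)" using j(2) F N by (simp add: log_less_iff)
  have w: "frac_weight m \<alpha> T = ?N powr (1 - \<alpha>) * ?F powr \<alpha>" by (simp add: frac_weight_def)
  have wN: "frac_weight m \<alpha> T * (?N / ?F) powr \<alpha> = ?N"
    unfolding w by (rule powr_interpolate[OF N F(1)])
  have wF: "frac_weight m \<alpha> T = ?F * (?N / ?F) powr (1 - \<alpha>)"
    unfolding w by (rule powr_interpolate[OF N F(1)])
  have w0: "frac_weight m \<alpha> T > 0" unfolding w using F N by simp
  show thesis
  proof (rule that[of j])
    have "(?N / ?F) powr \<alpha> \<le> (2 powr (real j + 1)) powr \<alpha>" using 2 F N \<alpha> by (intro powr_mono2) auto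
    also have "\<dots> = 2 powr \<alpha> * 2 powr (\<alpha> * real j)" by (simp add: powr_powr powr_add[symmetric] algebra_simps)
    also have "\<dots> \<le> 2 * 2 powr (\<alpha> * real j)" using powr_mono[of \<alpha> 1 2] \<alpha> by simp
    finally have "frac_weight m \<alpha> T * (?N / ?F) powr \<alpha> \<le> frac_weight m \<alpha> T * (2 * 2 powr (\<alpha> * real j))"
      using w0 by (intro mult_left_mono) auto
    then show "?N \<le> 2 * frac_weight m \<alpha> T * 2 powr (\<alpha> * real j)" unfolding wN by (simp add: algebra_simps)
    have "(2 powr real j) powr (1 - \<alpha>) \<le> (?N / ?F) powr (1 - \<alpha>)" using 1 \<alpha> by (intro powr_mono2) auto
    then have "?F * (2 powr real j) powr (1 - \<alpha>) \<le> frac_weight m \<alpha> T" unfolding wF using F by (intro mult_left_mono) auto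
    then have "?F * (2 powr real j) powr (1 - \<alpha>) * 2 powr (- (1 - \<alpha>) * real j) \<le> frac_weight m \<alpha> T * 2 powr (- (1 - \<alpha>) * real j)"
      by (rule mult_right_mono) simp
    moreover have "(2 powr real j) powr (1 - \<alpha>) * 2 powr (- (1 - \<alpha>) * real j) = 1"
      by (simp add: powr_powr powr_add[symmetric] algebra_simps)
    then have "?F * (2 powr real j) powr (1 - \<alpha>) * 2 powr (- (1 - \<alpha>) * real j) = ?F" by (simp only: mult.assoc mult_1_right)
    ultimately have "?F \<le> frac_weight m \<alpha> T * 2 powr (- (1 - \<alpha>) * real j)" by linarith
    also have "\<dots> \<le> 2 * (frac_weight m \<alpha> T * 2 powr (- (1 - \<alpha>) * real j))" using w0 by simp
    finally show "?F \<le> 2 * frac_weight m \<alpha> T * 2 powr (- (1 - \<alpha>) * real j)" by (simp add: mult.assoc)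
  qed
qed

lemma frac_weight_nonneg: "frac_weight m \<alpha> T \<ge> 0"
  by (simp add: frac_weight_def)

text \<open>Divided by twice its weight, T lies in a level, where the form is at most c. If F(T) = 0
  this normalisation is impossible, but then T vanishes on the truncation of \<eta>, hence on
  \<eta>.\<close>

lemma level_bound_frac_weight:
  assumes \<alpha>: "0 < \<alpha>" "\<alpha> < 1" and K: "compact K" and \<eta>: "\<eta> \<in> smooth_forms m"
    and T: "T \<in> normal_currents_in m K" and c: "c \<ge> 0" "\<And>j. level_bound m \<alpha> K j c \<eta>"
  shows "\<bar>T \<eta>\<bar> \<le> 2 * c * frac_weight m \<alpha> T"
proof (cases "fnorm m T > 0")
  case True
  note Tn = normal_currents_inD(1)[OF T]
  obtain j where j: "nmass m T \<le> 2 * frac_weight m \<alpha> T * 2 powr (\<alpha> * real j)"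
    "fnorm m T \<le> 2 * frac_weight m \<alpha> T * 2 powr (- (1 - \<alpha>) * real j)"
    using frac_weight_level[OF \<alpha> Tn True] by blast
  have N: "nmass m T > 0" using True normal_fnorm(3)[OF Tn] by linarith
  have w0: "frac_weight m \<alpha> T > 0" unfolding frac_weight_def using True N by simp
  define s where "s = 1 / (2 * frac_weight m \<alpha> T)"
  have s: "s > 0" "s * (2 * frac_weight m \<alpha> T) = 1" unfolding s_def using w0 by auto
  have "s *\<^sub>R T \<in> level m \<alpha> K j" unfolding level_def
  proof (intro CollectI conjI normal_currents_in_scaleR T)
    have "nmass m (s *\<^sub>R T) \<le> s * nmass m T" using normal_currents_scaleR(2)[OF Tn] s by simp
    also have "\<dots> \<le> s * (2 * frac_weight m \<alpha> T * 2 powr (\<alpha> * real j))" using j s by (intro mult_left_mono) auto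
    also have "\<dots> = 2 powr (\<alpha> * real j)" using s(2) by (metis mult.assoc mult_1)
    finally show "nmass m (s *\<^sub>R T) \<le> 2 powr (\<alpha> * real j)" .
    have "fnorm m (s *\<^sub>R T) \<le> s * fnorm m T" using fnorm_scaleR[OF Tn] s by simp
    also have "\<dots> \<le> s * (2 * frac_weight m \<alpha> T * 2 powr (- (1 - \<alpha>) * real j))" using j s by (intro mult_left_mono) auto
    also have "\<dots> = 2 powr (- (1 - \<alpha>) * real j)" using s(2) by (metis mult.assoc mult_1)
    finally show "fnorm m (s *\<^sub>R T) \<le> 2 powr (- (1 - \<alpha>) * real j)" .
  qed
  then have "\<bar>(s *\<^sub>R T) \<eta>\<bar> \<le> c" using c(2)[of j] unfolding level_bound_def by blast
  then have "s * \<bar>T \<eta>\<bar> \<le> c" using s by (simp add: scaleR_fun_def abs_mult)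
  then have "(2 * frac_weight m \<alpha> T) * (s * \<bar>T \<eta>\<bar>) \<le> (2 * frac_weight m \<alpha> T) * c" using w0 by (intro mult_left_mono) auto
  moreover have "(2 * frac_weight m \<alpha> T) * (s * \<bar>T \<eta>\<bar>) = (s * (2 * frac_weight m \<alpha> T)) * \<bar>T \<eta>\<bar>" by (simp only: ac_simps)
  ultimately have "\<bar>T \<eta>\<bar> \<le> (2 * frac_weight m \<alpha> T) * c" by (simp only: s(2) mult_1)
  then show ?thesis by (simp only: ac_simps)
next
  case False
  note Tn = normal_currents_inD(1)[OF T]
  obtain r where r: "r > 0" "K \<subseteq> ball 0 r" using compact_subset_ball[OF K] by blast
  obtain b where b: "b \<ge> 0" "flat_bound m b (cut_form r \<eta>)" using cut_flat_bound_exists[OF r(1) \<eta>] by blast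
  have "\<bar>T (cut_form r \<eta>)\<bar> \<le> b * fnorm m T" by (rule normal_fnorm_bound[OF Tn cut_smooth_forms[OF \<eta>] b(2,1)])
  moreover have "fnorm m T = 0" using False normal_fnorm(2)[OF Tn] by simp
  moreover have "T (cut_form r \<eta>) = T \<eta>"
    by (rule current_cut[OF normal_currents_inD(2)[OF T] _ \<eta>]) (use normal_currents_inD(3)[OF T] r in blast)
  ultimately have "T \<eta> = 0" by simp
  then show ?thesis using c frac_weight_nonneg[of m \<alpha> T] by simp
qed

text \<open>A functional bounded on the polar of a level inherits the estimates that define the
  level: forms of comass at most 1, differentials of such forms, and forms of flat bound 1 have a
  known size on the level, and a form vanishing near K has size 0. The factor 2 arises because mass
  and boundary mass are bounded separately.\<close>

lemma level_functional:
  assumes \<alpha>: "0 < \<alpha>" "\<alpha> < 1" and K: "compact K" and \<Psi>: "\<Psi> \<in> linear_functionals (smooth_forms m)"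
    and A: "A \<ge> 0" "\<And>\<eta>. \<eta> \<in> smooth_forms m \<Longrightarrow> level_bound m \<alpha> K j 1 \<eta> \<Longrightarrow> \<Psi> \<eta> \<le> A"
  shows "\<Psi> \<in> normal_currents_in m K" "frac_weight m \<alpha> \<Psi> \<le> 2 * A"
proof -
  let ?a = "2 powr (\<alpha> * real j)" and ?b = "2 powr (- (1 - \<alpha>) * real j)"
  have b: "\<bar>\<Psi> \<eta>\<bar> \<le> c * A" if "\<eta> \<in> smooth_forms m" "level_bound m \<alpha> K j c \<eta>" "c \<ge> 0" for \<eta> c
    by (rule homogeneous_bound[where P="level_bound m \<alpha> K j", OF \<Psi> level_bound_scaleR level_bound_mono A(2) A(1) that])
  obtain r where r: "r > 0" "K \<subseteq> ball 0 r" using compact_subset_ball[OF K] by blast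
  have cur: "\<Psi> \<in> currents m"
  proof -
    obtain E where E: "E \<ge> 0" "\<And>\<eta> b. \<eta> \<in> smooth_forms m \<Longrightarrow> b \<ge> 0 \<Longrightarrow> C1_bound m (cball 0 (2 * r)) b \<eta> \<Longrightarrow>
      flat_bound m (E * b) (cut_form r (\<eta> :: 'a form))" using cut_flat_bound[OF r(1)] by blast
    show ?thesis
    proof (rule currentsI[OF \<Psi> compact_cball])
      show "0 \<le> E * ?b * A" using E(1) A(1) by simp
      fix \<eta> :: "'a form" and s :: real assume \<eta>: "\<eta> \<in> smooth_forms m" "s \<ge> 0" "C1_bound m (cball 0 (2 * r)) s \<eta>"
      have "level_bound m \<alpha> K j (E * s * ?b) \<eta>"
        by (rule level_bound_cut[OF \<eta>(1) r(2), THEN iffD1, OF level_bound_flat[OF cut_smooth_forms[OF \<eta>(1)] E(2)[OF \<eta>]]])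
          (use E(1) \<eta>(2) in simp)
      from b[OF \<eta>(1) this] show "\<Psi> \<eta> \<le> E * ?b * A * s" using E(1) \<eta>(2) by (simp add: ac_simps)
    qed
  qed
  have "\<Psi> \<in> normal_currents m \<and> nmass m \<Psi> \<le> ?a * A + ?a * A"
  proof -
    have 1: "\<Psi> \<omega> \<le> ?a * A" if "\<omega> \<in> smooth_forms m" "form_bound m 1 \<omega>" for \<omega>
    proof -
      have "level_bound m \<alpha> K j ?a \<omega>" unfolding level_bound_def
      proof
        fix S assume S: "S \<in> level m \<alpha> K j"
        show "\<bar>S \<omega>\<bar> \<le> ?a" using nmass_bound[OF levelD(2)[OF S] that] levelD(6)[OF S] by simp
      qed
      then show ?thesis using b[OF that(1), of ?a] by simp
    qed
    have 2: "\<Psi> (ext_deriv n \<beta>) \<le> ?a * A" if "m = Suc n" "\<beta> \<in> smooth_forms n" "form_bound n 1 \<beta>" for n \<beta>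
    proof -
      have "\<bar>S (ext_deriv n \<beta>)\<bar> \<le> ?a" if S: "S \<in> level m \<alpha> K j" for S
        using nmass_boundary_bound[of S n \<beta> 1] levelD(2,6)[OF S] \<open>m = Suc n\<close> \<open>\<beta> \<in> smooth_forms n\<close> \<open>form_bound n 1 \<beta>\<close> by simp
      then have "level_bound m \<alpha> K j ?a (ext_deriv n \<beta>)" unfolding level_bound_def by blast
      moreover have "ext_deriv n \<beta> \<in> smooth_forms m" using that ext_deriv_smooth_forms by blast
      ultimately show ?thesis using b[of "ext_deriv n \<beta>" ?a] by simp
    qed
    have nn: "?a * A \<ge> 0" using A(1) by simp
    show ?thesis using normal_currentsI(1)[OF cur 1 2 nn] normal_currentsI(2)[OF cur 1 2 nn] by (rule conjI)
  qed
  then have n: "\<Psi> \<in> normal_currents m" "nmass m \<Psi> \<le> 2 * (?a * A)" unfolding mult_2 by (rule conjunct1, rule conjunct2)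
  have "normal_flat_norm m \<Psi> \<le> ereal (?b * A)" unfolding normal_flat_norm_le
  proof (intro ballI impI)
    fix \<omega> :: "'a form" assume \<omega>: "\<omega> \<in> smooth_forms m" "flat_bound m 1 \<omega>"
    have "level_bound m \<alpha> K j (1 * ?b) \<omega>" by (rule level_bound_flat[OF \<omega>]) simp
    from b[OF \<omega>(1) this] show "\<Psi> \<omega> \<le> ?b * A" by simp
  qed
  then have f: "fnorm m \<Psi> \<le> ?b * A" by (rule finite_fnorm(3)[OF \<Psi>])
  have "spt m \<Psi> \<subseteq> K"
  proof (rule spt_subsetI[OF compact_imp_closed[OF K]])
    fix \<omega> :: "'a form" assume \<omega>: "\<omega> \<in> smooth_forms m" "form_support \<omega> \<inter> K = {}"
    have "S \<omega> = 0" if S: "S \<in> level m \<alpha> K j" for S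
      by (rule current_vanish[OF levelD(4)[OF S] \<omega>(1)]) (use levelD(5)[OF S] \<omega>(2) in blast)
    then have "level_bound m \<alpha> K j 0 \<omega>" unfolding level_bound_def by simp
    then show "\<Psi> \<omega> = 0" using b[OF \<omega>(1), of 0] by simp
  qed
  then show "\<Psi> \<in> normal_currents_in m K" using n by (simp add: normal_currents_in_def)
  have "frac_weight m \<alpha> \<Psi> \<le> (2 * (?a * A)) powr (1 - \<alpha>) * (?b * A) powr \<alpha>"
    unfolding frac_weight_def
    using n f nmass_nonneg[OF n(1)] normal_fnorm(2)[OF n(1)] \<alpha> by (intro mult_mono powr_mono2) auto
  also have "\<dots> = 2 powr (1 - \<alpha>) * (A powr (1 - \<alpha>) * A powr \<alpha>) * (?a powr (1 - \<alpha>) * ?b powr \<alpha>)"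
    using A(1) by (simp add: powr_mult)
  \<comment> \<open>The exponents \<alpha> (1 - \<alpha>) j and -(1 - \<alpha>) \<alpha> j add up to
    0: the bound for the weight is the same on all levels.\<close>
  also have "?a powr (1 - \<alpha>) * ?b powr \<alpha> = 1"
    by (simp add: powr_powr powr_add[symmetric] algebra_simps)
  also have "A powr (1 - \<alpha>) * A powr \<alpha> = A" using A(1) by (cases "A = 0") (auto simp: powr_add[symmetric])
  also have "2 powr (1 - \<alpha>) * A * 1 \<le> 2 * A" using powr_mono[of "1 - \<alpha>" 1 2] \<alpha> A(1) by (simp add: mult_right_mono)
  finally show "frac_weight m \<alpha> \<Psi> \<le> 2 * A" .
qed

lemma charge_norm_le:
  assumes "0 \<le> C" "\<And>T. T \<in> normal_currents_in m K \<Longrightarrow> \<bar>\<omega> T\<bar> \<le> C * frac_weight m \<alpha> T"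
  shows "charge_norm m \<alpha> K \<omega> \<le> C"
  unfolding charge_norm_def by (rule cInf_lower) (use assms in \<open>auto intro: bdd_belowI[of _ 0]\<close>)

(* Extend diag eta |-> Phi eta by Hahn-Banach to all bounded sequences (eta_j) of forms, with respect
   to the supremum over j of |S eta_j|, S in level j. The restriction of the extension to the j-th
   entry is a normal current T_j, and Phi = sum_j T_j because the tails of diag eta tend to 0. *)
lemma frac_decomposition_exists:
  assumes \<alpha>: "0 < \<alpha>" "\<alpha> < 1" and K: "compact K" and \<Phi>: "\<Phi> \<in> linear_functionals (smooth_forms m)"
    and B: "B \<ge> 0" "\<And>\<eta>. \<eta> \<in> smooth_forms m \<Longrightarrow> \<bar>\<Phi> \<eta>\<bar> \<le> B * charge_norm m \<alpha> K (charge_of_form m K \<eta>)"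
  obtains Ts where "frac_decomposition m \<alpha> Ts \<Phi>" "\<And>k. Ts k \<in> normal_currents_in m K"
    "(\<Sum>k. frac_weight m \<alpha> (Ts k)) \<le> 4 * B" "\<Phi> \<in> frac_currents_in m \<alpha> K"
proof -
  obtain r where r: "r > 0" "K \<subseteq> ball 0 r" using compact_subset_ball[OF K] by blast
  let ?b = "\<lambda>j::nat. 2 powr (- (1 - \<alpha>) * real j)"
  have b1: "?b j \<le> 1" for j using powr_mono[of "- (1 - \<alpha>) * real j" 0 2] \<alpha> by (simp add: mult_nonpos_nonneg)
  have bmono: "?b j \<le> ?b n" if "n \<le> j" for n j using that \<alpha> by (intro powr_mono mult_left_mono_neg) auto
  have b0: "?b \<longlonglongrightarrow> 0"
  proof -
    have "?b = (\<lambda>j. (2 powr (- (1 - \<alpha>))) ^ j)" by (simp add: powr_realpow[symmetric] powr_powr)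
    moreover have "2 powr (- (1 - \<alpha>)) < 1" using powr_less_mono[of "- (1 - \<alpha>)" 0 2] \<alpha> by simp
    ultimately show ?thesis by (simp add: LIMSEQ_power_zero)
  qed
  define V :: "(nat \<Rightarrow> 'a form) set" where
    "V = {y. (\<forall>j. y j \<in> smooth_forms m) \<and> (\<exists>c. \<forall>j. level_bound m \<alpha> K j c (y j))}"
  define Q :: "(nat \<Rightarrow> 'a form) \<Rightarrow> real set" where
    "Q y = {\<bar>S (y j)\<bar> | j S. S \<in> level m \<alpha> K j}" for y
  define p where "p y = Sup (Q y)" for y
  \<comment> \<open>The current 0 keeps the sets Q y nonempty, so that upper bounds of their
    elements bound p.\<close>
  have z: "0 \<in> level m \<alpha> K j" for j by (rule zero_in_level[OF compact_imp_closed[OF K]])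
  have Qne: "Q y \<noteq> {}" for y using z unfolding Q_def by blast
  have p_le: "p y \<le> c" if "\<And>j. level_bound m \<alpha> K j c (y j)" for y c
    unfolding p_def by (rule cSup_least[OF Qne]) (use that in \<open>auto simp: Q_def level_bound_def\<close>)
  have p_ge: "level_bound m \<alpha> K j (p y) (y j)" if "y \<in> V" for y j
  proof -
    have "bdd_above (Q y)" using that unfolding V_def Q_def level_bound_def bdd_above_def by blast
    then show ?thesis unfolding level_bound_def p_def by (auto intro!: cSup_upper simp: Q_def)
  qed
  have p_nn: "p y \<ge> 0" if "y \<in> V" for y using p_ge[OF that, of 0] z[of 0] by (fastforce simp: level_bound_def)
  have lb_add: "level_bound m \<alpha> K j (c + d) (x + y)" if "x \<in> smooth_forms m" "y \<in> smooth_forms m" "level_bound m \<alpha> K j c x" "level_bound m \<alpha> K j d y" for j c d x y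
    unfolding level_bound_def
  proof
    fix S assume S: "S \<in> level m \<alpha> K j"
    have "S (x + y) = S x + S y" by (rule linear_functionals_add[OF levelD(3)[OF S] that(1,2)])
    then show "\<bar>S (x + y)\<bar> \<le> c + d" using that(3,4) S unfolding level_bound_def by fastforce
  qed
  have V: "subspace V" unfolding subspace_def
  proof (intro conjI ballI allI)
    show "0 \<in> V" unfolding V_def
      by (auto simp: smooth_forms_zero level_bound_def functional_zero[OF levelD(3)] intro: exI[of _ 0])
    fix x y assume xy: "x \<in> V" "y \<in> V"
    then have s: "x j \<in> smooth_forms m" "y j \<in> smooth_forms m" for j by (auto simp: V_def)
    show "x + y \<in> V" unfolding V_def using s lb_add[OF s p_ge[OF xy(1)] p_ge[OF xy(2)]]
      by (auto simp: smooth_forms_add)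
  next
    fix c x assume x: "x \<in> V"
    then have s: "x j \<in> smooth_forms m" for j by (auto simp: V_def)
    have "(c *\<^sub>R x) j = c *\<^sub>R x j" for j by (simp add: scaleR_fun_def)
    then show "c *\<^sub>R x \<in> V" unfolding V_def using s level_bound_scaleR[OF s p_ge[OF x], where a=c]
      by (auto simp: smooth_forms_scaleR)
  qed
  have p_add: "p (x + y) \<le> p x + p y" if xy: "x \<in> V" "y \<in> V" for x y
    by (rule p_le) (use lb_add[OF _ _ p_ge[OF xy(1)] p_ge[OF xy(2)]] xy in \<open>auto simp: V_def\<close>)
  have p_scale: "p (t *\<^sub>R x) = t * p x" if x: "x \<in> V" and t: "t \<ge> 0" for t x
  proof -
    have le: "p (t *\<^sub>R x) \<le> t * p x" if x: "x \<in> V" and t: "t \<ge> 0" for t x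
      by (rule p_le) (use level_bound_scaleR[OF _ p_ge[OF x], where a=t] x t in \<open>auto simp: V_def scaleR_fun_def[of t x]\<close>)
    show ?thesis
    proof (cases "t = 0")
      case True
      then show ?thesis using le[OF x t] p_nn[OF subspace_scale[OF V x, of t]] by simp
    next
      case False
      have "p ((1 / t) *\<^sub>R (t *\<^sub>R x)) \<le> (1 / t) * p (t *\<^sub>R x)"
        by (rule le) (use subspace_scale[OF V x] t in auto)
      then show ?thesis using le[OF x t] False t by (simp add: field_simps)
    qed
  qed
  define W where "W = (\<lambda>\<eta> (j::nat). \<eta>) ` (smooth_forms m :: 'a form set)"
  have diagV: "(\<lambda>j. \<eta>) \<in> V" if \<eta>: "\<eta> \<in> smooth_forms m" for \<eta>
  proof -
    obtain c where c: "c \<ge> 0" "flat_bound m c (cut_form r \<eta>)" using cut_flat_bound_exists[OF r(1) \<eta>] by blast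
    have "level_bound m \<alpha> K j c \<eta>" for j
    proof -
      have "level_bound m \<alpha> K j (c * ?b j) \<eta>"
        using level_bound_flat[OF cut_smooth_forms[OF \<eta>] c(2,1)] level_bound_cut[OF \<eta> r(2)] by blast
      then show ?thesis by (rule level_bound_mono) (use b1[of j] c(1) in \<open>simp add: mult_left_le\<close>)
    qed
    then show ?thesis unfolding V_def using \<eta> by blast
  qed
  have WV: "W \<subseteq> V" unfolding W_def using diagV by blast
  have W: "subspace W" unfolding subspace_def
  proof (intro conjI ballI allI)
    have "0 = (\<lambda>j::nat. 0 :: 'a form)" by (simp add: fun_eq_iff)
    then show "0 \<in> W" unfolding W_def using smooth_forms_zero[of m] by (rule image_eqI)
    fix x y assume "x \<in> W" "y \<in> W"
    then obtain \<eta> \<zeta> where \<eta>: "\<eta> \<in> smooth_forms m" "x = (\<lambda>j. \<eta>)" "\<zeta> \<in> smooth_forms m" "y = (\<lambda>j. \<zeta>)" unfolding W_def by blast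
    have "x + y = (\<lambda>j. \<eta> + \<zeta>)" unfolding \<eta>(2,4) by (simp add: plus_fun_def)
    then show "x + y \<in> W" unfolding W_def using smooth_forms_add[OF \<eta>(1,3)] by blast
  next
    fix c x assume "x \<in> W"
    then obtain \<eta> where \<eta>: "\<eta> \<in> smooth_forms m" "x = (\<lambda>j. \<eta>)" unfolding W_def by blast
    have "c *\<^sub>R x = (\<lambda>j. c *\<^sub>R \<eta>)" unfolding \<eta>(2) by (simp add: scaleR_fun_def)
    then show "c *\<^sub>R x \<in> W" unfolding W_def using smooth_forms_scaleR[OF \<eta>(1)] by blast
  qed
  define f where "f y = \<Phi> (y 0)" for y :: "nat \<Rightarrow> 'a form"
  \<comment> \<open>The factor 2 is the one of \<open>level_bound_frac_weight\<close>.\<close>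
  have fp: "\<bar>\<Phi> \<eta>\<bar> \<le> 2 * B * p (\<lambda>j. \<eta>)" if \<eta>: "\<eta> \<in> smooth_forms m" for \<eta>
  proof -
    have "charge_norm m \<alpha> K (charge_of_form m K \<eta>) \<le> 2 * p (\<lambda>j. \<eta>)"
    proof (rule charge_norm_le)
      show "0 \<le> 2 * p (\<lambda>j. \<eta>)" using p_nn[OF diagV[OF \<eta>]] by simp
      fix T assume T: "T \<in> normal_currents_in m K"
      show "\<bar>charge_of_form m K \<eta> T\<bar> \<le> 2 * p (\<lambda>j. \<eta>) * frac_weight m \<alpha> T"
        using level_bound_frac_weight[OF \<alpha> K \<eta> T p_nn[OF diagV[OF \<eta>]] p_ge[OF diagV[OF \<eta>]]] T by (simp add: charge_of_form_def)
    qed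
    then have "B * charge_norm m \<alpha> K (charge_of_form m K \<eta>) \<le> B * (2 * p (\<lambda>j. \<eta>))" using B(1) by (rule mult_left_mono)
    then show ?thesis using B(2)[OF \<eta>] by simp
  qed
  obtain g where g: "\<And>x y. x \<in> V \<Longrightarrow> y \<in> V \<Longrightarrow> g (x + y) = g x + g y" "\<And>t x. x \<in> V \<Longrightarrow> g (t *\<^sub>R x) = t * g x"
    "\<And>x. x \<in> W \<Longrightarrow> g x = f x" "\<And>x. x \<in> V \<Longrightarrow> g x \<le> 2 * B * p x"
  proof (rule hahn_banach[OF V W WV, of "\<lambda>x. 2 * B * p x" f])
    show "2 * B * p (x + y) \<le> 2 * B * p x + 2 * B * p y" if "x \<in> V" "y \<in> V" for x y
      using mult_left_mono[OF p_add[OF that], of "2 * B"] B(1) by (simp add: algebra_simps)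
    show "2 * B * p (t *\<^sub>R x) = t * (2 * B * p x)" if "x \<in> V" "t \<ge> 0" for t x using p_scale[OF that] by simp
    show "f (x + y) = f x + f y" if "x \<in> W" "y \<in> W" for x y
      using that linear_functionals_add[OF \<Phi>] by (auto simp: W_def f_def)
    show "f (t *\<^sub>R x) = t * f x" if "x \<in> W" for t x
      using that linear_functionals_scaleR[OF \<Phi>] by (auto simp: W_def f_def scaleR_fun_def[of t x])
    show "f x \<le> 2 * B * p x" if "x \<in> W" for x
      using that fp by (fastforce simp: W_def f_def)
  qed blast
  have gabs: "\<bar>g x\<bar> \<le> 2 * B * p x" if x: "x \<in> V" for x
  proof -
    have m: "(-1) *\<^sub>R x \<in> V" using subspace_scale[OF V x] .
    have "p ((-1) *\<^sub>R x) \<le> p x" by (rule p_le) (use level_bound_scaleR[OF _ p_ge[OF x], where a="-1"] x in \<open>auto simp: V_def\<close>)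
    then have "2 * B * p ((-1) *\<^sub>R x) \<le> 2 * B * p x" using B(1) by (intro mult_left_mono) auto
    moreover have "g ((-1) *\<^sub>R x) = - g x" using g(2)[OF x, of "-1"] by simp
    ultimately show ?thesis using g(4)[OF x] g(4)[OF m] by linarith
  qed
  define e where "e j \<eta> = (\<lambda>i. if i = j then \<eta> else (0::'a form))" for j :: nat and \<eta> :: "'a form"
  have lb0: "level_bound m \<alpha> K i c 0" if "c \<ge> 0" for i c
    using that by (simp add: level_bound_def functional_zero[OF levelD(3)])
  have eV: "e j \<eta> \<in> V" if \<eta>: "\<eta> \<in> smooth_forms m" for j \<eta>
  proof -
    have "level_bound m \<alpha> K i (p (\<lambda>j. \<eta>)) (e j \<eta> i)" for i
      using p_ge[OF diagV[OF \<eta>], of i] lb0[OF p_nn[OF diagV[OF \<eta>]]] unfolding e_def by (cases "i = j") simp_all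
    moreover have "e j \<eta> i \<in> smooth_forms m" for i using \<eta> by (simp add: e_def smooth_forms_zero)
    ultimately show ?thesis unfolding V_def by blast
  qed
  define \<Psi> where "\<Psi> j \<eta> = (if \<eta> \<in> smooth_forms m then g (e j \<eta>) else 0)" for j \<eta>
  have \<Psi>lin: "\<Psi> j \<in> linear_functionals (smooth_forms m)" for j
  proof -
    have "e j (x + y) = e j x + e j y" for x y by (auto simp: e_def fun_eq_iff)
    moreover have "e j (c *\<^sub>R x) = c *\<^sub>R e j x" for c x by (auto simp: e_def fun_eq_iff scaleR_fun_def)
    ultimately show ?thesis unfolding linear_functionals_def \<Psi>_def
      using g(1)[OF eV eV] g(2)[OF eV] by (auto simp: smooth_forms_add smooth_forms_scaleR)
  qed
  \<comment> \<open>The norm of \<Psi> j dual to level j. The dual of a supremum over j is a sum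
    over j, which is why the A j turn out to be summable.\<close>
  define A where "A j = Sup {\<Psi> j \<eta> | \<eta>. \<eta> \<in> smooth_forms m \<and> level_bound m \<alpha> K j 1 \<eta>}" for j
  have sumV: "(\<Sum>j<n. e j (\<eta> j)) \<in> V" if "\<And>j. \<eta> j \<in> smooth_forms m" for \<eta> n
    by (intro subspace_sum V eV that)
  have gsum: "g (\<Sum>j<n. e j (\<eta> j)) = (\<Sum>j<n. \<Psi> j (\<eta> j))" if "\<And>j. \<eta> j \<in> smooth_forms m" for \<eta> n
  proof (induction n)
    case 0
    show ?case using g(2)[OF subspace_0[OF V], of 0] by (simp add: zero_fun_def)
  next
    case (Suc n)
    have "g (\<Sum>j<Suc n. e j (\<eta> j)) = g (\<Sum>j<n. e j (\<eta> j)) + g (e n (\<eta> n))"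
      unfolding sum.lessThan_Suc by (rule g(1)[OF sumV[OF that] eV[OF that]])
    then show ?case unfolding Suc sum.lessThan_Suc[of "\<lambda>j. \<Psi> j (\<eta> j)"] using that by (simp only: \<Psi>_def if_True)
  qed
  have sum_at: "(\<Sum>j<n. e j (\<eta> j)) i = (if i < n then \<eta> i else 0)" for \<eta> :: "nat \<Rightarrow> 'a form" and n i
    by (simp add: sum_fun_apply e_def)
  \<comment> \<open>The test forms can be chosen independently for each j, because their combined
    sequence still has p at most 1.\<close>
  have \<Psi>sum: "(\<Sum>j<n. \<Psi> j (\<eta> j)) \<le> 2 * B" if \<eta>: "\<And>j. \<eta> j \<in> smooth_forms m" "\<And>j. level_bound m \<alpha> K j 1 (\<eta> j)" for \<eta> n
  proof -
    have "p (\<Sum>j<n. e j (\<eta> j)) \<le> 1" by (rule p_le) (use \<eta>(2) lb0[of 1] in \<open>simp add: sum_at\<close>)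
    then have "2 * B * p (\<Sum>j<n. e j (\<eta> j)) \<le> 2 * B * 1" using B(1) by (intro mult_left_mono) auto
    then have "g (\<Sum>j<n. e j (\<eta> j)) \<le> 2 * B" using g(4)[OF sumV[of \<eta>, OF \<eta>(1)]] by (smt (verit))
    then show ?thesis unfolding gsum[of \<eta>, OF \<eta>(1)] .
  qed
  have Abdd: "\<Psi> j \<eta> \<le> 2 * B" if "\<eta> \<in> smooth_forms m" "level_bound m \<alpha> K j 1 \<eta>" for j \<eta>
  proof -
    let ?e = "\<lambda>i. if i = j then \<eta> else 0"
    have "(\<Sum>i<Suc j. \<Psi> i (?e i)) \<le> 2 * B"
      by (rule \<Psi>sum) (use that smooth_forms_zero lb0[of 1] in auto)
    moreover have "(\<Sum>i<Suc j. \<Psi> i (?e i)) = (\<Sum>i<Suc j. if i = j then \<Psi> j \<eta> else 0)"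
      by (rule sum.cong) (auto simp: functional_zero[OF \<Psi>lin])
    ultimately show ?thesis by simp
  qed
  have A: "\<Psi> j \<eta> \<le> A j" if "\<eta> \<in> smooth_forms m" "level_bound m \<alpha> K j 1 \<eta>" for j \<eta>
    unfolding A_def by (rule cSup_upper) (use that Abdd in \<open>auto intro!: bdd_aboveI[of _ "2 * B"]\<close>)
  have A0: "A j \<ge> 0" for j using A[OF smooth_forms_zero lb0[of 1], of j] by (simp add: functional_zero[OF \<Psi>lin])
  have Asum: "(\<Sum>j<n. A j) \<le> 2 * B" for n
  proof (rule field_le_epsilon)
    fix \<epsilon> :: real assume \<epsilon>: "\<epsilon> > 0"
    \<comment> \<open>Each of the n suprema is approached up to an equal share of \<epsilon>; n + 1
      avoids division by 0.\<close>
    define d where "d = \<epsilon> / (real n + 1)"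
    have d: "d > 0" "real n * d \<le> \<epsilon>" using \<epsilon> by (auto simp: d_def field_simps)
    have "\<exists>\<eta>. \<eta> \<in> smooth_forms m \<and> level_bound m \<alpha> K j 1 \<eta> \<and> A j - d < \<Psi> j \<eta>" for j
    proof -
      have "A j - d < Sup {\<Psi> j \<eta> | \<eta>. \<eta> \<in> smooth_forms m \<and> level_bound m \<alpha> K j 1 \<eta>}" using d(1) by (simp add: A_def)
      from less_cSupD[OF _ this] show ?thesis using smooth_forms_zero lb0[of 1] by auto
    qed
    then obtain \<eta> where \<eta>: "\<And>j. \<eta> j \<in> smooth_forms m" "\<And>j. level_bound m \<alpha> K j 1 (\<eta> j)" "\<And>j. A j - d < \<Psi> j (\<eta> j)" by metis
    have "(\<Sum>j<n. A j) \<le> (\<Sum>j<n. \<Psi> j (\<eta> j) + d)" by (rule sum_mono) (use \<eta>(3) in \<open>auto simp: less_imp_le algebra_simps\<close>)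
    also have "\<dots> \<le> 2 * B + real n * d" using \<Psi>sum[where \<eta>=\<eta> and n=n, OF \<eta>(1,2)] by (simp add: sum.distrib)
    also have "\<dots> \<le> 2 * B + \<epsilon>" using d(2) by simp
    finally show "(\<Sum>j<n. A j) \<le> 2 * B + \<epsilon>" .
  qed
  note lf = level_functional[OF \<alpha> K \<Psi>lin A0 A]
  \<comment> \<open>A factor 2 from \<open>level_functional\<close> times the bound 2 B for the sum
    of the A j.\<close>
  have wsum: "(\<Sum>j<n. frac_weight m \<alpha> (\<Psi> j)) \<le> 4 * B" for n
    using sum_mono[of "{..<n}" "\<lambda>j. frac_weight m \<alpha> (\<Psi> j)" "\<lambda>j. 2 * A j"] lf(2) Asum[of n] by (simp add: sum_distrib_left[symmetric])
  have summ: "summable (\<lambda>j. frac_weight m \<alpha> (\<Psi> j))"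
    by (rule summableI_nonneg_bounded[where x="4 * B"]) (use frac_weight_nonneg wsum in auto)
  let ?P = "\<lambda>n. \<Sum>j<n. \<Psi> j"
  have PN: "?P n \<in> normal_currents_in m K" for n by (intro normal_currents_in_sum compact_imp_closed K lf(1))
  \<comment> \<open>On all of V the extension g need not be determined by its entries \<Psi> j. On a
    constant sequence it is, since the remainder vanishes before place n and is small on all levels
    from n on.\<close>
  have tail: "\<bar>(\<Phi> - ?P n) \<eta>\<bar> \<le> 2 * B * (c * ?b n)" if \<eta>: "\<eta> \<in> smooth_forms m" and c: "c \<ge> 0" "\<And>j. level_bound m \<alpha> K j (c * ?b j) \<eta>" for n \<eta> c
  proof -
    have s: "(\<Sum>j<n. e j \<eta>) \<in> V" using sumV[of "\<lambda>_. \<eta>"] \<eta> by simp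
    let ?t = "(\<lambda>j. \<eta>) - (\<Sum>j<n. e j \<eta>)"
    have t: "?t \<in> V" by (intro subspace_diff V diagV \<eta> s)
    have "g (\<lambda>j. \<eta>) = g (?t + (\<Sum>j<n. e j \<eta>))" by simp
    also have "\<dots> = g ?t + g (\<Sum>j<n. e j \<eta>)" by (rule g(1)[OF t s])
    finally have "g ?t = \<Phi> \<eta> - (\<Sum>j<n. \<Psi> j \<eta>)"
      using g(3)[of "\<lambda>j. \<eta>"] gsum[where \<eta>="\<lambda>_. \<eta>" and n=n] \<eta> by (simp add: W_def f_def)
    then have "(\<Phi> - ?P n) \<eta> = g ?t" by (simp add: sum_fun_apply)
    moreover have "p ?t \<le> c * ?b n"
    proof (rule p_le)
      fix j
      have "?t j = (if j < n then 0 else \<eta>)" using sum_at[where \<eta>="\<lambda>_. \<eta>"] by simp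
      moreover have "level_bound m \<alpha> K j (c * ?b n) \<eta>" if "\<not> j < n"
        by (rule level_bound_mono[OF c(2)]) (use bmono[of n j] that c(1) in \<open>simp add: mult_left_mono\<close>)
      ultimately show "level_bound m \<alpha> K j (c * ?b n) (?t j)" using lb0[of "c * ?b n"] c(1) by simp
    qed
    ultimately show ?thesis using gabs[OF t] B(1) mult_left_mono[of "p ?t" "c * ?b n" "2 * B"] by simp
  qed
  have lbcut: "\<exists>c\<ge>0. \<forall>j. level_bound m \<alpha> K j (c * ?b j) \<eta>" if \<eta>: "\<eta> \<in> smooth_forms m" for \<eta>
    using cut_flat_bound_exists[OF r(1) \<eta>] level_bound_flat[OF cut_smooth_forms[OF \<eta>]] level_bound_cut[OF \<eta> r(2)] by meson
  have F: "normal_flat_norm m (\<Phi> - ?P n) \<le> ereal (2 * B * ?b n)" for n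
    unfolding normal_flat_norm_le
  proof (intro ballI impI)
    fix \<omega> :: "'a form" assume \<omega>: "\<omega> \<in> smooth_forms m" "flat_bound m 1 \<omega>"
    show "(\<Phi> - ?P n) \<omega> \<le> 2 * B * ?b n"
      using tail[OF \<omega>(1), of 1 n] level_bound_flat[OF \<omega>, of \<alpha> K] by simp
  qed
  have Pl: "?P n \<in> linear_functionals (smooth_forms m)" for n using normal_currents_linear normal_currents_inD(1)[OF PN] by blast
  have dl: "\<Phi> - ?P n \<in> linear_functionals (smooth_forms m)" for n by (intro linear_functionals_minus \<Phi> Pl)
  have small: "\<exists>N. \<forall>n\<ge>N. 2 * B * ?b n < \<epsilon>" if "\<epsilon> > 0" for \<epsilon>
    using order_tendstoD(2)[OF tendsto_mult_right_zero[OF b0, of "2 * B"] that] by (simp add: eventually_sequentially)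
  have ap: "flat_approximation m ?P \<Phi>" unfolding flat_approximation_def
  proof (intro conjI)
    show "\<forall>n. ?P n \<in> normal_currents m" using normal_currents_inD(1)[OF PN] by blast
    show "\<forall>\<epsilon>>0. \<exists>N. \<forall>i\<ge>N. \<forall>j\<ge>N. normal_flat_norm m (?P i - ?P j) < ereal \<epsilon>"
    proof (intro allI impI)
      fix \<epsilon> :: real assume "\<epsilon> > 0"
      then obtain N where N: "\<forall>n\<ge>N. 2 * B * ?b n < \<epsilon> / 2" using small[of "\<epsilon> / 2"] by auto
      have "normal_flat_norm m (?P i - ?P j) < ereal \<epsilon>" if "i \<ge> N" "j \<ge> N" for i j
      proof -
        have 1: "normal_flat_norm m ((\<Phi> - ?P j) - (\<Phi> - ?P i)) \<le> ereal (2 * B * ?b j + 2 * B * ?b i)"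
          by (rule fnorm_triangle(2)[OF dl dl F F])
        have 2: "(\<Phi> - ?P j) - (\<Phi> - ?P i) = ?P i - ?P j" by (simp add: algebra_simps)
        have "2 * B * ?b j + 2 * B * ?b i < \<epsilon>"
          using N[rule_format, OF that(1)] N[rule_format, OF that(2)] by linarith
        then have "ereal (2 * B * ?b j + 2 * B * ?b i) < ereal \<epsilon>" by simp
        with 1[unfolded 2] show ?thesis by (rule le_less_trans)
      qed
      then show "\<exists>N. \<forall>i\<ge>N. \<forall>j\<ge>N. normal_flat_norm m (?P i - ?P j) < ereal \<epsilon>" by blast
    qed
    have "(\<Union>n. spt m (?P n)) \<subseteq> K" using normal_currents_inD(3)[OF PN] by blast
    then have "closure (\<Union>n. spt m (?P n)) \<subseteq> K" by (rule closure_minimal[OF _ compact_imp_closed[OF K]])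
    then show "compact (closure (\<Union>n. spt m (?P n)))"
      using compact_Int_closed[OF K closed_closure, of "\<Union>n. spt m (?P n)"] by (simp add: inf.absorb2)
    show "\<forall>\<omega>\<in>smooth_forms m. (\<lambda>n. ?P n \<omega>) \<longlonglongrightarrow> \<Phi> \<omega>"
    proof
      fix \<omega> :: "'a form" assume \<omega>: "\<omega> \<in> smooth_forms m"
      obtain c where c: "c \<ge> 0" "\<And>j. level_bound m \<alpha> K j (c * ?b j) \<omega>" using lbcut[OF \<omega>] by blast
      have z: "(\<lambda>n. 2 * B * (c * ?b n)) \<longlonglongrightarrow> 0" by (intro tendsto_mult_right_zero b0)
      have "(\<lambda>n. (\<Phi> - ?P n) \<omega>) \<longlonglongrightarrow> 0"
        by (rule Lim_null_comparison[OF _ z], rule always_eventually, unfold real_norm_def, rule allI, rule tail[OF \<omega> c])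
      then have "(\<lambda>n. \<Phi> \<omega> - (\<Phi> - ?P n) \<omega>) \<longlonglongrightarrow> \<Phi> \<omega> - 0" by (intro tendsto_intros)
      then show "(\<lambda>n. ?P n \<omega>) \<longlonglongrightarrow> \<Phi> \<omega>" by simp
    qed
  qed
  have cur: "\<Phi> \<in> currents m"
  proof -
    obtain E where E: "E \<ge> 0" "\<And>\<eta> b. \<eta> \<in> smooth_forms m \<Longrightarrow> b \<ge> 0 \<Longrightarrow> C1_bound m (cball 0 (2 * r)) b \<eta> \<Longrightarrow>
      flat_bound m (E * b) (cut_form r (\<eta> :: 'a form))" using cut_flat_bound[OF r(1)] by blast
    show ?thesis
    proof (rule currentsI[OF \<Phi> compact_cball])
      show "0 \<le> 2 * B * E" using E(1) B(1) by simp
      fix \<eta> :: "'a form" and s :: real assume \<eta>: "\<eta> \<in> smooth_forms m" "s \<ge> 0" "C1_bound m (cball 0 (2 * r)) s \<eta>"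
      have l: "level_bound m \<alpha> K j (E * s * ?b j) \<eta>" for j
        by (rule level_bound_cut[OF \<eta>(1) r(2), THEN iffD1, OF level_bound_flat[OF cut_smooth_forms[OF \<eta>(1)] E(2)[OF \<eta>]]])
          (use E(1) \<eta>(2) in simp)
      \<comment> \<open>With n = 0 the estimate of the tail bounds \<Phi> itself.\<close>
      from tail[OF \<eta>(1) _ l, of 0] show "\<Phi> \<eta> \<le> 2 * B * E * s" using E(1) \<eta>(2) by (simp add: mult.assoc)
    qed
  qed
  have fl: "\<Phi> \<in> flat_currents m" using cur ap by (auto simp: flat_currents_def)
  have dec: "frac_decomposition m \<alpha> \<Psi> \<Phi>" unfolding frac_decomposition_def
  proof (intro conjI)
    show "\<exists>C. compact C \<and> (\<forall>k. \<Psi> k \<in> normal_currents_in m C)" using K lf(1) by blast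
    show "summable (\<lambda>k. frac_weight m \<alpha> (\<Psi> k))" by (rule summ)
    have "flat_norm m (\<Phi> - ?P n) = fnorm m (\<Phi> - ?P n)" for n
      by (rule flat_norm_eq(1)[OF dl flat_approximation_minus[OF ap _ _ K]]) (use normal_currents_inD[OF PN] in auto)
    moreover have "(\<lambda>n. fnorm m (\<Phi> - ?P n)) \<longlonglongrightarrow> 0"
      by (rule tendsto_sandwich[OF _ _ tendsto_const tendsto_mult_right_zero[OF b0, of "2 * B"]])
        (use finite_fnorm[OF dl F] in auto)
    ultimately show "(\<lambda>n. flat_norm m (\<Phi> - ?P n)) \<longlonglongrightarrow> 0" by simp
  qed
  have "spt m \<Phi> \<subseteq> K"
  proof -
    have "(\<Union>n. spt m (?P n)) \<subseteq> K" using normal_currents_inD(3)[OF PN] by blast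
    then have "closure (\<Union>n. spt m (?P n)) \<subseteq> K" by (rule closure_minimal[OF _ compact_imp_closed[OF K]])
    then show ?thesis using spt_flat[OF ap] by blast
  qed
  then have "\<Phi> \<in> frac_currents_in m \<alpha> K" using fl dec by (auto simp: frac_currents_in_def frac_currents_def)
  moreover have "(\<Sum>k. frac_weight m \<alpha> (\<Psi> k)) \<le> 4 * B" by (rule suminf_le_const[OF summ wsum])
  ultimately show thesis using that dec lf(1) by blast
qed

section \<open>Flat currents carried by an affine subspace\<close>

lemma smooth_lipschitz_on_ball:
  assumes "smooth f"
  shows "\<exists>L\<ge>0. \<forall>x\<in>cball a r. \<forall>y\<in>cball a r. \<bar>f x - f y\<bar> \<le> L * norm (x - y)"
proof -
  obtain L where L: "L \<ge> 0" "\<forall>x\<in>cball a r. \<forall>u. \<bar>frechet_derivative f (at x) u\<bar> \<le> L * norm u"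
    using smooth_deriv_bound_compact[OF assms compact_cball] by blast
  have "norm (f x - f y) \<le> L * norm (x - y)" if "x \<in> cball a r" "y \<in> cball a r" for x y
  proof (rule differentiable_bound[OF convex_cball _ _ that(1,2)])
    show "(f has_derivative frechet_derivative f (at z)) (at z within cball a r)" for z
      by (rule has_derivative_at_withinI[OF smooth_has_derivative[OF assms]])
    show "onorm (frechet_derivative f (at z)) \<le> L" if "z \<in> cball a r" for z
      by (rule onorm_le) (use L that in auto)
  qed
  then show ?thesis using L(1) by auto
qed

text \<open>The cutoff is constant on both sides of a compact interval, and on that interval its
  derivative is bounded by continuity.\<close>

lemma cutoff_deriv_bound:
  obtains s where "s \<ge> 0" "\<And>t h. \<bar>frechet_derivative cutoff (at t) h\<bar> \<le> s * \<bar>h\<bar>"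
    "\<And>t. t > 2 \<Longrightarrow> frechet_derivative cutoff (at t) = (\<lambda>h. 0)"
proof -
  obtain s where s: "s \<ge> 0" "\<forall>t\<in>cball 0 2. \<forall>u. \<bar>frechet_derivative cutoff (at t) u\<bar> \<le> s * norm u"
    using smooth_deriv_bound_compact[OF smooth_cutoff compact_cball] by blast
  have 2: "frechet_derivative cutoff (at t) = (\<lambda>h. 0)" if "t > 2" for t
    by (rule frechet_derivative_const_on_open[of "{2<..}"]) (use that cutoff_0 in auto)
  have 1: "frechet_derivative cutoff (at t) = (\<lambda>h. 0)" if "t < 1" for t
    by (rule frechet_derivative_const_on_open[of "{..<1}"]) (use that cutoff_1 in auto)
  have "\<bar>frechet_derivative cutoff (at t) h\<bar> \<le> s * \<bar>h\<bar>" for t h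
  proof (cases "t \<in> cball 0 2")
    case False
    then have "t > 2 \<or> t < 1" by (auto simp: dist_real_def)
    then show ?thesis using 1[of t] 2[of t] s(1) by auto
  qed (use s in auto)
  then show ?thesis using that s(1) 2 by blast
qed

(* The gradient 1/delta of the cutoff is compensated by |zeta| <= L |u|, u = (x - c) . e, so that the
   bound on d theta does not depend on delta. *)
lemma hyperplane_cutoff:
  fixes e c :: "'a::euclidean_space"
  assumes e: "norm e = 1" and r: "r > 0" and \<zeta>: "\<zeta> \<in> smooth_forms k"
    and L: "L \<ge> 0" "\<And>x v. x \<in> cball 0 (2 * r) \<Longrightarrow> (\<And>i. i < k \<Longrightarrow> norm (v i) \<le> 1) \<Longrightarrow> \<bar>\<zeta> x v\<bar> \<le> L * \<bar>(x - c) \<bullet> e\<bar>"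
  obtains C where "C \<ge> 0" "\<And>\<delta>. 0 < \<delta> \<Longrightarrow> \<exists>\<theta>\<in>smooth_forms k.
      (\<forall>x v. x \<in> ball 0 r \<and> \<bar>(x - c) \<bullet> e\<bar> < \<delta> \<longrightarrow> \<theta> x v = \<zeta> x v) \<and>
      form_bound k (C * \<delta>) \<theta> \<and> form_bound (Suc k) C (ext_deriv k \<theta>)"
proof -
  obtain s where s: "s \<ge> 0" "\<And>t h. \<bar>frechet_derivative cutoff (at t) h\<bar> \<le> s * \<bar>h\<bar>"
    "\<And>t. t > 2 \<Longrightarrow> frechet_derivative cutoff (at t) = (\<lambda>h. 0)" using cutoff_deriv_bound by blast
  obtain b where b: "b \<ge> 0" "flat_bound k b (cut_form r \<zeta>)" using cut_flat_bound_exists[OF r \<zeta>] by blast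
  let ?u = "\<lambda>x. (x - c) \<bullet> e"
  \<comment> \<open>The term 2 L comes from |u| \<le> 2 \<delta> where h is nonzero, b from the
    differential of the truncated form, and 8 s L from the product of the gradient bound 4 s /
    \<delta> of h with L * 2 \<delta>.\<close>
  define C where "C = 2 * L + b + real (Suc k) * (8 * s * L)"
  have C: "C \<ge> 0" "2 * L \<le> C" using L(1) b(1) s(1) by (auto simp: C_def)
  have cs: "cut_form r \<zeta> \<in> smooth_forms k" by (rule cut_smooth_forms[OF \<zeta>])
  have cL: "\<bar>cut_form r \<zeta> x v\<bar> \<le> L * \<bar>?u x\<bar>" if "\<And>i. i < k \<Longrightarrow> norm (v i) \<le> 1" for x v
  proof (cases "x \<in> cball 0 (2 * r)")
    case True
    have "\<bar>cut_form r \<zeta> x v\<bar> \<le> 1 * \<bar>\<zeta> x v\<bar>" unfolding cut_form_def abs_mult by (intro mult_right_mono abs_bump_le_1) simp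
    also have "\<bar>\<zeta> x v\<bar> \<le> L * \<bar>?u x\<bar>" by (rule L(2)[OF True that])
    finally show ?thesis by simp
  next
    case False
    then have "bump 0 r x = 0" by (intro bump_0 r) auto
    then show ?thesis using L(1) by (simp add: cut_form_def)
  qed
  have main: "\<exists>\<theta>\<in>smooth_forms k. (\<forall>x v. x \<in> ball 0 r \<and> \<bar>?u x\<bar> < \<delta> \<longrightarrow> \<theta> x v = \<zeta> x v) \<and>
      form_bound k (C * \<delta>) \<theta> \<and> form_bound (Suc k) C (ext_deriv k \<theta>)" if \<delta>: "0 < \<delta>" for \<delta>
  proof -
    define h where "h x = cutoff ((?u x / \<delta>)\<^sup>2)" for x
    have sq: "(?u x / \<delta>)\<^sup>2 = (x \<bullet> e - c \<bullet> e) * (x \<bullet> e - c \<bullet> e) * (1 / \<delta>\<^sup>2)" for x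
      by (simp add: power2_eq_square inner_diff_left)
    have sq_smooth: "smooth (\<lambda>x. (?u x / \<delta>)\<^sup>2)" unfolding sq
      by (intro smooth_mult smooth_diff smooth_inner smooth_const)
    have hs: "smooth h" unfolding h_def[abs_def] by (rule smooth_compose_real[OF smooth_cutoff sq_smooth])
    have h01: "\<bar>h x\<bar> \<le> 1" for x unfolding h_def using cutoff_range by (simp add: abs_le_iff order.trans[of "- _" 0])
    have h0: "h x = 0" if "\<bar>?u x\<bar> > 2 * \<delta>" for x
    proof -
      have "2\<^sup>2 \<le> (\<bar>?u x\<bar> / \<delta>)\<^sup>2" by (rule power_mono) (use that \<delta> in \<open>auto simp: field_simps\<close>)
      then show ?thesis unfolding h_def by (intro cutoff_0) (simp add: power_divide)
    qed
    have h1: "h x = 1" if "\<bar>?u x\<bar> < \<delta>" for x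
    proof -
      have "(\<bar>?u x\<bar> / \<delta>)\<^sup>2 \<le> 1\<^sup>2" by (rule power_mono) (use that \<delta> in \<open>auto simp: field_simps\<close>)
      then show ?thesis unfolding h_def by (intro cutoff_1) (simp add: power_divide)
    qed
    have dh: "frechet_derivative h (at x) w = frechet_derivative cutoff (at ((?u x / \<delta>)\<^sup>2)) (2 * ?u x * (w \<bullet> e) / \<delta>\<^sup>2)" for x w
    proof -
      have 1: "((\<lambda>x. (?u x / \<delta>)\<^sup>2) has_derivative (\<lambda>w. 2 * ?u x * (w \<bullet> e) / \<delta>\<^sup>2)) (at x)"
        unfolding power2_eq_square using \<delta> by (auto intro!: derivative_eq_intros simp: fun_eq_iff field_simps)
      have "(h has_derivative (\<lambda>w. frechet_derivative cutoff (at ((?u x / \<delta>)\<^sup>2)) (2 * ?u x * (w \<bullet> e) / \<delta>\<^sup>2))) (at x)"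
        unfolding h_def[abs_def] by (rule has_derivative_compose[OF 1 smooth_has_derivative[OF smooth_cutoff]])
      from frechet_derivative_at[OF this] show ?thesis by (simp add: fun_eq_iff)
    qed
    have dh0: "frechet_derivative h (at x) w = 0" if "\<bar>?u x\<bar> > 2 * \<delta>" for x w
    proof -
      have "2\<^sup>2 \<le> (\<bar>?u x\<bar> / \<delta>)\<^sup>2" by (rule power_mono) (use that \<delta> in \<open>auto simp: field_simps\<close>)
      then have "(?u x / \<delta>)\<^sup>2 > 2" by (simp add: power_divide)
      then show ?thesis unfolding dh using s(3) by simp
    qed
    have dhb: "\<bar>frechet_derivative h (at x) w\<bar> \<le> 4 * s / \<delta> * norm w" if "\<bar>?u x\<bar> \<le> 2 * \<delta>" for x w
    proof -
      have "\<bar>2 * ?u x * (w \<bullet> e) / \<delta>\<^sup>2\<bar> \<le> 2 * (2 * \<delta>) * norm w / \<delta>\<^sup>2"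
      proof -
        have "\<bar>w \<bullet> e\<bar> \<le> norm w" using Cauchy_Schwarz_ineq2[of w e] e by simp
        then have "2 * \<bar>?u x\<bar> * \<bar>w \<bullet> e\<bar> \<le> 2 * (2 * \<delta>) * norm w" using that \<delta> by (intro mult_mono) auto
        then show ?thesis by (simp add: abs_mult divide_right_mono)
      qed
      also have "\<dots> = 4 / \<delta> * norm w" using \<delta> by (simp add: power2_eq_square)
      finally have "s * \<bar>2 * ?u x * (w \<bullet> e) / \<delta>\<^sup>2\<bar> \<le> s * (4 / \<delta> * norm w)" using s(1) by (rule mult_left_mono)
      then show ?thesis unfolding dh using s(2)[of "(?u x / \<delta>)\<^sup>2" "2 * ?u x * (w \<bullet> e) / \<delta>\<^sup>2"] by (simp add: ac_simps)
    qed
    let ?\<theta> = "\<lambda>x v. h x * cut_form r \<zeta> x v"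
    show ?thesis
    proof (intro bexI conjI allI impI)
      show "?\<theta> \<in> smooth_forms k" by (rule smooth_forms_mult[OF hs cs])
      fix x v assume "x \<in> ball 0 r \<and> \<bar>?u x\<bar> < \<delta>"
      then show "h x * cut_form r \<zeta> x v = \<zeta> x v" using h1[of x] bump_1[of x 0 r] by (simp add: cut_form_def)
    next
      show "form_bound k (C * \<delta>) ?\<theta>"
      proof (rule form_boundI)
        fix x :: 'a and v :: "nat \<Rightarrow> 'a" assume v: "\<And>i. i < k \<Longrightarrow> norm (v i) \<le> 1"
        show "\<bar>h x * cut_form r \<zeta> x v\<bar> \<le> C * \<delta>"
        proof (cases "\<bar>?u x\<bar> > 2 * \<delta>")
          case True then show ?thesis using h0 C \<delta> by simp
        next
          case False
          have "\<bar>h x * cut_form r \<zeta> x v\<bar> \<le> 1 * (L * \<bar>?u x\<bar>)" unfolding abs_mult by (intro mult_mono h01 cL v) auto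
          also have "\<dots> \<le> L * (2 * \<delta>)" using False L(1) by (simp add: mult_left_mono)
          also have "\<dots> \<le> C * \<delta>" using mult_right_mono[OF C(2), of \<delta>] \<delta> by (simp add: ac_simps)
          finally show ?thesis .
        qed
      qed
      show "form_bound (Suc k) C (ext_deriv k ?\<theta>)"
      proof (rule form_boundI)
        fix x :: 'a and v :: "nat \<Rightarrow> 'a" assume v: "\<And>i. i < Suc k \<Longrightarrow> norm (v i) \<le> 1"
        have eb: "\<bar>ext_deriv k (cut_form r \<zeta>) x v\<bar> \<le> b" using b(2) v unfolding flat_bound_def by (blast intro: form_boundD)
        show "\<bar>ext_deriv k ?\<theta> x v\<bar> \<le> C"
        proof (cases "\<bar>?u x\<bar> > 2 * \<delta>")
          case True
          have "\<bar>ext_deriv k ?\<theta> x v\<bar> \<le> 1 * b + real (Suc k) * (0 * (L * \<bar>?u x\<bar>))"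
            by (rule ext_deriv_mult_bound[OF hs cs v order.refl _ h01 eb cL]) (use dh0[OF True] in auto)
          then show ?thesis using C_def L(1) s(1) by (simp add: add_increasing2)
        next
          case False
          then have u: "\<bar>?u x\<bar> \<le> 2 * \<delta>" by simp
          have "\<bar>ext_deriv k ?\<theta> x v\<bar> \<le> 1 * b + real (Suc k) * (4 * s / \<delta> * (L * \<bar>?u x\<bar>))"
            by (rule ext_deriv_mult_bound[OF hs cs v _ dhb[OF u] h01 eb cL]) (use s \<delta> in auto)
          also have "\<dots> \<le> 1 * b + real (Suc k) * (4 * s / \<delta> * (L * (2 * \<delta>)))"
            using u L(1) s(1) \<delta> by (intro add_left_mono mult_left_mono) auto
          also have "\<dots> = b + real (Suc k) * (8 * s * L)" using \<delta> by simp
          also have "\<dots> \<le> C" using C_def L(1) by simp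
          finally show ?thesis .
        qed
      qed
    qed
  qed
  show thesis by (rule that[OF C(1) main])
qed

text \<open>A flat current may have infinite mass, so T \<theta> cannot be estimated by the comass
  of \<theta>. The value of a normal approximation Us N at \<theta> is small with \<delta>, and T -
  Us N is controlled by the flat bound of \<theta>, which does not grow as \<delta> tends to
  0.\<close>

lemma flat_vanish_limit:
  assumes T: "T \<in> linear_functionals (smooth_forms m)" and ap: "flat_approximation m Us T" and C: "C \<ge> 0"
    and app: "\<And>\<delta>. 0 < \<delta> \<Longrightarrow> \<exists>\<theta>\<in>smooth_forms m. flat_bound m (C * max 1 \<delta>) \<theta> \<and> T \<theta> = t \<and> (\<forall>n. \<bar>Us n \<theta>\<bar> \<le> C * \<delta> * nmass m (Us n))"
  shows "t = 0"
proof -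
  have "\<bar>t\<bar> \<le> 0"
  proof (rule field_le_epsilon)
    fix \<epsilon> :: real assume \<epsilon>: "\<epsilon> > 0"
    define \<epsilon>' where "\<epsilon>' = \<epsilon> / (2 * (C + 1))"
    have \<epsilon>': "\<epsilon>' > 0" "C * \<epsilon>' \<le> \<epsilon> / 2" unfolding \<epsilon>'_def using \<epsilon> C by (auto simp: field_simps)
    obtain N where N: "normal_flat_norm m (T - Us N) \<le> ereal \<epsilon>'" using flat_tail[OF T ap \<epsilon>'(1)] by blast
    let ?M = "nmass m (Us N)"
    have M: "?M \<ge> 0" by (rule nmass_nonneg[OF flat_approximation_normal[OF ap]])
    \<comment> \<open>Chosen after N, since it depends on the mass of Us N, and capped at 1 so that
      \<open>max 1 \<delta>\<close> is 1.\<close>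
    define \<delta> where "\<delta> = min 1 (\<epsilon> / (2 * (C * ?M + 1)))"
    have \<delta>: "\<delta> > 0" "\<delta> \<le> 1" unfolding \<delta>_def using \<epsilon> C M by (auto simp: add_nonneg_pos)
    have "C * ?M * \<delta> \<le> C * ?M * (\<epsilon> / (2 * (C * ?M + 1)))" unfolding \<delta>_def using C M by (intro mult_left_mono) auto
    also have "C * ?M * (\<epsilon> / (2 * (C * ?M + 1))) = \<epsilon> / 2 * (C * ?M / (C * ?M + 1))" by simp
    also have "\<dots> \<le> \<epsilon> / 2 * 1" using \<epsilon> C M by (intro mult_left_mono) (auto simp: divide_le_eq add_nonneg_pos)
    finally have \<delta>2: "C * \<delta> * ?M \<le> \<epsilon> / 2" by (simp add: ac_simps)
    obtain \<theta> where \<theta>: "\<theta> \<in> smooth_forms m" "flat_bound m (C * max 1 \<delta>) \<theta>" "T \<theta> = t" "\<bar>Us N \<theta>\<bar> \<le> C * \<delta> * ?M"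
      using app[OF \<delta>(1)] by blast
    have "max 1 \<delta> = 1" using \<delta> by simp
    then have fb: "flat_bound m C \<theta>" using \<theta>(2) by simp
    have "\<bar>(T - Us N) \<theta>\<bar> \<le> C * \<epsilon>'"
      by (rule fnorm_bound[OF linear_functionals_minus[OF T normal_currents_linear[OF flat_approximation_normal[OF ap]]] N \<theta>(1) fb C])
    then show "\<bar>t\<bar> \<le> 0 + \<epsilon>" using \<theta>(3,4) \<epsilon>'(2) \<delta>2 by simp
  qed
  then show ?thesis by simp
qed

text \<open>The form \<theta> of \<open>hyperplane_cutoff\<close> agrees with \<zeta> near the
  support of T, has small comass and a differential of bounded comass. In the first case the normal
  approximations are estimated by mass, in the second by boundary mass; there the flat bound of
  d\<theta> involves no further derivative since d d = 0.\<close>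

lemma flat_vanish_on_hyperplane:
  fixes e c :: "'a::euclidean_space"
  assumes T: "T \<in> flat_currents m" and K: "spt m T \<subseteq> K" "compact K" and e: "norm e = 1" and Ke: "\<And>x. x \<in> K \<Longrightarrow> (x - c) \<bullet> e = 0"
    and \<zeta>: "\<zeta> \<in> smooth_forms k"
    and L: "\<And>r. r > 0 \<Longrightarrow> \<exists>L\<ge>0. \<forall>x v. x \<in> cball 0 (2 * r) \<and> (\<forall>i<k. norm (v i) \<le> 1) \<longrightarrow> \<bar>\<zeta> x v\<bar> \<le> L * \<bar>(x - c) \<bullet> e\<bar>"
  shows "m = k \<Longrightarrow> T \<zeta> = 0" "m = Suc k \<Longrightarrow> T (ext_deriv k \<zeta>) = 0"
proof -
  obtain Us where ap: "flat_approximation m Us T" and Tc: "T \<in> currents m" using T by (auto simp: flat_currents_def)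
  obtain r where r: "r > 0" "K \<subseteq> ball 0 r" using compact_subset_ball[OF K(2)] by blast
  obtain L where L': "L \<ge> 0" "\<And>x v. x \<in> cball 0 (2 * r) \<Longrightarrow> (\<And>i. i < k \<Longrightarrow> norm (v i) \<le> 1) \<Longrightarrow> \<bar>\<zeta> x v\<bar> \<le> L * \<bar>(x - c) \<bullet> e\<bar>"
    using L[OF r(1)] by blast
  obtain C where C: "C \<ge> 0" "\<And>\<delta>. 0 < \<delta> \<Longrightarrow> \<exists>\<theta>\<in>smooth_forms k.
      (\<forall>x v. x \<in> ball 0 r \<and> \<bar>(x - c) \<bullet> e\<bar> < \<delta> \<longrightarrow> \<theta> x v = \<zeta> x v) \<and>
      form_bound k (C * \<delta>) \<theta> \<and> form_bound (Suc k) C (ext_deriv k \<theta>)"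
    using hyperplane_cutoff[OF e r(1) \<zeta> L'] by blast
  let ?U = "\<lambda>\<delta>. ball 0 r \<inter> {x. \<bar>(x - c) \<bullet> e\<bar> < \<delta>}"
  have U: "open (?U \<delta>)" for \<delta> by (intro open_Int open_ball open_Collect_less continuous_intros)
  have sU: "spt m T \<subseteq> ?U \<delta>" if "\<delta> > 0" for \<delta> using K(1) r(2) Ke that by force
  note n = flat_approximation_normal[OF ap]
  show "T \<zeta> = 0" if mk: "m = k"
  proof (rule flat_vanish_limit[OF currents_linear[OF Tc] ap C(1)])
    fix \<delta> :: real assume \<delta>: "0 < \<delta>"
    obtain \<theta> where \<theta>: "\<theta> \<in> smooth_forms k" "\<forall>x v. x \<in> ball 0 r \<and> \<bar>(x - c) \<bullet> e\<bar> < \<delta> \<longrightarrow> \<theta> x v = \<zeta> x v"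
      "form_bound k (C * \<delta>) \<theta>" "form_bound (Suc k) C (ext_deriv k \<theta>)" using C(2)[OF \<delta>] by blast
    have "flat_bound m (C * max 1 \<delta>) \<theta>" unfolding flat_bound_def mk
      using form_bound_mono[OF \<theta>(3), of "C * max 1 \<delta>"] form_bound_mono[OF \<theta>(4), of "C * max 1 \<delta>"] C(1) \<delta>
      by (simp add: mult_left_mono mult_le_cancel_left1)
    moreover have "T \<theta> = T \<zeta>"
      by (rule current_cong[OF Tc _ _ U sU[OF \<delta>]]) (use \<theta>(1,2) \<zeta> mk in auto)
    moreover have "\<bar>Us n \<theta>\<bar> \<le> C * \<delta> * nmass m (Us n)" for n
      by (rule nmass_bound[OF n]) (use \<theta> mk C(1) \<delta> in auto)
    ultimately show "\<exists>\<theta>\<in>smooth_forms m. flat_bound m (C * max 1 \<delta>) \<theta> \<and> T \<theta> = T \<zeta> \<and> (\<forall>n. \<bar>Us n \<theta>\<bar> \<le> C * \<delta> * nmass m (Us n))"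
      using \<theta>(1) mk by blast
  qed
  show "T (ext_deriv k \<zeta>) = 0" if mk: "m = Suc k"
  proof (rule flat_vanish_limit[OF currents_linear[OF Tc] ap C(1)])
    fix \<delta> :: real assume \<delta>: "0 < \<delta>"
    obtain \<theta> where \<theta>: "\<theta> \<in> smooth_forms k" "\<forall>x v. x \<in> ball 0 r \<and> \<bar>(x - c) \<bullet> e\<bar> < \<delta> \<longrightarrow> \<theta> x v = \<zeta> x v"
      "form_bound k (C * \<delta>) \<theta>" "form_bound (Suc k) C (ext_deriv k \<theta>)" using C(2)[OF \<delta>] by blast
    have d: "ext_deriv k \<theta> \<in> smooth_forms m" "ext_deriv k \<zeta> \<in> smooth_forms m"
      using ext_deriv_smooth_forms[OF \<theta>(1)] ext_deriv_smooth_forms[OF \<zeta>] mk by auto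
    have Cm: "0 \<le> C * max 1 \<delta>" "C \<le> C * max 1 \<delta>" using C(1) \<delta> by (auto simp: mult_le_cancel_left1)
    have "flat_bound m (C * max 1 \<delta>) (ext_deriv k \<theta>)" unfolding flat_bound_def
    proof
      show "form_bound m (C * max 1 \<delta>) (ext_deriv k \<theta>)" using form_bound_mono[OF \<theta>(4) Cm(2)] mk by simp
      show "form_bound (Suc m) (C * max 1 \<delta>) (ext_deriv m (ext_deriv k \<theta>))"
        unfolding form_bound_def mk ext_deriv_ext_deriv[OF \<theta>(1)] using Cm(1) by simp
    qed
    moreover have "T (ext_deriv k \<theta>) = T (ext_deriv k \<zeta>)"
    proof (rule current_cong[OF Tc d U sU[OF \<delta>]])
      fix x v assume x: "x \<in> ?U \<delta>"
      have "dform \<theta> x u w = dform \<zeta> x u w" for u w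
      proof (rule dform_eqI)
        have "((\<lambda>y. \<zeta> y w) has_derivative (\<lambda>u. dform \<zeta> x u w)) (at x)" by (rule dform_has_derivative[OF \<zeta>])
        then show "((\<lambda>y. \<theta> y w) has_derivative (\<lambda>u. dform \<zeta> x u w)) (at x)"
          by (rule has_derivative_transform_within_open[OF _ U x]) (use \<theta>(2) in auto)
      qed
      then show "ext_deriv k \<theta> x v = ext_deriv k \<zeta> x v" by (simp add: ext_deriv_eq)
    qed
    moreover have "\<bar>Us n (ext_deriv k \<theta>)\<bar> \<le> C * \<delta> * nmass m (Us n)" for n
      using nmass_boundary_bound[OF n[unfolded mk] \<theta>(1,3)] C(1) \<delta> mk by simp
    ultimately show "\<exists>\<theta>\<in>smooth_forms m. flat_bound m (C * max 1 \<delta>) \<theta> \<and> T \<theta> = T (ext_deriv k \<zeta>) \<and> (\<forall>n. \<bar>Us n \<theta>\<bar> \<le> C * \<delta> * nmass m (Us n))"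
      using d(1) by blast
  qed
qed

section \<open>Projection onto an affine subspace\<close>

lemma has_derivative_affine: "bounded_linear A \<Longrightarrow> frechet_derivative (\<lambda>x. a + A x) (at x) = A"
  by (rule frechet_derivative_at[symmetric]) (auto intro!: derivative_eq_intros bounded_linear_imp_has_derivative)

lemma smooth_map_affine: "bounded_linear A \<Longrightarrow> smooth_map (\<lambda>x. a + A x)"
  unfolding smooth_map_def inner_add_left
  by (intro ballI smooth_add smooth_const smooth_bounded_linear bounded_linear_compose[OF bounded_linear_inner_left])

(* With u = (x - c) . e and gamma = i_e eta, the form eta minus its pullback by the projection P is
   zeta + d(u gamma) - u d gamma, where zeta, u gamma and u d gamma vanish on the hyperplane u = 0. *)
lemma flat_current_project_direction:
  fixes e c :: "'a::euclidean_space"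
  assumes T: "T \<in> flat_currents m" and K: "spt m T \<subseteq> K" "compact K" and e: "norm e = 1" and Ke: "\<And>x. x \<in> K \<Longrightarrow> (x - c) \<bullet> e = 0"
    and \<eta>: "\<eta> \<in> smooth_forms m"
  shows "T \<eta> = T (pullback (\<lambda>x. x - ((x - c) \<bullet> e) *\<^sub>R e) \<eta>)"
proof -
  let ?\<pi> = "\<lambda>v. v - (v \<bullet> e) *\<^sub>R e" and ?P = "\<lambda>x. x - ((x - c) \<bullet> e) *\<^sub>R e" and ?u = "\<lambda>x. (x - c) \<bullet> e"
  have bl: "bounded_linear ?\<pi>"
    by (intro bounded_linear_sub bounded_linear_ident bounded_linear_compose[OF bounded_linear_scaleR_left bounded_linear_inner_left])
  have Pe: "?P = (\<lambda>x. (c \<bullet> e) *\<^sub>R e + ?\<pi> x)" by (simp add: fun_eq_iff algebra_simps)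
  have Ps: "smooth_map ?P" unfolding Pe by (rule smooth_map_affine[OF bl])
  have pb: "pullback ?P \<eta> x v = \<eta> (?P x) (\<lambda>j. ?\<pi> (v j))" for x v
    unfolding pullback_def unfolding Pe has_derivative_affine[OF bl] ..
  have pbs: "pullback ?P \<eta> \<in> smooth_forms m" by (rule pullback_smooth_forms[OF Ps \<eta>])
  have Tc: "T \<in> currents m" using T by (simp add: flat_currents_def)
  note Tl = currents_linear[OF Tc]
  have \<pi>norm: "norm (?\<pi> v) \<le> norm v" for v
  proof -
    have "(norm (?\<pi> v))\<^sup>2 = (norm v)\<^sup>2 - (v \<bullet> e)\<^sup>2"
      unfolding power2_norm_eq_inner using e
      by (simp add: inner_diff_left inner_diff_right inner_commute[of e v] norm_eq_1 power2_eq_square)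
    then have "(norm (?\<pi> v))\<^sup>2 \<le> (norm v)\<^sup>2" by simp
    then show ?thesis by (rule power2_le_imp_le) simp
  qed
  define \<zeta> where "\<zeta> = (\<lambda>x v. \<eta> x (\<lambda>j. ?\<pi> (v j)) - pullback ?P \<eta> x v)"
  have \<eta>\<pi>: "(\<lambda>x v. \<eta> x (\<lambda>j. ?\<pi> (v j))) \<in> smooth_forms m"
    by (rule smooth_formsI, rule covectors_compose[OF smooth_forms_covector[OF \<eta>] bounded_linear.linear[OF bl]], rule smooth_forms_smooth[OF \<eta>])
  have \<zeta>s: "\<zeta> \<in> smooth_forms m"
    using smooth_forms_diff[OF \<eta>\<pi> pbs] by (simp add: \<zeta>_def fun_diff_def)
  have T\<zeta>: "T \<zeta> = 0"
  proof (rule flat_vanish_on_hyperplane(1)[OF T K e Ke \<zeta>s _ refl])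
    fix r :: real assume r: "r > 0"
    \<comment> \<open>The point x has norm at most 2 r, and |u| is at most 2 r + |c|, so this ball
      contains both x and its projection.\<close>
    define \<rho> where "\<rho> = 4 * r + norm c"
    have "\<exists>L\<ge>0. \<forall>x\<in>cball 0 \<rho>. \<forall>y\<in>cball 0 \<rho>. \<bar>\<eta> x I - \<eta> y I\<bar> \<le> L * norm (x - y)" for I
      by (rule smooth_lipschitz_on_ball[OF smooth_forms_smooth[OF \<eta>]])
    then obtain L where L: "\<And>I. L I \<ge> 0" "\<And>I x y. x \<in> cball 0 \<rho> \<Longrightarrow> y \<in> cball 0 \<rho> \<Longrightarrow> \<bar>\<eta> x I - \<eta> y I\<bar> \<le> L I * norm (x - y)" by metis
    let ?S = "\<Sum>I\<in>basis_tuples m. L I"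
    have "\<bar>\<zeta> x v\<bar> \<le> ?S * \<bar>?u x\<bar>" if x: "x \<in> cball 0 (2 * r)" and v: "\<forall>i<m. norm (v i) \<le> 1" for x v
    proof -
      have ux: "\<bar>?u x\<bar> \<le> 2 * r + norm c"
        using Cauchy_Schwarz_ineq2[of "x - c" e] e norm_triangle_ineq4[of x c] x by simp
      have P: "norm (x - ?P x) = \<bar>?u x\<bar>" using e by simp
      have "norm (?P x) \<le> norm x + \<bar>?u x\<bar>" using norm_triangle_ineq4[of x "?u x *\<^sub>R e"] e by simp
      then have in\<rho>: "x \<in> cball 0 \<rho>" "?P x \<in> cball 0 \<rho>" using x ux r unfolding \<rho>_def by auto
      \<comment> \<open>The difference is taken as one covector, so that the Lipschitz bounds of its
        finitely many coefficients suffice.\<close>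
      let ?\<phi> = "\<lambda>w. \<eta> x w + (-1) * \<eta> (?P x) w"
      have "?\<phi> \<in> covectors m" by (intro covectors_add covectors_scale smooth_forms_covector[OF \<eta>])
      then have "\<bar>?\<phi> (\<lambda>j. ?\<pi> (v j))\<bar> \<le> (\<Sum>I\<in>basis_tuples m. \<bar>?\<phi> I\<bar>)"
        by (rule covector_bound) (use \<pi>norm v in \<open>meson order.trans\<close>)
      also have "\<dots> \<le> (\<Sum>I\<in>basis_tuples m. L I * \<bar>?u x\<bar>)"
        by (rule sum_mono) (use L(2)[OF in\<rho>] e in simp)
      finally show ?thesis unfolding \<zeta>_def pb by (simp add: sum_distrib_right)
    qed
    then show "\<exists>L\<ge>0. \<forall>x v. x \<in> cball 0 (2 * r) \<and> (\<forall>i<m. norm (v i) \<le> 1) \<longrightarrow> \<bar>\<zeta> x v\<bar> \<le> L * \<bar>?u x\<bar>"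
      using L(1) by (intro exI[of _ ?S]) (auto simp: sum_nonneg)
  qed
  show ?thesis
  proof (cases m)
    case 0
    \<comment> \<open>In degree 0 there are no slots to project, so \<zeta> is already the whole
      difference.\<close>
    have "\<eta> - pullback ?P \<eta> = \<zeta>"
    proof (intro ext)
      fix x v
      have "\<eta> x v = \<eta> x (\<lambda>j. ?\<pi> (v j))" by (rule covector_cong[OF smooth_forms_covector[OF \<eta>]]) (simp add: 0)
      then show "(\<eta> - pullback ?P \<eta>) x v = \<zeta> x v" by (simp add: \<zeta>_def)
    qed
    then show ?thesis using T\<zeta> form_functional_diff[OF Tl \<eta> pbs] by simp
  next
    case (Suc n)
    define \<gamma> where "\<gamma> = (\<lambda>x w. \<eta> x (case_nat e w))"
    have \<gamma>: "\<gamma> \<in> smooth_forms n" unfolding \<gamma>_def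
      by (rule smooth_formsI, rule covector_case_nat, use smooth_forms_covector[OF \<eta>] Suc in simp, rule smooth_forms_smooth[OF \<eta>])
    have us: "smooth ?u" by (auto intro: smooth_diff smooth_inner smooth_const simp: inner_diff_left)
    let ?\<beta> = "\<lambda>x w. ?u x * \<gamma> x w" and ?\<tau> = "\<lambda>x v. ?u x * ext_deriv n \<gamma> x v"
    have \<beta>: "?\<beta> \<in> smooth_forms n" by (rule smooth_forms_mult[OF us \<gamma>])
    have \<tau>: "?\<tau> \<in> smooth_forms m" using smooth_forms_mult[OF us ext_deriv_smooth_forms[OF \<gamma>]] Suc by simp
    have bound: "\<exists>L\<ge>0. \<forall>x v. x \<in> cball 0 (2 * r) \<and> (\<forall>i<k. norm (v i) \<le> 1) \<longrightarrow> \<bar>?u x * \<xi> x v\<bar> \<le> L * \<bar>?u x\<bar>"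
      if \<xi>: "\<xi> \<in> smooth_forms k" for \<xi> k and r :: real
    proof -
      obtain b where b: "b \<ge> 0" "C1_bound k (cball 0 (2 * r)) b \<xi>" using C1_bound_exists[OF compact_cball \<xi>] by blast
      have "\<bar>\<xi> x v\<bar> \<le> real (card (basis_tuples k :: (nat \<Rightarrow> 'a) set)) * b" if "x \<in> cball 0 (2 * r)" "\<forall>i<k. norm (v i) \<le> 1" for x v
        by (rule covector_bound_const[OF smooth_forms_covector[OF \<xi>]]) (use that b(2) in \<open>auto simp: C1_bound_def\<close>)
      then have "\<bar>?u x * \<xi> x v\<bar> \<le> (real (card (basis_tuples k :: (nat \<Rightarrow> 'a) set)) * b) * \<bar>?u x\<bar>" if "x \<in> cball 0 (2 * r)" "\<forall>i<k. norm (v i) \<le> 1" for x v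
        unfolding abs_mult using that by (subst mult.commute) (intro mult_right_mono, auto)
      then show ?thesis using b(1) by (intro exI[of _ "real (card (basis_tuples k :: (nat \<Rightarrow> 'a) set)) * b"]) auto
    qed
    have T\<tau>: "T ?\<tau> = 0"
      by (rule flat_vanish_on_hyperplane(1)[OF T K e Ke \<tau> _ refl])
        (assumption, unfold Suc, rule bound[OF ext_deriv_smooth_forms[OF \<gamma>]])
    have T\<beta>: "T (ext_deriv n ?\<beta>) = 0"
      by (rule flat_vanish_on_hyperplane(2)[OF T K e Ke \<beta> bound[OF \<gamma>] Suc])
    have du: "frechet_derivative ?u (at x) w = w \<bullet> e" for x w
    proof -
      have "(?u has_derivative (\<lambda>w. (w - 0) \<bullet> e)) (at x)"
        by (rule has_derivative_inner_left[OF has_derivative_diff[OF has_derivative_ident has_derivative_const]])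
      from fun_cong[OF frechet_derivative_at[OF this], of w] show ?thesis by simp
    qed
    have d\<beta>: "ext_deriv n ?\<beta> \<in> smooth_forms m" using ext_deriv_smooth_forms[OF \<beta>] Suc by simp
    \<comment> \<open>By the Leibniz rule, d(u \<gamma>) and u d\<gamma> differ by du \<and>
      \<gamma>. As du is the pairing with e, this is the part of \<eta> split off by
      \<open>covector_split_direction\<close>.\<close>
    have "\<eta> - pullback ?P \<eta> = (\<zeta> + ext_deriv n ?\<beta>) - ?\<tau>"
    proof (intro ext)
      fix x v
      have 1: "\<eta> x v = \<eta> x (\<lambda>j. ?\<pi> (v j)) + (\<Sum>i<m. (-1) ^ i * (v i \<bullet> e) * \<gamma> x (del i v))"
        unfolding \<gamma>_def by (rule covector_split_direction[OF smooth_forms_covector[OF \<eta>]])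
      have 2: "ext_deriv n ?\<beta> x v = ?\<tau> x v + (\<Sum>i<m. (-1) ^ i * (v i \<bullet> e) * \<gamma> x (del i v))"
        unfolding ext_deriv_mult[OF us \<gamma>] du Suc lessThan_Suc_atMost by (simp add: mult.assoc)
      show "(\<eta> - pullback ?P \<eta>) x v = ((\<zeta> + ext_deriv n ?\<beta>) - ?\<tau>) x v"
        using 1 2 by (simp add: \<zeta>_def)
    qed
    then have "T (\<eta> - pullback ?P \<eta>) = T \<zeta> + T (ext_deriv n ?\<beta>) - T ?\<tau>"
      using form_functional_diff[OF Tl smooth_forms_add[OF \<zeta>s d\<beta>] \<tau>] linear_functionals_add[OF Tl \<zeta>s d\<beta>] by simp
    then show ?thesis using T\<zeta> T\<tau> T\<beta> form_functional_diff[OF Tl \<eta> pbs] by simp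
  qed
qed

text \<open>For orthonormal E this is the orthogonal projection onto the complement of its span, and
  x |-> (c - proj E c) + proj E x is the projection onto the affine subspace through c orthogonal to
  E.\<close>

definition proj :: "'a::euclidean_space set \<Rightarrow> 'a \<Rightarrow> 'a" where
  "proj E v = v - (\<Sum>e\<in>E. (v \<bullet> e) *\<^sub>R e)"

lemma bounded_linear_proj: "bounded_linear (proj E)"
  unfolding proj_def[abs_def]
  by (intro bounded_linear_sub bounded_linear_ident bounded_linear_sum
      bounded_linear_compose[OF bounded_linear_scaleR_left bounded_linear_inner_left])

lemma proj_insert:
  assumes "finite E" "e \<notin> E" "\<And>f. f \<in> E \<Longrightarrow> e \<bullet> f = 0"
  shows "proj (insert e E) v = proj E (v - (v \<bullet> e) *\<^sub>R e)"
  using assms by (simp add: proj_def inner_diff_left algebra_simps)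

lemma pullback_affine: "bounded_linear A \<Longrightarrow> pullback (\<lambda>x. a + A x) \<eta> x v = \<eta> (a + A x) (\<lambda>j. A (v j))"
  unfolding pullback_def has_derivative_affine ..

text \<open>Induction over E, one direction at a time: as the directions are orthogonal, the single
  projections compose to the one for all of E.\<close>

lemma flat_current_project:
  assumes T: "T \<in> flat_currents m" and K: "spt m T \<subseteq> K" "compact K"
    and E: "finite E" "\<And>e. e \<in> E \<Longrightarrow> norm e = 1" "pairwise orthogonal E"
    and KE: "\<And>x e. x \<in> K \<Longrightarrow> e \<in> E \<Longrightarrow> (x - c) \<bullet> e = 0"
    and \<eta>: "\<eta> \<in> smooth_forms m"
  shows "T \<eta> = T (pullback (\<lambda>x. (c - proj E c) + proj E x) \<eta>)"
  using E KE
proof (induction E rule: finite_induct)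
  case empty
  have "pullback (\<lambda>x. (c - proj {} c) + proj {} x) \<eta> = \<eta>"
    unfolding pullback_affine[OF bounded_linear_proj, abs_def] by (simp add: proj_def)
  then show ?case by simp
next
  case (insert e E)
  let ?\<eta>' = "pullback (\<lambda>x. (c - proj E c) + proj E x) \<eta>"
  let ?P = "\<lambda>x. x - ((x - c) \<bullet> e) *\<^sub>R e"
  have o: "e \<bullet> f = 0" if "f \<in> E" for f
  proof -
    have "e \<noteq> f" using insert.hyps(2) that by blast
    then have "orthogonal e f" using pairwiseD[OF insert.prems(2), of e f] that by simp
    then show ?thesis by (simp add: orthogonal_def)
  qed
  have \<eta>': "?\<eta>' \<in> smooth_forms m" by (intro pullback_smooth_forms smooth_map_affine bounded_linear_proj \<eta>)
  have bl: "bounded_linear (\<lambda>v. v - (v \<bullet> e) *\<^sub>R e)"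
    by (intro bounded_linear_sub bounded_linear_ident bounded_linear_compose[OF bounded_linear_scaleR_left bounded_linear_inner_left])
  have Pe: "?P = (\<lambda>x. (c \<bullet> e) *\<^sub>R e + (x - (x \<bullet> e) *\<^sub>R e))" by (simp add: fun_eq_iff algebra_simps)
  have pe: "proj E e = e" using o by (simp add: proj_def)
  note lin = bounded_linear.linear[OF bounded_linear_proj[of E]]
  have pi: "proj (insert e E) v = proj E (v - (v \<bullet> e) *\<^sub>R e)" for v
    by (rule proj_insert[OF insert.hyps(1,2) o])
  have comp: "(c - proj (insert e E) c) + proj (insert e E) x = (c - proj E c) + proj E (?P x)" for x
    by (simp add: pi linear_diff[OF lin] linear_add[OF lin] linear_cmul[OF lin] pe algebra_simps)
  have "T \<eta> = T ?\<eta>'" using insert by (simp add: pairwise_insert)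
  also have "\<dots> = T (pullback ?P ?\<eta>')"
    by (rule flat_current_project_direction[OF T K _ _ \<eta>']) (use insert.prems in auto)
  also have "pullback ?P ?\<eta>' = pullback (\<lambda>x. (c - proj (insert e E) c) + proj (insert e E) x) \<eta>"
  proof (intro ext)
    fix x v
    have "pullback ?P ?\<eta>' x v = ?\<eta>' ((c \<bullet> e) *\<^sub>R e + (x - (x \<bullet> e) *\<^sub>R e)) (\<lambda>j. v j - (v j \<bullet> e) *\<^sub>R e)"
      unfolding Pe by (rule pullback_affine[OF bl])
    also have "(c \<bullet> e) *\<^sub>R e + (x - (x \<bullet> e) *\<^sub>R e) = ?P x" by (simp add: algebra_simps)
    also have "?\<eta>' (?P x) (\<lambda>j. v j - (v j \<bullet> e) *\<^sub>R e) = \<eta> ((c - proj E c) + proj E (?P x)) (\<lambda>j. proj E (v j - (v j \<bullet> e) *\<^sub>R e))"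
      unfolding pullback_affine[OF bounded_linear_proj] ..
    also have "\<dots> = pullback (\<lambda>x. (c - proj (insert e E) c) + proj (insert e E) x) \<eta> x v"
      by (rule sym, rule trans[OF pullback_affine[OF bounded_linear_proj]], unfold comp, unfold pi, rule refl)
    finally show "pullback ?P ?\<eta>' x v = pullback (\<lambda>x. (c - proj (insert e E) c) + proj (insert e E) x) \<eta> x v" .
  qed
  finally show ?case .
qed

section \<open>Pushforward\<close>

definition pushforward :: "nat \<Rightarrow> ('a::euclidean_space \<Rightarrow> 'a) \<Rightarrow> 'a current \<Rightarrow> 'a current" where
  "pushforward m f T = (\<lambda>\<eta>. if \<eta> \<in> smooth_forms m then T (pullback f \<eta>) else 0)"

text \<open>Comass is tested on vectors of norm at most 1, and the derivative of f sends these to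
  vectors of the same kind.\<close>

lemma pullback_form_bound:
  assumes "\<And>x h. norm (frechet_derivative f (at x) h) \<le> norm h" "form_bound m c \<omega>"
  shows "form_bound m c (pullback f \<omega>)"
  unfolding form_bound_def pullback_def
  by (intro allI impI form_boundD[OF assms(2)]) (use assms(1) order.trans in blast)

text \<open>Pullback along f preserves comass bounds and commutes with d, so none of mass, boundary
  mass and flat norm increases. As f has values in K, the pulled back form depends only on \<eta>
  over K; this gives both the support in K and the continuity criterion over K.\<close>

lemma pushforward_frac:
  assumes f: "smooth_map f" "\<And>x. f x \<in> K" "\<And>x h. norm (frechet_derivative f (at x) h) \<le> norm h" and K: "compact K"
    and \<alpha>: "0 < \<alpha>" "\<alpha> < 1" and T: "T \<in> normal_currents m"
  shows "pushforward m f T \<in> normal_currents_in m K" "frac_weight m \<alpha> (pushforward m f T) \<le> frac_weight m \<alpha> T"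
proof -
  let ?S = "pushforward m f T"
  note Tl = normal_currents_linear[OF T]
  note pbs = pullback_smooth_forms[OF f(1)]
  have add: "pullback f (\<omega> + \<eta>) = pullback f \<omega> + pullback f \<eta>" for \<omega> \<eta> by (simp add: pullback_def plus_fun_def)
  have scale: "pullback f (a *\<^sub>R \<omega>) = a *\<^sub>R pullback f \<omega>" for a \<omega> by (auto simp: pullback_def scaleR_fun_def)
  have lin: "?S \<in> linear_functionals (smooth_forms m)"
    unfolding linear_functionals_def pushforward_def
    by (auto simp: smooth_forms_add smooth_forms_scaleR add scale linear_functionals_add[OF Tl pbs pbs] linear_functionals_scaleR[OF Tl pbs])
  let ?n = "real (card (basis_tuples m :: (nat \<Rightarrow> 'a) set))"
  have cur: "?S \<in> currents m"
  proof (rule currentsI[OF lin K])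
    show "0 \<le> ?n * nmass m T" using nmass_nonneg[OF T] by simp
    fix \<eta> :: "'a form" and b :: real assume \<eta>: "\<eta> \<in> smooth_forms m" "b \<ge> 0" "C1_bound m K b \<eta>"
    have "form_bound m (?n * b) (pullback f \<eta>)"
    proof (rule form_boundI)
      fix x :: 'a and v :: "nat \<Rightarrow> 'a" assume v: "\<And>i. i < m \<Longrightarrow> norm (v i) \<le> 1"
      show "\<bar>pullback f \<eta> x v\<bar> \<le> ?n * b" unfolding pullback_def
      proof (rule covector_bound_const[OF smooth_forms_covector[OF \<eta>(1)]])
        show "norm (frechet_derivative f (at x) (v i)) \<le> 1" if "i < m" for i
          by (rule order.trans[OF f(3) v[OF that]])
      qed (use f(2) \<eta>(3) in \<open>auto simp: C1_bound_def\<close>)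
    qed
    from nmass_bound[OF T pbs[OF \<eta>(1)] this] show "?S \<eta> \<le> ?n * nmass m T * b"
      using \<eta>(1,2) by (simp add: pushforward_def ac_simps)
  qed
  from nmass_split[OF T] obtain a b where ab: "nmass m T = a + b" "a \<ge> 0" "b \<ge> 0"
    "\<And>\<omega>. \<omega> \<in> smooth_forms m \<Longrightarrow> form_bound m 1 \<omega> \<Longrightarrow> T \<omega> \<le> a"
    "\<And>n \<beta>. m = Suc n \<Longrightarrow> \<beta> \<in> smooth_forms n \<Longrightarrow> form_bound n 1 \<beta> \<Longrightarrow> T (ext_deriv n \<beta>) \<le> b" by metis
  have 1: "?S \<omega> \<le> a" if "\<omega> \<in> smooth_forms m" "form_bound m 1 \<omega>" for \<omega>
    using ab(4)[OF pbs[OF that(1)] pullback_form_bound[OF f(3) that(2)]] that(1) by (simp add: pushforward_def)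
  have 2: "?S (ext_deriv n \<beta>) \<le> b" if "m = Suc n" "\<beta> \<in> smooth_forms n" "form_bound n 1 \<beta>" for n \<beta>
    using ab(5)[OF that(1) pbs[OF that(2)] pullback_form_bound[OF f(3) that(3)]] ext_deriv_smooth_forms[OF that(2)] that(1)
    by (simp add: pushforward_def ext_deriv_pullback[OF f(1) that(2)])
  have n: "?S \<in> normal_currents m" by (rule normal_currentsI(1)[OF cur 1 2 ab(3)])
  have N: "nmass m ?S \<le> nmass m T" unfolding ab(1) by (rule normal_currentsI(2)[OF cur 1 2 ab(3)])
  have "normal_flat_norm m ?S \<le> ereal (fnorm m T)" unfolding normal_flat_norm_le
  proof (intro ballI impI)
    fix \<omega> :: "'a form" assume \<omega>: "\<omega> \<in> smooth_forms m" "flat_bound m 1 \<omega>"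
    have "flat_bound m 1 (pullback f \<omega>)" using \<omega>(2) unfolding flat_bound_def ext_deriv_pullback[OF f(1) \<omega>(1)]
      using pullback_form_bound[OF f(3)] by blast
    from normal_fnorm_bound[OF T pbs[OF \<omega>(1)] this] show "?S \<omega> \<le> fnorm m T" using \<omega>(1) by (simp add: pushforward_def)
  qed
  then have F: "fnorm m ?S \<le> fnorm m T" by (rule finite_fnorm(3)[OF lin])
  show "frac_weight m \<alpha> ?S \<le> frac_weight m \<alpha> T" unfolding frac_weight_def
    using N F nmass_nonneg[OF n] normal_fnorm(2)[OF n] \<alpha> by (intro mult_mono powr_mono2) auto
  have "spt m ?S \<subseteq> K"
  proof (rule spt_subsetI[OF compact_imp_closed[OF K]])
    fix \<omega> :: "'a form" assume \<omega>: "\<omega> \<in> smooth_forms m" "form_support \<omega> \<inter> K = {}"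
    have "\<omega> (f x) v = 0" for x v
    proof (rule ccontr)
      assume "\<omega> (f x) v \<noteq> 0"
      then have "f x \<in> form_support \<omega>" unfolding form_support_def by (intro subsetD[OF closure_subset]) blast
      then show False using \<omega>(2) f(2) by blast
    qed
    then have "pullback f \<omega> = 0" by (simp add: pullback_def zero_fun_def)
    then show "?S \<omega> = 0" using functional_zero[OF Tl] by (simp add: pushforward_def)
  qed
  then show "?S \<in> normal_currents_in m K" using n by (simp add: normal_currents_in_def)
qed

section \<open>Smooth nonexpansive maps into a convex set\<close>

text \<open>Differentiation under the integral over a fixed box. The variable y occurs only in
  \<psi>, so continuity of q is enough; the minus sign comes from x - y. \<open>Blinfun\<close>
  appears because \<open>leibniz_rule\<close> takes derivatives as bounded linear operators.\<close>

lemma convolution_has_derivative: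
  fixes \<psi> q :: "'a::euclidean_space \<Rightarrow> real"
  assumes \<psi>: "smooth \<psi>" and q: "continuous_on UNIV q"
  shows "((\<lambda>y. integral (cbox a b) (\<lambda>x. \<psi> (x - y) * q x)) has_derivative
    (\<lambda>u. integral (cbox a b) (\<lambda>x. frechet_derivative \<psi> (at (x - y0)) (- u) * q x))) (at y0)"
proof -
  define fx where "fx y x = Blinfun (\<lambda>u. frechet_derivative \<psi> (at (x - y)) (- u) * q x)" for y x
  have "bounded_linear (\<lambda>u. frechet_derivative \<psi> (at (x - y)) (- u) * q x)" for x y
    by (intro bounded_linear_compose[OF bounded_linear_mult_left]
        bounded_linear_compose[OF has_derivative_bounded_linear[OF smooth_has_derivative[OF \<psi>]]]
        bounded_linear_minus bounded_linear_ident)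
  then have ap: "blinfun_apply (fx y x) = (\<lambda>u. frechet_derivative \<psi> (at (x - y)) (- u) * q x)" for x y
    unfolding fx_def by (rule bounded_linear_Blinfun_apply)
  have qc: "continuous_on S (\<lambda>x. q (g x))" if "continuous_on S g" for S and g :: "'c::topological_space \<Rightarrow> 'a"
    by (rule continuous_on_compose2[OF q that]) simp
  have sc: "continuous_on S (\<lambda>x. \<phi> (g x))" if "continuous_on S g" "smooth \<phi>" for S \<phi> and g :: "'c::topological_space \<Rightarrow> 'a"
    by (rule continuous_on_compose2[OF smooth_continuous[OF that(2), of UNIV] that(1)]) simp
  have D: "((\<lambda>y. integral (cbox a b) (\<lambda>x. \<psi> (x - y) * q x)) has_derivative integral (cbox a b) (fx y0)) (at y0 within UNIV)"
  proof (rule leibniz_rule)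
    fix y x :: 'a
    have "((\<lambda>y. x - y) has_derivative (\<lambda>u. 0 - u)) (at y)"
      by (intro has_derivative_diff has_derivative_const has_derivative_ident)
    from has_derivative_compose[OF this smooth_has_derivative[OF \<psi>]]
    have "((\<lambda>y. \<psi> (x - y)) has_derivative (\<lambda>u. frechet_derivative \<psi> (at (x - y)) (- u))) (at y)" by simp
    from has_derivative_mult_left[OF this, of "q x"]
    show "((\<lambda>y. \<psi> (x - y) * q x) has_derivative blinfun_apply (fx y x)) (at y within UNIV)" unfolding ap by simp
    show "(\<lambda>x. \<psi> (x - y) * q x) integrable_on cbox a b"
      by (intro integrable_continuous continuous_on_mult sc qc \<psi> continuous_intros)
  next
    show "continuous_on (UNIV \<times> cbox a b) (\<lambda>(y, x). fx y x)"
    proof (rule continuous_on_blinfun_componentwise)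
      fix i :: 'a
      have "continuous_on (UNIV \<times> cbox a b) (\<lambda>p. frechet_derivative \<psi> (at (snd p - fst p)) (- i) * q (snd p))"
        by (intro continuous_on_mult sc[of _ "\<lambda>p. snd p - fst p" "\<lambda>z. frechet_derivative \<psi> (at z) (- i)"] qc smooth_deriv \<psi> continuous_intros)
      then show "continuous_on (UNIV \<times> cbox a b) (\<lambda>p. blinfun_apply (case p of (y, x) \<Rightarrow> fx y x) i)"
        by (simp add: case_prod_unfold ap)
    qed
  qed auto
  have "fx y0 integrable_on cbox a b"
  proof (intro integrable_continuous continuous_on_blinfun_componentwise)
    fix i :: 'a
    show "continuous_on (cbox a b) (\<lambda>x. blinfun_apply (fx y0 x) i)" unfolding ap
      by (intro continuous_on_mult sc[of _ "\<lambda>x. x - y0" "\<lambda>z. frechet_derivative \<psi> (at z) (- i)"] qc smooth_deriv \<psi> continuous_intros)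
  qed
  then have "blinfun_apply (integral (cbox a b) (fx y0)) = (\<lambda>u. integral (cbox a b) (\<lambda>x. frechet_derivative \<psi> (at (x - y0)) (- u) * q x))"
    by (simp add: fun_eq_iff blinfun_apply_integral ap)
  then show ?thesis using D by simp
qed

text \<open>The derivative is an integral of the same kind with a derivative of \<psi> as kernel, so
  the induction runs over all kernels.\<close>

lemma smooth_convolution:
  fixes \<psi> q :: "'a::euclidean_space \<Rightarrow> real"
  assumes \<psi>: "smooth \<psi>" and q: "continuous_on UNIV q"
  shows "smooth (\<lambda>y. integral (cbox a b) (\<lambda>x. \<psi> (x - y) * q x))"
proof (rule smoothI)
  fix n
  show "ck n UNIV (\<lambda>y. integral (cbox a b) (\<lambda>x. \<psi> (x - y) * q x))" using \<psi>
  proof (induction n arbitrary: \<psi>)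
    case 0
    then show ?case unfolding ck_0 differentiable_def using convolution_has_derivative[OF _ q] by blast
  next
    case (Suc n)
    show ?case
    proof (rule ck_SucI[OF open_UNIV convolution_has_derivative[OF Suc(2) q]])
      fix u
      show "ck n UNIV (\<lambda>y. integral (cbox a b) (\<lambda>x. frechet_derivative \<psi> (at (x - y)) (- u) * q x))"
        by (rule Suc.IH[OF smooth_deriv[OF Suc(2)]])
    qed
  qed
qed

lemma nonexpansive_derivative:
  assumes D: "(f has_derivative D) (at x)" and f: "\<And>y. norm (f y - f x) \<le> norm (y - x)"
  shows "norm (D h) \<le> norm h"
proof (cases "h = 0")
  case True
  then show ?thesis using linear_0[OF has_derivative_linear[OF D]] by simp
next
  case False
  have "norm (D h) \<le> norm h + e" if e: "e > 0" for e
  proof -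
    let ?e = "e / norm h"
    have "?e > 0" using e False by simp
    then obtain d where d: "d > 0" "\<And>y. norm (y - x) < d \<Longrightarrow> norm (f y - f x - D (y - x)) \<le> ?e * norm (y - x)"
      using D unfolding has_derivative_at_alt by blast
    define t where "t = d / (2 * norm h)"
    have t: "t > 0" "norm (t *\<^sub>R h) < d" using d(1) False by (auto simp: t_def)
    have "norm (f (x + t *\<^sub>R h) - f x - D (t *\<^sub>R h)) \<le> ?e * norm (t *\<^sub>R h)" using d(2)[of "x + t *\<^sub>R h"] t by simp
    moreover have "norm (f (x + t *\<^sub>R h) - f x) \<le> norm (t *\<^sub>R h)" using f[of "x + t *\<^sub>R h"] by simp
    ultimately have "norm (D (t *\<^sub>R h)) \<le> norm (t *\<^sub>R h) + ?e * norm (t *\<^sub>R h)"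
      using norm_triangle_sub[of "D (t *\<^sub>R h)" "f (x + t *\<^sub>R h) - f x"] by (simp add: norm_minus_commute)
    then have "t * norm (D h) \<le> t * (norm h + e)"
      using t(1) False linear_cmul[OF has_derivative_linear[OF D]] by (simp add: algebra_simps)
    then show ?thesis using t(1) by simp
  qed
  then show ?thesis by (rule field_le_epsilon)
qed

text \<open>F is the average of p (y + z) over z with the normalised bump as weight. Averages of
  points of K stay in K by separation, and averaging does not increase distances. Where p is affine
  around y, the linear part averages to 0 because the weight is even, and only the value at the
  centre remains.\<close>

lemma mollify:
  fixes p :: "'a::euclidean_space \<Rightarrow> 'a"
  assumes p: "\<And>x y. norm (p x - p y) \<le> norm (x - y)" and K: "convex K" "closed K" "\<And>x. p x \<in> K" and \<epsilon>: "\<epsilon> > 0"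
  obtains F where "smooth_map F" "\<And>y. F y \<in> K" "\<And>x y. norm (F x - F y) \<le> norm (x - y)"
    "\<And>y a A. bounded_linear A \<Longrightarrow> (\<And>z. norm z \<le> 2 * \<epsilon> \<Longrightarrow> p (y + z) = a + A z) \<Longrightarrow> F y = a"
proof -
  let ?w = "(2 * \<epsilon>) *\<^sub>R One :: 'a" and ?\<phi> = "bump (0::'a) \<epsilon>"
  let ?J = "cbox (- ?w) ?w"
  have J: "z \<in> ?J" if "norm z \<le> 2 * \<epsilon>" for z :: 'a
    unfolding mem_box using that Basis_le_norm[of _ z] by (auto simp: abs_le_iff intro: order.trans) (smt (verit))
  have \<phi>0: "?\<phi> z = 0" if "\<not> norm z \<le> 2 * \<epsilon>" for z by (rule bump_0[OF \<epsilon>]) (use that in simp)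
  have \<phi>c: "continuous_on S ?\<phi>" for S by (rule smooth_continuous[OF smooth_bump])
  have pc: "continuous_on S p" for S unfolding continuous_on_iff dist_norm using le_less_trans[OF p] by blast
  have pc': "continuous_on S (\<lambda>z. p (y + z))" for S y
    by (rule continuous_on_compose2[OF pc[of UNIV]]) (auto intro!: continuous_intros)
  define I where "I = integral ?J ?\<phi>"
  have \<phi>int: "?\<phi> integrable_on ?J" by (rule integrable_continuous[OF \<phi>c])
  have "I \<ge> 0" unfolding I_def by (rule integral_nonneg[OF \<phi>int]) (simp add: bump_range)
  moreover have "I \<noteq> 0"
  proof
    assume "I = 0"
    then have "\<forall>x\<in>?J. ?\<phi> x = 0" unfolding I_def
      by (subst (asm) integral_cbox_eq_0_iff[OF \<phi>c]) (use \<epsilon> in \<open>auto simp: bump_range box_ne_empty\<close>)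
    then show False using J[of 0] bump_1[of "0::'a" 0 \<epsilon>] \<epsilon> by simp
  qed
  ultimately have I: "I > 0" by simp
  have int: "(\<lambda>z. ?\<phi> z *\<^sub>R p (y + z)) integrable_on ?J" for y
    by (intro integrable_continuous continuous_on_scaleR \<phi>c pc')
  define F where "F y = (1 / I) *\<^sub>R integral ?J (\<lambda>z. ?\<phi> z *\<^sub>R p (y + z))" for y
  have Fin: "F y \<bullet> v = (1 / I) * integral ?J (\<lambda>z. ?\<phi> z * (p (y + z) \<bullet> v))" for y v
    unfolding F_def using integral_component_eq[OF int, of y v]
    by (simp add: integral_linear[OF int bounded_linear_inner_left, unfolded o_def, symmetric])
  show thesis
  proof (rule that)
    show "smooth_map F" unfolding smooth_map_def
    proof
      fix v :: 'a assume "v \<in> Basis"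
      have qc: "continuous_on UNIV (\<lambda>x. p x \<bullet> v)" by (intro continuous_intros pc)
      show "smooth (\<lambda>y. F y \<bullet> v)"
      proof (rule smoothI)
        fix n
        have "ck n (ball y0 1) (\<lambda>y. F y \<bullet> v)" for y0
        proof (rule ck_cong[OF open_ball])
          \<comment> \<open>To have y only in the kernel, the integral is taken over x = y + z; its
            domain then moves with y. The box enlarged by \<open>One\<close> contains all these
            domains for y in the unit ball around y0, and the integrand vanishes on the
            surplus.\<close>
          let ?J' = "cbox (y0 - ?w - One) (y0 + ?w + One)"
          show "ck n (ball y0 1) (\<lambda>y. (1 / I) * integral ?J' (\<lambda>x. ?\<phi> (x - y) * (p x \<bullet> v)))"
            by (intro ck_subset[OF smoothD subset_UNIV] smooth_mult smooth_const smooth_convolution smooth_bump qc)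
          fix y assume y: "y \<in> ball y0 1"
          let ?g = "\<lambda>x. ?\<phi> (x - y) * (p x \<bullet> v)"
          have gint: "(?g has_integral integral (cbox (y - ?w) (y + ?w)) ?g) (cbox (y - ?w) (y + ?w))"
            by (rule integrable_integral, rule integrable_continuous, intro continuous_on_mult continuous_intros
                continuous_on_subset[OF qc] continuous_on_compose2[OF \<phi>c[of UNIV], where f="\<lambda>x. x - y"]) auto
          have "(?g has_integral integral (cbox (y - ?w) (y + ?w)) ?g) ?J'"
          proof (rule has_integral_on_superset[OF gint])
            fix x assume "x \<notin> cbox (y - ?w) (y + ?w)"
            then have "x - y \<notin> ?J" by (auto simp: mem_box algebra_simps)
            then show "?g x = 0" using J \<phi>0 by force
          next
            have "\<bar>(y - y0) \<bullet> i\<bar> \<le> 1" if "i \<in> Basis" for i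
              using Basis_le_norm[OF that, of "y - y0"] y by (simp add: dist_norm norm_minus_commute)
            then show "cbox (y - ?w) (y + ?w) \<subseteq> ?J'"
              unfolding subset_box by (auto simp: inner_simps abs_le_iff) (smt (verit))+
          qed
          then have "integral ?J' ?g = integral (cbox (y - ?w) (y + ?w)) ?g" by (rule integral_unique)
          also have "\<dots> = integral ?J (\<lambda>z. ?\<phi> z * (p (y + z) \<bullet> v))"
            using integral_shift_cbox[of "y - ?w" y "y + ?w" ?g] by (simp add: add.commute)
          finally show "F y \<bullet> v = (1 / I) * integral ?J' ?g" unfolding Fin by simp
        qed
        then show "ck n UNIV (\<lambda>y. F y \<bullet> v)" unfolding ck_def by (meson centre_in_ball zero_less_one)
      qed
    qed
    show "F y \<in> K" for y
    proof (rule ccontr)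
      assume "F y \<notin> K"
      then obtain a b where ab: "a \<bullet> F y < b" "\<forall>x\<in>K. a \<bullet> x > b" using separating_hyperplane_closed_point[OF K(1,2)] by blast
      have "integral ?J (\<lambda>z. ?\<phi> z * b) \<le> integral ?J (\<lambda>z. ?\<phi> z * (p (y + z) \<bullet> a))"
      proof (rule integral_le)
        show "?\<phi> z * b \<le> ?\<phi> z * (p (y + z) \<bullet> a)" for z
          using ab(2) K(3)[of "y + z"] by (intro mult_left_mono) (auto simp: bump_range inner_commute less_imp_le)
      qed (intro integrable_continuous continuous_on_mult continuous_intros \<phi>c pc')+
      then have "I * b \<le> I * (F y \<bullet> a)" unfolding Fin using I by (simp add: I_def)
      then show False using ab(1) I by (simp add: inner_commute)
    qed
    show "norm (F x - F y) \<le> norm (x - y)" for x y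
    proof -
      let ?D = "\<lambda>z. ?\<phi> z *\<^sub>R p (x + z) - ?\<phi> z *\<^sub>R p (y + z)"
      have "norm (integral ?J ?D) \<le> integral ?J (\<lambda>z. ?\<phi> z * norm (x - y))"
      proof (rule integral_norm_bound_integral)
        show "norm (?D z) \<le> ?\<phi> z * norm (x - y)" for z
          using p[of "x + z" "y + z"] by (simp add: scaleR_diff_right[symmetric] bump_range mult_left_mono)
      qed (intro integrable_continuous continuous_on_mult continuous_on_diff continuous_on_scaleR continuous_on_const \<phi>c pc')+
      also have "integral ?J (\<lambda>z. ?\<phi> z * norm (x - y)) = I * norm (x - y)" by (simp add: I_def)
      finally have b: "norm (integral ?J ?D) \<le> I * norm (x - y)" .
      have "F x - F y = (1 / I) *\<^sub>R integral ?J ?D"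
        unfolding F_def integral_diff[OF int int] by (simp add: scaleR_diff_right)
      then have "I * norm (F x - F y) = norm (integral ?J ?D)" using I by simp
      then have "I * norm (F x - F y) \<le> I * norm (x - y)" using b by linarith
      then show ?thesis using I by simp
    qed
    show "F y = a" if A: "bounded_linear A" and pa: "\<And>z. norm z \<le> 2 * \<epsilon> \<Longrightarrow> p (y + z) = a + A z" for y a A
    proof -
      have Ac: "continuous_on S A" for S using A linear_continuous_on by blast
      have even: "?\<phi> (- z) = ?\<phi> z" for z by (simp add: bump_def)
      let ?M = "integral ?J (\<lambda>z. ?\<phi> z *\<^sub>R A z)"
      have "integral ?J (\<lambda>z. ?\<phi> (- z) *\<^sub>R A (- z)) = ?M" using integral_reflect[of ?w "- ?w" "\<lambda>z. ?\<phi> z *\<^sub>R A z"] by simp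
      \<comment> \<open>Reflection of the box together with evenness of the weight.\<close>
      then have "?M = - ?M" unfolding even using A by (simp add: linear_neg[OF bounded_linear.linear[OF A]])
      then have "2 *\<^sub>R ?M = 0" unfolding scaleR_2 by (rule iffD1[OF eq_neg_iff_add_eq_0])
      then have M: "?M = 0" by simp
      have "integral ?J (\<lambda>z. ?\<phi> z *\<^sub>R p (y + z)) = integral ?J (\<lambda>z. ?\<phi> z *\<^sub>R a + ?\<phi> z *\<^sub>R A z)"
        by (rule integral_cong) (use pa \<phi>0 in \<open>force simp: scaleR_add_right[symmetric]\<close>)
      also have "\<dots> = integral ?J (\<lambda>z. ?\<phi> z *\<^sub>R a) + ?M"
        by (intro integral_add integrable_continuous continuous_on_scaleR continuous_on_const \<phi>c Ac)
      also have "integral ?J (\<lambda>z. ?\<phi> z *\<^sub>R a) = I *\<^sub>R a" unfolding I_def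
        using integral_linear[OF \<phi>int bounded_linear_scaleR_left[of a]] by (simp add: o_def)
      finally show "F y = a" unfolding F_def M using I by simp
    qed
  qed
qed

text \<open>With P the projection of w onto the affine subspace, w - P is a combination of E and
  hence orthogonal to P - k for every k in K; Pythagoras shows that no point of K is closer to
  w.\<close>

lemma closest_point_proj:
  assumes K: "convex K" "closed K" and E: "finite E" "\<And>e. e \<in> E \<Longrightarrow> norm e = 1" "pairwise orthogonal E"
    and KE: "\<And>x e. x \<in> K \<Longrightarrow> e \<in> E \<Longrightarrow> (x - c) \<bullet> e = 0" and w: "(c - proj E c) + proj E w \<in> K"
  shows "closest_point K w = (c - proj E c) + proj E w"
proof (rule closest_point_unique[OF K w, symmetric], rule ballI)
  fix k assume k: "k \<in> K"
  let ?P = "(c - proj E c) + proj E w"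
  have d: "w - ?P = (\<Sum>e\<in>E. ((w - c) \<bullet> e) *\<^sub>R e)"
    by (simp add: proj_def inner_diff_left scaleR_diff_left sum_subtractf)
  have "(?P - k) \<bullet> e = 0" if "e \<in> E" for e
    using KE[OF k that] KE[OF w that] by (simp add: inner_diff_left inner_add_left)
  then have o: "(w - ?P) \<bullet> (?P - k) = 0" unfolding d inner_sum_left by (intro sum.neutral) (simp add: inner_commute)
  have "(norm (w - k))\<^sup>2 = (norm ((w - ?P) + (?P - k)))\<^sup>2" by simp
  also have "\<dots> = (norm (w - ?P))\<^sup>2 + (norm (?P - k))\<^sup>2"
    by (rule norm_add_Pythagorean) (use o in \<open>simp add: orthogonal_def\<close>)
  finally have "(norm (w - ?P))\<^sup>2 \<le> (norm (w - k))\<^sup>2" by simp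
  then have "norm (w - ?P) \<le> norm (w - k)" by (rule power2_le_imp_le) simp
  then show "dist w ?P \<le> dist w k" by (simp add: dist_norm)
qed

lemma proj_orthogonal:
  assumes "finite E" "\<And>e. e \<in> E \<Longrightarrow> norm e = 1" "pairwise orthogonal E" "e \<in> E"
  shows "proj E v \<bullet> e = 0"
proof -
  have "(\<Sum>f\<in>E. (v \<bullet> f) * (f \<bullet> e)) = (\<Sum>f\<in>E. if f = e then v \<bullet> e else 0)"
  proof (rule sum.cong[OF refl])
    fix f assume f: "f \<in> E"
    show "(v \<bullet> f) * (f \<bullet> e) = (if f = e then v \<bullet> e else 0)"
      using assms(2)[OF f] pairwiseD[OF assms(3) f assms(4)] by (auto simp: orthogonal_def norm_eq_1)
  qed
  then show ?thesis using assms(1,4) by (simp add: proj_def inner_diff_left inner_sum_left)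
qed

lemma norm_proj_le:
  assumes E: "finite E" "\<And>e. e \<in> E \<Longrightarrow> norm e = 1" "pairwise orthogonal E"
  shows "norm (proj E v) \<le> norm v"
proof -
  have d: "v - proj E v = (\<Sum>e\<in>E. (v \<bullet> e) *\<^sub>R e)" by (simp add: proj_def)
  have "(v - proj E v) \<bullet> proj E v = 0" unfolding d inner_sum_left
    by (intro sum.neutral ballI) (simp add: inner_commute[of _ "proj E v"] proj_orthogonal[OF E])
  then have "orthogonal (v - proj E v) (proj E v)" by (simp add: orthogonal_def)
  from norm_add_Pythagorean[OF this] have "(norm (proj E v))\<^sup>2 \<le> (norm v)\<^sup>2" by simp
  then show ?thesis by (rule power2_le_imp_le) simp
qed

(* E is an orthonormal basis of the orthogonal complement of the direction of the affine hull. *)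
lemma relative_frame:
  fixes K :: "'a::euclidean_space set"
  assumes K: "convex K" "K \<noteq> {}"
  obtains c r E where "c \<in> K" "r > 0" "finite E" "\<And>e. e \<in> E \<Longrightarrow> norm e = 1" "pairwise orthogonal E"
    "\<And>x e. x \<in> K \<Longrightarrow> e \<in> E \<Longrightarrow> (x - c) \<bullet> e = 0"
    "\<And>x. (\<And>e. e \<in> E \<Longrightarrow> (x - c) \<bullet> e = 0) \<Longrightarrow> norm (x - c) \<le> r \<Longrightarrow> x \<in> K"
proof -
  obtain c where "c \<in> rel_interior K" using rel_interior_eq_empty[OF K(1)] K(2) by blast
  then obtain r where r: "c \<in> K" "r > 0" "cball c r \<inter> affine hull K \<subseteq> K" unfolding mem_rel_interior_cball by blast
  define L where "L = span ((\<lambda>x. - c + x) ` K)"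
  have L: "subspace L" unfolding L_def by simp
  have aff: "affine hull K = (\<lambda>x. c + x) ` L" unfolding L_def
    by (rule affine_hull_span_gen[OF hull_inc[OF r(1)]])
  obtain E where E: "E \<subseteq> L\<^sup>\<bottom>" "pairwise orthogonal E" "\<And>x. x \<in> E \<Longrightarrow> norm x = 1" "independent E" "span E = L\<^sup>\<bottom>"
    using orthonormal_basis_subspace[OF subspace_orthogonal_comp[of L]] by metis
  show thesis
  proof (rule that[OF r(1,2) _ E(3,2)])
    show "finite E" by (rule independent_imp_finite[OF E(4)])
    fix x e assume x: "x \<in> K" and e: "e \<in> E"
    have "x - c \<in> L" unfolding L_def by (rule span_base) (use x in \<open>auto simp: image_iff\<close>)
    then show "(x - c) \<bullet> e = 0" using E(1) e by (auto simp: orthogonal_comp_def orthogonal_def)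
  next
    fix x assume xe: "\<And>e. e \<in> E \<Longrightarrow> (x - c) \<bullet> e = 0" and n: "norm (x - c) \<le> r"
    have "orthogonal (x - c) y" if "y \<in> span E" for y
      by (rule orthogonal_to_span[OF that]) (use xe in \<open>simp add: orthogonal_def\<close>)
    then have "x - c \<in> L\<^sup>\<bottom>\<^sup>\<bottom>" unfolding E(5) orthogonal_comp_def[of "L\<^sup>\<bottom>"] by (auto simp: orthogonal_commute)
    then have "x - c \<in> L" using orthogonal_comp_self[OF L] by simp
    then have "x \<in> affine hull K" unfolding aff by (intro image_eqI[of _ _ "x - c"]) auto
    then show "x \<in> K" using r(3) n by (auto simp: dist_norm norm_minus_commute)
  qed
qed

(* f is the closest point map of K, mollified at a scale proportional to 1 - mu, after the homothety
   of centre c and ratio mu, which pushes K into its relative interior. *)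
lemma convex_retraction:
  fixes K :: "'a::euclidean_space set"
  assumes K: "compact K" "convex K" "K \<noteq> {}"
  obtains c E where "finite E" "\<And>e. e \<in> E \<Longrightarrow> norm e = 1" "pairwise orthogonal E"
    "\<And>x e. x \<in> K \<Longrightarrow> e \<in> E \<Longrightarrow> (x - c) \<bullet> e = 0"
    "\<And>\<mu>. 0 < \<mu> \<Longrightarrow> \<mu> < 1 \<Longrightarrow> \<exists>f U. smooth_map f \<and> (\<forall>x. f x \<in> K) \<and>
      (\<forall>x h. norm (frechet_derivative f (at x) h) \<le> norm h) \<and> open U \<and> K \<subseteq> U \<and>
      (\<forall>x\<in>U. f x = c + \<mu> *\<^sub>R (proj E x - proj E c))"
proof -
  note Kc = compact_imp_closed[OF K(1)]
  obtain c r E where cE: "c \<in> K" "r > 0" and E: "finite E" "\<And>e. e \<in> E \<Longrightarrow> norm e = 1" "pairwise orthogonal E"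
    and KE: "\<And>x e. x \<in> K \<Longrightarrow> e \<in> E \<Longrightarrow> (x - c) \<bullet> e = 0"
    and rK: "\<And>x. (\<And>e. e \<in> E \<Longrightarrow> (x - c) \<bullet> e = 0) \<Longrightarrow> norm (x - c) \<le> r \<Longrightarrow> x \<in> K"
    using relative_frame[OF K(2,3)] by blast
  note lin = bounded_linear.linear[OF bounded_linear_proj[of E]]
  have pK: "proj E (k - c) = k - c" if "k \<in> K" for k using KE[OF that] by (simp add: proj_def)
  have main: "\<exists>f U. smooth_map f \<and> (\<forall>x. f x \<in> K) \<and>
      (\<forall>x h. norm (frechet_derivative f (at x) h) \<le> norm h) \<and> open U \<and> K \<subseteq> U \<and>
      (\<forall>x\<in>U. f x = c + \<mu> *\<^sub>R (proj E x - proj E c))" if \<mu>: "0 < \<mu>" "\<mu> < 1" for \<mu>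
  proof -
    \<comment> \<open>The vector \<mu> (x - k) + z below has norm at most \<epsilon> + 2 \<epsilon>,
      and this has to fit into (1 - \<mu>) r.\<close>
    define \<epsilon> where "\<epsilon> = (1 - \<mu>) * r / 3"
    have \<epsilon>: "\<epsilon> > 0" using \<mu> cE by (simp add: \<epsilon>_def)
    have p: "norm (closest_point K x - closest_point K y) \<le> norm (x - y)" for x y
      using closest_point_lipschitz[OF K(2) Kc K(3)] by (simp add: dist_norm)
    obtain F where F: "smooth_map F" "\<And>y. F y \<in> K" "\<And>x y. norm (F x - F y) \<le> norm (x - y)"
      "\<And>y a A. bounded_linear A \<Longrightarrow> (\<And>z. norm z \<le> 2 * \<epsilon> \<Longrightarrow> closest_point K (y + z) = a + A z) \<Longrightarrow> F y = a"
      using mollify[of "closest_point K", OF p K(2) Kc closest_point_in_set[OF Kc K(3)] \<epsilon>] by blast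
    let ?h = "\<lambda>x. c + \<mu> *\<^sub>R (x - c)"
    define f where "f x = F (?h x)" for x
    have hs: "smooth_map ?h"
    proof -
      have "?h = (\<lambda>x. (c - \<mu> *\<^sub>R c) + \<mu> *\<^sub>R x)" by (simp add: fun_eq_iff algebra_simps)
      then show ?thesis using smooth_map_affine[OF bounded_linear_scaleR_right] by metis
    qed
    have fs: "smooth_map f" unfolding smooth_map_def f_def
    proof
      fix b :: 'a assume "b \<in> Basis"
      then have "smooth (\<lambda>y. F y \<bullet> b)" using F(1) smooth_map_def by blast
      from smooth_compose[OF this hs] show "smooth (\<lambda>x. F (?h x) \<bullet> b)" .
    qed
    have fl: "norm (f y - f x) \<le> norm (y - x)" for x y
    proof -
      have "norm (f y - f x) \<le> norm (?h y - ?h x)" unfolding f_def by (rule F(3))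
      also have "?h y - ?h x = \<mu> *\<^sub>R (y - x)" by (simp add: algebra_simps)
      also have "norm \<dots> \<le> norm (y - x)" using \<mu> by (simp add: mult_left_le_one_le)
      finally show ?thesis .
    qed
    have fd: "norm (frechet_derivative f (at x) h) \<le> norm h" for x h
      by (rule nonexpansive_derivative[OF smooth_map_has_derivative[OF fs] fl])
    let ?U = "\<Union>k\<in>K. ball k \<epsilon>"
    have "f x = c + \<mu> *\<^sub>R (proj E x - proj E c)" if xU: "x \<in> ?U" for x
    proof -
      obtain k where k: "k \<in> K" "x \<in> ball k \<epsilon>" using xU by blast
      then have kx: "norm (x - k) < \<epsilon>" by (simp add: dist_norm norm_minus_commute)
      have "closest_point K (?h x + z) = (c + \<mu> *\<^sub>R (proj E x - proj E c)) + proj E z" if z: "norm z \<le> 2 * \<epsilon>" for z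
      proof -
        let ?P = "(c - proj E c) + proj E (?h x + z)"
        \<comment> \<open>The projected point is \<mu> k + (1 - \<mu>) q: its displacement from
          \<mu> k + (1 - \<mu>) c is absorbed into q, which stays in the relative ball of radius r
          around c and hence in K.\<close>
        define q where "q = c + (1 / (1 - \<mu>)) *\<^sub>R proj E (\<mu> *\<^sub>R (x - k) + z)"
        have Pe: "?P = (c + \<mu> *\<^sub>R (proj E x - proj E c)) + proj E z"
          by (simp add: linear_add[OF lin] linear_cmul[OF lin] linear_diff[OF lin] algebra_simps)
        have "?P = \<mu> *\<^sub>R k + (1 - \<mu>) *\<^sub>R q"
        proof -
          have "(1 - \<mu>) *\<^sub>R q = (1 - \<mu>) *\<^sub>R c + proj E (\<mu> *\<^sub>R (x - k) + z)"
            unfolding q_def using \<mu> by (simp add: scaleR_add_right)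
          moreover have "\<mu> *\<^sub>R (k - c) = \<mu> *\<^sub>R proj E (k - c)" using pK[OF k(1)] by simp
          ultimately show ?thesis unfolding Pe
            by (simp add: linear_add[OF lin] linear_cmul[OF lin] linear_diff[OF lin] algebra_simps)
        qed
        moreover have "q \<in> K"
        proof (rule rK)
          show "(q - c) \<bullet> e = 0" if "e \<in> E" for e
            unfolding q_def using proj_orthogonal[OF E that] by simp
          have "norm (proj E (\<mu> *\<^sub>R (x - k) + z)) \<le> norm (\<mu> *\<^sub>R (x - k) + z)" by (rule norm_proj_le[OF E])
          also have "\<dots> \<le> \<mu> * norm (x - k) + norm z" using norm_triangle_ineq[of "\<mu> *\<^sub>R (x - k)" z] \<mu> by simp
          also have "\<dots> \<le> 1 * norm (x - k) + 2 * \<epsilon>" using \<mu> z by (intro add_mono mult_right_mono) auto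
          also have "\<dots> \<le> (1 - \<mu>) * r" using kx by (simp add: \<epsilon>_def)
          finally show "norm (q - c) \<le> r" unfolding q_def using \<mu> by (simp add: divide_le_eq mult.commute)
        qed
        ultimately have "?P \<in> K" using convexD[OF K(2) k(1), of q \<mu> "1 - \<mu>"] \<mu> by simp
        from closest_point_proj[OF K(2) Kc E KE this] show ?thesis unfolding Pe .
      qed
      then show ?thesis unfolding f_def by (rule F(4)[OF bounded_linear_proj])
    qed
    moreover have "open ?U" by auto
    moreover have "K \<subseteq> ?U" using \<epsilon> by force
    ultimately show ?thesis using fs fd F(2) unfolding f_def by blast
  qed
  show thesis by (rule that[OF E KE main])
qed

section \<open>Norms of charges\<close>

text \<open>The infimum is itself an admissible constant: where g x > 0 by division, and where g x =
  0 because any admissible constant gives f x \<le> 0. It serves for \<open>charge_norm\<close> and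
  \<open>dual_norm\<close> alike.\<close>

lemma Inf_bound:
  fixes f g :: "'x \<Rightarrow> real"
  assumes "0 \<le> C" "\<And>x. x \<in> A \<Longrightarrow> f x \<le> C * g x" "\<And>x. x \<in> A \<Longrightarrow> g x \<ge> 0"
  defines "I \<equiv> Inf {C. 0 \<le> C \<and> (\<forall>x\<in>A. f x \<le> C * g x)}"
  shows "0 \<le> I" "x \<in> A \<Longrightarrow> f x \<le> I * g x"
proof -
  let ?S = "{C. 0 \<le> C \<and> (\<forall>x\<in>A. f x \<le> C * g x)}"
  have ne: "C \<in> ?S" using assms(1,2) by blast
  show "0 \<le> I" unfolding I_def by (rule cInf_greatest) (use ne in auto)
  assume x: "x \<in> A"
  show "f x \<le> I * g x"
  proof (cases "g x = 0")
    case True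
    then show ?thesis using assms(2)[OF x] by simp
  next
    case False
    then have g: "g x > 0" using assms(3)[OF x] by simp
    have "f x / g x \<le> I" unfolding I_def
      by (rule cInf_greatest) (use ne x g in \<open>auto simp: divide_le_eq\<close>)
    then show ?thesis using g by (simp add: divide_le_eq)
  qed
qed

lemma charge_norm_bound:
  assumes "\<omega> \<in> frac_charges m \<alpha> K"
  shows "0 \<le> charge_norm m \<alpha> K \<omega>"
    "T \<in> normal_currents_in m K \<Longrightarrow> \<bar>\<omega> T\<bar> \<le> charge_norm m \<alpha> K \<omega> * frac_weight m \<alpha> T"
proof -
  obtain C where C: "C \<ge> 0" "\<And>T. T \<in> normal_currents_in m K \<Longrightarrow> \<bar>\<omega> T\<bar> \<le> C * frac_weight m \<alpha> T"
    using assms by (auto simp: frac_charges_def)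
  note b = Inf_bound[where f="\<lambda>T. \<bar>\<omega> T\<bar>" and A="normal_currents_in m K" and g="frac_weight m \<alpha>", OF C frac_weight_nonneg]
  show "0 \<le> charge_norm m \<alpha> K \<omega>" unfolding charge_norm_def by (rule b(1))
  show "T \<in> normal_currents_in m K \<Longrightarrow> \<bar>\<omega> T\<bar> \<le> charge_norm m \<alpha> K \<omega> * frac_weight m \<alpha> T"
    unfolding charge_norm_def by (rule b(2))
qed

lemma frac_charges_add:
  assumes "\<omega> \<in> frac_charges m \<alpha> K" "\<omega>' \<in> frac_charges m \<alpha> K"
  shows "\<omega> + \<omega>' \<in> frac_charges m \<alpha> K"
    "charge_norm m \<alpha> K (\<omega> + \<omega>') \<le> charge_norm m \<alpha> K \<omega> + charge_norm m \<alpha> K \<omega>'"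
proof -
  let ?c = "charge_norm m \<alpha> K \<omega> + charge_norm m \<alpha> K \<omega>'"
  have c: "?c \<ge> 0" using charge_norm_bound(1)[OF assms(1)] charge_norm_bound(1)[OF assms(2)] by simp
  have b: "\<bar>(\<omega> + \<omega>') T\<bar> \<le> ?c * frac_weight m \<alpha> T" if "T \<in> normal_currents_in m K" for T
    using charge_norm_bound(2)[OF assms(1) that] charge_norm_bound(2)[OF assms(2) that] by (simp add: ring_distribs)
  show "charge_norm m \<alpha> K (\<omega> + \<omega>') \<le> ?c" by (rule charge_norm_le[OF c b])
  show "\<omega> + \<omega>' \<in> frac_charges m \<alpha> K"
    using assms b c linear_functionals_plus unfolding frac_charges_def by blast
qed

lemma frac_charges_scaleR:
  assumes "\<omega> \<in> frac_charges m \<alpha> K"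
  shows "a *\<^sub>R \<omega> \<in> frac_charges m \<alpha> K" "charge_norm m \<alpha> K (a *\<^sub>R \<omega>) \<le> \<bar>a\<bar> * charge_norm m \<alpha> K \<omega>"
proof -
  let ?c = "\<bar>a\<bar> * charge_norm m \<alpha> K \<omega>"
  have c: "?c \<ge> 0" using charge_norm_bound(1)[OF assms(1)] by simp
  have b: "\<bar>(a *\<^sub>R \<omega>) T\<bar> \<le> ?c * frac_weight m \<alpha> T" if "T \<in> normal_currents_in m K" for T
    using mult_left_mono[OF charge_norm_bound(2)[OF assms(1) that], of "\<bar>a\<bar>"] by (simp add: scaleR_fun_def abs_mult mult.assoc)
  show "charge_norm m \<alpha> K (a *\<^sub>R \<omega>) \<le> ?c" by (rule charge_norm_le[OF c b])
  show "a *\<^sub>R \<omega> \<in> frac_charges m \<alpha> K"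
    using assms b c linear_functionals_cmul unfolding frac_charges_def by blast
qed

lemma frac_charges_diff:
  assumes "\<omega> \<in> frac_charges m \<alpha> K" "\<omega>' \<in> frac_charges m \<alpha> K"
  shows "\<omega> - \<omega>' \<in> frac_charges m \<alpha> K"
proof -
  have "\<omega> - \<omega>' = \<omega> + (-1) *\<^sub>R \<omega>'" by (simp add: fun_eq_iff scaleR_fun_def)
  then show ?thesis using frac_charges_add(1)[OF assms(1) frac_charges_scaleR(1)[OF assms(2)]] by metis
qed

text \<open>A smooth form has a bound common to all levels, and
  \<open>level_bound_frac_weight\<close> turns it into a bound by the weight.\<close>

lemma charge_of_form_frac_charge:
  assumes K: "compact K" and \<alpha>: "0 < \<alpha>" "\<alpha> < 1" and \<eta>: "\<eta> \<in> smooth_forms m"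
  shows "charge_of_form m K \<eta> \<in> frac_charges m \<alpha> K"
proof -
  obtain r where r: "r > 0" "K \<subseteq> ball 0 r" using compact_subset_ball[OF K] by blast
  obtain c where c: "c \<ge> 0" "flat_bound m c (cut_form r \<eta>)" using cut_flat_bound_exists[OF r(1) \<eta>] by blast
  have "level_bound m \<alpha> K j c \<eta>" for j
  proof -
    have "level_bound m \<alpha> K j (c * 2 powr (- (1 - \<alpha>) * real j)) \<eta>"
      using level_bound_flat[OF cut_smooth_forms[OF \<eta>] c(2,1)] level_bound_cut[OF \<eta> r(2)] by blast
    moreover have "2 powr (- (1 - \<alpha>) * real j) \<le> 1" using powr_mono[of "- (1 - \<alpha>) * real j" 0 2] \<alpha> by (simp add: mult_nonpos_nonneg)
    ultimately show ?thesis using level_bound_mono mult_left_mono[of _ 1 c] c(1) by fastforce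
  qed
  from level_bound_frac_weight[OF \<alpha> K \<eta> _ c(1) this]
  have "\<bar>charge_of_form m K \<eta> T\<bar> \<le> (2 * c) * frac_weight m \<alpha> T" if "T \<in> normal_currents_in m K" for T
    using that by (simp add: charge_of_form_def)
  moreover have "0 \<le> 2 * c" using c(1) by simp
  moreover have "charge_of_form m K \<eta> \<in> linear_functionals (normal_currents_in m K)"
  proof -
    have "(t *\<^sub>R S) \<eta> = t * S \<eta>" for t and S :: "'a current" by (simp add: scaleR_fun_def)
    then show ?thesis
      by (auto simp: linear_functionals_def charge_of_form_def normal_currents_in_add normal_currents_in_scaleR)
  qed
  ultimately show ?thesis unfolding frac_charges_def by blast
qed

lemma charge_of_form_add:
  assumes "\<eta> \<in> smooth_forms m" "\<zeta> \<in> smooth_forms m"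
  shows "charge_of_form m K (\<eta> + \<zeta>) = charge_of_form m K \<eta> + charge_of_form m K \<zeta>"
proof
  fix T
  show "charge_of_form m K (\<eta> + \<zeta>) T = (charge_of_form m K \<eta> + charge_of_form m K \<zeta>) T"
    using linear_functionals_add[OF normal_currents_linear[OF normal_currents_inD(1)] assms, of T K]
    by (simp add: charge_of_form_def)
qed

lemma charge_of_form_scaleR:
  assumes "\<eta> \<in> smooth_forms m"
  shows "charge_of_form m K (a *\<^sub>R \<eta>) = a *\<^sub>R charge_of_form m K \<eta>"
proof
  fix T
  show "charge_of_form m K (a *\<^sub>R \<eta>) T = (a *\<^sub>R charge_of_form m K \<eta>) T"
    using linear_functionals_scaleR[OF normal_currents_linear[OF normal_currents_inD(1)] assms, of T K a]
    by (simp add: charge_of_form_def scaleR_fun_def[of a "\<lambda>T. if T \<in> normal_currents_in m K then T \<eta> else 0"])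
qed

section \<open>Testing fractional currents against smooth forms\<close>

text \<open>The constant k is carried along because each derivative replaces k by k \<mu>.\<close>

lemma iter_deriv_dilation:
  assumes "smooth g"
  shows "iter_deriv us (\<lambda>x. k * g (a + \<mu> *\<^sub>R x)) = (\<lambda>x. (k * \<mu> ^ length us) * iter_deriv us g (a + \<mu> *\<^sub>R x))"
  using assms
proof (induction us arbitrary: g k)
  case (Cons u us)
  have "frechet_derivative (\<lambda>x. k * g (a + \<mu> *\<^sub>R x)) (at x) u = (k * \<mu>) * frechet_derivative g (at (a + \<mu> *\<^sub>R x)) u" for x
  proof -
    have "((\<lambda>x. a + \<mu> *\<^sub>R x) has_derivative (\<lambda>h. \<mu> *\<^sub>R h)) (at x)" by (auto intro!: derivative_eq_intros)
    from has_derivative_mult_right[OF has_derivative_compose[OF this smooth_has_derivative[OF Cons(2)]], of k]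
    have "((\<lambda>x. k * g (a + \<mu> *\<^sub>R x)) has_derivative (\<lambda>h. k * frechet_derivative g (at (a + \<mu> *\<^sub>R x)) (\<mu> *\<^sub>R h))) (at x)" .
    from fun_cong[OF frechet_derivative_at[OF this], of u]
    have "frechet_derivative (\<lambda>x. k * g (a + \<mu> *\<^sub>R x)) (at x) u = k * frechet_derivative g (at (a + \<mu> *\<^sub>R x)) (\<mu> *\<^sub>R u)" by simp
    then show ?thesis using linear_cmul[OF has_derivative_linear[OF smooth_has_derivative[OF Cons(2)]]] by simp
  qed
  then show ?case using Cons.IH[OF smooth_deriv[OF Cons(2)], of "k * \<mu>" u] by (simp add: mult.assoc)
qed simp

text \<open>On a compact set all derivatives of the dilated form converge uniformly: the chain rule
  contributes powers of \<mu> n, and the shift of the argument is controlled by a Lipschitz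
  bound.\<close>

lemma current_dilation_tendsto:
  assumes T: "T \<in> currents m" and \<eta>: "\<eta> \<in> smooth_forms m" and \<mu>: "\<And>n. 0 < \<mu> n" "\<And>n. \<mu> n < 1" "\<mu> \<longlonglongrightarrow> 1"
  shows "(\<lambda>n. T (pullback (\<lambda>x. (c - \<mu> n *\<^sub>R c) + \<mu> n *\<^sub>R x) \<eta>)) \<longlonglongrightarrow> T \<eta>"
proof (rule current_tendsto[OF T _ \<eta>])
  show "pullback (\<lambda>x. (c - \<mu> n *\<^sub>R c) + \<mu> n *\<^sub>R x) \<eta> \<in> smooth_forms m" for n
    by (rule pullback_smooth_forms[OF smooth_map_affine[OF bounded_linear_scaleR_right] \<eta>])
  fix C :: "'a set" and us :: "'a list" and v and \<epsilon> :: real assume C: "compact C" and \<epsilon>: "\<epsilon> > 0"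
  \<comment> \<open>The exponent \<open>?k\<close> counts one factor \<mu> n for each of the m slots
    and one for each derivative.\<close>
  let ?g = "\<lambda>y. \<eta> y v" and ?k = "m + length us"
  have g: "smooth ?g" by (rule smooth_forms_smooth[OF \<eta>])
  let ?G = "iter_deriv us ?g" and ?h = "\<lambda>n x. (c - \<mu> n *\<^sub>R c) + \<mu> n *\<^sub>R x"
  obtain \<rho> where \<rho>: "C \<subseteq> cball c \<rho>" "\<rho> \<ge> 0"
    using bounded_subset_ballD[OF compact_imp_bounded[OF C], of c] by (meson ball_subset_cball less_imp_le order.trans)
  obtain L where L: "L \<ge> 0" "\<forall>x\<in>cball c \<rho>. \<forall>y\<in>cball c \<rho>. \<bar>?G x - ?G y\<bar> \<le> L * norm (x - y)"
    using smooth_lipschitz_on_ball[OF smooth_iter_deriv[OF g]] by blast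
  define M where "M = \<bar>?G c\<bar> + L * \<rho>"
  have M: "\<bar>?G y\<bar> \<le> M" if "y \<in> cball c \<rho>" for y
  proof -
    have "\<bar>?G y - ?G c\<bar> \<le> L * norm (y - c)" using L(2) that \<rho>(2) by auto
    also have "\<dots> \<le> L * \<rho>" using that L(1) by (intro mult_left_mono) (auto simp: dist_norm norm_minus_commute)
    finally show ?thesis unfolding M_def by linarith
  qed
  have "(\<lambda>n. \<bar>\<mu> n ^ ?k - 1\<bar> * M + L * ((1 - \<mu> n) * \<rho>)) \<longlonglongrightarrow> \<bar>1 ^ ?k - 1\<bar> * M + L * ((1 - 1) * \<rho>)"
    by (intro tendsto_intros \<mu>(3))
  then have "(\<lambda>n. \<bar>\<mu> n ^ ?k - 1\<bar> * M + L * ((1 - \<mu> n) * \<rho>)) \<longlonglongrightarrow> 0" by simp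
  from order_tendstoD(2)[OF this \<epsilon>]
  show "eventually (\<lambda>n. \<forall>x\<in>C. \<bar>iter_deriv us (\<lambda>y. pullback (?h n) \<eta> y v - \<eta> y v) x\<bar> < \<epsilon>) sequentially"
  proof (rule eventually_mono)
    fix n assume n: "\<bar>\<mu> n ^ ?k - 1\<bar> * M + L * ((1 - \<mu> n) * \<rho>) < \<epsilon>"
    have pb: "pullback (?h n) \<eta> y v = \<mu> n ^ m * ?g (?h n y)" for y
      unfolding pullback_affine[OF bounded_linear_scaleR_right] by (rule covector_scale_all[OF smooth_forms_covector[OF \<eta>]])
    show "\<forall>x\<in>C. \<bar>iter_deriv us (\<lambda>y. pullback (?h n) \<eta> y v - \<eta> y v) x\<bar> < \<epsilon>"
    proof
      fix x assume "x \<in> C"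
      then have x: "x \<in> cball c \<rho>" using \<rho> by blast
      have hx: "?h n x - x = (1 - \<mu> n) *\<^sub>R (c - x)" "c - ?h n x = \<mu> n *\<^sub>R (c - x)" by (simp_all add: algebra_simps)
      have hin: "?h n x \<in> cball c \<rho>" unfolding mem_cball dist_norm hx(2) using x \<mu>(1,2)[of n]
        by (auto simp: dist_norm intro: order.trans[OF mult_left_le_one_le])
      have s1: "smooth (\<lambda>y. \<mu> n ^ m * ?g (?h n y))"
        by (intro smooth_mult smooth_const smooth_compose[OF g smooth_map_affine[OF bounded_linear_scaleR_right]])
      have s2: "smooth (\<lambda>y. (-1) * ?g (0 + 1 *\<^sub>R y))" using smooth_mult[OF smooth_const[of "-1"] g] by simp
      have "iter_deriv us (\<lambda>y. pullback (?h n) \<eta> y v - \<eta> y v) x =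
          iter_deriv us (\<lambda>y. \<mu> n ^ m * ?g (?h n y) + (-1) * ?g (0 + 1 *\<^sub>R y)) x" unfolding pb by simp
      also have "\<dots> = (\<mu> n ^ m * \<mu> n ^ length us) * ?G (?h n x) + (-1) * ?G x"
        unfolding iter_deriv_add[OF s1 s2] unfolding iter_deriv_dilation[OF g] by simp
      also have "\<dots> = (\<mu> n ^ ?k - 1) * ?G (?h n x) + (?G (?h n x) - ?G x)" by (simp add: power_add algebra_simps)
      finally have "\<bar>iter_deriv us (\<lambda>y. pullback (?h n) \<eta> y v - \<eta> y v) x\<bar> \<le> \<bar>\<mu> n ^ ?k - 1\<bar> * \<bar>?G (?h n x)\<bar> + \<bar>?G (?h n x) - ?G x\<bar>"
        using abs_triangle_ineq[of "(\<mu> n ^ ?k - 1) * ?G (?h n x)" "?G (?h n x) - ?G x"] unfolding abs_mult by (simp only:)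
      also have "\<dots> \<le> \<bar>\<mu> n ^ ?k - 1\<bar> * M + L * ((1 - \<mu> n) * \<rho>)"
      proof (intro add_mono mult_left_mono M hin)
        have "\<bar>?G (?h n x) - ?G x\<bar> \<le> L * norm (?h n x - x)" using L(2) hin x by blast
        also have "norm (?h n x - x) = (1 - \<mu> n) * norm (c - x)" unfolding hx(1) using \<mu>(2)[of n] by simp
        also have "L * \<dots> \<le> L * ((1 - \<mu> n) * \<rho>)" using x \<mu>(2)[of n] L(1) by (intro mult_left_mono) (auto simp: dist_norm)
        finally show "\<bar>?G (?h n x) - ?G x\<bar> \<le> L * ((1 - \<mu> n) * \<rho>)" .
      qed simp
      finally show "\<bar>iter_deriv us (\<lambda>y. pullback (?h n) \<eta> y v - \<eta> y v) x\<bar> < \<epsilon>" using n by linarith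
    qed
  qed
qed

lemma frac_current_form_bound:
  assumes K: "compact K" "convex K" and \<alpha>: "0 < \<alpha>" "\<alpha> < 1" and T: "T \<in> flat_currents m" "spt m T \<subseteq> K"
    and dec: "frac_decomposition m \<alpha> Ts T" and \<eta>: "\<eta> \<in> smooth_forms m"
  shows "\<bar>T \<eta>\<bar> \<le> (\<Sum>k. frac_weight m \<alpha> (Ts k)) * charge_norm m \<alpha> K (charge_of_form m K \<eta>)"
proof -
  let ?W = "\<Sum>k. frac_weight m \<alpha> (Ts k)" and ?c = "charge_norm m \<alpha> K (charge_of_form m K \<eta>)"
  have Tc: "T \<in> currents m" using T(1) by (simp add: flat_currents_def)
  have sw: "summable (\<lambda>k. frac_weight m \<alpha> (Ts k))" using dec by (simp add: frac_decomposition_def)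
  note ch = charge_of_form_frac_charge[OF K(1) \<alpha> \<eta>]
  have c0: "?c \<ge> 0" by (rule charge_norm_bound(1)[OF ch])
  have W0: "?W \<ge> 0" by (rule suminf_nonneg[OF sw frac_weight_nonneg])
  show ?thesis
  proof (cases "K = {}")
    case True
    \<comment> \<open>There is no map into the empty set, but a current with empty support is
      0.\<close>
    then have "T \<eta> = 0" using current_vanish[OF Tc \<eta>] T(2) by blast
    then show ?thesis using c0 W0 by simp
  next
    case False
    show ?thesis
    proof (rule convex_retraction[OF K False])
      fix c E assume E: "finite E" "\<And>e. e \<in> E \<Longrightarrow> norm e = 1" "pairwise orthogonal E"
      and KE: "\<And>x e. x \<in> K \<Longrightarrow> e \<in> E \<Longrightarrow> (x - c) \<bullet> e = 0"
      and ret: "\<And>\<mu>. 0 < \<mu> \<Longrightarrow> \<mu> < 1 \<Longrightarrow> \<exists>f U. smooth_map f \<and> (\<forall>x. f x \<in> K) \<and>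
      (\<forall>x h. norm (frechet_derivative f (at x) h) \<le> norm h) \<and> open U \<and> K \<subseteq> U \<and>
      (\<forall>x\<in>U. f x = c + \<mu> *\<^sub>R (proj E x - proj E c))"
    have key: "\<bar>T (pullback (\<lambda>x. (c - \<mu> *\<^sub>R c) + \<mu> *\<^sub>R x) \<eta>)\<bar> \<le> ?W * ?c" if \<mu>: "0 < \<mu>" "\<mu> < 1" for \<mu>
    proof -
      obtain f U where f: "smooth_map f" "\<And>x. f x \<in> K" "\<And>x h. norm (frechet_derivative f (at x) h) \<le> norm h"
        and U: "open U" "K \<subseteq> U" "\<And>x. x \<in> U \<Longrightarrow> f x = c + \<mu> *\<^sub>R (proj E x - proj E c)"
        using ret[OF \<mu>] by blast
      have sums: "(\<lambda>k. Ts k (pullback f \<eta>)) sums T (pullback f \<eta>)"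
        by (rule frac_decomposition_limits(3)[OF T(1) dec pullback_smooth_forms[OF f(1) \<eta>]])
      \<comment> \<open>The currents Ts k may leave K, and the charge of \<eta> only estimates
        currents in K; it is applied to their pushforwards.\<close>
      have le: "norm (Ts k (pullback f \<eta>)) \<le> ?c * frac_weight m \<alpha> (Ts k)" for k
      proof -
        have Tn: "Ts k \<in> normal_currents m" using dec normal_currents_inD(1) unfolding frac_decomposition_def by blast
        note pf = pushforward_frac[OF f K(1) \<alpha> Tn]
        have "\<bar>Ts k (pullback f \<eta>)\<bar> = \<bar>charge_of_form m K \<eta> (pushforward m f (Ts k))\<bar>"
          using pf(1) \<eta> by (simp add: charge_of_form_def pushforward_def)
        also have "\<dots> \<le> ?c * frac_weight m \<alpha> (pushforward m f (Ts k))" by (rule charge_norm_bound(2)[OF ch pf(1)])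
        also have "\<dots> \<le> ?c * frac_weight m \<alpha> (Ts k)" using pf(2) c0 by (rule mult_left_mono)
        finally show ?thesis by simp
      qed
      have "norm (\<Sum>k. Ts k (pullback f \<eta>)) \<le> (\<Sum>k. ?c * frac_weight m \<alpha> (Ts k))"
        by (rule norm_suminf_le[OF le summable_mult[OF sw]])
      then have b: "\<bar>T (pullback f \<eta>)\<bar> \<le> ?W * ?c"
        using sums_unique[OF sums] suminf_mult[OF sw, of ?c] by (simp add: mult.commute)
      let ?h = "\<lambda>x. (c - \<mu> *\<^sub>R c) + \<mu> *\<^sub>R x" and ?P = "\<lambda>x. (c - proj E c) + proj E x"
      let ?\<eta>' = "pullback ?h \<eta>"
      have \<eta>': "?\<eta>' \<in> smooth_forms m" by (rule pullback_smooth_forms[OF smooth_map_affine[OF bounded_linear_scaleR_right] \<eta>])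
      \<comment> \<open>Near K, f is the dilation \<open>?h\<close> after the projection
        \<open>?P\<close>, so T cannot tell the two pullbacks apart; the projection is then removed
        by \<open>flat_current_project\<close>.\<close>
      have "T (pullback f \<eta>) = T (pullback ?P ?\<eta>')"
      proof (rule current_cong[OF Tc _ _ U(1)])
        show "pullback f \<eta> \<in> smooth_forms m" "pullback ?P ?\<eta>' \<in> smooth_forms m"
          by (intro pullback_smooth_forms f(1) \<eta> \<eta>' smooth_map_affine bounded_linear_proj)+
        show "spt m T \<subseteq> U" using T(2) U(2) by blast
        fix x v assume x: "x \<in> U"
        let ?Q = "\<lambda>x. (c - \<mu> *\<^sub>R proj E c) + \<mu> *\<^sub>R proj E x"
        have blQ: "bounded_linear (\<lambda>x. \<mu> *\<^sub>R proj E x)" by (rule bounded_linear_compose[OF bounded_linear_scaleR_right bounded_linear_proj])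
        have fQ: "f y = ?Q y" if "y \<in> U" for y using U(3)[OF that] by (simp add: algebra_simps)
        have "(?Q has_derivative (\<lambda>x. \<mu> *\<^sub>R proj E x)) (at x)"
          using has_derivative_affine[OF blQ, of "c - \<mu> *\<^sub>R proj E c" x] smooth_map_has_derivative[OF smooth_map_affine[OF blQ, of "c - \<mu> *\<^sub>R proj E c"], of x] by simp
        then have "(f has_derivative (\<lambda>x. \<mu> *\<^sub>R proj E x)) (at x)"
          by (rule has_derivative_transform_within_open[OF _ U(1) x]) (simp add: fQ)
        then have df: "frechet_derivative f (at x) = (\<lambda>x. \<mu> *\<^sub>R proj E x)" by (rule frechet_derivative_at[symmetric])
        have "pullback f \<eta> x v = \<eta> (?Q x) (\<lambda>j. \<mu> *\<^sub>R proj E (v j))" unfolding pullback_def df fQ[OF x] ..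
        also have "\<dots> = \<eta> (?h (?P x)) (\<lambda>j. \<mu> *\<^sub>R proj E (v j))" by (simp add: algebra_simps)
        also have "\<dots> = ?\<eta>' (?P x) (\<lambda>j. proj E (v j))" by (rule pullback_affine[OF bounded_linear_scaleR_right, symmetric])
        also have "\<dots> = pullback ?P ?\<eta>' x v" by (rule pullback_affine[OF bounded_linear_proj, symmetric])
        finally show "pullback f \<eta> x v = pullback ?P ?\<eta>' x v" .
      qed
      also have "\<dots> = T ?\<eta>'" by (rule flat_current_project[OF T K(1) E KE \<eta>', symmetric])
      finally show ?thesis using b by simp
    qed
    \<comment> \<open>The shift by 2 keeps \<mu> 0 positive.\<close>
    define \<mu> where "\<mu> n = 1 - 1 / real (n + 2)" for n
    have \<mu>: "0 < \<mu> n" "\<mu> n < 1" for n by (auto simp: \<mu>_def)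
    have "\<mu> \<longlonglongrightarrow> 1 - 0" unfolding \<mu>_def
      by (intro tendsto_diff tendsto_const LIMSEQ_ignore_initial_segment[OF lim_1_over_n])
    then have "(\<lambda>n. T (pullback (\<lambda>x. (c - \<mu> n *\<^sub>R c) + \<mu> n *\<^sub>R x) \<eta>)) \<longlonglongrightarrow> T \<eta>"
      by (intro current_dilation_tendsto[OF Tc \<eta> \<mu>]) simp
    from tendsto_rabs[OF this] show ?thesis
      by (rule LIMSEQ_le_const2) (use key[OF \<mu>] in blast)
    qed
  qed
qed

section \<open>The duality\<close>

lemma frac_norm_le:
  assumes "frac_decomposition m \<alpha> Ts T" shows "frac_norm m \<alpha> T \<le> (\<Sum>k. frac_weight m \<alpha> (Ts k))"
  unfolding frac_norm_def
proof (rule cInf_lower)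
  show "bdd_below {\<Sum>k. frac_weight m \<alpha> (Ts k) |Ts. frac_decomposition m \<alpha> Ts T}"
    by (rule bdd_belowI[of _ 0]) (auto simp: frac_decomposition_def intro!: suminf_nonneg frac_weight_nonneg)
qed (use assms in blast)

text \<open>The estimate for a single decomposition passes to the infimum after division by the
  charge norm; if that norm is 0, every decomposition already gives T \<eta> = 0.\<close>

lemma frac_norm_form_bound:
  assumes K: "compact K" "convex K" and \<alpha>: "0 < \<alpha>" "\<alpha> < 1" and T: "T \<in> frac_currents_in m \<alpha> K"
  shows "0 \<le> frac_norm m \<alpha> T"
    "\<eta> \<in> smooth_forms m \<Longrightarrow> \<bar>T \<eta>\<bar> \<le> frac_norm m \<alpha> T * charge_norm m \<alpha> K (charge_of_form m K \<eta>)"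
proof -
  let ?S = "{\<Sum>k. frac_weight m \<alpha> (Ts k) |Ts. frac_decomposition m \<alpha> Ts T}"
  have T': "T \<in> flat_currents m" "spt m T \<subseteq> K" and ne: "?S \<noteq> {}"
    using T by (auto simp: frac_currents_in_def frac_currents_def)
  show "0 \<le> frac_norm m \<alpha> T" unfolding frac_norm_def
    by (rule cInf_greatest[OF ne]) (auto simp: frac_decomposition_def intro!: suminf_nonneg frac_weight_nonneg)
  assume \<eta>: "\<eta> \<in> smooth_forms m"
  let ?c = "charge_norm m \<alpha> K (charge_of_form m K \<eta>)"
  have c0: "?c \<ge> 0" by (rule charge_norm_bound(1)[OF charge_of_form_frac_charge[OF K(1) \<alpha> \<eta>]])
  have b: "\<bar>T \<eta>\<bar> \<le> s * ?c" if "s \<in> ?S" for s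
    using that frac_current_form_bound[OF K \<alpha> T' _ \<eta>] by blast
  show "\<bar>T \<eta>\<bar> \<le> frac_norm m \<alpha> T * ?c"
  proof (cases "?c = 0")
    case True
    then show ?thesis using b ne by fastforce
  next
    case False
    then have c: "?c > 0" using c0 by simp
    have "\<bar>T \<eta>\<bar> / ?c \<le> frac_norm m \<alpha> T" unfolding frac_norm_def
      by (rule cInf_greatest[OF ne]) (use b c in \<open>auto simp: divide_le_eq\<close>)
    then show ?thesis using c by (simp add: divide_le_eq)
  qed
qed

lemma frac_currents_in_linear: "T \<in> frac_currents_in m \<alpha> K \<Longrightarrow> T \<in> linear_functionals (smooth_forms m)"
  by (auto simp: frac_currents_in_def frac_currents_def flat_currents_def currents_linear)

context
  fixes K :: "'a::euclidean_space set" and m :: nat and \<alpha> :: real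
  assumes K: "compact K" "convex K" and \<alpha>: "0 < \<alpha>" "\<alpha> < 1"
begin

abbreviation (input) "fcur \<equiv> frac_currents_in m \<alpha> K"
abbreviation (input) "lch \<equiv> little_frac_charges m \<alpha> K"
abbreviation (input) "cnorm \<equiv> charge_norm m \<alpha> K"
abbreviation (input) "\<iota> \<equiv> charge_of_form m K"

text \<open>The converse of \<open>frac_norm_form_bound\<close> up to the constant 4. Membership is
  thereby expressed by values on forms, so that linearity of the space needs no manipulation of
  decompositions.\<close>

lemma fcurI:
  assumes "\<Phi> \<in> linear_functionals (smooth_forms m)" "B \<ge> 0" "\<And>\<eta>. \<eta> \<in> smooth_forms m \<Longrightarrow> \<bar>\<Phi> \<eta>\<bar> \<le> B * cnorm (\<iota> \<eta>)"
  shows "\<Phi> \<in> fcur" "frac_norm m \<alpha> \<Phi> \<le> 4 * B"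
  using frac_decomposition_exists[OF \<alpha> K(1) assms] frac_norm_le order.trans by metis+

text \<open>The infimum in \<open>frac_norm\<close> ranges over decompositions with arbitrary
  compact support. Splitting the functional T anew yields one inside K, at the price of the factor
  4.\<close>

lemma fcur_decomposition:
  assumes T: "T \<in> fcur"
  obtains Ts where "frac_decomposition m \<alpha> Ts T" "\<And>k. Ts k \<in> normal_currents_in m K"
    "(\<Sum>k. frac_weight m \<alpha> (Ts k)) \<le> 4 * frac_norm m \<alpha> T"
  using frac_decomposition_exists[OF \<alpha> K(1) frac_currents_in_linear[OF T] frac_norm_form_bound[OF K \<alpha> T]] by metis

section \<open>The space of little charges\<close>

lemma lch_charge: "\<omega> \<in> lch \<Longrightarrow> \<omega> \<in> frac_charges m \<alpha> K"
  by (simp add: little_frac_charges_def)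

lemma \<iota>_charge: "\<eta> \<in> smooth_forms m \<Longrightarrow> \<iota> \<eta> \<in> frac_charges m \<alpha> K"
  by (rule charge_of_form_frac_charge[OF K(1) \<alpha>])

lemma cnorm_zero: "cnorm 0 = 0"
proof (rule antisym)
  show "cnorm 0 \<le> 0" by (rule charge_norm_le) auto
  have "0 \<in> frac_charges m \<alpha> K" by (auto simp: frac_charges_def linear_functionals_def intro!: exI[of _ 0])
  then show "0 \<le> cnorm 0" by (rule charge_norm_bound(1))
qed

lemma \<iota>_lch: assumes "\<eta> \<in> smooth_forms m" shows "\<iota> \<eta> \<in> lch"
  unfolding little_frac_charges_def using \<iota>_charge[OF assms] assms cnorm_zero by (auto intro!: bexI[of _ \<eta>])

lemma lch_add: assumes "\<omega> \<in> lch" "\<omega>' \<in> lch" shows "\<omega> + \<omega>' \<in> lch"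
  unfolding little_frac_charges_def
proof (intro CollectI conjI allI impI)
  show "\<omega> + \<omega>' \<in> frac_charges m \<alpha> K" by (intro frac_charges_add lch_charge assms)
  fix \<epsilon> :: real assume "\<epsilon> > 0"
  then have "\<epsilon> / 2 > 0" by simp
  then obtain \<eta> \<eta>' where \<eta>: "\<eta> \<in> smooth_forms m" "cnorm (\<omega> - \<iota> \<eta>) < \<epsilon> / 2" "\<eta>' \<in> smooth_forms m" "cnorm (\<omega>' - \<iota> \<eta>') < \<epsilon> / 2"
    using assms unfolding little_frac_charges_def by blast
  have "cnorm ((\<omega> - \<iota> \<eta>) + (\<omega>' - \<iota> \<eta>')) \<le> cnorm (\<omega> - \<iota> \<eta>) + cnorm (\<omega>' - \<iota> \<eta>')"
    by (intro frac_charges_add(2) frac_charges_diff lch_charge assms \<iota>_charge \<eta>)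
  moreover have "(\<omega> - \<iota> \<eta>) + (\<omega>' - \<iota> \<eta>') = (\<omega> + \<omega>') - \<iota> (\<eta> + \<eta>')" using charge_of_form_add[OF \<eta>(1,3)] by simp
  ultimately show "\<exists>\<eta>\<in>smooth_forms m. cnorm (\<omega> + \<omega>' - \<iota> \<eta>) < \<epsilon>"
    using \<eta> by (intro bexI[of _ "\<eta> + \<eta>'"] smooth_forms_add) auto
qed

lemma lch_scaleR: assumes "\<omega> \<in> lch" shows "a *\<^sub>R \<omega> \<in> lch"
  unfolding little_frac_charges_def
proof (intro CollectI conjI allI impI)
  show "a *\<^sub>R \<omega> \<in> frac_charges m \<alpha> K" by (intro frac_charges_scaleR lch_charge assms)
  fix \<epsilon> :: real assume \<epsilon>: "\<epsilon> > 0"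
  then have "\<epsilon> / (\<bar>a\<bar> + 1) > 0" by (simp add: add_nonneg_pos)
  then obtain \<eta> where \<eta>: "\<eta> \<in> smooth_forms m" "cnorm (\<omega> - \<iota> \<eta>) < \<epsilon> / (\<bar>a\<bar> + 1)"
    using assms unfolding little_frac_charges_def by blast
  have d: "\<omega> - \<iota> \<eta> \<in> frac_charges m \<alpha> K" by (intro frac_charges_diff lch_charge assms \<iota>_charge \<eta>)
  have "cnorm (a *\<^sub>R (\<omega> - \<iota> \<eta>)) \<le> \<bar>a\<bar> * cnorm (\<omega> - \<iota> \<eta>)" by (rule frac_charges_scaleR(2)[OF d])
  also have "\<dots> \<le> (\<bar>a\<bar> + 1) * cnorm (\<omega> - \<iota> \<eta>)" using charge_norm_bound(1)[OF d] by (intro mult_right_mono) auto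
  also have "\<dots> < \<epsilon>" using \<eta>(2) by (simp add: less_divide_eq add_nonneg_pos mult.commute)
  finally have "cnorm (a *\<^sub>R (\<omega> - \<iota> \<eta>)) < \<epsilon>" .
  moreover have "a *\<^sub>R (\<omega> - \<iota> \<eta>) = a *\<^sub>R \<omega> - \<iota> (a *\<^sub>R \<eta>)" using charge_of_form_scaleR[OF \<eta>(1)] by (simp add: scaleR_diff_right)
  ultimately show "\<exists>\<eta>\<in>smooth_forms m. cnorm (a *\<^sub>R \<omega> - \<iota> \<eta>) < \<epsilon>"
    using \<eta> by (intro bexI[of _ "a *\<^sub>R \<eta>"] smooth_forms_scaleR) auto
qed

section \<open>The bracket as a limit over approximating forms\<close>

lemma lch_approx:
  assumes "\<omega> \<in> lch"
  obtains \<eta>s where "\<And>n. \<eta>s n \<in> smooth_forms m" "(\<lambda>n. cnorm (\<omega> - \<iota> (\<eta>s n))) \<longlonglongrightarrow> 0"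
proof -
  have "\<forall>n. \<exists>\<eta>. \<eta> \<in> smooth_forms m \<and> cnorm (\<omega> - \<iota> \<eta>) < inverse (real (Suc n))"
    using assms unfolding little_frac_charges_def by (simp add: Bex_def)
  then obtain \<eta>s where \<eta>s: "\<And>n. \<eta>s n \<in> smooth_forms m" "\<And>n. cnorm (\<omega> - \<iota> (\<eta>s n)) < inverse (real (Suc n))" by metis
  have "(\<lambda>n. cnorm (\<omega> - \<iota> (\<eta>s n))) \<longlonglongrightarrow> 0"
  proof (rule tendsto_sandwich[OF _ _ tendsto_const LIMSEQ_inverse_real_of_nat])
    show "eventually (\<lambda>n. 0 \<le> cnorm (\<omega> - \<iota> (\<eta>s n))) sequentially"
      by (intro always_eventually allI charge_norm_bound(1) frac_charges_diff lch_charge assms \<iota>_charge \<eta>s)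
    show "eventually (\<lambda>n. cnorm (\<omega> - \<iota> (\<eta>s n)) \<le> inverse (real (Suc n))) sequentially"
      by (intro always_eventually allI less_imp_le \<eta>s)
  qed
  then show thesis using that \<eta>s(1) by blast
qed

text \<open>The estimate of a charge by its norm is summed over the decomposition. The last claim
  applies this to \<omega> minus the charge of \<eta>, whose sum over the decomposition is known
  because the series converges on \<eta>.\<close>

lemma decomposition_pairing:
  assumes T: "T \<in> flat_currents m" and dec: "frac_decomposition m \<alpha> Ts T" "\<And>k. Ts k \<in> normal_currents_in m K"
    and \<omega>: "\<omega> \<in> frac_charges m \<alpha> K"
  shows "summable (\<lambda>k. \<omega> (Ts k))" "\<bar>\<Sum>k. \<omega> (Ts k)\<bar> \<le> cnorm \<omega> * (\<Sum>k. frac_weight m \<alpha> (Ts k))"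
    "\<eta> \<in> smooth_forms m \<Longrightarrow> \<bar>(\<Sum>k. \<omega> (Ts k)) - T \<eta>\<bar> \<le> cnorm (\<omega> - \<iota> \<eta>) * (\<Sum>k. frac_weight m \<alpha> (Ts k))"
proof -
  have sw: "summable (\<lambda>k. frac_weight m \<alpha> (Ts k))" using dec by (simp add: frac_decomposition_def)
  have gen: "summable (\<lambda>k. \<omega> (Ts k)) \<and> \<bar>\<Sum>k. \<omega> (Ts k)\<bar> \<le> cnorm \<omega> * (\<Sum>k. frac_weight m \<alpha> (Ts k))"
    if \<omega>: "\<omega> \<in> frac_charges m \<alpha> K" for \<omega>
  proof
    have b: "norm (\<omega> (Ts k)) \<le> cnorm \<omega> * frac_weight m \<alpha> (Ts k)" for k
      using charge_norm_bound(2)[OF \<omega> dec(2)] by simp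
    show "summable (\<lambda>k. \<omega> (Ts k))" by (rule summable_comparison_test'[OF summable_mult[OF sw], of 0]) (rule b)
    have "norm (\<Sum>k. \<omega> (Ts k)) \<le> (\<Sum>k. cnorm \<omega> * frac_weight m \<alpha> (Ts k))"
      by (rule norm_suminf_le[OF b summable_mult[OF sw]])
    then show "\<bar>\<Sum>k. \<omega> (Ts k)\<bar> \<le> cnorm \<omega> * (\<Sum>k. frac_weight m \<alpha> (Ts k))" using suminf_mult[OF sw] by simp
  qed
  show s: "summable (\<lambda>k. \<omega> (Ts k))" and "\<bar>\<Sum>k. \<omega> (Ts k)\<bar> \<le> cnorm \<omega> * (\<Sum>k. frac_weight m \<alpha> (Ts k))"
    using gen[OF \<omega>] by auto
  assume \<eta>: "\<eta> \<in> smooth_forms m"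
  have Ts: "(\<lambda>k. Ts k \<eta>) sums T \<eta>" by (rule frac_decomposition_limits(3)[OF T dec(1) \<eta>])
  have "(\<lambda>k. (\<omega> - \<iota> \<eta>) (Ts k)) = (\<lambda>k. \<omega> (Ts k) - Ts k \<eta>)" using dec(2) by (simp add: charge_of_form_def)
  then have "(\<lambda>k. (\<omega> - \<iota> \<eta>) (Ts k)) sums ((\<Sum>k. \<omega> (Ts k)) - T \<eta>)" using sums_diff[OF summable_sums[OF s] Ts] by simp
  then show "\<bar>(\<Sum>k. \<omega> (Ts k)) - T \<eta>\<bar> \<le> cnorm (\<omega> - \<iota> \<eta>) * (\<Sum>k. frac_weight m \<alpha> (Ts k))"
    using gen[OF frac_charges_diff[OF \<omega> \<iota>_charge[OF \<eta>]]] sums_unique by fastforce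
qed

lemma pairing_tendsto:
  assumes T: "T \<in> flat_currents m" and dec: "frac_decomposition m \<alpha> Ts T" "\<And>k. Ts k \<in> normal_currents_in m K"
    and \<omega>: "\<omega> \<in> lch" and \<eta>s: "\<And>n. \<eta>s n \<in> smooth_forms m" "(\<lambda>n. cnorm (\<omega> - \<iota> (\<eta>s n))) \<longlonglongrightarrow> 0"
  shows "(\<lambda>n. T (\<eta>s n)) \<longlonglongrightarrow> (\<Sum>k. \<omega> (Ts k))"
proof -
  let ?W = "\<Sum>k. frac_weight m \<alpha> (Ts k)"
  have b: "\<bar>(\<Sum>k. \<omega> (Ts k)) - T (\<eta>s n)\<bar> \<le> cnorm (\<omega> - \<iota> (\<eta>s n)) * ?W" for n
    by (rule decomposition_pairing(3)[OF T dec lch_charge[OF \<omega>] \<eta>s(1)])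
  have z: "(\<lambda>n. cnorm (\<omega> - \<iota> (\<eta>s n)) * ?W) \<longlonglongrightarrow> 0" by (rule tendsto_mult_left_zero[OF \<eta>s(2)])
  have "(\<lambda>n. (\<Sum>k. \<omega> (Ts k)) - T (\<eta>s n)) \<longlonglongrightarrow> 0"
    by (rule Lim_null_comparison[OF _ z], rule always_eventually, unfold real_norm_def, rule allI, rule b)
  then have "(\<lambda>n. (\<Sum>k. \<omega> (Ts k)) - ((\<Sum>k. \<omega> (Ts k)) - T (\<eta>s n))) \<longlonglongrightarrow> (\<Sum>k. \<omega> (Ts k)) - 0" by (intro tendsto_intros)
  then show ?thesis by simp
qed

text \<open>For every admissible decomposition the sum is the limit of the numbers T (\<eta>s n),
  which do not mention the decomposition; so the value in \<open>bracket\<close> is unique.\<close>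

lemma bracket_eq:
  assumes T: "T \<in> flat_currents m" and dec: "frac_decomposition m \<alpha> Ts T" "\<And>k. Ts k \<in> normal_currents_in m K" and \<omega>: "\<omega> \<in> lch"
  shows "bracket m \<alpha> K \<omega> T = (\<Sum>k. \<omega> (Ts k))"
  unfolding bracket_def
proof (rule the_equality)
  show "\<exists>Ts'. frac_decomposition m \<alpha> Ts' T \<and> (\<forall>k. Ts' k \<in> normal_currents_in m K) \<and> (\<lambda>k. \<omega> (Ts' k)) sums (\<Sum>k. \<omega> (Ts k))"
    using dec summable_sums[OF decomposition_pairing(1)[OF T dec lch_charge[OF \<omega>]]] by blast
  fix r assume "\<exists>Ts'. frac_decomposition m \<alpha> Ts' T \<and> (\<forall>k. Ts' k \<in> normal_currents_in m K) \<and> (\<lambda>k. \<omega> (Ts' k)) sums r"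
  then obtain Ts' where Ts': "frac_decomposition m \<alpha> Ts' T" "\<And>k. Ts' k \<in> normal_currents_in m K" "(\<lambda>k. \<omega> (Ts' k)) sums r" by blast
  obtain \<eta>s where \<eta>s: "\<And>n. \<eta>s n \<in> smooth_forms m" "(\<lambda>n. cnorm (\<omega> - \<iota> (\<eta>s n))) \<longlonglongrightarrow> 0" using lch_approx[OF \<omega>] by blast
  have "(\<Sum>k. \<omega> (Ts' k)) = (\<Sum>k. \<omega> (Ts k))"
    by (rule LIMSEQ_unique[OF pairing_tendsto[OF T Ts'(1,2) \<omega> \<eta>s] pairing_tendsto[OF T dec \<omega> \<eta>s]])
  then show "r = (\<Sum>k. \<omega> (Ts k))" using sums_unique[OF Ts'(3)] by simp
qed

lemma fcur_flat: "T \<in> fcur \<Longrightarrow> T \<in> flat_currents m"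
  by (simp add: frac_currents_in_def frac_currents_def)

lemma bracket_bound:
  assumes T: "T \<in> fcur" and \<omega>: "\<omega> \<in> lch"
  shows "\<bar>bracket m \<alpha> K \<omega> T\<bar> \<le> 4 * frac_norm m \<alpha> T * cnorm \<omega>"
proof -
  obtain Ts where Ts: "frac_decomposition m \<alpha> Ts T" "\<And>k. Ts k \<in> normal_currents_in m K"
    "(\<Sum>k. frac_weight m \<alpha> (Ts k)) \<le> 4 * frac_norm m \<alpha> T" using fcur_decomposition[OF T] by blast
  have "\<bar>bracket m \<alpha> K \<omega> T\<bar> \<le> cnorm \<omega> * (\<Sum>k. frac_weight m \<alpha> (Ts k))"
    unfolding bracket_eq[OF fcur_flat[OF T] Ts(1,2) \<omega>]
    by (rule decomposition_pairing(2)[OF fcur_flat[OF T] Ts(1,2) lch_charge[OF \<omega>]])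
  also have "\<dots> \<le> cnorm \<omega> * (4 * frac_norm m \<alpha> T)"
    using Ts(3) charge_norm_bound(1)[OF lch_charge[OF \<omega>]] by (rule mult_left_mono)
  finally show ?thesis by (simp add: mult.commute)
qed

lemma bracket_tendsto:
  assumes T: "T \<in> fcur" and \<omega>: "\<omega> \<in> lch" and \<eta>s: "\<And>n. \<eta>s n \<in> smooth_forms m" "(\<lambda>n. cnorm (\<omega> - \<iota> (\<eta>s n))) \<longlonglongrightarrow> 0"
  shows "(\<lambda>n. T (\<eta>s n)) \<longlonglongrightarrow> bracket m \<alpha> K \<omega> T"
proof -
  obtain Ts where Ts: "frac_decomposition m \<alpha> Ts T" "\<And>k. Ts k \<in> normal_currents_in m K" using fcur_decomposition[OF T] by metis
  show ?thesis unfolding bracket_eq[OF fcur_flat[OF T] Ts \<omega>] by (rule pairing_tendsto[OF fcur_flat[OF T] Ts \<omega> \<eta>s])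
qed

lemma bracket_form: assumes T: "T \<in> fcur" and \<eta>: "\<eta> \<in> smooth_forms m" shows "bracket m \<alpha> K (\<iota> \<eta>) T = T \<eta>"
proof -
  have "(\<lambda>n. T \<eta>) \<longlonglongrightarrow> bracket m \<alpha> K (\<iota> \<eta>) T"
    by (rule bracket_tendsto[OF T \<iota>_lch[OF \<eta>] \<eta>]) (simp add: cnorm_zero)
  then show ?thesis by (simp add: LIMSEQ_const_iff)
qed

text \<open>Linearity in the charge is linearity of T on forms, carried over by
  approximation.\<close>

lemma bracket_add_charge:
  assumes T: "T \<in> fcur" and \<omega>: "\<omega> \<in> lch" "\<omega>' \<in> lch"
  shows "bracket m \<alpha> K (\<omega> + \<omega>') T = bracket m \<alpha> K \<omega> T + bracket m \<alpha> K \<omega>' T"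
proof -
  obtain \<eta>s where \<eta>s: "\<And>n. \<eta>s n \<in> smooth_forms m" "(\<lambda>n. cnorm (\<omega> - \<iota> (\<eta>s n))) \<longlonglongrightarrow> 0" using lch_approx[OF \<omega>(1)] by blast
  obtain \<zeta>s where \<zeta>s: "\<And>n. \<zeta>s n \<in> smooth_forms m" "(\<lambda>n. cnorm (\<omega>' - \<iota> (\<zeta>s n))) \<longlonglongrightarrow> 0" using lch_approx[OF \<omega>(2)] by blast
  have s: "\<eta>s n + \<zeta>s n \<in> smooth_forms m" for n by (intro smooth_forms_add \<eta>s \<zeta>s)
  have d: "(\<omega> + \<omega>') - \<iota> (\<eta>s n + \<zeta>s n) = (\<omega> - \<iota> (\<eta>s n)) + (\<omega>' - \<iota> (\<zeta>s n))" for n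
    using charge_of_form_add[OF \<eta>s(1) \<zeta>s(1)] by simp
  have c: "\<omega> - \<iota> (\<eta>s n) \<in> frac_charges m \<alpha> K" "\<omega>' - \<iota> (\<zeta>s n) \<in> frac_charges m \<alpha> K" for n
    by (intro frac_charges_diff lch_charge \<omega> \<iota>_charge \<eta>s \<zeta>s)+
  have "(\<lambda>n. cnorm ((\<omega> + \<omega>') - \<iota> (\<eta>s n + \<zeta>s n))) \<longlonglongrightarrow> 0" unfolding d
  proof (rule tendsto_sandwich[OF _ _ tendsto_const])
    show "(\<lambda>n. cnorm (\<omega> - \<iota> (\<eta>s n)) + cnorm (\<omega>' - \<iota> (\<zeta>s n))) \<longlonglongrightarrow> 0" using tendsto_add[OF \<eta>s(2) \<zeta>s(2)] by simp
  qed (intro always_eventually allI charge_norm_bound(1) frac_charges_add c)+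
  from bracket_tendsto[OF T lch_add[OF \<omega>] s this]
  have "(\<lambda>n. T (\<eta>s n + \<zeta>s n)) \<longlonglongrightarrow> bracket m \<alpha> K (\<omega> + \<omega>') T" .
  moreover have "(\<lambda>n. T (\<eta>s n + \<zeta>s n)) \<longlonglongrightarrow> bracket m \<alpha> K \<omega> T + bracket m \<alpha> K \<omega>' T"
    unfolding linear_functionals_add[OF frac_currents_in_linear[OF T] \<eta>s(1) \<zeta>s(1)]
    by (intro tendsto_add bracket_tendsto[OF T] \<omega> \<eta>s \<zeta>s)
  ultimately show ?thesis by (rule LIMSEQ_unique)
qed

lemma bracket_scaleR_charge:
  assumes T: "T \<in> fcur" and \<omega>: "\<omega> \<in> lch"
  shows "bracket m \<alpha> K (a *\<^sub>R \<omega>) T = a * bracket m \<alpha> K \<omega> T"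
proof -
  obtain \<eta>s where \<eta>s: "\<And>n. \<eta>s n \<in> smooth_forms m" "(\<lambda>n. cnorm (\<omega> - \<iota> (\<eta>s n))) \<longlonglongrightarrow> 0" using lch_approx[OF \<omega>] by blast
  have s: "a *\<^sub>R \<eta>s n \<in> smooth_forms m" for n by (intro smooth_forms_scaleR \<eta>s)
  have d: "a *\<^sub>R \<omega> - \<iota> (a *\<^sub>R \<eta>s n) = a *\<^sub>R (\<omega> - \<iota> (\<eta>s n))" for n
    using charge_of_form_scaleR[OF \<eta>s(1)] by (simp add: scaleR_diff_right)
  have c: "\<omega> - \<iota> (\<eta>s n) \<in> frac_charges m \<alpha> K" for n by (intro frac_charges_diff lch_charge \<omega> \<iota>_charge \<eta>s)
  have "(\<lambda>n. cnorm (a *\<^sub>R \<omega> - \<iota> (a *\<^sub>R \<eta>s n))) \<longlonglongrightarrow> 0" unfolding d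
    by (rule tendsto_sandwich[OF _ _ tendsto_const tendsto_mult_right_zero[OF \<eta>s(2), of "\<bar>a\<bar>"]])
      (intro always_eventually allI charge_norm_bound(1) frac_charges_scaleR c)+
  from bracket_tendsto[OF T lch_scaleR[OF \<omega>] s this]
  have "(\<lambda>n. T (a *\<^sub>R \<eta>s n)) \<longlonglongrightarrow> bracket m \<alpha> K (a *\<^sub>R \<omega>) T" .
  moreover have "(\<lambda>n. T (a *\<^sub>R \<eta>s n)) \<longlonglongrightarrow> a * bracket m \<alpha> K \<omega> T"
    unfolding linear_functionals_scaleR[OF frac_currents_in_linear[OF T] \<eta>s(1)]
    by (intro tendsto_mult_left bracket_tendsto[OF T \<omega> \<eta>s])
  ultimately show ?thesis by (rule LIMSEQ_unique)
qed

section \<open>Linear structure of the fractional currents in K\<close>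

lemma fcur_add: assumes "S \<in> fcur" "T \<in> fcur" shows "S + T \<in> fcur"
proof (rule fcurI(1))
  show "S + T \<in> linear_functionals (smooth_forms m)" by (rule linear_functionals_plus[OF frac_currents_in_linear[OF assms(1)] frac_currents_in_linear[OF assms(2)]])
  show "0 \<le> frac_norm m \<alpha> S + frac_norm m \<alpha> T" using frac_norm_form_bound(1)[OF K \<alpha> assms(1)] frac_norm_form_bound(1)[OF K \<alpha> assms(2)] by simp
  show "\<bar>(S + T) \<eta>\<bar> \<le> (frac_norm m \<alpha> S + frac_norm m \<alpha> T) * cnorm (\<iota> \<eta>)" if "\<eta> \<in> smooth_forms m" for \<eta>
    using frac_norm_form_bound(2)[OF K \<alpha> assms(1) that] frac_norm_form_bound(2)[OF K \<alpha> assms(2) that] by (simp add: ring_distribs)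
qed

lemma fcur_scaleR: assumes "T \<in> fcur" shows "a *\<^sub>R T \<in> fcur"
proof (rule fcurI(1))
  show "a *\<^sub>R T \<in> linear_functionals (smooth_forms m)" by (rule linear_functionals_cmul[OF frac_currents_in_linear[OF assms]])
  show "0 \<le> \<bar>a\<bar> * frac_norm m \<alpha> T" using frac_norm_form_bound(1)[OF K \<alpha> assms] by simp
  show "\<bar>(a *\<^sub>R T) \<eta>\<bar> \<le> (\<bar>a\<bar> * frac_norm m \<alpha> T) * cnorm (\<iota> \<eta>)" if "\<eta> \<in> smooth_forms m" for \<eta>
    using mult_left_mono[OF frac_norm_form_bound(2)[OF K \<alpha> assms that], of "\<bar>a\<bar>"] by (simp add: scaleR_fun_def abs_mult mult.assoc)
qed

section \<open>The canonical map into the dual\<close>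

abbreviation (input) "dual \<equiv> dual_space lch cnorm"
abbreviation (input) "dnorm \<equiv> dual_norm lch cnorm"
text \<open>The value 0 outside \<open>lch\<close> is the convention of
  \<open>linear_functionals\<close>, under which equal functionals are equal functions.\<close>

abbreviation (input) "J \<equiv> (\<lambda>T \<omega>. if \<omega> \<in> lch then bracket m \<alpha> K \<omega> T else 0)"

lemma J_dual: assumes T: "T \<in> fcur" shows "J T \<in> dual" "dnorm (J T) \<le> 4 * frac_norm m \<alpha> T"
proof -
  have nn: "0 \<le> 4 * frac_norm m \<alpha> T" using frac_norm_form_bound(1)[OF K \<alpha> T] by simp
  have b: "\<forall>\<omega>\<in>lch. \<bar>J T \<omega>\<bar> \<le> 4 * frac_norm m \<alpha> T * cnorm \<omega>" using bracket_bound[OF T] by simp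
  have "J T \<in> linear_functionals lch" unfolding linear_functionals_def
    by (simp add: lch_add lch_scaleR bracket_add_charge[OF T] bracket_scaleR_charge[OF T])
  then show "J T \<in> dual" unfolding dual_space_def using nn b by blast
  show "dnorm (J T) \<le> 4 * frac_norm m \<alpha> T" unfolding dual_norm_def
    by (rule cInf_lower) (use nn b in \<open>auto intro: bdd_belowI[of _ 0]\<close>)
qed

lemma J_add: assumes "S \<in> fcur" "T \<in> fcur" shows "J (S + T) = J S + J T"
proof
  fix \<omega>
  have "bracket m \<alpha> K \<omega> (S + T) = bracket m \<alpha> K \<omega> S + bracket m \<alpha> K \<omega> T" if \<omega>: "\<omega> \<in> lch"
  proof -
    obtain \<eta>s where \<eta>s: "\<And>n. \<eta>s n \<in> smooth_forms m" "(\<lambda>n. cnorm (\<omega> - \<iota> (\<eta>s n))) \<longlonglongrightarrow> 0" using lch_approx[OF \<omega>] by blast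
    have "(\<lambda>n. S (\<eta>s n) + T (\<eta>s n)) \<longlonglongrightarrow> bracket m \<alpha> K \<omega> (S + T)"
      using bracket_tendsto[OF fcur_add[OF assms] \<omega> \<eta>s] by simp
    moreover have "(\<lambda>n. S (\<eta>s n) + T (\<eta>s n)) \<longlonglongrightarrow> bracket m \<alpha> K \<omega> S + bracket m \<alpha> K \<omega> T"
      by (rule tendsto_add[OF bracket_tendsto[OF assms(1) \<omega> \<eta>s] bracket_tendsto[OF assms(2) \<omega> \<eta>s]])
    ultimately show ?thesis by (rule LIMSEQ_unique)
  qed
  then show "J (S + T) \<omega> = (J S + J T) \<omega>" by simp
qed

lemma J_scaleR: assumes "T \<in> fcur" shows "J (a *\<^sub>R T) = a *\<^sub>R J T"
proof
  fix \<omega>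
  have "bracket m \<alpha> K \<omega> (a *\<^sub>R T) = a * bracket m \<alpha> K \<omega> T" if \<omega>: "\<omega> \<in> lch"
  proof -
    obtain \<eta>s where \<eta>s: "\<And>n. \<eta>s n \<in> smooth_forms m" "(\<lambda>n. cnorm (\<omega> - \<iota> (\<eta>s n))) \<longlonglongrightarrow> 0" using lch_approx[OF \<omega>] by blast
    have "(\<lambda>n. a * T (\<eta>s n)) \<longlonglongrightarrow> bracket m \<alpha> K \<omega> (a *\<^sub>R T)"
      using bracket_tendsto[OF fcur_scaleR[OF assms] \<omega> \<eta>s, of a] by (simp add: scaleR_fun_def[of a T])
    moreover have "(\<lambda>n. a * T (\<eta>s n)) \<longlonglongrightarrow> a * bracket m \<alpha> K \<omega> T"
      by (rule tendsto_mult_left[OF bracket_tendsto[OF assms \<omega> \<eta>s]])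
    ultimately show ?thesis by (rule LIMSEQ_unique)
  qed
  then show "J (a *\<^sub>R T) \<omega> = (a *\<^sub>R J T) \<omega>" by (simp add: scaleR_fun_def[of a "J T"])
qed

text \<open>A fractional current is determined by its values on smooth forms, and these are its
  brackets with the charges of the forms.\<close>

lemma J_inj: "inj_on J fcur"
proof (rule inj_onI)
  fix S T assume S: "S \<in> fcur" and T: "T \<in> fcur" and eq: "J S = J T"
  show "S = T"
  proof (rule linear_functionals_eqI[OF frac_currents_in_linear[OF S] frac_currents_in_linear[OF T]])
    fix \<eta> :: "'a form" assume \<eta>: "\<eta> \<in> smooth_forms m"
    show "S \<eta> = T \<eta>" using fun_cong[OF eq, of "\<iota> \<eta>"] \<iota>_lch[OF \<eta>] bracket_form[OF S \<eta>] bracket_form[OF T \<eta>] by simp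
  qed
qed

lemma dual_bound:
  assumes "\<Phi> \<in> dual" shows "0 \<le> dnorm \<Phi>" "\<omega> \<in> lch \<Longrightarrow> \<bar>\<Phi> \<omega>\<bar> \<le> dnorm \<Phi> * cnorm \<omega>"
proof -
  obtain B where B: "B \<ge> 0" "\<And>\<omega>. \<omega> \<in> lch \<Longrightarrow> \<bar>\<Phi> \<omega>\<bar> \<le> B * cnorm \<omega>" using assms by (auto simp: dual_space_def)
  note b = Inf_bound[where f="\<lambda>\<omega>. \<bar>\<Phi> \<omega>\<bar>" and A=lch and g=cnorm, OF B charge_norm_bound(1)[OF lch_charge]]
  show "0 \<le> dnorm \<Phi>" unfolding dual_norm_def by (rule b(1))
  show "\<omega> \<in> lch \<Longrightarrow> \<bar>\<Phi> \<omega>\<bar> \<le> dnorm \<Phi> * cnorm \<omega>" unfolding dual_norm_def by (rule b(2))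
qed

text \<open>Composing \<Phi> with the passage from forms to charges gives a functional bounded by
  the charge norm, hence a current T by \<open>fcurI\<close>. The continuous functionals J T and
  \<Phi> agree on charges of forms, and these are dense in the little charges.\<close>

lemma J_preimage:
  assumes \<Phi>: "\<Phi> \<in> dual"
  obtains T where "T \<in> fcur" "J T = \<Phi>" "frac_norm m \<alpha> T \<le> 4 * dnorm \<Phi>"
proof -
  have L: "\<Phi> \<in> linear_functionals lch" using \<Phi> by (simp add: dual_space_def)
  define T where "T \<eta> = (if \<eta> \<in> smooth_forms m then \<Phi> (\<iota> \<eta>) else 0)" for \<eta>
  have lin: "T \<in> linear_functionals (smooth_forms m)"
    unfolding linear_functionals_def T_def
    by (auto simp: smooth_forms_add smooth_forms_scaleR charge_of_form_add charge_of_form_scaleR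
        linear_functionals_add[OF L \<iota>_lch \<iota>_lch] linear_functionals_scaleR[OF L \<iota>_lch])
  have b: "\<bar>T \<eta>\<bar> \<le> dnorm \<Phi> * cnorm (\<iota> \<eta>)" if "\<eta> \<in> smooth_forms m" for \<eta>
    using dual_bound(2)[OF \<Phi> \<iota>_lch[OF that]] that by (simp add: T_def)
  note T = fcurI[OF lin dual_bound(1)[OF \<Phi>] b]
  have "J T \<omega> = \<Phi> \<omega>" for \<omega>
  proof (cases "\<omega> \<in> lch")
    case True
    obtain \<eta>s where \<eta>s: "\<And>n. \<eta>s n \<in> smooth_forms m" "(\<lambda>n. cnorm (\<omega> - \<iota> (\<eta>s n))) \<longlonglongrightarrow> 0" using lch_approx[OF True] by blast
    have d: "\<Phi> (\<omega> - \<iota> (\<eta>s n)) = \<Phi> \<omega> - T (\<eta>s n)" "\<omega> - \<iota> (\<eta>s n) \<in> lch" for n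
    proof -
      have e: "\<omega> - \<iota> (\<eta>s n) = \<omega> + (-1) *\<^sub>R \<iota> (\<eta>s n)" by (simp add: fun_eq_iff scaleR_fun_def)
      show "\<omega> - \<iota> (\<eta>s n) \<in> lch" unfolding e by (intro lch_add lch_scaleR True \<iota>_lch \<eta>s)
      show "\<Phi> (\<omega> - \<iota> (\<eta>s n)) = \<Phi> \<omega> - T (\<eta>s n)" unfolding e
        using linear_functionals_add[OF L True lch_scaleR[OF \<iota>_lch[OF \<eta>s(1)]], of "-1" n]
          linear_functionals_scaleR[OF L \<iota>_lch[OF \<eta>s(1)], of "-1" n] \<eta>s(1)[of n] by (simp add: T_def)
    qed
    have bb: "\<bar>\<Phi> \<omega> - T (\<eta>s n)\<bar> \<le> dnorm \<Phi> * cnorm (\<omega> - \<iota> (\<eta>s n))" for n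
      using dual_bound(2)[OF \<Phi> d(2)] d(1) by metis
    have z: "(\<lambda>n. dnorm \<Phi> * cnorm (\<omega> - \<iota> (\<eta>s n))) \<longlonglongrightarrow> 0" by (rule tendsto_mult_right_zero[OF \<eta>s(2)])
    have "(\<lambda>n. \<Phi> \<omega> - T (\<eta>s n)) \<longlonglongrightarrow> 0"
      by (rule Lim_null_comparison[OF _ z], rule always_eventually, unfold real_norm_def, rule allI, rule bb)
    then have "(\<lambda>n. \<Phi> \<omega> - (\<Phi> \<omega> - T (\<eta>s n))) \<longlonglongrightarrow> \<Phi> \<omega> - 0" by (intro tendsto_intros)
    then have "(\<lambda>n. T (\<eta>s n)) \<longlonglongrightarrow> \<Phi> \<omega>" by simp
    from LIMSEQ_unique[OF bracket_tendsto[OF T(1) True \<eta>s] this] show ?thesis using True by simp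
  next
    case False
    then show ?thesis using linear_functionals_outside[OF L False] by simp
  qed
  then have "J T = \<Phi>" by (rule ext)
  then show thesis using that[OF T(1) _ T(2)] by blast
qed

text \<open>Both bounds hold with constant 4; linearity of the inverse follows from that of J by
  injectivity.\<close>

lemma frac_duality: "isomorphism_between fcur (frac_norm m \<alpha>) dual dnorm J"
  unfolding isomorphism_between_def
proof (intro conjI)
  have img: "J ` fcur = dual"
  proof
    show "J ` fcur \<subseteq> dual" using J_dual(1) by blast
    show "dual \<subseteq> J ` fcur"
    proof
      fix \<Phi> assume "\<Phi> \<in> dual"
      then obtain T where "T \<in> fcur" "J T = \<Phi>" using J_preimage by blast
      then show "\<Phi> \<in> J ` fcur" by blast
    qed
  qed
  show "bij_betw J fcur dual" unfolding bij_betw_def using J_inj img by (rule conjI)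
  show "bounded_linear_between fcur (frac_norm m \<alpha>) dual dnorm J" unfolding bounded_linear_between_def
  proof (intro conjI ballI allI)
    show "J \<in> fcur \<rightarrow> dual" by (rule Pi_I) (rule J_dual(1))
    show "\<exists>B. \<forall>f\<in>fcur. dnorm (J f) \<le> B * frac_norm m \<alpha> f" using J_dual(2) by blast
  qed (rule J_add J_scaleR, assumption+)+
  let ?I = "inv_into fcur J"
  have I: "?I \<Phi> \<in> fcur" "J (?I \<Phi>) = \<Phi>" if "\<Phi> \<in> dual" for \<Phi>
    using that inv_into_into[of \<Phi> J fcur] f_inv_into_f[of \<Phi> J fcur] img by blast+
  have Ieq: "?I (J T) = T" if "T \<in> fcur" for T by (rule inv_into_f_f[OF J_inj that])
  show "bounded_linear_between dual dnorm fcur (frac_norm m \<alpha>) ?I" unfolding bounded_linear_between_def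
  proof (intro conjI ballI allI)
    show "?I \<in> dual \<rightarrow> fcur" by (rule Pi_I) (rule I(1))
    show "?I (\<Phi> + \<Psi>) = ?I \<Phi> + ?I \<Psi>" if "\<Phi> \<in> dual" "\<Psi> \<in> dual" for \<Phi> \<Psi>
    proof -
      have "?I (J (?I \<Phi> + ?I \<Psi>)) = ?I \<Phi> + ?I \<Psi>" by (rule Ieq[OF fcur_add[OF I(1)[OF that(1)] I(1)[OF that(2)]]])
      then show ?thesis unfolding J_add[OF I(1)[OF that(1)] I(1)[OF that(2)]] I(2)[OF that(1)] I(2)[OF that(2)] .
    qed
    show "?I (a *\<^sub>R \<Phi>) = a *\<^sub>R ?I \<Phi>" if "\<Phi> \<in> dual" for a \<Phi>
    proof -
      have "?I (J (a *\<^sub>R ?I \<Phi>)) = a *\<^sub>R ?I \<Phi>" by (rule Ieq[OF fcur_scaleR[OF I(1)[OF that]]])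
      then show ?thesis unfolding J_scaleR[OF I(1)[OF that]] I(2)[OF that] .
    qed
    have "frac_norm m \<alpha> (?I \<Phi>) \<le> 4 * dnorm \<Phi>" if \<Phi>: "\<Phi> \<in> dual" for \<Phi>
    proof -
      obtain T where T: "T \<in> fcur" "J T = \<Phi>" "frac_norm m \<alpha> T \<le> 4 * dnorm \<Phi>" using J_preimage[OF \<Phi>] by blast
      then show ?thesis using Ieq[OF T(1)] by simp
    qed
    then show "\<exists>B. \<forall>f\<in>dual. frac_norm m \<alpha> (?I f) \<le> B * dnorm f" by blast
  qed
qed

end

theorem proposition7p2:
  fixes K :: "(real ^ 'd) set" and m :: nat and \<alpha> :: real
  assumes "compact K" and "convex K" and "0 < \<alpha>" and "\<alpha> < 1"
  shows "isomorphism_between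
    (frac_currents_in m \<alpha> K) (frac_norm m \<alpha>)
    (dual_space (little_frac_charges m \<alpha> K) (charge_norm m \<alpha> K))
    (dual_norm (little_frac_charges m \<alpha> K) (charge_norm m \<alpha> K))
    (\<lambda>T \<omega>. if \<omega> \<in> little_frac_charges m \<alpha> K then bracket m \<alpha> K \<omega> T else 0)"
  by (rule frac_duality[OF assms])

end
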